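(* Let $m,n\ge0$ and $d\ge1$ be integers. For all partitions $\mu\vdash m$ and $\nu\vdash n$, $$\mathrm{char}\big(\mathrm{sInd}_{m,n}^{d}(V_{\mu}\otimes V_{\nu})\big)=\big(s_{\mu}[H]\,s_{\nu}\{E\}\big)_{d}.$$
   Context: All vector spaces are over $\mathbb{C}$. Schur superalgebra. Let $\mathbb{C}^m\oplus\mathbb{C}^n$ be the superspace with even basis $e_1,\dots,e_m$ and odd basis $e_{m+1},\dots,e_{m+n}$; put $p(i)=0$ for $i\le m$ and $p(i)=1$ for $i>m$. Let $T=(\mathbb{C}^m\oplus\mathbb{C}^n)^{\otimes d}$. The symmetric group $S_d$ acts on $T$ from the right: $(k,k+1)$ sends $e_{i_1}\otimes\cdots\otimes e_{i_d}$ to $(-1)^{p(i_k)p(i_{k+1})}$ times the tensor obtained by exchanging the $k$-th and $(k+1)$-st factors. The Schur superalgebra is $S(m,n;d)=\mathrm{End}_{S_d}(T)$, the superalgebra of all linear endomorphisms (even and odd) of $T$ commuting with $S_d$. The group $S_m\times S_n$ is embedded in the even part of $S(m,n;d)$ by $(\tau,\sigma)\mapsto g^{\otimes d}$, where $g(e_i)=e_{\tau(i)}$ for $i\le m$ and $g(e_{m+j})=e_{m+\sigma(j)}$ for $j\le n$. Superinduction. For a representation $U$ of $S_m\times S_n$ (regarded as a purely even superspace), $\mathrm{sInd}_{m,n}^{d}U=\mathrm{Hom}_{S_m\times S_n}(S(m,n;d),U)$ is the superspace of linear maps $f$ with $f(g\eta)=g\cdot f(\eta)$ for $g\in S_m\times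 S_n$, $\eta\in S(m,n;d)$; it is a left $S(m,n;d)$-supermodule via $(\xi\cdot f)(\eta)=(-1)^{|\xi|(|f|+|\eta|)}f(\eta\xi)$ for homogeneous $\xi,f,\eta$. Formal characters. For $\kappa\in\mathbb{N}^{m+n}$ with $\sum_i\kappa_i=d$, let $\xi_\kappa\in S(m,n;d)$ be the projection of $T$ onto the span of those $e_{i_1}\otimes\cdots\otimes e_{i_d}$ in which each $e_i$ occurs $\kappa_i$ times (along the spans for the other $\kappa$). For a finite-dimensional supermodule $V$, $\mathrm{char}(V)=\sum_\kappa \dim(\xi_\kappa V)\prod_{i=1}^m x_i^{\kappa_i}\prod_{j=1}^n y_j^{\kappa_{m+j}}$. Superplethysm. For $i\ge1$ let $p_i[\cdot]$ be the $\mathbb{C}$-algebra endomorphism with $x_j\mapsto x_j^i$, $y_j\mapsto(-1)^{i-1}y_j^i$, and $p_i\{\cdot\}$ the one with $x_j\mapsto(-1)^{i-1}x_j^i$, $y_j\mapsto y_j^i$; both are extended to formal power series in $x_1,\dots,x_m,y_1,\dots,y_n$. For a symmetric function $f=\sum_\mu c_\mu p_\mu$ (power sum expansion), $f[g]=\sum_\mu c_\mu\prod_k p_{\mu_k}[g]$ and $f\{g\}=\sum_\mu c_\mu\prod_k p_{\mu_k}\{g\}$. Put $$H=\frac{\prod_{j=1}^n(1+y_j)}{\prod_{i=1}^m(1-x_i)},\qquad E=\frac{\prod_{i=1}^m(1+x_i)}{\prod_{j=1}^n(1-y_j)}$$ as formal power series. $(F)_d$ denotes the homogeneous component of total degree $d$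 of a power series $F$. $V_\mu$ is the Specht module (irreducible representation of $S_m$) indexed by $\mu\vdash m$, and $s_\mu$ the Schur function. *)

theory Defs
  imports
    Complex_Main
    "HOL-Library.Function_Algebras"
    "HOL-Library.Multiset"
    "HOL-Combinatorics.Permutations"
begin

section \<open>Complex vector spaces\<close>

class cvec = ab_group_add +
  fixes scaleC :: "complex \<Rightarrow> 'a \<Rightarrow> 'a" (infixr \<open>*\<^sub>C\<close> 75)
  assumes scaleC_add_right: "a *\<^sub>C (x + y) = a *\<^sub>C x + a *\<^sub>C y"
    and scaleC_add_left: "(a + b) *\<^sub>C x = a *\<^sub>C x + b *\<^sub>C x"
    and scaleC_scaleC: "a *\<^sub>C b *\<^sub>C x = (a * b) *\<^sub>C x"
    and scaleC_one: "1 *\<^sub>C x = x"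

global_interpretation cv: vector_space "scaleC :: complex \<Rightarrow> 'a::cvec \<Rightarrow> 'a"
  by unfold_locales (rule scaleC_add_right scaleC_add_left scaleC_scaleC scaleC_one)+

instantiation complex :: cvec
begin
definition scaleC_complex :: "complex \<Rightarrow> complex \<Rightarrow> complex" where
  "scaleC_complex a x = a * x"
instance by standard (simp_all add: scaleC_complex_def algebra_simps)
end

instantiation "fun" :: (type, cvec) cvec
begin
definition scaleC_fun :: "complex \<Rightarrow> ('a \<Rightarrow> 'b) \<Rightarrow> 'a \<Rightarrow> 'b" where
  "scaleC_fun a f = (\<lambda>x. a *\<^sub>C f x)"
instance
  by standard
    (simp_all add: scaleC_fun_def fun_eq_iff scaleC_add_right scaleC_add_left scaleC_scaleC scaleC_one)
end

text \<open>The linear maps from a subspace \<open>V\<close> to a subspace \<open>W\<close>. So that distinct elements are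
  distinct linear maps on \<open>V\<close>, they are extended by \<open>0\<close> (not linearly) outside \<open>V\<close>.\<close>

definition lin_maps :: "'a::cvec set \<Rightarrow> 'b::cvec set \<Rightarrow> ('a \<Rightarrow> 'b) set" where
  "lin_maps V W = {F. (\<forall>u\<in>V. \<forall>v\<in>V. F (u + v) = F u + F v) \<and> (\<forall>c. \<forall>v\<in>V. F (c *\<^sub>C v) = c *\<^sub>C F v)
                      \<and> F ` V \<subseteq> W \<and> (\<forall>v. v \<notin> V \<longrightarrow> F v = 0)}"

lemma lin_maps_zero:
  assumes "F \<in> lin_maps V W"
  shows "F 0 = 0"
proof (cases "0 \<in> V")
  case True
  have "\<forall>c. \<forall>v\<in>V. F (c *\<^sub>C v) = c *\<^sub>C F v"
    using assms unfolding lin_maps_def by blast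
  then have "F (0 *\<^sub>C 0) = 0 *\<^sub>C F 0"
    using True by blast
  then show ?thesis
    by (simp only: cv.scale_zero_left)
next
  case False
  have "\<forall>v. v \<notin> V \<longrightarrow> F v = 0"
    using assms unfolding lin_maps_def by blast
  then show ?thesis
    using False by blast
qed

definition delta :: "'a \<Rightarrow> 'a \<Rightarrow> complex" where
  "delta x = (\<lambda>y. if y = x then 1 else 0)"

section \<open>The Schur superalgebra\<close>

text \<open>Indices are shifted to start from \<open>0\<close>: the even basis vectors are \<open>e\<^sub>i\<close> with \<open>i < m\<close>, the odd ones
  \<open>e\<^bsub>m + j\<^esub>\<close> with \<open>j < n\<close>. The tensor power is modelled by its coordinates:
  \<open>delta [i\<^sub>1, \<dots>, i\<^sub>d]\<close> stands for \<open>e\<^bsub>i\<^sub>1\<^esub> \<otimes> \<dots> \<otimes> e\<^bsub>i\<^sub>d\<^esub>\<close>.\<close>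

definition idx_parity :: "nat \<Rightarrow> nat \<Rightarrow> nat" where
  "idx_parity m i = (if i < m then 0 else 1)"

definition words :: "nat \<Rightarrow> nat \<Rightarrow> nat \<Rightarrow> nat list set" where
  "words m n d = {w. length w = d \<and> set w \<subseteq> {..<m + n}}"

type_synonym tens = "nat list \<Rightarrow> complex"

definition tpow :: "nat \<Rightarrow> nat \<Rightarrow> nat \<Rightarrow> tens set" where
  "tpow m n d = {v. \<forall>w. w \<notin> words m n d \<longrightarrow> v w = 0}"

text \<open>The endomorphism of the tensor power with prescribed values on the basis.\<close>

definition on_basis :: "nat \<Rightarrow> nat \<Rightarrow> nat \<Rightarrow> (nat list \<Rightarrow> tens) \<Rightarrow> tens \<Rightarrow> tens" where
  "on_basis m n d \<phi> = (\<lambda>v. if v \<in> tpow m n d then \<Sum>w\<in>words m n d. v w *\<^sub>C \<phi> w else 0)"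

definition adj_swap :: "nat \<Rightarrow> nat \<Rightarrow> nat \<Rightarrow> nat \<Rightarrow> tens \<Rightarrow> tens" where
  "adj_swap m n d k = on_basis m n d
     (\<lambda>w. (-1) ^ (idx_parity m (w ! k) * idx_parity m (w ! Suc k)) *\<^sub>C delta (w[k := w ! Suc k, Suc k := w ! k]))"

text \<open>The operators by which the elements of the symmetric group act. Since the adjacent
  transpositions are involutions, closure under composition suffices.\<close>

inductive_set sym_ops :: "nat \<Rightarrow> nat \<Rightarrow> nat \<Rightarrow> (tens \<Rightarrow> tens) set" for m n d where
  one: "on_basis m n d delta \<in> sym_ops m n d"
| step: "s \<in> sym_ops m n d \<Longrightarrow> Suc k < d \<Longrightarrow> adj_swap m n d k \<circ> s \<in> sym_ops m n d"

definition schur_alg :: "nat \<Rightarrow> nat \<Rightarrow> nat \<Rightarrow> (tens \<Rightarrow> tens) set" where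
  "schur_alg m n d = {\<xi> \<in> lin_maps (tpow m n d) (tpow m n d). \<forall>s\<in>sym_ops m n d. \<xi> \<circ> s = s \<circ> \<xi>}"

text \<open>Parities are numbers \<open>0\<close>, \<open>1\<close>. The next two functions give the homogeneous components of
  parity \<open>a\<close> of a tensor and of an endomorphism.\<close>

definition vec_part :: "nat \<Rightarrow> nat \<Rightarrow> tens \<Rightarrow> tens" where
  "vec_part m a v = (\<lambda>w. if (\<Sum>i\<leftarrow>w. idx_parity m i) mod 2 = a then v w else 0)"

definition end_part :: "nat \<Rightarrow> nat \<Rightarrow> nat \<Rightarrow> nat \<Rightarrow> (tens \<Rightarrow> tens) \<Rightarrow> tens \<Rightarrow> tens" where
  "end_part m n d a \<xi> = (\<lambda>v. if v \<in> tpow m n d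
     then \<Sum>b\<in>{0, 1}. vec_part m ((a + b) mod 2) (\<xi> (vec_part m b v)) else 0)"

text \<open>The image of \<open>(\<tau>, \<sigma>)\<close> is \<open>g \<otimes> \<dots> \<otimes> g\<close>, where \<open>g\<close> permutes the basis as in \<open>idx_perm\<close>.\<close>

definition idx_perm :: "nat \<Rightarrow> (nat \<Rightarrow> nat) \<Rightarrow> (nat \<Rightarrow> nat) \<Rightarrow> nat \<Rightarrow> nat" where
  "idx_perm m \<tau> \<sigma> i = (if i < m then \<tau> i else m + \<sigma> (i - m))"

definition grp_emb :: "nat \<Rightarrow> nat \<Rightarrow> nat \<Rightarrow> (nat \<Rightarrow> nat) \<Rightarrow> (nat \<Rightarrow> nat) \<Rightarrow> tens \<Rightarrow> tens" where
  "grp_emb m n d \<tau> \<sigma> = on_basis m n d (\<lambda>w. delta (map (idx_perm m \<tau> \<sigma>) w))"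

text \<open>A weight \<open>\<kappa> \<in> \<nat>\<^bsup>m + n\<^esup>\<close> with \<open>\<Sum>\<kappa>\<^sub>i = d\<close> is the multiset in which \<open>i\<close> has multiplicity \<open>\<kappa>\<^sub>i\<close>.\<close>

definition weights :: "nat \<Rightarrow> nat \<Rightarrow> nat \<Rightarrow> nat multiset set" where
  "weights m n d = {\<kappa>. set_mset \<kappa> \<subseteq> {..<m + n} \<and> size \<kappa> = d}"

definition weight_proj :: "nat \<Rightarrow> nat \<Rightarrow> nat \<Rightarrow> nat multiset \<Rightarrow> tens \<Rightarrow> tens" where
  "weight_proj m n d \<kappa> = on_basis m n d (\<lambda>w. if mset w = \<kappa> then delta w else 0)"

section \<open>Superinduction\<close>

text \<open>A representation of \<open>S\<^sub>m \<times> S\<^sub>n\<close> is given by a subspace \<open>U\<close> and an action \<open>\<rho>\<close>.\<close>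

definition sInd :: "nat \<Rightarrow> nat \<Rightarrow> nat \<Rightarrow> 'u::cvec set \<Rightarrow> ((nat \<Rightarrow> nat) \<Rightarrow> (nat \<Rightarrow> nat) \<Rightarrow> 'u \<Rightarrow> 'u)
    \<Rightarrow> ((tens \<Rightarrow> tens) \<Rightarrow> 'u) set" where
  "sInd m n d U \<rho> = {f \<in> lin_maps (schur_alg m n d) U.
     \<forall>\<tau> \<sigma> \<eta>. \<tau> permutes {..<m} \<longrightarrow> \<sigma> permutes {..<n} \<longrightarrow> \<eta> \<in> schur_alg m n d \<longrightarrow>
       f (grp_emb m n d \<tau> \<sigma> \<circ> \<eta>) = \<rho> \<tau> \<sigma> (f \<eta>)}"

text \<open>As the target is purely even, \<open>f\<close> has parity \<open>b\<close> iff it vanishes on the elements of parity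
  different from \<open>b\<close>.\<close>

definition hom_part :: "nat \<Rightarrow> nat \<Rightarrow> nat \<Rightarrow> nat \<Rightarrow> ((tens \<Rightarrow> tens) \<Rightarrow> 'u::cvec) \<Rightarrow> (tens \<Rightarrow> tens) \<Rightarrow> 'u" where
  "hom_part m n d b f = (\<lambda>\<eta>. if \<eta> \<in> schur_alg m n d then f (end_part m n d b \<eta>) else 0)"

text \<open>The action \<open>\<xi> \<cdot> f\<close>, extended from homogeneous \<open>\<xi>\<close>, \<open>f\<close>, \<open>\<eta>\<close> by additivity; see
  \<open>sInd_act_homogeneous\<close> below.\<close>

definition sInd_act :: "nat \<Rightarrow> nat \<Rightarrow> nat \<Rightarrow> (tens \<Rightarrow> tens) \<Rightarrow> ((tens \<Rightarrow> tens) \<Rightarrow> 'u::cvec)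
    \<Rightarrow> (tens \<Rightarrow> tens) \<Rightarrow> 'u" where
  "sInd_act m n d \<xi> f = (\<lambda>\<eta>. if \<eta> \<in> schur_alg m n d then
     \<Sum>a\<in>{0, 1}. \<Sum>b\<in>{0, 1}. \<Sum>c\<in>{0, 1}. (-1) ^ (a * (b + c)) *\<^sub>C
       hom_part m n d b f (end_part m n d c \<eta> \<circ> end_part m n d a \<xi>)
     else 0)"

definition end_homogeneous :: "nat \<Rightarrow> nat \<Rightarrow> nat \<Rightarrow> nat \<Rightarrow> (tens \<Rightarrow> tens) \<Rightarrow> bool" where
  "end_homogeneous m n d a \<xi> \<longleftrightarrow> (\<forall>b\<in>{0, 1}. \<forall>v\<in>tpow m n d.
     vec_part m b v = v \<longrightarrow> vec_part m ((a + b) mod 2) (\<xi> v) = \<xi> v)"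

lemma vec_part_vec_part: "vec_part m a (vec_part m b v) = (if a = b then vec_part m a v else 0)"
  by (auto simp: vec_part_def fun_eq_iff)

lemma vec_part_sum: "vec_part m 0 v + vec_part m (Suc 0) v = v"
  by (auto simp: vec_part_def fun_eq_iff)

lemma vec_part_in: "v \<in> tpow m n d \<Longrightarrow> vec_part m b v \<in> tpow m n d"
  by (auto simp: vec_part_def tpow_def)

lemma vec_part_other:
  assumes "vec_part m a v = v" "b \<noteq> a"
  shows "vec_part m b v = 0"
proof -
  have "vec_part m b (vec_part m a v) = 0"
    using assms(2) by (simp only: vec_part_vec_part if_False)
  then show ?thesis by (simp only: assms(1))
qed

lemma end_part_homogeneous:
  assumes \<xi>: "\<xi> \<in> lin_maps (tpow m n d) (tpow m n d)" "end_homogeneous m n d a \<xi>"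
    and "a \<in> {0, 1}" "a' \<in> {0, 1}"
  shows "end_part m n d a' \<xi> = (if a' = a then \<xi> else 0)"
proof
  fix v
  show "end_part m n d a' \<xi> v = (if a' = a then \<xi> else 0) v"
  proof (cases "v \<in> tpow m n d")
    case False
    then show ?thesis using \<xi>(1) by (auto simp: end_part_def lin_maps_def)
  next
    case True
    have h: "vec_part m ((a + b) mod 2) (\<xi> (vec_part m b v)) = \<xi> (vec_part m b v)" if "b \<in> {0, 1}" for b
    proof -
      have "vec_part m b (vec_part m b v) = vec_part m b v"
        by (simp add: vec_part_vec_part)
      then show ?thesis
        using \<xi>(2) that vec_part_in[OF True] unfolding end_homogeneous_def by blast
    qed
    have "\<xi> (vec_part m 0 v + vec_part m 1 v) = \<xi> (vec_part m 0 v) + \<xi> (vec_part m 1 v)"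
      using \<xi>(1) vec_part_in[OF True] by (auto simp: lin_maps_def)
    then have s: "\<xi> v = \<xi> (vec_part m 0 v) + \<xi> (vec_part m 1 v)"
      by (simp add: vec_part_sum)
    have e: "end_part m n d a' \<xi> v =
        vec_part m (a' mod 2) (\<xi> (vec_part m 0 v)) + vec_part m ((a' + 1) mod 2) (\<xi> (vec_part m 1 v))"
      using True by (simp add: end_part_def)
    show ?thesis
    proof (cases "a' = a")
      case True
      have "vec_part m (a mod 2) (\<xi> (vec_part m 0 v)) = \<xi> (vec_part m 0 v)"
        "vec_part m ((a + 1) mod 2) (\<xi> (vec_part m 1 v)) = \<xi> (vec_part m 1 v)"
        using h[of 0] h[of 1] by simp_all
      then show ?thesis using e s unfolding True by (simp only: simp_thms if_True)
    next
      case False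
      then have "a' mod 2 \<noteq> (a + 0) mod 2" "(a' + 1) mod 2 \<noteq> (a + 1) mod 2"
        using assms(3,4) by auto
      then show ?thesis
        using e vec_part_other[OF h[of 0]] vec_part_other[OF h[of 1]] False by simp
    qed
  qed
qed

lemma lin_maps_comp:
  assumes F: "F \<in> lin_maps V W" and G: "G \<in> lin_maps W X"
  shows "G \<circ> F \<in> lin_maps V X"
  using F lin_maps_zero[OF G] G by (fastforce simp: lin_maps_def image_subset_iff)

lemma schur_alg_comp:
  assumes "\<eta> \<in> schur_alg m n d" "\<xi> \<in> schur_alg m n d"
  shows "\<eta> \<circ> \<xi> \<in> schur_alg m n d"
proof -
  have "\<eta> \<circ> \<xi> \<circ> s = s \<circ> (\<eta> \<circ> \<xi>)" if "s \<in> sym_ops m n d" for s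
  proof -
    have "\<eta> \<circ> \<xi> \<circ> s = \<eta> \<circ> (s \<circ> \<xi>)"
      using assms(2) that by (simp only: schur_alg_def mem_Collect_eq comp_assoc)
    also have "\<dots> = s \<circ> (\<eta> \<circ> \<xi>)"
      using assms(1) that by (simp only: schur_alg_def mem_Collect_eq flip: comp_assoc)
    finally show ?thesis .
  qed
  then show ?thesis
    using assms lin_maps_comp by (simp only: schur_alg_def mem_Collect_eq) blast
qed

lemma end_homogeneousD:
  assumes "end_homogeneous m n d a \<xi>" "b \<in> {0, 1}" "v \<in> tpow m n d" "vec_part m b v = v"
  shows "vec_part m ((a + b) mod 2) (\<xi> v) = \<xi> v"
  using assms unfolding end_homogeneous_def by blast

lemma end_homogeneous_comp:
  assumes "\<xi> \<in> schur_alg m n d" "end_homogeneous m n d a \<xi>" "end_homogeneous m n d c \<eta>"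
  shows "end_homogeneous m n d ((a + c) mod 2) (\<eta> \<circ> \<xi>)"
proof (unfold end_homogeneous_def, intro ballI impI)
  fix b v assume b: "b \<in> {0, 1}" and v: "v \<in> tpow m n d" "vec_part m b v = v"
  have 1: "vec_part m ((a + b) mod 2) (\<xi> v) = \<xi> v"
    by (rule end_homogeneousD[OF assms(2) b v])
  have 2: "\<xi> v \<in> tpow m n d"
    using assms(1) v(1) unfolding schur_alg_def lin_maps_def by blast
  have 3: "k mod 2 \<in> {0, 1}" for k :: nat
    by (cases k rule: parity_cases) simp_all
  have "(c + (a + b) mod 2) mod 2 = (c + (a + b)) mod 2"
    by (rule mod_add_right_eq)
  also have "c + (a + b) = (a + c) + b"
    by simp
  also have "\<dots> mod 2 = ((a + c) mod 2 + b) mod 2"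
    by (rule mod_add_left_eq [symmetric])
  finally have 4: "(c + (a + b) mod 2) mod 2 = ((a + c) mod 2 + b) mod 2" .
  show "vec_part m (((a + c) mod 2 + b) mod 2) ((\<eta> \<circ> \<xi>) v) = (\<eta> \<circ> \<xi>) v"
    using end_homogeneousD[OF assms(3) 3 2 1] by (simp only: 4 comp_apply)
qed

lemma sInd_act_homogeneous:
  fixes f :: "(tens \<Rightarrow> tens) \<Rightarrow> 'u::cvec"
  assumes \<xi>: "\<xi> \<in> schur_alg m n d" "end_homogeneous m n d a \<xi>" "a \<in> {0, 1}"
    and f: "f \<in> lin_maps (schur_alg m n d) U" "b \<in> {0, 1}"
      "\<And>\<eta>. \<eta> \<in> schur_alg m n d \<Longrightarrow> end_homogeneous m n d (1 - b) \<eta> \<Longrightarrow> f \<eta> = 0"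
    and \<eta>: "\<eta> \<in> schur_alg m n d" "end_homogeneous m n d c \<eta>" "c \<in> {0, 1}"
  shows "sInd_act m n d \<xi> f \<eta> = (-1) ^ (a * (b + c)) *\<^sub>C f (\<eta> \<circ> \<xi>)"
proof -
  have lin: "\<zeta> \<in> lin_maps (tpow m n d) (tpow m n d)" if "\<zeta> \<in> schur_alg m n d" for \<zeta>
    using that by (simp add: schur_alg_def)
  note f0 = lin_maps_zero[OF f(1)] and \<eta>0 = lin_maps_zero[OF lin[OF \<eta>(1)]]
  have hp: "hom_part m n d b' f (\<eta> \<circ> \<xi>) = (if b' = b then f (\<eta> \<circ> \<xi>) else 0)" if b': "b' \<in> {0, 1}" for b'
  proof -
    note c = schur_alg_comp[OF \<eta>(1) \<xi>(1)] end_homogeneous_comp[OF \<xi>(1,2) \<eta>(2)]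
    have ac: "(a + c) mod 2 \<in> {0, 1}" by auto
    have "hom_part m n d b' f (\<eta> \<circ> \<xi>) = (if b' = (a + c) mod 2 then f (\<eta> \<circ> \<xi>) else 0)"
      using c end_part_homogeneous[OF lin[OF c(1)] c(2) ac b'] f0 by (auto simp: hom_part_def)
    moreover have "f (\<eta> \<circ> \<xi>) = 0" if "(a + c) mod 2 \<noteq> b"
    proof -
      have "(a + c) mod 2 = 1 - b" using that f(2) by auto
      then show ?thesis using f(3) c by simp
    qed
    ultimately show ?thesis by auto
  qed
  have hz: "hom_part m n d b' f 0 = 0" for b'
  proof -
    have "end_part m n d b' (0 :: tens \<Rightarrow> tens) = 0"
      by (auto simp: end_part_def vec_part_def fun_eq_iff)
    then show ?thesis using f0 by (simp add: hom_part_def)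
  qed
  have ez: "\<eta> \<circ> 0 = 0" "0 \<circ> \<xi> = 0" "0 \<circ> 0 = (0 :: tens \<Rightarrow> tens)"
    using \<eta>0 by (simp_all add: fun_eq_iff)
  have hp': "hom_part m n d b' f (end_part m n d c' \<eta> \<circ> end_part m n d a' \<xi>) =
      (if a' = a \<and> b' = b \<and> c' = c then f (\<eta> \<circ> \<xi>) else 0)"
    if "a' \<in> {0, 1}" "b' \<in> {0, 1}" "c' \<in> {0, 1}" for a' b' c'
    unfolding end_part_homogeneous[OF lin[OF \<xi>(1)] \<xi>(2,3) that(1)]
      end_part_homogeneous[OF lin[OF \<eta>(1)] \<eta>(2,3) that(3)]
    using hp[OF that(2)] by (cases "a' = a"; cases "c' = c") (simp_all only: if_True if_False simp_thms ez hz)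
  have "sInd_act m n d \<xi> f \<eta> = (\<Sum>a'\<in>{0, 1}. \<Sum>b'\<in>{0, 1}. \<Sum>c'\<in>{0, 1}.
      (-1) ^ (a' * (b' + c')) *\<^sub>C (if a' = a \<and> b' = b \<and> c' = c then f (\<eta> \<circ> \<xi>) else 0))"
    using \<eta>(1) by (simp only: sInd_act_def if_True hp' cong: sum.cong)
  also have "\<dots> = (-1) ^ (a * (b + c)) *\<^sub>C f (\<eta> \<circ> \<xi>)"
    using \<xi>(3) f(2) \<eta>(3) by (elim insertE emptyE) simp_all
  finally show ?thesis .
qed

section \<open>Specht modules\<close>

definition is_partition :: "nat list \<Rightarrow> nat \<Rightarrow> bool" where
  "is_partition \<mu> k \<longleftrightarrow> sorted_wrt (\<ge>) \<mu> \<and> 0 \<notin> set \<mu> \<and> sum_list \<mu> = k"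

definition cells :: "nat list \<Rightarrow> (nat \<times> nat) set" where
  "cells \<mu> = {(i, j). i < length \<mu> \<and> j < \<mu> ! i}"

text \<open>A tableau is a bijective filling of the cells by \<open>0, \<dots>, |\<mu>| - 1\<close>. The tabloid \<open>{t}\<close> is encoded by
  the function sending each entry to its row (and everything else to \<open>0\<close>), and the
  permutation module \<open>M\<^sup>\<mu>\<close> consists of functions on tabloids.\<close>

definition is_tableau :: "nat list \<Rightarrow> (nat \<times> nat \<Rightarrow> nat) \<Rightarrow> bool" where
  "is_tableau \<mu> t \<longleftrightarrow> bij_betw t (cells \<mu>) {..<sum_list \<mu>}"

definition row_of :: "nat list \<Rightarrow> (nat \<times> nat \<Rightarrow> nat) \<Rightarrow> nat \<Rightarrow> nat" where
  "row_of \<mu> t x = fst (inv_into (cells \<mu>) t x)"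

definition col_of :: "nat list \<Rightarrow> (nat \<times> nat \<Rightarrow> nat) \<Rightarrow> nat \<Rightarrow> nat" where
  "col_of \<mu> t x = snd (inv_into (cells \<mu>) t x)"

definition tabloid :: "nat list \<Rightarrow> (nat \<times> nat \<Rightarrow> nat) \<Rightarrow> nat \<Rightarrow> nat" where
  "tabloid \<mu> t x = (if x < sum_list \<mu> then row_of \<mu> t x else 0)"

definition col_stab :: "nat list \<Rightarrow> (nat \<times> nat \<Rightarrow> nat) \<Rightarrow> (nat \<Rightarrow> nat) set" where
  "col_stab \<mu> t = {\<pi>. \<pi> permutes {..<sum_list \<mu>} \<and>
                        (\<forall>x<sum_list \<mu>. col_of \<mu> t (\<pi> x) = col_of \<mu> t x)}"

definition polytabloid :: "nat list \<Rightarrow> (nat \<times> nat \<Rightarrow> nat) \<Rightarrow> (nat \<Rightarrow> nat) \<Rightarrow> complex" where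
  "polytabloid \<mu> t = (\<Sum>\<pi>\<in>col_stab \<mu> t. of_int (sign \<pi>) *\<^sub>C delta (tabloid \<mu> (\<pi> \<circ> t)))"

definition specht :: "nat list \<Rightarrow> ((nat \<Rightarrow> nat) \<Rightarrow> complex) set" where
  "specht \<mu> = cv.span {polytabloid \<mu> t | t. is_tableau \<mu> t}"

text \<open>The action of \<open>\<pi>\<close> sends \<open>delta {t}\<close> to \<open>delta {\<pi> t}\<close>, the tabloid \<open>{\<pi> t}\<close> being
  \<open>{t} \<circ> inv \<pi>\<close>.\<close>

definition tabloid_act :: "(nat \<Rightarrow> nat) \<Rightarrow> ((nat \<Rightarrow> nat) \<Rightarrow> complex) \<Rightarrow> (nat \<Rightarrow> nat) \<Rightarrow> complex" where
  "tabloid_act \<pi> v = (\<lambda>r. v (r \<circ> \<pi>))"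

text \<open>Outer tensor products, for spaces of functions on \<open>'a\<close> and on \<open>'b\<close>.\<close>

definition outer_tensor :: "('a \<Rightarrow> complex) set \<Rightarrow> ('b \<Rightarrow> complex) set \<Rightarrow> ('a \<times> 'b \<Rightarrow> complex) set" where
  "outer_tensor V W = cv.span {\<lambda>(r, s). v r * w s | v w. v \<in> V \<and> w \<in> W}"

definition outer_act :: "(nat \<Rightarrow> nat) \<Rightarrow> (nat \<Rightarrow> nat) \<Rightarrow> ((nat \<Rightarrow> nat) \<times> (nat \<Rightarrow> nat) \<Rightarrow> complex)
    \<Rightarrow> (nat \<Rightarrow> nat) \<times> (nat \<Rightarrow> nat) \<Rightarrow> complex" where
  "outer_act \<tau> \<sigma> u = (\<lambda>(r, s). u (r \<circ> \<tau>, s \<circ> \<sigma>))"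

section \<open>Formal power series in countably many variables\<close>

text \<open>A monomial \<open>\<Prod>z\<^sub>i\<^bsup>\<kappa> i\<^esup>\<close> is encoded as the multiset of its variables.\<close>

typedef mps = "UNIV :: (nat multiset \<Rightarrow> complex) set"
  morphisms mcoeff Abs_mps ..

setup_lifting type_definition_mps

lemma mps_eqI: "(\<And>\<kappa>. mcoeff f \<kappa> = mcoeff g \<kappa>) \<Longrightarrow> f = g"
  by (simp add: mcoeff_inject [symmetric] fun_eq_iff)

lemma finite_splits: "finite {(\<alpha>, \<beta>). \<alpha> + \<beta> = (\<kappa> :: 'a multiset)}"
proof -
  have "{\<alpha>. \<alpha> \<subseteq># \<kappa>} \<subseteq> mset ` {ys. set ys \<subseteq> set_mset \<kappa> \<and> length ys \<le> size \<kappa>}"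
  proof
    fix \<alpha> assume "\<alpha> \<in> {\<alpha>. \<alpha> \<subseteq># \<kappa>}"
    moreover obtain ys where "mset ys = \<alpha>" using ex_mset by blast
    ultimately have "set ys \<subseteq> set_mset \<kappa>" "length ys \<le> size \<kappa>"
      using set_mset_mono[of \<alpha> \<kappa>] size_mset_mono[of \<alpha> \<kappa>] by auto
    with \<open>mset ys = \<alpha>\<close> show "\<alpha> \<in> mset ` {ys. set ys \<subseteq> set_mset \<kappa> \<and> length ys \<le> size \<kappa>}"
      by blast
  qed
  then have "finite {\<alpha>. \<alpha> \<subseteq># \<kappa>}"
    by (rule finite_subset) (intro finite_imageI finite_lists_length_le finite_set_mset)
  moreover have "{(\<alpha>, \<beta>). \<alpha> + \<beta> = \<kappa>} \<subseteq> {\<alpha>. \<alpha> \<subseteq># \<kappa>} \<times> {\<beta>. \<beta> \<subseteq># \<kappa>}"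
    by auto
  ultimately show ?thesis
    by (meson finite_SigmaI finite_subset)
qed

instantiation mps :: comm_ring_1
begin
lift_definition zero_mps :: mps is "\<lambda>_. 0" .
lift_definition one_mps :: mps is "\<lambda>\<kappa>. if \<kappa> = {#} then 1 else 0" .
lift_definition plus_mps :: "mps \<Rightarrow> mps \<Rightarrow> mps" is "\<lambda>f g \<kappa>. f \<kappa> + g \<kappa>" .
lift_definition minus_mps :: "mps \<Rightarrow> mps \<Rightarrow> mps" is "\<lambda>f g \<kappa>. f \<kappa> - g \<kappa>" .
lift_definition uminus_mps :: "mps \<Rightarrow> mps" is "\<lambda>f \<kappa>. - f \<kappa>" .
lift_definition times_mps :: "mps \<Rightarrow> mps \<Rightarrow> mps" is
  "\<lambda>f g \<kappa>. \<Sum>(\<alpha>, \<beta>) | \<alpha> + \<beta> = \<kappa>. f \<alpha> * g \<beta>" .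
instance
proof
  fix f g h :: mps
  show "f * g * h = f * (g * h)"
  proof (rule mps_eqI)
    fix \<kappa>
    let ?D = "\<lambda>\<kappa>. {(\<alpha>, \<beta>). \<alpha> + \<beta> = (\<kappa> :: nat multiset)}"
    have "mcoeff (f * g * h) \<kappa> =
        (\<Sum>(\<gamma>, \<delta>)\<in>?D \<kappa>. \<Sum>(\<alpha>, \<beta>)\<in>?D \<gamma>. mcoeff f \<alpha> * mcoeff g \<beta> * mcoeff h \<delta>)"
      by (simp add: times_mps.rep_eq sum_distrib_right case_prod_unfold)
    also have "\<dots> = (\<Sum>((\<gamma>, \<delta>), (\<alpha>, \<beta>))\<in>(SIGMA p:?D \<kappa>. ?D (fst p)). mcoeff f \<alpha> * mcoeff g \<beta> * mcoeff h \<delta>)"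
      by (subst sum.Sigma [symmetric]) (auto simp: finite_splits finite_splits [unfolded case_prod_unfold] case_prod_unfold)
    also have "\<dots> = (\<Sum>((\<alpha>, \<epsilon>), (\<beta>, \<delta>))\<in>(SIGMA p:?D \<kappa>. ?D (snd p)). mcoeff f \<alpha> * mcoeff g \<beta> * mcoeff h \<delta>)"
      by (rule sum.reindex_bij_witness
            [where i = "\<lambda>((\<alpha>, \<epsilon>), (\<beta>, \<delta>)). ((\<alpha> + \<beta>, \<delta>), (\<alpha>, \<beta>))"
               and j = "\<lambda>((\<gamma>, \<delta>), (\<alpha>, \<beta>)). ((\<alpha>, \<beta> + \<delta>), (\<beta>, \<delta>))"])
         (auto simp: ac_simps)
    also have "\<dots> = (\<Sum>(\<alpha>, \<epsilon>)\<in>?D \<kappa>. \<Sum>(\<beta>, \<delta>)\<in>?D \<epsilon>. mcoeff f \<alpha> * mcoeff g \<beta> * mcoeff h \<delta>)"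
      by (subst sum.Sigma [symmetric]) (auto simp: finite_splits finite_splits [unfolded case_prod_unfold] case_prod_unfold)
    also have "\<dots> = mcoeff (f * (g * h)) \<kappa>"
      by (simp add: times_mps.rep_eq sum_distrib_left case_prod_unfold mult.assoc)
    finally show "mcoeff (f * g * h) \<kappa> = mcoeff (f * (g * h)) \<kappa>" .
  qed
  show "f * g = g * f"
  proof (rule mps_eqI)
    fix \<kappa>
    show "mcoeff (f * g) \<kappa> = mcoeff (g * f) \<kappa>"
      unfolding times_mps.rep_eq
      by (rule sum.reindex_bij_witness[where i = prod.swap and j = prod.swap]) (auto simp: ac_simps)
  qed
  show "1 * f = f"
  proof (rule mps_eqI)
    fix \<kappa>
    have "mcoeff (1 * f) \<kappa> = (\<Sum>(\<alpha>, \<beta>)\<in>{({#}, \<kappa>)}. mcoeff 1 \<alpha> * mcoeff f \<beta>)"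
      unfolding times_mps.rep_eq
      by (rule sum.mono_neutral_right) (auto simp: finite_splits one_mps.rep_eq split: if_splits)
    then show "mcoeff (1 * f) \<kappa> = mcoeff f \<kappa>"
      by (simp add: one_mps.rep_eq)
  qed
  show "(f + g) * h = f * h + g * h"
    by (rule mps_eqI) (simp add: times_mps.rep_eq plus_mps.rep_eq algebra_simps case_prod_unfold sum.distrib)
  show "f + g + h = f + (g + h)" "f + g = g + f" "0 + f = f" "- f + f = 0" "f - g = f + - g"
    by (transfer; simp add: fun_eq_iff)+
  show "(0 :: mps) \<noteq> 1"
    by transfer (auto simp: fun_eq_iff)
qed
end

instantiation mps :: cvec
begin
lift_definition scaleC_mps :: "complex \<Rightarrow> mps \<Rightarrow> mps" is "\<lambda>c f \<kappa>. c * f \<kappa>" .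
instance by standard (transfer; simp add: fun_eq_iff algebra_simps)+
end

lemma mps_dvd_one_unique:
  fixes f g h :: mps
  assumes "f * g = 1" "f * h = 1"
  shows "g = h"
  by (metis assms mult.assoc mult.commute mult_1)

text \<open>Inverses of units; all other series get inverse \<open>0\<close>.\<close>

instantiation mps :: inverse
begin
definition inverse_mps :: "mps \<Rightarrow> mps" where
  "inverse_mps f = (if f dvd 1 then THE g. f * g = 1 else 0)"
definition divide_mps :: "mps \<Rightarrow> mps \<Rightarrow> mps" where
  "divide_mps f g = f * inverse g"
instance ..
end

lemma mps_inverse_eqI: "f * g = 1 \<Longrightarrow> inverse f = (g :: mps)"
  unfolding inverse_mps_def by (auto simp: dvd_def intro!: the_equality dest: mps_dvd_one_unique)

text \<open>The variable \<open>z\<^sub>i\<close>. In the ring of the characters \<open>x\<^bsub>i+1\<^esub>\<close> is \<open>z\<^sub>i\<close> for \<open>i < m\<close>, and \<open>y\<^bsub>j+1\<^esub>\<close> is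
  \<open>z\<^bsub>m+j\<^esub>\<close> for \<open>j < n\<close>.\<close>

lift_definition mvar :: "nat \<Rightarrow> mps" is "\<lambda>i \<kappa>. if \<kappa> = {#i#} then 1 else 0" .

lift_definition homog_part :: "nat \<Rightarrow> mps \<Rightarrow> mps" is "\<lambda>d f \<kappa>. if size \<kappa> = d then f \<kappa> else 0" .

lemma mps_one_minus_var_unit:
  "(1 - mvar i) * Abs_mps (\<lambda>\<kappa>. if \<exists>k. \<kappa> = replicate_mset k i then 1 else 0) = 1" (is "_ * ?g = _")
proof (rule mps_eqI)
  fix \<kappa>
  have "mcoeff (mvar i * ?g) \<kappa> = (\<Sum>(\<alpha>, \<beta>)\<in>(if i \<in># \<kappa> then {({#i#}, \<kappa> - {#i#})} else {}). mcoeff ?g \<beta>)"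
    unfolding times_mps.rep_eq mvar.rep_eq
    by (intro sum.mono_neutral_cong_right) (auto simp: finite_splits split: if_splits)
  also have "\<dots> = (if i \<in># \<kappa> \<and> (\<exists>k. \<kappa> - {#i#} = replicate_mset k i) then 1 else 0)"
    by (auto simp: Abs_mps_inverse)
  also have "i \<in># \<kappa> \<and> (\<exists>k. \<kappa> - {#i#} = replicate_mset k i) \<longleftrightarrow> (\<exists>k. \<kappa> = replicate_mset (Suc k) i)"
    by (metis add_mset_remove_trivial insert_DiffM replicate_mset_Suc union_single_eq_member add_mset_add_single)
  finally have "mcoeff (mvar i * ?g) \<kappa> = (if \<exists>k. \<kappa> = replicate_mset (Suc k) i then 1 else 0)" .
  moreover have "(\<exists>k. \<kappa> = replicate_mset k i) \<longleftrightarrow> \<kappa> = {#} \<or> (\<exists>k. \<kappa> = replicate_mset (Suc k) i)"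
    by (metis not0_implies_Suc replicate_mset_0)
  ultimately show "mcoeff ((1 - mvar i) * ?g) \<kappa> = mcoeff 1 \<kappa>"
    by (auto simp: left_diff_distrib minus_mps.rep_eq one_mps.rep_eq Abs_mps_inverse)
qed

text \<open>For \<open>k \<ge> 1\<close>, the substitution \<open>z\<^sub>j \<mapsto> c\<^sub>j z\<^sub>j\<^sup>k\<close>: the monomial \<open>\<alpha>\<close> becomes \<open>\<Prod>\<^sub>j c\<^sub>j\<^bsup>\<alpha> j\<^esup>\<close> times the
  monomial \<open>k \<alpha>\<close>. The sum has at most one term.\<close>

lift_definition subst_pow :: "(nat \<Rightarrow> complex) \<Rightarrow> nat \<Rightarrow> mps \<Rightarrow> mps" is
  "\<lambda>c k f \<kappa>. \<Sum>\<alpha> | repeat_mset k \<alpha> = \<kappa>. (\<Prod>j\<in>#\<alpha>. c j) * f \<alpha>" .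

lemma repeat_mset_eq_iff: "k \<ge> 1 \<Longrightarrow> repeat_mset k \<alpha> = repeat_mset k \<beta> \<longleftrightarrow> \<alpha> = \<beta>"
  by (auto simp: multiset_eq_iff)

lemma repeat_mset_sum_iff:
  assumes "k \<ge> 1" "repeat_mset k \<alpha> + repeat_mset k \<beta> = repeat_mset k \<gamma>"
  shows "\<alpha> + \<beta> = \<gamma>"
  using assms repeat_mset_eq_iff by (metis repeat_mset_distrib2)

lemma mcoeff_subst_pow_repeat:
  assumes "k \<ge> 1"
  shows "mcoeff (subst_pow c k f) (repeat_mset k \<alpha>) = (\<Prod>j\<in>#\<alpha>. c j) * mcoeff f \<alpha>"
proof -
  have "{\<beta>. repeat_mset k \<beta> = repeat_mset k \<alpha>} = {\<alpha>}"
    using repeat_mset_eq_iff[OF assms] by blast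
  then show ?thesis by (simp add: subst_pow.rep_eq)
qed

lemma mcoeff_subst_pow_0: "\<kappa> \<notin> range (repeat_mset k) \<Longrightarrow> mcoeff (subst_pow c k f) \<kappa> = 0"
proof -
  assume "\<kappa> \<notin> range (repeat_mset k)"
  then have "{\<beta>. repeat_mset k \<beta> = \<kappa>} = {}" by blast
  then show ?thesis by (simp add: subst_pow.rep_eq)
qed

lemma subst_pow_one: "k \<ge> 1 \<Longrightarrow> subst_pow c k 1 = 1"
proof (rule mps_eqI)
  fix \<kappa> :: "nat multiset"
  assume k: "k \<ge> 1"
  show "mcoeff (subst_pow c k 1) \<kappa> = mcoeff 1 \<kappa>"
  proof (cases "\<kappa> \<in> range (repeat_mset k)")
    case True
    then obtain \<alpha> where "\<kappa> = repeat_mset k \<alpha>" by blast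
    moreover have "repeat_mset k \<alpha> = {#} \<longleftrightarrow> \<alpha> = {#}"
      using repeat_mset_eq_iff[OF k, of \<alpha> "{#}"] by simp
    ultimately show ?thesis
      by (simp add: mcoeff_subst_pow_repeat[OF k] one_mps.rep_eq)
  next
    case False
    then have "\<kappa> \<noteq> {#}" by (metis rangeI repeat_mset_empty)
    then show ?thesis by (simp add: mcoeff_subst_pow_0[OF False] one_mps.rep_eq)
  qed
qed

lemma subst_pow_add: "subst_pow c k (f + g) = subst_pow c k f + subst_pow c k g"
  by (rule mps_eqI) (simp add: subst_pow.rep_eq plus_mps.rep_eq distrib_left sum.distrib)

lemma subst_pow_scaleC: "subst_pow c k (a *\<^sub>C f) = a *\<^sub>C subst_pow c k f"
  by (rule mps_eqI) (simp add: subst_pow.rep_eq scaleC_mps.rep_eq sum_distrib_left mult.left_commute)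

lemma subst_pow_mult:
  assumes k: "k \<ge> 1"
  shows "subst_pow c k (f * g) = subst_pow c k f * subst_pow c k g"
proof (rule mps_eqI)
  fix \<kappa>
  let ?D = "\<lambda>\<kappa>. {(\<alpha>, \<beta>). \<alpha> + \<beta> = (\<kappa> :: nat multiset)}"
  let ?S = "subst_pow c k"
  show "mcoeff (?S (f * g)) \<kappa> = mcoeff (?S f * ?S g) \<kappa>"
  proof (cases "\<kappa> \<in> range (repeat_mset k)")
    case True
    then obtain \<gamma> where \<gamma>: "\<kappa> = repeat_mset k \<gamma>" by blast
    have "mcoeff (?S f * ?S g) \<kappa> = (\<Sum>(\<alpha>, \<beta>)\<in>?D \<kappa>. mcoeff (?S f) \<alpha> * mcoeff (?S g) \<beta>)"
      by (simp add: times_mps.rep_eq)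
    also have "\<dots> = (\<Sum>(\<alpha>, \<beta>)\<in>map_prod (repeat_mset k) (repeat_mset k) ` ?D \<gamma>.
        mcoeff (?S f) \<alpha> * mcoeff (?S g) \<beta>)"
    proof (rule sum.mono_neutral_right[OF finite_splits])
      show "map_prod (repeat_mset k) (repeat_mset k) ` ?D \<gamma> \<subseteq> ?D \<kappa>"
        unfolding \<gamma> by (auto simp flip: repeat_mset_distrib2)
      show "\<forall>p\<in>?D \<kappa> - map_prod (repeat_mset k) (repeat_mset k) ` ?D \<gamma>.
          (case p of (\<alpha>, \<beta>) \<Rightarrow> mcoeff (?S f) \<alpha> * mcoeff (?S g) \<beta>) = 0"
      proof (clarify, rule ccontr)
        fix \<alpha> \<beta>
        assume n: "(\<alpha>, \<beta>) \<notin> map_prod (repeat_mset k) (repeat_mset k) ` ?D (\<gamma> :: nat multiset)"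
          and s: "\<kappa> = \<alpha> + \<beta>" and nz: "mcoeff (?S f) \<alpha> * mcoeff (?S g) \<beta> \<noteq> 0"
        have "\<alpha> \<in> range (repeat_mset k)" "\<beta> \<in> range (repeat_mset k)"
          using nz mcoeff_subst_pow_0[of \<alpha> k c f] mcoeff_subst_pow_0[of \<beta> k c g] by auto
        then obtain \<alpha>' \<beta>' where ab: "\<alpha> = repeat_mset k \<alpha>'" "\<beta> = repeat_mset k \<beta>'" by blast
        then have "\<alpha>' + \<beta>' = \<gamma>"
          using s \<gamma> repeat_mset_sum_iff[OF k] by metis
        then have "(\<alpha>', \<beta>') \<in> ?D \<gamma>" by simp
        then show False using n ab by (metis (no_types, lifting) imageI map_prod_simp)
      qed
    qed
    also have "\<dots> = (\<Sum>(\<alpha>, \<beta>)\<in>?D \<gamma>. mcoeff (?S f) (repeat_mset k \<alpha>) * mcoeff (?S g) (repeat_mset k \<beta>))"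
      by (subst sum.reindex) (auto simp: inj_on_def repeat_mset_eq_iff[OF k] case_prod_unfold)
    also have "\<dots> = (\<Sum>(\<alpha>, \<beta>)\<in>?D \<gamma>. (\<Prod>j\<in>#\<gamma>. c j) * (mcoeff f \<alpha> * mcoeff g \<beta>))"
      by (rule sum.cong) (auto simp: mcoeff_subst_pow_repeat[OF k])
    also have "\<dots> = mcoeff (?S (f * g)) \<kappa>"
      by (simp add: \<gamma> mcoeff_subst_pow_repeat[OF k] times_mps.rep_eq sum_distrib_left case_prod_unfold)
    finally show ?thesis by simp
  next
    case False
    have "mcoeff (?S f) \<alpha> * mcoeff (?S g) \<beta> = 0" if "\<alpha> + \<beta> = \<kappa>" for \<alpha> \<beta>
    proof (rule ccontr)
      assume nz: "mcoeff (?S f) \<alpha> * mcoeff (?S g) \<beta> \<noteq> 0"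
      have "\<alpha> \<in> range (repeat_mset k)" "\<beta> \<in> range (repeat_mset k)"
        using nz mcoeff_subst_pow_0[of \<alpha> k c f] mcoeff_subst_pow_0[of \<beta> k c g] by auto
      then obtain \<alpha>' \<beta>' where "\<kappa> = repeat_mset k (\<alpha>' + \<beta>')"
        using \<open>\<alpha> + \<beta> = \<kappa>\<close> by (metis imageE repeat_mset_distrib2)
      then show False using False by blast
    qed
    then have "mcoeff (?S f * ?S g) \<kappa> = 0"
      unfolding times_mps.rep_eq by (intro sum.neutral) auto
    then show ?thesis by (simp add: mcoeff_subst_pow_0[OF False])
  qed
qed

lemma mcoeff_mvar_power: "mcoeff (mvar i ^ k) \<kappa> = (if \<kappa> = replicate_mset k i then 1 else 0)"
proof (induction k arbitrary: \<kappa>)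
  case 0
  then show ?case by (simp add: one_mps.rep_eq)
next
  case (Suc k)
  have "mcoeff (mvar i ^ Suc k) \<kappa> =
      (\<Sum>(\<alpha>, \<beta>) | \<alpha> + \<beta> = \<kappa>. if \<alpha> = {#i#} \<and> \<beta> = replicate_mset k i then 1 else 0)"
    by (auto simp: times_mps.rep_eq mvar.rep_eq Suc.IH intro!: sum.cong)
  also have "\<dots> = (\<Sum>(\<alpha>, \<beta>)\<in>(if \<kappa> = replicate_mset (Suc k) i then {({#i#}, replicate_mset k i)} else {}). 1)"
    by (intro sum.mono_neutral_cong_right) (auto simp: finite_splits split: if_splits)
  finally show ?case by simp
qed

lemma subst_pow_mvar:
  assumes k: "k \<ge> 1"
  shows "subst_pow c k (mvar i) = c i *\<^sub>C mvar i ^ k"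
proof (rule mps_eqI)
  fix \<kappa>
  show "mcoeff (subst_pow c k (mvar i)) \<kappa> = mcoeff (c i *\<^sub>C mvar i ^ k) \<kappa>"
  proof (cases "\<kappa> \<in> range (repeat_mset k)")
    case True
    then obtain \<alpha> where "\<kappa> = repeat_mset k \<alpha>" by blast
    moreover have "repeat_mset k \<alpha> = replicate_mset k i \<longleftrightarrow> \<alpha> = {#i#}"
      using repeat_mset_eq_iff[OF k, of \<alpha> "{#i#}"] by simp
    ultimately show ?thesis
      by (simp add: mcoeff_subst_pow_repeat[OF k] scaleC_mps.rep_eq mcoeff_mvar_power mvar.rep_eq)
  next
    case False
    then have "\<kappa> \<noteq> replicate_mset k i" by (metis rangeI repeat_mset_replicate_mset)
    then show ?thesis
      by (simp add: mcoeff_subst_pow_0[OF False] scaleC_mps.rep_eq mcoeff_mvar_power)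
  qed
qed

section \<open>Symmetric functions\<close>

text \<open>Symmetric functions are power series of bounded degree in all of the variables
  \<open>z\<^sub>0, z\<^sub>1, \<dots>\<close>. The Schur function is the generating function of the semistandard tableaux.\<close>

definition is_ssyt :: "nat list \<Rightarrow> (nat \<times> nat \<Rightarrow> nat) \<Rightarrow> bool" where
  "is_ssyt \<mu> t \<longleftrightarrow> (\<forall>i j. (i, Suc j) \<in> cells \<mu> \<longrightarrow> t (i, j) \<le> t (i, Suc j)) \<and>
                 (\<forall>i j. (Suc i, j) \<in> cells \<mu> \<longrightarrow> t (i, j) < t (Suc i, j)) \<and>
                 (\<forall>c. c \<notin> cells \<mu> \<longrightarrow> t c = 0)"

lift_definition schur :: "nat list \<Rightarrow> mps" is
  "\<lambda>\<mu> \<kappa>. of_nat (card {t. is_ssyt \<mu> t \<and> image_mset t (mset_set (cells \<mu>)) = \<kappa>})" .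

text \<open>The power sum \<open>\<Sum>\<^sub>i z\<^sub>i\<^sup>k\<close>, for \<open>k \<ge> 1\<close>.\<close>

lift_definition powsum :: "nat \<Rightarrow> mps" is
  "\<lambda>k \<kappa>. if \<exists>i. \<kappa> = replicate_mset k i then 1 else 0" .

definition powsum_expansion :: "mps \<Rightarrow> (nat list \<Rightarrow> complex) \<Rightarrow> bool" where
  "powsum_expansion f c \<longleftrightarrow> finite {l. c l \<noteq> 0} \<and> (\<forall>l. c l \<noteq> 0 \<longrightarrow> is_partition l (sum_list l)) \<and>
     f = (\<Sum>l | c l \<noteq> 0. c l *\<^sub>C (\<Prod>k\<leftarrow>l. powsum k))"

text \<open>Plethysm with respect to a family \<open>\<theta>\<close> of endomorphisms, \<open>\<theta> k\<close> being the effect of \<open>p\<^sub>k\<close>.\<close>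

definition plethysm :: "(nat \<Rightarrow> mps \<Rightarrow> mps) \<Rightarrow> mps \<Rightarrow> mps \<Rightarrow> mps" where
  "plethysm \<theta> f g = (let c = (THE c. powsum_expansion f c) in
     \<Sum>l | c l \<noteq> 0. c l *\<^sub>C (\<Prod>k\<leftarrow>l. \<theta> k g))"

text \<open>The operations \<open>p\<^sub>k[\<cdot>]\<close> and \<open>p\<^sub>k{\<cdot>}\<close>.\<close>

definition pow_bracket :: "nat \<Rightarrow> nat \<Rightarrow> mps \<Rightarrow> mps" where
  "pow_bracket m k = subst_pow (\<lambda>j. if j < m then 1 else (-1) ^ (k - 1)) k"

definition pow_brace :: "nat \<Rightarrow> nat \<Rightarrow> mps \<Rightarrow> mps" where
  "pow_brace m k = subst_pow (\<lambda>j. if j < m then (-1) ^ (k - 1) else 1) k"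

definition H_series :: "nat \<Rightarrow> nat \<Rightarrow> mps" where
  "H_series m n = (\<Prod>j<n. 1 + mvar (m + j)) / (\<Prod>i<m. 1 - mvar i)"

definition E_series :: "nat \<Rightarrow> nat \<Rightarrow> mps" where
  "E_series m n = (\<Prod>i<m. 1 + mvar i) / (\<Prod>j<n. 1 - mvar (m + j))"

section \<open>Formal characters\<close>

definition fchar :: "nat \<Rightarrow> nat \<Rightarrow> nat \<Rightarrow> ((tens \<Rightarrow> tens) \<Rightarrow> 'v \<Rightarrow> 'v) \<Rightarrow> 'v::cvec set \<Rightarrow> mps" where
  "fchar m n d act V = (\<Sum>\<kappa>\<in>weights m n d. of_nat (cv.dim (act (weight_proj m n d \<kappa>) ` V)) *\<^sub>C
     ((\<Prod>i<m. mvar i ^ count \<kappa> i) * (\<Prod>j<n. mvar (m + j) ^ count \<kappa> (m + j))))"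

end

theory Submission
  imports Defs "HOL-Library.Product_Lexorder" "HOL-Combinatorics.Orbits"
begin

text \<open>
  A weight space of the superinduced module is identified with the space of equivariant maps from a
  signed permutation module, whose basis consists of the nonnegative integer matrices with prescribed
  column sums and with entries at most 1 in the odd blocks, into the outer tensor product of the
  Specht modules.  Its dimension is the trace of the averaging projection, a sum over the group of
  products of characters.  On the other side, a coefficient of a product of power sums of H and E over
  the cycles of a permutation counts, with the same signs, the matrices fixed by it.  What links the
  two is that the Schur function is the Frobenius characteristic of the Specht module; this follows by
  counting dimensions of weight spaces via a straightening of bideterminants.
\<close>

section \<open>Dimensions and traces\<close>

text \<open>Weight spaces, Specht modules and their tensor products are all spaces of functions on
  finite sets, so a projection is a kernel and its trace a plain sum. No classification of
  irreducible representations enters: a kernel \<open>K\<close> for a Specht module only has to be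
  invariant under the group, and \<open>\<Sum>r. K r (r \<circ> \<pi>)\<close> then plays the part
  of the character.

  The obstacle is the signs. An endomorphism commuting with the signed action of the symmetric group
  has matrix coefficients indexed by words in pairs (row, column). Multiplied by \<open>gam\<close>,
  they change sign exactly when two odd pairs are exchanged; so on words of given content they are
  multiples of the sorting sign \<open>osgn\<close>, and they vanish if an odd pair is repeated. A
  k-cycle of rows that fixes a matrix rotates blocks of k letters of equal parity. For odd letters
  this costs (-1)^(k-1), which is the sign built into p_k[.] and p_k{.}.

  Since \<open>plethysm\<close> selects the power sum expansion by a definite description, the
  products of power sums must also be shown to be linearly independent.\<close>

global_interpretation cvp: vector_space_pair
  "scaleC :: complex \<Rightarrow> 'a::cvec \<Rightarrow> 'a" "scaleC :: complex \<Rightarrow> 'b::cvec \<Rightarrow> 'b"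
  by unfold_locales

lemma scaleC_fun_apply [simp]: "(a *\<^sub>C f) x = a *\<^sub>C f x"
  by (simp add: scaleC_fun_def)

lemma scaleC_complex [simp]: "a *\<^sub>C (b :: complex) = a * b"
  by (simp add: scaleC_complex_def)

lemma sum_fun_apply: "(\<Sum>i\<in>I. f i) x = (\<Sum>i\<in>I. f i x)" for f :: "'i \<Rightarrow> 'a \<Rightarrow> 'b::comm_monoid_add"
  by (induction I rule: infinite_finite_induct) auto

lemma fun_eq_sum_delta:
  assumes "finite Y" "\<And>y. y \<notin> Y \<Longrightarrow> v y = 0"
  shows "v = (\<Sum>y\<in>Y. v y *\<^sub>C delta y)"
proof
  fix x
  have "(\<Sum>y\<in>Y. v y *\<^sub>C delta y) x = (\<Sum>y\<in>Y. if x = y then v y else 0)"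
    by (auto simp: sum_fun_apply delta_def intro!: sum.cong)
  then show "v x = (\<Sum>y\<in>Y. v y *\<^sub>C delta y) x"
    using assms by (simp add: sum.delta')
qed

lemma dim_image_inj_on:
  assumes lin: "Vector_Spaces.linear scaleC scaleC f" and S: "cv.subspace S" and inj: "inj_on f S"
  shows "cv.dim (f ` S) = cv.dim S"
proof -
  obtain B where B: "B \<subseteq> S" "cv.independent B" "S \<subseteq> cv.span B" "card B = cv.dim S"
    using cv.basis_exists by metis
  have sp: "cv.span B = S"
    using B S by (metis cv.span_minimal subset_antisym)
  have "cv.independent (f ` B)"
    by (rule cvp.linear_independent_injective_image[OF lin B(2)]) (simp add: sp inj)
  moreover have "cv.span (f ` B) = f ` S"
    using cvp.linear_span_image[OF lin, of B] sp by simp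
  moreover have "card (f ` B) = card B"
    using inj B(1) by (meson card_image inj_on_subset)
  ultimately show ?thesis
    using cv.dim_span_eq_card_independent B(4) by metis
qed

text \<open>Expand each column of \<open>k\<close> in a basis \<open>B\<close> of \<open>W\<close>
  and exchange the sums. The contribution of \<open>b\<close> becomes the
  \<open>b\<close>-coordinate of the image of \<open>b\<close> under the kernel, and this image is
  \<open>b\<close> itself, so every basis vector contributes 1 to the trace.\<close>

lemma dim_eq_trace:
  fixes k :: "'y \<Rightarrow> 'y \<Rightarrow> complex"
  assumes Y: "finite Y" and W: "cv.subspace W" and supp: "\<And>v y. v \<in> W \<Longrightarrow> y \<notin> Y \<Longrightarrow> v y = 0"
    and kW: "\<And>y'. y' \<in> Y \<Longrightarrow> (\<lambda>y. k y y') \<in> W"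
    and repr: "\<And>v y. v \<in> W \<Longrightarrow> y \<in> Y \<Longrightarrow> v y = (\<Sum>y'\<in>Y. k y y' * v y')"
  shows "of_nat (cv.dim W) = (\<Sum>y\<in>Y. k y y)"
proof -
  obtain B where B: "B \<subseteq> W" "cv.independent B" "W \<subseteq> cv.span B" "card B = cv.dim W"
    using cv.basis_exists by metis
  have "W \<subseteq> cv.span (delta ` Y)"
  proof
    fix v assume "v \<in> W"
    then have "v = (\<Sum>y\<in>Y. v y *\<^sub>C delta y)"
      by (intro fun_eq_sum_delta Y supp)
    also have "\<dots> \<in> cv.span (delta ` Y)"
      by (intro cv.span_sum cv.span_scale cv.span_base) auto
    finally show "v \<in> cv.span (delta ` Y)" .
  qed
  then have finB: "finite B"
    using cv.independent_span_bound[of "delta ` Y" B] B Y by auto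
  have sp: "cv.span B = W"
    using B W by (metis cv.span_minimal subset_antisym)
  define R where "R v = cv.representation B v" for v
  have R: "v = (\<Sum>b\<in>B. R v b *\<^sub>C b)" if "v \<in> W" for v
    unfolding R_def using cv.sum_representation_eq[OF B(2) _ finB order_refl] that sp by metis
  have "(\<Sum>y\<in>Y. k y y) = (\<Sum>y\<in>Y. \<Sum>b\<in>B. R (\<lambda>x. k x y) b * b y)"
  proof (rule sum.cong[OF refl])
    fix y assume "y \<in> Y"
    have "k y y = (\<Sum>b\<in>B. R (\<lambda>x. k x y) b *\<^sub>C b) y"
      using R[OF kW[OF \<open>y \<in> Y\<close>]] by metis
    then show "k y y = (\<Sum>b\<in>B. R (\<lambda>x. k x y) b * b y)"
      by (simp add: sum_fun_apply)
  qed
  also have "\<dots> = (\<Sum>b\<in>B. \<Sum>y\<in>Y. R (\<lambda>x. k x y) b * b y)"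
    by (rule sum.swap)
  also have "\<dots> = (\<Sum>b\<in>B. 1)"
  proof (rule sum.cong[OF refl])
    fix b assume b: "b \<in> B"
    have "b = (\<Sum>y\<in>Y. b y *\<^sub>C (\<lambda>x. k x y))"
    proof
      fix x
      show "b x = (\<Sum>y\<in>Y. b y *\<^sub>C (\<lambda>x. k x y)) x"
      proof (cases "x \<in> Y")
        case True
        then show ?thesis
          using repr[of b x] b B(1) by (auto simp: sum_fun_apply mult.commute)
      next
        case False
        have "k x y = 0" if "y \<in> Y" for y
          using supp[OF kW[OF that] False] .
        then show ?thesis
          using supp[of b x] b B(1) False by (auto simp: sum_fun_apply)
      qed
    qed
    then have "R b b = R (\<Sum>y\<in>Y. b y *\<^sub>C (\<lambda>x. k x y)) b"
      by simp
    also have "\<dots> = (\<Sum>y\<in>Y. R (b y *\<^sub>C (\<lambda>x. k x y)) b)"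
      unfolding R_def
      by (subst cv.representation_sum[OF B(2)])
         (auto simp: sum_fun_apply sp intro!: cv.subspace_scale[OF W] kW)
    also have "\<dots> = (\<Sum>y\<in>Y. R (\<lambda>x. k x y) b * b y)"
      unfolding R_def
      by (intro sum.cong refl) (auto simp: cv.representation_scale[OF B(2)] sp kW mult.commute)
    finally have "R b b = (\<Sum>y\<in>Y. R (\<lambda>x. k x y) b * b y)" .
    moreover have "R b b = 1"
      unfolding R_def using cv.representation_basis[OF B(2) b] by simp
    ultimately show "(\<Sum>y\<in>Y. R (\<lambda>x. k x y) b * b y) = 1" by simp
  qed
  also have "\<dots> = of_nat (cv.dim W)"
    using B(4) by simp
  finally show ?thesis by simp
qed

section \<open>Projection kernels and the dimension of spaces of equivariant maps\<close>

text \<open>A kernel \<open>K\<close> on \<open>X\<close> encodes a linear projection onto \<open>U\<close>.\<close>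

definition proj_kernel :: "'x set \<Rightarrow> ('x \<Rightarrow> complex) set \<Rightarrow> ('x \<Rightarrow> 'x \<Rightarrow> complex) \<Rightarrow> bool" where
  "proj_kernel X U K \<longleftrightarrow> (\<forall>y\<in>X. (\<lambda>x. K x y) \<in> U) \<and> (\<forall>u\<in>U. \<forall>x. u x = (\<Sum>y\<in>X. K x y * u y))"

text \<open>A linear left inverse of the inclusion of \<open>U\<close> is a projection onto
  \<open>U\<close>; the kernel is its matrix with respect to the functions
  \<open>delta y\<close>.\<close>

lemma proj_kernel_exists:
  assumes X: "finite X" and U: "cv.subspace U" and supp: "\<And>u x. u \<in> U \<Longrightarrow> x \<notin> X \<Longrightarrow> u x = 0"
  shows "\<exists>K. proj_kernel X U K"
proof -
  have lid: "Vector_Spaces.linear scaleC scaleC (id :: ('a \<Rightarrow> complex) \<Rightarrow> _)"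
    by (rule cv.linear_id)
  obtain g :: "('a \<Rightarrow> complex) \<Rightarrow> ('a \<Rightarrow> complex)"
    where g: "range g \<subseteq> U" "Vector_Spaces.linear scaleC scaleC g" "\<forall>v\<in>U. g (id v) = v"
    using cvp.linear_exists_left_inverse_on[OF lid U] by auto
  have "proj_kernel X U (\<lambda>x y. g (delta y) x)"
    unfolding proj_kernel_def
  proof (intro conjI ballI allI)
    fix u x assume u: "u \<in> U"
    have "u = g u" using g(3) u by simp
    also have "\<dots> = g (\<Sum>y\<in>X. u y *\<^sub>C delta y)"
      using fun_eq_sum_delta[OF X supp[OF u]] by simp
    also have "\<dots> = (\<Sum>y\<in>X. u y *\<^sub>C g (delta y))"
      by (simp add: cvp.linear_sum[OF g(2)] cvp.linear_scale[OF g(2)])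
    finally have "u x = (\<Sum>y\<in>X. u y *\<^sub>C g (delta y)) x" by metis
    then show "u x = (\<Sum>y\<in>X. g (delta y) x * u y)"
      by (simp add: sum_fun_apply mult.commute)
  qed (use g(1) in auto)
  then show ?thesis by blast
qed

text \<open>\<open>G\<close> acts on \<open>U \<subseteq> \<complex>\<^bsup>X\<^esup>\<close> by \<open>(g u) x = u (xa g x)\<close>, and on the space with basis \<open>Q\<close> by
  \<open>g q = eps g q (qa g q)\<close>. The equivariant maps from the second space to the first one are encoded
  as functions on \<open>Q \<times> X\<close>.\<close>

locale signed_action =
  fixes G :: "'g set" and mul :: "'g \<Rightarrow> 'g \<Rightarrow> 'g"
    and Q :: "'q set" and qa :: "'g \<Rightarrow> 'q \<Rightarrow> 'q" and eps :: "'g \<Rightarrow> 'q \<Rightarrow> complex"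
    and X :: "'x set" and xa :: "'g \<Rightarrow> 'x \<Rightarrow> 'x"
    and U :: "('x \<Rightarrow> complex) set" and K :: "'x \<Rightarrow> 'x \<Rightarrow> complex"
  assumes G: "finite G" "G \<noteq> {}" and mul: "h \<in> G \<Longrightarrow> bij_betw (\<lambda>g. mul g h) G G"
    and Q: "finite Q" and qa: "g \<in> G \<Longrightarrow> q \<in> Q \<Longrightarrow> qa g q \<in> Q"
    and qa_mul: "g \<in> G \<Longrightarrow> h \<in> G \<Longrightarrow> q \<in> Q \<Longrightarrow> qa (mul g h) q = qa g (qa h q)"
    and eps_mul: "g \<in> G \<Longrightarrow> h \<in> G \<Longrightarrow> q \<in> Q \<Longrightarrow> eps (mul g h) q = eps g (qa h q) * eps h q"
    and eps_sq: "g \<in> G \<Longrightarrow> q \<in> Q \<Longrightarrow> eps g q * eps g q = 1"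
    and X: "finite X" and xa: "g \<in> G \<Longrightarrow> bij_betw (xa g) X X"
    and xa_mul: "g \<in> G \<Longrightarrow> h \<in> G \<Longrightarrow> x \<in> X \<Longrightarrow> xa (mul g h) x = xa h (xa g x)"
    and U: "cv.subspace U" and suppU: "u \<in> U \<Longrightarrow> x \<notin> X \<Longrightarrow> u x = 0"
    and K: "proj_kernel X U K"
    and K_inv: "g \<in> G \<Longrightarrow> x \<in> X \<Longrightarrow> y \<in> X \<Longrightarrow> K (xa g x) (xa g y) = K x y"
begin

definition equi_maps :: "('q \<times> 'x \<Rightarrow> complex) set" where
  "equi_maps = {\<phi>. (\<forall>q x. (q, x) \<notin> Q \<times> X \<longrightarrow> \<phi> (q, x) = 0) \<and> (\<forall>q\<in>Q. (\<lambda>x. \<phi> (q, x)) \<in> U) \<and>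
     (\<forall>g\<in>G. \<forall>q\<in>Q. \<forall>x\<in>X. \<phi> (qa g q, x) = eps g q * \<phi> (q, xa g x))}"

lemma subspace_equi_maps: "cv.subspace equi_maps"
proof -
  have "(\<lambda>x. 0) \<in> U" "\<And>u v. u \<in> U \<Longrightarrow> v \<in> U \<Longrightarrow> (\<lambda>x. u x + v x) \<in> U"
    "\<And>c u. u \<in> U \<Longrightarrow> (\<lambda>x. c * u x) \<in> U"
    using cv.subspace_0[OF U] cv.subspace_add[OF U] cv.subspace_scale[OF U]
    by (auto simp: zero_fun_def plus_fun_def scaleC_fun_def)
  then show ?thesis
    unfolding cv.subspace_def equi_maps_def by (auto simp: algebra_simps)
qed

text \<open>The projection whose trace is taken applies \<open>K\<close> in the second variable and
  then averages over \<open>G\<close>. On the diagonal only the \<open>g\<close> with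
  \<open>qa g q = q\<close> survive, which separates the two factors.\<close>

lemma dim_equi_maps:
  "of_nat (cv.dim equi_maps) =
    (\<Sum>g\<in>G. (\<Sum>q | q \<in> Q \<and> qa g q = q. eps g q) * (\<Sum>x\<in>X. K x (xa g x))) / of_nat (card G)"
proof -
  let ?N = "of_nat (card G) :: complex"
  have N: "?N \<noteq> 0" using G by simp
  have KU: "(\<lambda>x. K x y) \<in> U" if "y \<in> X" for y
    using K that by (auto simp: proj_kernel_def)
  have Krep: "u x = (\<Sum>y\<in>X. K x y * u y)" if "u \<in> U" for u x
    using K that by (auto simp: proj_kernel_def)
  have xaX: "xa g x \<in> X" if "g \<in> G" "x \<in> X" for g x
    using xa[OF that(1)] that(2) by (auto simp: bij_betw_def)
  \<comment> \<open>The averaged operator sends \<open>\<phi>\<close> to the mean over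
    \<open>g\<close> of \<open>eps g q * (\<Sum>x'. K x (xa g x') * \<phi> (qa g q, x'))\<close>. A
    sign squares to 1, so \<open>eps g q\<close> also undoes the sign in the equivariance
    condition.\<close>
  define k where "k y y' = (case y of (q, x) \<Rightarrow> case y' of (q', x') \<Rightarrow>
    if q \<in> Q then (\<Sum>g\<in>G. if q' = qa g q then eps g q * K x (xa g x') else 0) / ?N else 0)"
    for y y' :: "'q \<times> 'x"
  have "of_nat (cv.dim equi_maps) = (\<Sum>y\<in>Q \<times> X. k y y)"
  proof (rule dim_eq_trace[where k = k])
    show "finite (Q \<times> X)" using Q X by simp
    show "cv.subspace equi_maps" by (rule subspace_equi_maps)
    show "\<And>v y. v \<in> equi_maps \<Longrightarrow> y \<notin> Q \<times> X \<Longrightarrow> v y = 0"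
      by (auto simp: equi_maps_def)
  next
    fix y' assume "y' \<in> Q \<times> X"
    then obtain q' x' where y': "y' = (q', x')" "q' \<in> Q" "x' \<in> X" by auto
    have cU: "(\<lambda>x. k (q, x) y') \<in> U" if "q \<in> Q" for q
    proof -
      have "(\<Sum>g\<in>G. ((if q' = qa g q then eps g q else 0) / ?N) *\<^sub>C (\<lambda>x. K x (xa g x'))) \<in> U"
        by (intro cv.subspace_sum[OF U] cv.subspace_scale[OF U] KU xaX y')
      also have "(\<Sum>g\<in>G. ((if q' = qa g q then eps g q else 0) / ?N) *\<^sub>C (\<lambda>x. K x (xa g x')))
          = (\<lambda>x. k (q, x) y')"
        by (auto simp: fun_eq_iff k_def y' sum_fun_apply sum_divide_distrib that intro!: sum.cong)
      finally show ?thesis .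
    qed
    have eq: "k (qa h q, x) y' = eps h q * k (q, xa h x) y'" if h: "h \<in> G" "q \<in> Q" "x \<in> X" for h q x
    proof -
      \<comment> \<open>Each summand at \<open>g\<close> is rewritten in terms of
        \<open>mul g h\<close>: the cocycle rule supplies the sign and the invariance of
        \<open>K\<close> absorbs \<open>xa h\<close>. Right translation by \<open>h\<close> then
        restores a sum over \<open>g\<close>.\<close>
      have "(\<Sum>g\<in>G. if q' = qa g (qa h q) then eps g (qa h q) * K x (xa g x') else 0)
        = (\<Sum>g\<in>G. eps h q * (if q' = qa (mul g h) q then eps (mul g h) q * K (xa h x) (xa (mul g h) x') else 0))"
      proof (intro sum.cong refl)
        fix g assume g: "g \<in> G"
        have 1: "K (xa h x) (xa (mul g h) x') = K x (xa g x')"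
          using xa_mul[OF g h(1) y'(3)] K_inv[OF h(1,3) xaX[OF g y'(3)]] by simp
        have 2: "eps h q * eps (mul g h) q = eps g (qa h q)"
          using eps_mul[OF g h(1,2)] eps_sq[OF h(1,2)] by (metis mult.assoc mult.commute mult_1)
        show "(if q' = qa g (qa h q) then eps g (qa h q) * K x (xa g x') else 0) =
          eps h q * (if q' = qa (mul g h) q then eps (mul g h) q * K (xa h x) (xa (mul g h) x') else 0)"
          unfolding 1 qa_mul[OF g h(1,2)] 2[symmetric] by simp
      qed
      also have "\<dots> = (\<Sum>g\<in>G. eps h q * (if q' = qa g q then eps g q * K (xa h x) (xa g x') else 0))"
        by (rule sum.reindex_bij_betw[OF mul[OF h(1)]])
      finally show ?thesis
        using qa[OF h(1,2)] h(2) by (simp add: k_def y' sum_distrib_left)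
    qed
    have s0: "k (q, x) y' = 0" if "(q, x) \<notin> Q \<times> X" for q x
    proof (cases "q \<in> Q")
      case True
      with that have "x \<notin> X" by simp
      then show ?thesis using suppU[OF cU[OF True]] by simp
    qed (simp add: k_def y')
    show "(\<lambda>y. k y y') \<in> equi_maps"
      unfolding equi_maps_def mem_Collect_eq by (intro conjI allI ballI impI s0 cU eq)
  next
    fix \<phi> y assume \<phi>: "\<phi> \<in> equi_maps" and "y \<in> Q \<times> X"
    then obtain q x where y: "y = (q, x)" "q \<in> Q" "x \<in> X" by auto
    have \<phi>U: "(\<lambda>x. \<phi> (q, x)) \<in> U"
      using \<phi> y by (auto simp: equi_maps_def)
    have "(\<Sum>y'\<in>Q \<times> X. k y y' * \<phi> y') = (\<Sum>q'\<in>Q. \<Sum>x'\<in>X. \<Sum>g\<in>G.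
        (if q' = qa g q then eps g q * K x (xa g x') / ?N * \<phi> (q', x') else 0))"
      unfolding sum.cartesian_product[where A = Q and B = X]
      by (auto simp: k_def y sum_divide_distrib sum_distrib_right intro!: sum.cong)
    also have "\<dots> = (\<Sum>q'\<in>Q. \<Sum>g\<in>G. \<Sum>x'\<in>X.
        (if q' = qa g q then eps g q * K x (xa g x') / ?N * \<phi> (q', x') else 0))"
      by (intro sum.cong refl sum.swap)
    also have "\<dots> = (\<Sum>g\<in>G. \<Sum>q'\<in>Q. \<Sum>x'\<in>X.
        (if q' = qa g q then eps g q * K x (xa g x') / ?N * \<phi> (q', x') else 0))"
      by (rule sum.swap)
    also have "\<dots> = (\<Sum>g\<in>G. \<phi> y / ?N)"
    proof (intro sum.cong refl)
      fix g assume g: "g \<in> G"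
      have "(\<Sum>q'\<in>Q. \<Sum>x'\<in>X. (if q' = qa g q then eps g q * K x (xa g x') / ?N * \<phi> (q', x') else 0))
        = (\<Sum>q'\<in>Q. if q' = qa g q then (\<Sum>x'\<in>X. eps g q * K x (xa g x') / ?N * \<phi> (qa g q, x')) else 0)"
        by (intro sum.cong refl) auto
      also have "\<dots> = (\<Sum>x'\<in>X. eps g q * K x (xa g x') / ?N * \<phi> (qa g q, x'))"
        using qa[OF g y(2)] Q by (simp add: sum.delta')
      also have "\<dots> = (\<Sum>x'\<in>X. K x (xa g x') / ?N * \<phi> (q, xa g x'))"
      proof (intro sum.cong refl)
        fix x' assume x': "x' \<in> X"
        have "\<phi> (qa g q, x') = eps g q * \<phi> (q, xa g x')"
          using \<phi> g y x' by (auto simp: equi_maps_def)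
        then show "eps g q * K x (xa g x') / ?N * \<phi> (qa g q, x') = K x (xa g x') / ?N * \<phi> (q, xa g x')"
          using eps_sq[OF g y(2)] by (simp add: mult.left_commute mult.commute)
      qed
      also have "\<dots> = (\<Sum>x'\<in>X. K x x' / ?N * \<phi> (q, x'))"
        by (rule sum.reindex_bij_betw[OF xa[OF g]])
      also have "\<dots> = (\<Sum>x'\<in>X. K x x' * \<phi> (q, x')) / ?N"
        by (simp add: sum_divide_distrib)
      also have "(\<Sum>x'\<in>X. K x x' * \<phi> (q, x')) = \<phi> y"
        using Krep[OF \<phi>U, of x] y by simp
      finally show "(\<Sum>q'\<in>Q. \<Sum>x'\<in>X. (if q' = qa g q then eps g q * K x (xa g x') / ?N * \<phi> (q', x') else 0))
        = \<phi> y / ?N" .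
    qed
    also have "\<dots> = \<phi> y" using N by simp
    finally show "\<phi> y = (\<Sum>y'\<in>Q \<times> X. k y y' * \<phi> y')" by simp
  qed
  also have "\<dots> = (\<Sum>q\<in>Q. \<Sum>x\<in>X. \<Sum>g\<in>G. (if qa g q = q then eps g q * K x (xa g x) / ?N else 0))"
    unfolding sum.cartesian_product[where A = Q and B = X]
    by (auto simp: k_def sum_divide_distrib intro!: sum.cong)
  also have "\<dots> = (\<Sum>q\<in>Q. \<Sum>g\<in>G. \<Sum>x\<in>X. (if qa g q = q then eps g q * K x (xa g x) / ?N else 0))"
    by (intro sum.cong refl sum.swap)
  also have "\<dots> = (\<Sum>g\<in>G. \<Sum>q\<in>Q. \<Sum>x\<in>X. (if qa g q = q then eps g q * K x (xa g x) / ?N else 0))"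
    by (rule sum.swap)
  also have "\<dots> = (\<Sum>g\<in>G. (\<Sum>q\<in>Q. (if qa g q = q then eps g q else 0)) * (\<Sum>x\<in>X. K x (xa g x)) / ?N)"
    unfolding sum_product sum_divide_distrib by (intro sum.cong refl) auto
  also have "\<dots> = (\<Sum>g\<in>G. (\<Sum>q | q \<in> Q \<and> qa g q = q. eps g q) * (\<Sum>x\<in>X. K x (xa g x)) / ?N)"
    by (simp add: sum.inter_filter[OF Q])
  finally show ?thesis by (simp add: sum_divide_distrib)
qed

end

section \<open>The Specht module and its character\<close>

lemma bij_betw_perms_comp_right:
  "\<rho> permutes S \<Longrightarrow> bij_betw (\<lambda>\<pi>. \<pi> \<circ> \<rho>) {\<pi>. \<pi> permutes S} {\<pi>. \<pi> permutes S}"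
  by (rule bij_betw_byWitness[where f' = "\<lambda>\<pi>. \<pi> \<circ> inv \<rho>"])
     (auto simp: permutes_inv_o comp_assoc intro: permutes_compose permutes_inv)

lemma bij_betw_perms_comp_left:
  "\<rho> permutes S \<Longrightarrow> bij_betw (\<lambda>\<pi>. \<rho> \<circ> \<pi>) {\<pi>. \<pi> permutes S} {\<pi>. \<pi> permutes S}"
  by (rule bij_betw_byWitness[where f' = "\<lambda>\<pi>. inv \<rho> \<circ> \<pi>"])
     (auto simp: permutes_inv_o comp_assoc[symmetric] intro: permutes_compose permutes_inv)

text \<open>A finite set that contains all tabloids of all partitions of \<open>m\<close>, since
  such a partition has at most \<open>m\<close> rows. It is not restricted to actual tabloids:
  closure under permutations of the entries is all that the kernels require, and vectors of the
  Specht module vanish elsewhere.\<close>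

definition row_maps :: "nat \<Rightarrow> (nat \<Rightarrow> nat) set" where
  "row_maps m = {r. (\<forall>x<m. r x < m) \<and> (\<forall>x\<ge>m. r x = 0)}"

lemma finite_row_maps: "finite (row_maps m)"
proof (rule finite_subset)
  show "row_maps m \<subseteq> {f. \<forall>x. (x \<in> {..<m} \<longrightarrow> f x \<in> {..<m}) \<and> (x \<notin> {..<m} \<longrightarrow> f x = 0)}"
    by (auto simp: row_maps_def)
  show "finite {f :: nat \<Rightarrow> nat. \<forall>x. (x \<in> {..<m} \<longrightarrow> f x \<in> {..<m}) \<and> (x \<notin> {..<m} \<longrightarrow> f x = 0)}"
    by (intro finite_set_of_finite_funs) auto
qed

lemma permutes_lessThan: "\<pi> permutes {..<m} \<Longrightarrow> (\<pi> x < m) = (x < (m::nat))"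
  using permutes_in_image[of \<pi> "{..<m}" x] by simp

lemma permutes_ge: "\<pi> permutes {..<m} \<Longrightarrow> m \<le> x \<Longrightarrow> \<pi> x = (x::nat)"
  by (auto simp: permutes_def)

lemma row_maps_comp: "r \<in> row_maps m \<Longrightarrow> \<pi> permutes {..<m} \<Longrightarrow> r \<circ> \<pi> \<in> row_maps m"
  by (auto simp: row_maps_def permutes_lessThan permutes_ge)

lemma bij_betw_row_maps:
  "\<pi> permutes {..<m} \<Longrightarrow> bij_betw (\<lambda>r. r \<circ> \<pi>) (row_maps m) (row_maps m)"
  by (rule bij_betw_byWitness[where f' = "\<lambda>r. r \<circ> inv \<pi>"])
     (auto simp: permutes_inv_o comp_assoc intro: row_maps_comp permutes_inv)

lemma finite_cells [simp]: "finite (cells \<mu>)"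
proof -
  have "cells \<mu> = (SIGMA i:{..<length \<mu>}. {..<\<mu> ! i})"
    by (auto simp: cells_def)
  then show ?thesis by simp
qed

lemma card_cells: "card (cells \<mu>) = sum_list \<mu>"
proof -
  have "cells \<mu> = (SIGMA i:{..<length \<mu>}. {..<\<mu> ! i})"
    by (auto simp: cells_def)
  then show ?thesis by (simp add: sum_list_sum_nth atLeast0LessThan)
qed

lemma tableau_exists: "\<exists>t. is_tableau \<mu> t"
  using ex_bij_betw_finite_nat[OF finite_cells, of \<mu>] by (auto simp: is_tableau_def card_cells atLeast0LessThan)

lemma tableau_inv_into:
  assumes "is_tableau \<mu> t"
  shows "x < sum_list \<mu> \<Longrightarrow> inv_into (cells \<mu>) t x \<in> cells \<mu>"
    and "x < sum_list \<mu> \<Longrightarrow> t (inv_into (cells \<mu>) t x) = x"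
    and "c \<in> cells \<mu> \<Longrightarrow> inv_into (cells \<mu>) t (t c) = c"
    and "c \<in> cells \<mu> \<Longrightarrow> t c < sum_list \<mu>"
  using assms unfolding is_tableau_def
  by (auto simp: bij_betw_def inv_into_into f_inv_into_f)

lemma is_tableau_comp:
  "is_tableau \<mu> t \<Longrightarrow> \<pi> permutes {..<sum_list \<mu>} \<Longrightarrow> is_tableau \<mu> (\<pi> \<circ> t)"
  unfolding is_tableau_def using bij_betw_trans permutes_imp_bij by blast

lemma tableau_comp_inv_into:
  assumes t: "is_tableau \<mu> t" and \<pi>: "\<pi> permutes {..<sum_list \<mu>}" and x: "x < sum_list \<mu>"
  shows "inv_into (cells \<mu>) (\<pi> \<circ> t) x = inv_into (cells \<mu>) t (inv \<pi> x)"
proof (rule inv_into_f_eq)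
  have y: "inv \<pi> x < sum_list \<mu>"
    using permutes_lessThan[OF permutes_inv[OF \<pi>]] x by simp
  show "inj_on (\<pi> \<circ> t) (cells \<mu>)"
    using is_tableau_comp[OF t \<pi>] by (simp add: is_tableau_def bij_betw_def)
  show "inv_into (cells \<mu>) t (inv \<pi> x) \<in> cells \<mu>"
    by (rule tableau_inv_into(1)[OF t y])
  show "(\<pi> \<circ> t) (inv_into (cells \<mu>) t (inv \<pi> x)) = x"
    using tableau_inv_into(2)[OF t y] permutes_inverses(1)[OF \<pi>] by simp
qed

lemma tabloid_comp:
  assumes "is_tableau \<mu> t" and \<pi>: "\<pi> permutes {..<sum_list \<mu>}"
  shows "tabloid \<mu> (\<pi> \<circ> t) = tabloid \<mu> t \<circ> inv \<pi>"
  using permutes_lessThan[OF permutes_inv[OF \<pi>]]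
  by (auto simp: fun_eq_iff tabloid_def row_of_def tableau_comp_inv_into[OF assms])

lemma col_stab_permutes: "\<rho> \<in> col_stab \<mu> t \<Longrightarrow> \<rho> permutes {..<sum_list \<mu>}"
  by (simp add: col_stab_def)

lemma finite_col_stab [simp]: "finite (col_stab \<mu> t)"
  by (rule finite_subset[of _ "{\<pi>. \<pi> permutes {..<sum_list \<mu>}}"]) (auto simp: col_stab_def finite_permutations)

lemma col_stab_inv: "\<rho> \<in> col_stab \<mu> t \<Longrightarrow> inv \<rho> \<in> col_stab \<mu> t"
  unfolding col_stab_def
  by (clarsimp simp: permutes_inv) (metis permutes_inv permutes_inverses(1) permutes_lessThan)

lemma col_stab_comp: "\<rho> \<in> col_stab \<mu> t \<Longrightarrow> \<sigma> \<in> col_stab \<mu> t \<Longrightarrow> \<rho> \<circ> \<sigma> \<in> col_stab \<mu> t"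
  unfolding col_stab_def by (auto simp: permutes_compose permutes_lessThan)

lemma polytabloid_apply:
  assumes "is_tableau \<mu> t"
  shows "polytabloid \<mu> t r = (\<Sum>\<rho>\<in>col_stab \<mu> t. of_int (sign \<rho>) * of_bool (r \<circ> \<rho> = tabloid \<mu> t))"
  unfolding polytabloid_def sum_fun_apply
proof (rule sum.cong[OF refl])
  fix \<rho> assume "\<rho> \<in> col_stab \<mu> t"
  then have \<rho>: "\<rho> permutes {..<sum_list \<mu>}" by (rule col_stab_permutes)
  have "r = tabloid \<mu> t \<circ> inv \<rho> \<longleftrightarrow> r \<circ> \<rho> = tabloid \<mu> t"
    using permutes_inv_o[OF \<rho>] by (metis comp_assoc comp_id)
  then show "(of_int (sign \<rho>) *\<^sub>C delta (tabloid \<mu> (\<rho> \<circ> t))) r =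
      of_int (sign \<rho>) * of_bool (r \<circ> \<rho> = tabloid \<mu> t)"
    by (auto simp: delta_def tabloid_comp[OF assms \<rho>])
qed

lemma permutes_permutation: "\<pi> permutes {..<m::nat} \<Longrightarrow> permutation \<pi>"
  using permutation_permutes by blast

text \<open>Conjugation by \<open>\<pi>\<close> carries the column stabilizer of \<open>t\<close>
  onto that of \<open>\<pi> \<circ> t\<close> and preserves signs, so the two alternating sums agree
  term by term.\<close>

lemma polytabloid_comp:
  assumes t: "is_tableau \<mu> t" and \<pi>: "\<pi> permutes {..<sum_list \<mu>}"
  shows "polytabloid \<mu> (\<pi> \<circ> t) = tabloid_act \<pi> (polytabloid \<mu> t)"
proof
  fix r
  let ?c = "\<lambda>\<rho>. inv \<pi> \<circ> \<rho> \<circ> \<pi>" and ?d = "\<lambda>\<rho>. \<pi> \<circ> \<rho> \<circ> inv \<pi>"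
  have i: "inv \<pi> \<circ> \<pi> = id" "\<pi> \<circ> inv \<pi> = id" "\<And>x. inv \<pi> (\<pi> x) = x" "\<And>x. \<pi> (inv \<pi> x) = x"
    using permutes_inv_o[OF \<pi>] permutes_inverses[OF \<pi>] by auto
  have col: "col_of \<mu> (\<pi> \<circ> t) x = col_of \<mu> t (inv \<pi> x)" if "x < sum_list \<mu>" for x
    using tableau_comp_inv_into[OF t \<pi> that] by (simp add: col_of_def)
  have c: "?c \<rho> \<in> col_stab \<mu> t" if "\<rho> \<in> col_stab \<mu> (\<pi> \<circ> t)" for \<rho>
  proof -
    have "\<rho> permutes {..<sum_list \<mu>}" using that by (rule col_stab_permutes)
    then have "?c \<rho> permutes {..<sum_list \<mu>}"
      by (intro permutes_compose permutes_inv \<pi>)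
    moreover have "col_of \<mu> t (inv \<pi> (\<rho> (\<pi> x))) = col_of \<mu> t x" if x: "x < sum_list \<mu>" for x
    proof -
      have x': "\<pi> x < sum_list \<mu>" using x permutes_lessThan[OF \<pi>] by simp
      have "col_of \<mu> (\<pi> \<circ> t) (\<rho> (\<pi> x)) = col_of \<mu> (\<pi> \<circ> t) (\<pi> x)"
        using \<open>\<rho> \<in> _\<close> x' by (simp add: col_stab_def)
      then show ?thesis
        using col x' permutes_lessThan[OF \<open>\<rho> permutes _\<close>] i by simp
    qed
    ultimately show ?thesis by (simp add: col_stab_def)
  qed
  have d: "?d \<rho> \<in> col_stab \<mu> (\<pi> \<circ> t)" if "\<rho> \<in> col_stab \<mu> t" for \<rho>
  proof -
    have \<rho>: "\<rho> permutes {..<sum_list \<mu>}" using that by (rule col_stab_permutes)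
    then have "?d \<rho> permutes {..<sum_list \<mu>}"
      by (intro permutes_compose permutes_inv \<pi>)
    moreover have "col_of \<mu> (\<pi> \<circ> t) (\<pi> (\<rho> (inv \<pi> x))) = col_of \<mu> (\<pi> \<circ> t) x" if x: "x < sum_list \<mu>" for x
      using x \<open>\<rho> \<in> _\<close> permutes_lessThan[OF \<pi>] permutes_lessThan[OF permutes_inv[OF \<pi>]] permutes_lessThan[OF \<rho>]
      by (simp add: col i col_stab_def)
    ultimately show ?thesis by (simp add: col_stab_def)
  qed
  have "polytabloid \<mu> (\<pi> \<circ> t) r =
      (\<Sum>\<rho>\<in>col_stab \<mu> (\<pi> \<circ> t). of_int (sign \<rho>) * of_bool (r \<circ> \<rho> = tabloid \<mu> (\<pi> \<circ> t)))"
    by (rule polytabloid_apply[OF is_tableau_comp[OF t \<pi>]])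
  also have "\<dots> = (\<Sum>\<rho>\<in>col_stab \<mu> t. of_int (sign \<rho>) * of_bool (r \<circ> \<pi> \<circ> \<rho> = tabloid \<mu> t))"
  proof (rule sum.reindex_bij_witness[where i = ?d and j = ?c])
    fix \<rho> assume \<rho>: "\<rho> \<in> col_stab \<mu> (\<pi> \<circ> t)"
    then have p: "permutation \<rho>" "permutation \<pi>" "permutation (inv \<pi>)"
      using col_stab_permutes permutes_permutation \<pi> permutes_inv by blast+
    have "sign (?c \<rho>) = sign \<pi> * sign \<rho> * sign \<pi>"
      using p by (simp add: sign_compose permutation_compose sign_inverse)
    then have "sign (?c \<rho>) = sign \<rho>"
      by (metis mult.assoc mult.commute mult_1 sign_idempotent)
    moreover have "r \<circ> \<pi> \<circ> ?c \<rho> = tabloid \<mu> t \<longleftrightarrow> r \<circ> \<rho> = tabloid \<mu> (\<pi> \<circ> t)"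
    proof -
      have "r \<circ> \<pi> \<circ> ?c \<rho> = r \<circ> \<rho> \<circ> \<pi>"
        by (simp add: fun_eq_iff i)
      then show ?thesis
        unfolding tabloid_comp[OF t \<pi>] using i by (metis comp_assoc comp_id)
    qed
    ultimately show "of_int (sign (?c \<rho>)) * of_bool (r \<circ> \<pi> \<circ> ?c \<rho> = tabloid \<mu> t) =
        of_int (sign \<rho>) * (of_bool (r \<circ> \<rho> = tabloid \<mu> (\<pi> \<circ> t)) :: complex)" by simp
  qed (use c d i in \<open>auto simp: fun_eq_iff\<close>)
  also have "\<dots> = tabloid_act \<pi> (polytabloid \<mu> t) r"
    by (simp add: tabloid_act_def polytabloid_apply[OF t])
  finally show "polytabloid \<mu> (\<pi> \<circ> t) r = tabloid_act \<pi> (polytabloid \<mu> t) r" .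
qed

text \<open>The condition \<open>is_tableau\<close> leaves the values off the cells free, so
  equality of fillings can only be expected on the cells.\<close>

lemma polytabloid_cong:
  assumes "\<And>c. c \<in> cells \<mu> \<Longrightarrow> t c = t' c"
  shows "polytabloid \<mu> t = polytabloid \<mu> t'"
proof -
  have 1: "inv_into (cells \<mu>) (\<pi> \<circ> t) = inv_into (cells \<mu>) (\<pi> \<circ> t')" for \<pi> :: "nat \<Rightarrow> nat"
    unfolding inv_into_def by (intro ext arg_cong[of _ _ Eps]) (use assms in auto)
  have 2: "inv_into (cells \<mu>) t = inv_into (cells \<mu>) t'"
    using 1[of id] by simp
  have "col_stab \<mu> t = col_stab \<mu> t'"
    by (simp add: col_stab_def col_of_def 2)
  moreover have "tabloid \<mu> (\<pi> \<circ> t) = tabloid \<mu> (\<pi> \<circ> t')" for \<pi>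
    by (simp add: fun_eq_iff tabloid_def row_of_def 1)
  ultimately show ?thesis by (simp add: polytabloid_def)
qed

text \<open>Any two tableaux of the same shape differ by a permutation of the entries, so one
  polytabloid generates the module. Vectors can then be written with coefficients indexed by
  permutations.\<close>

lemma specht_eq_span:
  assumes t: "is_tableau \<mu> t"
  shows "specht \<mu> = cv.span ((\<lambda>\<pi>. tabloid_act \<pi> (polytabloid \<mu> t)) ` {\<pi>. \<pi> permutes {..<sum_list \<mu>}})"
proof -
  have "\<exists>\<pi>. \<pi> permutes {..<sum_list \<mu>} \<and> polytabloid \<mu> s = tabloid_act \<pi> (polytabloid \<mu> t)"
    if s: "is_tableau \<mu> s" for s
  proof -
    define \<pi> where "\<pi> x = (if x < sum_list \<mu> then s (inv_into (cells \<mu>) t x) else x)" for x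
    have "bij_betw (s \<circ> inv_into (cells \<mu>) t) {..<sum_list \<mu>} {..<sum_list \<mu>}"
      using s t unfolding is_tableau_def by (meson bij_betw_inv_into bij_betw_trans)
    then have "bij_betw \<pi> {..<sum_list \<mu>} {..<sum_list \<mu>}"
      by (subst bij_betw_cong[of _ _ "s \<circ> inv_into (cells \<mu>) t"]) (auto simp: \<pi>_def)
    then have \<pi>: "\<pi> permutes {..<sum_list \<mu>}"
      by (rule bij_imp_permutes) (simp add: \<pi>_def)
    have "polytabloid \<mu> s = polytabloid \<mu> (\<pi> \<circ> t)"
      by (rule polytabloid_cong) (simp add: \<pi>_def tableau_inv_into[OF t])
    then show ?thesis using \<pi> polytabloid_comp[OF t \<pi>] by auto
  qed
  then have "{polytabloid \<mu> s | s. is_tableau \<mu> s} \<subseteq>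
      (\<lambda>\<pi>. tabloid_act \<pi> (polytabloid \<mu> t)) ` {\<pi>. \<pi> permutes {..<sum_list \<mu>}}"
    by blast
  moreover have "tabloid_act \<pi> (polytabloid \<mu> t) \<in> {polytabloid \<mu> s | s. is_tableau \<mu> s}"
    if "\<pi> permutes {..<sum_list \<mu>}" for \<pi>
    using polytabloid_comp[OF t that] is_tableau_comp[OF t that] by (metis (mono_tags, lifting) mem_Collect_eq)
  ultimately have "{polytabloid \<mu> s | s. is_tableau \<mu> s} =
      (\<lambda>\<pi>. tabloid_act \<pi> (polytabloid \<mu> t)) ` {\<pi>. \<pi> permutes {..<sum_list \<mu>}}"
    by blast
  then show ?thesis by (simp add: specht_def)
qed

lemma length_le_sum_list: "0 \<notin> set \<mu> \<Longrightarrow> length \<mu> \<le> sum_list (\<mu> :: nat list)"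
  by (induction \<mu>) auto

lemma tabloid_in_row_maps:
  assumes "is_partition \<mu> m" "is_tableau \<mu> t"
  shows "tabloid \<mu> t \<in> row_maps m"
proof -
  have "row_of \<mu> t x < length \<mu>" if "x < sum_list \<mu>" for x
    using tableau_inv_into(1)[OF assms(2) that] by (auto simp: row_of_def cells_def)
  moreover have "length \<mu> \<le> m" "sum_list \<mu> = m"
    using assms(1) length_le_sum_list by (auto simp: is_partition_def)
  ultimately show ?thesis
    by (fastforce simp: row_maps_def tabloid_def)
qed

lemma linear_tabloid_act: "Vector_Spaces.linear scaleC scaleC (tabloid_act \<pi>)"
  by (rule Vector_Spaces.linear_iff[THEN iffD2])
     (auto simp: cv.vector_space_axioms tabloid_act_def fun_eq_iff)

lemma subspace_specht: "cv.subspace (specht \<mu>)"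
  by (simp add: specht_def)

lemma specht_support:
  assumes \<mu>: "is_partition \<mu> m" and "v \<in> specht \<mu>" "r \<notin> row_maps m"
  shows "v r = 0"
proof -
  have "specht \<mu> \<subseteq> {v. v r = 0}"
    unfolding specht_def
  proof (rule cv.span_minimal)
    show "cv.subspace {v :: _ \<Rightarrow> complex. v r = 0}"
      by (auto simp: cv.subspace_def)
    have ne: "r \<noteq> tabloid \<mu> (\<pi> \<circ> t)" if "is_tableau \<mu> t" "\<pi> \<in> col_stab \<mu> t" for t \<pi>
      using tabloid_in_row_maps[OF \<mu> is_tableau_comp[OF that(1) col_stab_permutes[OF that(2)]]] assms(3)
      by blast
    have "polytabloid \<mu> t r = 0" if "is_tableau \<mu> t" for t
      unfolding polytabloid_def sum_fun_apply
      by (rule sum.neutral) (simp add: delta_def ne[OF that])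
    then show "{polytabloid \<mu> t | t. is_tableau \<mu> t} \<subseteq> {v. v r = 0}"
      by blast
  qed
  then show ?thesis using assms(2) by auto
qed

lemma specht_tabloid_act:
  assumes "v \<in> specht \<mu>" "\<pi> permutes {..<sum_list \<mu>}"
  shows "tabloid_act \<pi> v \<in> specht \<mu>"
proof -
  have "tabloid_act \<pi> ` specht \<mu> = cv.span (tabloid_act \<pi> ` {polytabloid \<mu> t | t. is_tableau \<mu> t})"
    unfolding specht_def by (rule cvp.linear_span_image[OF linear_tabloid_act, symmetric])
  also have "\<dots> \<subseteq> specht \<mu>"
    unfolding specht_def
  proof (rule cv.span_mono, safe)
    fix t assume t: "is_tableau \<mu> t"
    show "\<exists>t'. tabloid_act \<pi> (polytabloid \<mu> t) = polytabloid \<mu> t' \<and> is_tableau \<mu> t'"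
      using polytabloid_comp[OF t assms(2)] is_tableau_comp[OF t assms(2)] by metis
  qed
  finally show ?thesis using assms(1) by blast
qed

text \<open>Maschke's averaging argument.\<close>

lemma specht_kernel_exists:
  assumes \<mu>: "is_partition \<mu> m"
  shows "\<exists>K. proj_kernel (row_maps m) (specht \<mu>) K \<and>
    (\<forall>\<pi> r s. \<pi> permutes {..<m} \<longrightarrow> K (r \<circ> \<pi>) (s \<circ> \<pi>) = K r s)"
proof -
  let ?P = "{\<pi>. \<pi> permutes {..<m}}"
  let ?X = "row_maps m"
  have m: "sum_list \<mu> = m" using \<mu> by (simp add: is_partition_def)
  have finP: "finite ?P" by (simp add: finite_permutations)
  have cP: "of_nat (card ?P) \<noteq> (0::complex)"
    by (simp add: card_permutations)
  obtain K0 where K0: "proj_kernel ?X (specht \<mu>) K0"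
    using proj_kernel_exists[OF finite_row_maps subspace_specht, of \<mu> m] specht_support[OF \<mu>] by metis
  have K0rep: "u r = (\<Sum>s\<in>?X. K0 r s * u s)" if "u \<in> specht \<mu>" for u r
    using K0 that unfolding proj_kernel_def by blast
  have K0col: "(\<lambda>r. K0 r s) \<in> specht \<mu>" if "s \<in> ?X" for s
    using K0 that unfolding proj_kernel_def by blast
  define K where "K r s = (\<Sum>\<tau>\<in>?P. K0 (r \<circ> \<tau>) (s \<circ> \<tau>)) / of_nat (card ?P)" for r s
  have Kcol: "(\<lambda>r. K r s) \<in> specht \<mu>" if "s \<in> ?X" for s
  proof -
    have "(1 / of_nat (card ?P)) *\<^sub>C (\<Sum>\<tau>\<in>?P. tabloid_act \<tau> (\<lambda>r. K0 r (s \<circ> \<tau>))) \<in> specht \<mu>"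
      by (intro cv.subspace_scale cv.subspace_sum subspace_specht specht_tabloid_act K0col
            row_maps_comp[OF that]) (simp_all add: m)
    also have "(1 / of_nat (card ?P)) *\<^sub>C (\<Sum>\<tau>\<in>?P. tabloid_act \<tau> (\<lambda>r. K0 r (s \<circ> \<tau>))) = (\<lambda>r. K r s)"
      by (simp add: fun_eq_iff K_def sum_fun_apply tabloid_act_def)
    finally show ?thesis .
  qed
  have Krep: "u r = (\<Sum>s\<in>?X. K r s * u s)" if u: "u \<in> specht \<mu>" for u r
  proof -
    have "(\<Sum>s\<in>?X. K r s * u s) = (\<Sum>s\<in>?X. \<Sum>\<tau>\<in>?P. K0 (r \<circ> \<tau>) (s \<circ> \<tau>) * u s) / of_nat (card ?P)"
      unfolding K_def sum_divide_distrib sum_distrib_right by (intro sum.cong refl) simp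
    also have "(\<Sum>s\<in>?X. \<Sum>\<tau>\<in>?P. K0 (r \<circ> \<tau>) (s \<circ> \<tau>) * u s) =
        (\<Sum>\<tau>\<in>?P. \<Sum>s\<in>?X. K0 (r \<circ> \<tau>) (s \<circ> \<tau>) * u s)"
      by (rule sum.swap)
    also have "\<dots> = (\<Sum>\<tau>\<in>?P. u r)"
    proof (intro sum.cong refl)
      fix \<tau> assume "\<tau> \<in> ?P"
      then have \<tau>: "\<tau> permutes {..<m}" by simp
      \<comment> \<open>\<open>K0\<close> reproduces every vector of the Specht module, in
        particular the translate of \<open>u\<close> by the inverse of \<open>\<tau>\<close>;
        evaluating that at \<open>r \<circ> \<tau>\<close> gives back \<open>u r\<close>.\<close>
      have "(\<Sum>s\<in>?X. K0 (r \<circ> \<tau>) (s \<circ> \<tau>) * u s) =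
          (\<Sum>s\<in>?X. K0 (r \<circ> \<tau>) (s \<circ> \<tau>) * tabloid_act (inv \<tau>) u (s \<circ> \<tau>))"
        by (simp add: tabloid_act_def comp_assoc permutes_inv_o[OF \<tau>])
      also have "\<dots> = (\<Sum>s\<in>?X. K0 (r \<circ> \<tau>) s * tabloid_act (inv \<tau>) u s)"
        by (rule sum.reindex_bij_betw[OF bij_betw_row_maps[OF \<tau>]])
      also have "\<dots> = tabloid_act (inv \<tau>) u (r \<circ> \<tau>)"
        by (rule K0rep[of "tabloid_act (inv \<tau>) u", symmetric]) (simp add: specht_tabloid_act[OF u] m permutes_inv[OF \<tau>])
      also have "\<dots> = u r"
        by (simp add: tabloid_act_def comp_assoc permutes_inv_o[OF \<tau>])
      finally show "(\<Sum>s\<in>?X. K0 (r \<circ> \<tau>) (s \<circ> \<tau>) * u s) = u r" .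
    qed
    finally show ?thesis using cP by simp
  qed
  have Kinv: "K (r \<circ> \<pi>) (s \<circ> \<pi>) = K r s" if \<pi>: "\<pi> permutes {..<m}" for \<pi> r s
    using sum.reindex_bij_betw[OF bij_betw_perms_comp_left[OF \<pi>], of "\<lambda>\<tau>. K0 (r \<circ> \<tau>) (s \<circ> \<tau>)"]
    by (simp add: K_def comp_assoc)
  have "proj_kernel ?X (specht \<mu>) K"
    unfolding proj_kernel_def
  proof (intro conjI ballI allI)
    fix u r assume "u \<in> specht \<mu>"
    then show "u r = (\<Sum>s\<in>?X. K r s * u s)" by (fact Krep)
  qed (fact Kcol)
  moreover have "\<forall>\<pi> r s. \<pi> permutes {..<m} \<longrightarrow> K (r \<circ> \<pi>) (s \<circ> \<pi>) = K r s"
  proof (intro allI impI)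
    fix \<pi> r s assume \<pi>: "\<pi> permutes {..<m}"
    show "K (r \<circ> \<pi>) (s \<circ> \<pi>) = K r s" by (rule Kinv[OF \<pi>])
  qed
  ultimately show ?thesis by (intro exI[of _ K] conjI)
qed

section \<open>Words, semistandard tableaux and straightening\<close>

lemma permutes_comp_cancel: "\<rho> permutes S \<Longrightarrow> f \<circ> \<rho> = h \<circ> \<rho> \<longleftrightarrow> f = h"
  by (metis comp_assoc comp_id permutes_inv_o(1))

text \<open>Words of length \<open>m\<close> and content \<open>\<kappa>\<close>, which index a
  basis of the weight space \<open>\<kappa>\<close> of an \<open>m\<close>-th tensor power. The
  value 0 beyond \<open>m\<close> makes equality of words equality of functions.\<close>

definition word_maps :: "nat \<Rightarrow> nat multiset \<Rightarrow> (nat \<Rightarrow> nat) set" where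
  "word_maps m \<kappa> = {w. (\<forall>x\<ge>m. w x = 0) \<and> image_mset w (mset_set {..<m}) = \<kappa>}"

lemma finite_word_maps: "finite (word_maps m \<kappa>)"
proof (rule finite_subset)
  show "word_maps m \<kappa> \<subseteq> {f. \<forall>x. (x \<in> {..<m} \<longrightarrow> f x \<in> set_mset \<kappa>) \<and> (x \<notin> {..<m} \<longrightarrow> f x = 0)}"
    by (auto simp: word_maps_def)
  show "finite {f :: nat \<Rightarrow> nat. \<forall>x. (x \<in> {..<m} \<longrightarrow> f x \<in> set_mset \<kappa>) \<and> (x \<notin> {..<m} \<longrightarrow> f x = 0)}"
    by (intro finite_set_of_finite_funs) auto
qed

lemma word_maps_comp:
  assumes "w \<in> word_maps m \<kappa>" "\<pi> permutes {..<m}"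
  shows "w \<circ> \<pi> \<in> word_maps m \<kappa>"
proof -
  have "image_mset (w \<circ> \<pi>) (mset_set {..<m}) = image_mset w (image_mset \<pi> (mset_set {..<m}))"
    by (rule multiset.map_comp[symmetric])
  also have "image_mset \<pi> (mset_set {..<m}) = mset_set {..<m}"
    using permutes_image[OF assms(2)] permutes_inj_on[OF assms(2)] by (simp add: image_mset_mset_set)
  finally have "image_mset (w \<circ> \<pi>) (mset_set {..<m}) = image_mset w (mset_set {..<m})" .
  then show ?thesis
    using assms(1) permutes_ge[OF assms(2)] unfolding word_maps_def mem_Collect_eq by (metis comp_apply)
qed

lemma word_maps_comp_iff:
  assumes "\<pi> permutes {..<m}"
  shows "w \<circ> \<pi> \<in> word_maps m \<kappa> \<longleftrightarrow> w \<in> word_maps m \<kappa>"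
  using word_maps_comp[OF _ assms] word_maps_comp[OF _ permutes_inv[OF assms], of "w \<circ> \<pi>"]
  by (auto simp: comp_assoc permutes_inv_o[OF assms])

text \<open>The coefficients are indexed by \<open>I\<close> and not by the vectors, so
  \<open>f\<close> may fail to be injective.\<close>

lemma span_image_finite:
  assumes "finite I" "v \<in> cv.span (f ` I)"
  shows "\<exists>a. v = (\<Sum>i\<in>I. a i *\<^sub>C f i)"
  using assms(2)
proof (induction rule: cv.span_induct_alt)
  case base
  then show ?case by (intro exI[of _ "\<lambda>_. 0"]) simp
next
  case (step c x y)
  then obtain i a where i: "i \<in> I" "x = f i" and a: "y = (\<Sum>i\<in>I. a i *\<^sub>C f i)" by auto
  have "c *\<^sub>C x + y = (\<Sum>j\<in>I. (if j = i then c *\<^sub>C f j else 0) + a j *\<^sub>C f j)"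
    using i assms(1) by (simp add: sum.distrib sum.delta' a)
  also have "\<dots> = (\<Sum>j\<in>I. ((if j = i then c else 0) + a j) *\<^sub>C f j)"
    by (intro sum.cong) (auto simp: scaleC_add_left)
  finally show ?case by (intro exI[of _ "\<lambda>j. (if j = i then c else 0) + a j"])
qed

section \<open>Fillings of a shape and the functions \<open>phi\<close> attached to them\<close>

text \<open>The space spanned by the \<open>phi v\<close> is isomorphic to the weight space \<open>\<kappa>\<close> of the Schur module:
  up to a scalar depending on the monomial, \<open>phi v\<close> lists the coefficients of the product, over the columns
  of \<open>\<mu>\<close>, of the minors \<open>det (x\<^bsub>i, v(i', j)\<^esub>)\<close>.\<close>

locale tableau_frame =
  fixes \<mu> :: "nat list" and m :: nat and t :: "nat \<times> nat \<Rightarrow> nat" and \<kappa> :: "nat multiset"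
  assumes part: "is_partition \<mu> m" and tab: "is_tableau \<mu> t"
begin

definition "row x = row_of \<mu> t x"
definition "col x = col_of \<mu> t x"

abbreviation "perms \<equiv> {\<pi>. \<pi> permutes {..<m}}"
abbreviation "cstab \<equiv> col_stab \<mu> t"
abbreviation "r0 \<equiv> tabloid \<mu> t"

definition phi :: "(nat \<Rightarrow> nat) \<Rightarrow> (nat \<Rightarrow> nat) \<times> (nat \<Rightarrow> nat) \<Rightarrow> complex" where
  "phi v = (\<lambda>(w, r). \<Sum>\<pi>\<in>cstab. \<Sum>g\<in>perms. of_int (sign \<pi>) * of_bool (w \<circ> g = v \<circ> \<pi> \<and> r \<circ> g = r0))"

definition col_strict :: "(nat \<Rightarrow> nat) \<Rightarrow> bool" where
  "col_strict v \<longleftrightarrow> (\<forall>i j. (Suc i, j) \<in> cells \<mu> \<longrightarrow> v (t (i, j)) < v (t (Suc i, j)))"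

definition row_weak :: "(nat \<Rightarrow> nat) \<Rightarrow> bool" where
  "row_weak v \<longleftrightarrow> (\<forall>i j. (i, Suc j) \<in> cells \<mu> \<longrightarrow> v (t (i, j)) \<le> v (t (i, Suc j)))"

definition sst :: "(nat \<Rightarrow> nat) set" where
  "sst = {v \<in> word_maps m \<kappa>. col_strict v \<and> row_weak v}"

lemma sum_m: "sum_list \<mu> = m"
  using part by (simp add: is_partition_def)

lemma cell_row_col: "x < m \<Longrightarrow> (row x, col x) \<in> cells \<mu>"
  and t_row_col: "x < m \<Longrightarrow> t (row x, col x) = x"
  and row_t: "c \<in> cells \<mu> \<Longrightarrow> row (t c) = fst c"
  and col_t: "c \<in> cells \<mu> \<Longrightarrow> col (t c) = snd c"
  and t_less: "c \<in> cells \<mu> \<Longrightarrow> t c < m"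
  using tableau_inv_into[OF tab] by (simp_all add: row_def col_def row_of_def col_of_def sum_m)

lemma row_col_inj: "x < m \<Longrightarrow> y < m \<Longrightarrow> row x = row y \<Longrightarrow> col x = col y \<Longrightarrow> x = y"
  by (metis t_row_col)

lemma r0_eq: "r0 x = (if x < m then row x else 0)"
  by (simp add: tabloid_def row_def sum_m)

lemma cstab_iff: "\<pi> \<in> cstab \<longleftrightarrow> \<pi> permutes {..<m} \<and> (\<forall>x<m. col (\<pi> x) = col x)"
  by (simp add: col_stab_def col_def sum_m)

lemma cstab_perm: "\<pi> \<in> cstab \<Longrightarrow> \<pi> permutes {..<m}"
  by (simp add: cstab_iff)

lemma part_mono: "i \<le> i' \<Longrightarrow> i' < length \<mu> \<Longrightarrow> \<mu> ! i' \<le> \<mu> ! i"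
  using part unfolding is_partition_def
  by (cases "i = i'") (auto simp: sorted_wrt_iff_nth_less)

lemma cells_down: "(i, j) \<in> cells \<mu> \<Longrightarrow> i' \<le> i \<Longrightarrow> j' \<le> j \<Longrightarrow> (i', j') \<in> cells \<mu>"
  using part_mono[of i' i] by (auto simp: cells_def)

text \<open>The parts of the conjugate partition.\<close>

definition col_len :: "nat \<Rightarrow> nat" where
  "col_len j = card {i. (i, j) \<in> cells \<mu>}"

lemma cells_iff: "(i, j) \<in> cells \<mu> \<longleftrightarrow> i < col_len j"
proof -
  let ?S = "{i. (i, j) \<in> cells \<mu>}"
  have fin: "finite ?S"
    by (rule finite_subset[of _ "fst ` cells \<mu>"]) (force simp: image_iff)+
  have "\<exists>n. ?S = {..<n}"
  proof (cases "?S = {}")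
    case False
    obtain M where M: "(M, j) \<in> cells \<mu>" "\<And>i. (i, j) \<in> cells \<mu> \<Longrightarrow> i \<le> M"
      using Max_in[OF fin False] Max_ge[OF fin] by blast
    have "?S = {..<Suc M}"
      using M cells_down[OF M(1) _ order_refl] by (auto simp: less_Suc_eq_le)
    then show ?thesis by blast
  qed (auto intro: exI[of _ 0])
  then obtain n where n: "?S = {..<n}" by blast
  then have "col_len j = n" by (simp add: col_len_def)
  then show ?thesis using n by auto
qed

lemma col_len_mono: "j \<le> j' \<Longrightarrow> col_len j' \<le> col_len j"
  using cells_down cells_iff by (meson not_le order_refl)

lemma finite_perms: "finite perms"
  by (simp add: finite_permutations)

text \<open>Replacing \<open>g\<close> by \<open>g \<circ> \<pi>\<close> moves the column
  permutation from the word to the tabloid. For fixed \<open>w\<close> this shows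
  \<open>phi v\<close> as a combination of translates of one polytabloid, hence as an element of the
  Specht module.\<close>

lemma phi_eq_polytabloid:
  "phi v (w, r) = (\<Sum>g\<in>perms. of_bool (w \<circ> g = v) * polytabloid \<mu> t (r \<circ> g))"
proof -
  have "phi v (w, r) = (\<Sum>\<pi>\<in>cstab. \<Sum>g\<in>perms. of_int (sign \<pi>) * of_bool (w \<circ> g = v \<and> r \<circ> g \<circ> \<pi> = r0))"
    unfolding phi_def prod.case
  proof (rule sum.cong[OF refl])
    fix \<pi> assume "\<pi> \<in> cstab"
    then have \<pi>: "\<pi> permutes {..<m}" by (rule cstab_perm)
    have e: "w \<circ> (g \<circ> \<pi>) = v \<circ> \<pi> \<longleftrightarrow> w \<circ> g = v" for g
      by (metis comp_assoc permutes_comp_cancel[OF \<pi>])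
    have "(\<Sum>g\<in>perms. of_int (sign \<pi>) * of_bool (w \<circ> g = v \<circ> \<pi> \<and> r \<circ> g = r0) :: complex) =
      (\<Sum>g\<in>perms. of_int (sign \<pi>) * of_bool (w \<circ> (g \<circ> \<pi>) = v \<circ> \<pi> \<and> r \<circ> (g \<circ> \<pi>) = r0))"
      by (rule sum.reindex_bij_betw[OF bij_betw_perms_comp_right[OF \<pi>], symmetric])
    then show "(\<Sum>g\<in>perms. of_int (sign \<pi>) * of_bool (w \<circ> g = v \<circ> \<pi> \<and> r \<circ> g = r0) :: complex) =
      (\<Sum>g\<in>perms. of_int (sign \<pi>) * of_bool (w \<circ> g = v \<and> r \<circ> g \<circ> \<pi> = r0))"
      by (simp add: e comp_assoc)
  qed
  also have "\<dots> = (\<Sum>g\<in>perms. \<Sum>\<pi>\<in>cstab. of_int (sign \<pi>) * of_bool (w \<circ> g = v \<and> r \<circ> g \<circ> \<pi> = r0))"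
    by (rule sum.swap)
  also have "\<dots> = (\<Sum>g\<in>perms. of_bool (w \<circ> g = v) * polytabloid \<mu> t (r \<circ> g))"
    unfolding polytabloid_apply[OF tab] sum_distrib_left by (intro sum.cong refl) simp
  finally show ?thesis .
qed

text \<open>Translating the sum over the column stabilizer by \<open>\<rho>\<close> pulls out its
  sign: a product of minors alternates in the entries of each column.\<close>

lemma phi_cstab:
  assumes \<rho>: "\<rho> \<in> cstab"
  shows "phi (v \<circ> \<rho>) = of_int (sign \<rho>) *\<^sub>C phi v"
proof (rule ext, clarify)
  fix w r
  have p: "permutation \<rho>" using cstab_perm[OF \<rho>] by (rule permutes_permutation)
  have bij: "bij_betw (\<lambda>\<pi>. \<rho> \<circ> \<pi>) cstab cstab"
    using col_stab_comp[OF \<rho>] col_stab_comp[OF col_stab_inv[OF \<rho>]] permutes_inv_o[OF cstab_perm[OF \<rho>]]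
    by (intro bij_betw_byWitness[where f' = "\<lambda>\<pi>. inv \<rho> \<circ> \<pi>"]) (auto simp flip: comp_assoc)
  have "(of_int (sign \<rho>) *\<^sub>C phi v) (w, r) = of_int (sign \<rho>) * (\<Sum>\<pi>\<in>cstab. \<Sum>g\<in>perms.
      of_int (sign (\<rho> \<circ> \<pi>)) * of_bool (w \<circ> g = v \<circ> (\<rho> \<circ> \<pi>) \<and> r \<circ> g = r0))"
    by (simp add: phi_def sum.reindex_bij_betw[OF bij,
      of "\<lambda>\<pi>. \<Sum>g\<in>perms. of_int (sign \<pi>) * of_bool (w \<circ> g = v \<circ> \<pi> \<and> r \<circ> g = r0)"])
  also have "\<dots> = phi (v \<circ> \<rho>) (w, r)"
    unfolding phi_def prod.case sum_distrib_left
  proof (intro sum.cong refl)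
    fix \<pi> g assume "\<pi> \<in> cstab"
    then have "permutation \<pi>" using cstab_perm permutes_permutation by blast
    then have "sign \<rho> * sign (\<rho> \<circ> \<pi>) = sign \<pi>"
      using p by (simp add: sign_compose flip: mult.assoc)
    then have "of_int (sign \<rho>) * of_int (sign (\<rho> \<circ> \<pi>)) = (of_int (sign \<pi>) :: complex)"
      by (metis of_int_mult)
    then show "of_int (sign \<rho>) * (of_int (sign (\<rho> \<circ> \<pi>)) * of_bool (w \<circ> g = v \<circ> (\<rho> \<circ> \<pi>) \<and> r \<circ> g = r0)) =
        (of_int (sign \<pi>) * of_bool (w \<circ> g = v \<circ> \<rho> \<circ> \<pi> \<and> r \<circ> g = r0) :: complex)"
      by (simp add: comp_assoc flip: mult.assoc)
  qed
  finally show "phi (v \<circ> \<rho>) (w, r) = (of_int (sign \<rho>) *\<^sub>C phi v) (w, r)" by simp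
qed

lemma transpose_cstab:
  "x < m \<Longrightarrow> y < m \<Longrightarrow> col x = col y \<Longrightarrow> transpose x y \<in> cstab"
  by (auto simp: cstab_iff transpose_def intro: permutes_swap_id)

lemma phi_transpose:
  assumes "x < m" "y < m" "col x = col y" "x \<noteq> y"
  shows "phi (v \<circ> transpose x y) = - phi v"
  using phi_cstab[OF transpose_cstab[OF assms(1-3)], of v] assms(4) by (simp add: sign_swap_id)

lemma phi_eq_0:
  assumes "x < m" "y < m" "col x = col y" "x \<noteq> y" "v x = v y"
  shows "phi v = 0"
proof -
  have "v \<circ> transpose x y = v" using assms(5) by (auto simp: transpose_def)
  then have e: "phi v = - phi v" using phi_transpose[OF assms(1-4), of v] by metis
  have "phi v p = 0" for p using fun_cong[OF e, of p] by (simp add: eq_neg_iff_add_eq_0 flip: mult_2)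
  then show ?thesis by (simp add: fun_eq_iff)
qed

text \<open>The Garnir relations: the cells of \<open>Z\<close> do not fit into different rows, so some transposition in
  \<open>Z\<close> cancels the terms in pairs.\<close>

lemma garnir:
  assumes Z: "Z \<subseteq> {..<m}"
    and coll: "\<And>\<pi>. \<pi> \<in> cstab \<Longrightarrow> \<exists>x y. x \<noteq> y \<and> x < m \<and> y < m \<and> \<pi> x \<in> Z \<and> \<pi> y \<in> Z \<and> row x = row y"
  shows "(\<Sum>\<sigma> | \<sigma> permutes Z. of_int (sign \<sigma>) *\<^sub>C phi (v \<circ> \<sigma>)) = 0"
proof (rule ext, clarify)
  fix w r :: "nat \<Rightarrow> nat"
  let ?PZ = "{\<sigma>. \<sigma> permutes Z}"
  have finZ: "finite Z" using Z by (rule finite_subset) simp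
  let ?f = "\<lambda>\<pi> (\<sigma>, g). of_int (sign \<sigma>) * of_bool (w \<circ> g = v \<circ> \<sigma> \<circ> \<pi> \<and> r \<circ> g = r0) :: complex"
  have z: "(\<Sum>p\<in>?PZ \<times> perms. ?f \<pi> p) = 0" if "\<pi> \<in> cstab" for \<pi>
  proof -
    have \<pi>: "\<pi> permutes {..<m}" using that by (rule cstab_perm)
    obtain x y where xy: "x \<noteq> y" "x < m" "y < m" "\<pi> x \<in> Z" "\<pi> y \<in> Z" "row x = row y"
      using coll[OF \<open>\<pi> \<in> cstab\<close>] by blast
    let ?s = "transpose (\<pi> x) (\<pi> y)" and ?s' = "transpose x y"
    let ?i = "\<lambda>(\<sigma>, g). (\<sigma> \<circ> ?s, g \<circ> ?s')"
    have ne: "\<pi> x \<noteq> \<pi> y"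
      using xy(1) permutes_inj[OF \<pi>] by (simp add: inj_eq)
    \<comment> \<open>The transposition of two letters of \<open>Z\<close> after
      \<open>\<pi>\<close> is the transposition of \<open>x\<close> and \<open>y\<close> before it.
      As \<open>x\<close> and \<open>y\<close> lie in one row, \<open>r0\<close> is unchanged, so
      passing to \<open>(\<sigma> \<circ> ?s, g \<circ> ?s')\<close> keeps the conditions and
      reverses the sign.\<close>
    have s\<pi>: "?s \<circ> \<pi> = \<pi> \<circ> ?s'"
      using permutes_inj[OF \<pi>] by (auto simp: fun_eq_iff transpose_def inj_eq)
    have ps': "?s' permutes {x, y}"
      by (rule permutes_swap_id) auto
    have "(\<Sum>p\<in>?PZ \<times> perms. ?f \<pi> p) = (\<Sum>p\<in>?PZ \<times> perms. - ?f \<pi> p)"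
    proof (rule sum.reindex_bij_witness[where i = ?i and j = ?i])
      fix p assume "p \<in> ?PZ \<times> perms"
      then obtain \<sigma> g where p: "p = (\<sigma>, g)" "\<sigma> permutes Z" "g permutes {..<m}" by auto
      show "?i (?i p) = p"
        by (simp add: p comp_assoc)
      then show "?i (?i p) = p" .
      show "?i p \<in> ?PZ \<times> perms"
        using p xy by (auto intro!: permutes_compose permutes_swap_id)
      then show "?i p \<in> ?PZ \<times> perms" .
      have "permutation \<sigma>"
        using p(2) finZ permutation_permutes by blast
      then have "sign (\<sigma> \<circ> ?s) = - sign \<sigma>"
        by (simp add: sign_compose permutation_swap_id sign_swap_id ne)
      moreover have "w \<circ> (g \<circ> ?s') = v \<circ> (\<sigma> \<circ> ?s) \<circ> \<pi> \<longleftrightarrow> w \<circ> g = v \<circ> \<sigma> \<circ> \<pi>"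
      proof -
        have "v \<circ> (\<sigma> \<circ> ?s) \<circ> \<pi> = v \<circ> \<sigma> \<circ> (?s \<circ> \<pi>)"
          by (simp only: comp_assoc)
        also have "\<dots> = v \<circ> \<sigma> \<circ> \<pi> \<circ> ?s'"
          unfolding s\<pi> by (simp only: comp_assoc)
        finally show ?thesis
          by (simp only: comp_assoc[symmetric] permutes_comp_cancel[OF ps'])
      qed
      moreover have "r \<circ> (g \<circ> ?s') = r0 \<longleftrightarrow> r \<circ> g = r0"
      proof -
        have "r0 \<circ> ?s' = r0"
          using xy by (auto simp: fun_eq_iff transpose_def r0_eq)
        then show ?thesis
          by (metis comp_assoc permutes_comp_cancel[OF ps'])
      qed
      ultimately show "- ?f \<pi> (?i p) = ?f \<pi> p"
        by (simp add: p)
    qed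
    then show ?thesis by (simp add: sum_negf)
  qed
  have "(\<Sum>\<sigma>\<in>?PZ. of_int (sign \<sigma>) *\<^sub>C phi (v \<circ> \<sigma>)) (w, r) =
      (\<Sum>\<sigma>\<in>?PZ. \<Sum>\<pi>\<in>cstab. \<Sum>g\<in>perms. of_int (sign \<pi>) * ?f \<pi> (\<sigma>, g))"
    by (auto simp: sum_fun_apply phi_def sum_distrib_left mult.left_commute intro!: sum.cong)
  also have "\<dots> = (\<Sum>\<pi>\<in>cstab. \<Sum>\<sigma>\<in>?PZ. \<Sum>g\<in>perms. of_int (sign \<pi>) * ?f \<pi> (\<sigma>, g))"
    by (rule sum.swap)
  also have "\<dots> = (\<Sum>\<pi>\<in>cstab. of_int (sign \<pi>) * (\<Sum>p\<in>?PZ \<times> perms. ?f \<pi> p))"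
    by (simp add: sum_distrib_left sum.cartesian_product case_prod_unfold mult.assoc)
  also have "\<dots> = 0"
    using z by simp
  finally show "(\<Sum>\<sigma> | \<sigma> permutes Z. of_int (sign \<sigma>) *\<^sub>C phi (v \<circ> \<sigma>)) (w, r) = 0 (w, r)" by simp
qed

end

section \<open>Linear independence of the \<open>phi v\<close> for semistandard
  \<open>v\<close>\<close>

context tableau_frame
begin

text \<open>Together with \<open>row_stat\<close> this orders fillings of a fixed content. A column
  permutation leaves \<open>col_stat\<close> unchanged, and sorting a column downwards raises
  \<open>row_stat\<close>; in the straightening, \<open>col_stat\<close> rises when large entries
  move from a column to the next one.\<close>

definition col_stat :: "(nat \<Rightarrow> nat) \<Rightarrow> nat" where "col_stat v = (\<Sum>x<m. col x * v x)"
definition row_stat :: "(nat \<Rightarrow> nat) \<Rightarrow> nat" where "row_stat v = (\<Sum>x<m. row x * v x)"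

lemma sum_transpose:
  fixes f v :: "nat \<Rightarrow> nat"
  assumes xy: "x < m" "y < m" "x \<noteq> y"
  shows "(\<Sum>z<m. f z * (v \<circ> transpose x y) z) + (f x * v x + f y * v y) = (\<Sum>z<m. f z * v z) + (f x * v y + f y * v x)"
proof -
  have *: "(\<Sum>z<m. g z) = g x + (g y + (\<Sum>z\<in>{..<m} - {x} - {y}. g z))" for g :: "nat \<Rightarrow> nat"
    using xy by (simp add: sum.remove[of "{..<m}" x] sum.remove[of "{..<m} - {x}" y])
  have "(\<Sum>z\<in>{..<m} - {x} - {y}. f z * (v \<circ> transpose x y) z) = (\<Sum>z\<in>{..<m} - {x} - {y}. f z * v z)"
    by (intro sum.cong) (auto simp: transpose_def)
  then show ?thesis
    unfolding *[of "\<lambda>z. f z * (v \<circ> transpose x y) z"] *[of "\<lambda>z. f z * v z"] by simp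
qed

lemma row_stat_transpose:
  assumes "x < m" "y < m" "row x < row y" "v y < v x"
  shows "row_stat v < row_stat (v \<circ> transpose x y)"
proof -
  obtain a where a: "row y = row x + a" "a > 0"
    using less_imp_add_positive[OF assms(3)] by metis
  obtain b where b: "v x = v y + b" "b > 0"
    using less_imp_add_positive[OF assms(4)] by metis
  have "row x * v x + row y * v y < row x * v y + row y * v x"
    using a b by (simp add: algebra_simps)
  then show ?thesis
    using sum_transpose[OF assms(1,2), of row v] assms(3) unfolding row_stat_def by fastforce
qed

lemma col_stat_cstab:
  assumes "\<pi> \<in> cstab"
  shows "col_stat (v \<circ> \<pi>) = col_stat v"
proof -
  have \<pi>: "\<pi> permutes {..<m}" using assms by (rule cstab_perm)
  have "(\<Sum>x<m. col x * v x) = (\<Sum>x<m. col (\<pi> x) * v (\<pi> x))"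
    by (rule sum.permute[OF \<pi>, unfolded comp_def])
  also have "\<dots> = (\<Sum>x<m. col x * v (\<pi> x))"
    using assms by (intro sum.cong) (auto simp: cstab_iff)
  finally show ?thesis by (simp add: col_stat_def)
qed

lemma col_strictD:
  assumes v: "col_strict v" and xy: "x < m" "y < m" "col x = col y" "row x < row y"
  shows "v x < v y"
proof -
  have "v (t (i, j)) < v (t (i', j))" if "i < i'" "(i', j) \<in> cells \<mu>" for i i' j
    using that
  proof (induction i' rule: nat_induct)
    case (Suc i')
    have c: "(i', j) \<in> cells \<mu>" using cells_down[OF Suc.prems(2)] by simp
    have "v (t (i', j)) < v (t (Suc i', j))"
      using v Suc.prems(2) unfolding col_strict_def by blast
    then show ?case
      using Suc.IH[OF _ c] Suc.prems(1) by (cases "i = i'") auto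
  qed simp
  from this[OF xy(4) cell_row_col[OF xy(2)]] show ?thesis
    using t_row_col xy by metis
qed

lemma not_col_strict:
  assumes "\<not> col_strict u"
  obtains x y where "x < m" "y < m" "col x = col y" "row x < row y" "u y \<le> u x"
proof -
  obtain i j where ij: "(Suc i, j) \<in> cells \<mu>" "\<not> u (t (i, j)) < u (t (Suc i, j))"
    using assms by (auto simp: col_strict_def)
  then have "(i, j) \<in> cells \<mu>" using cells_down by (meson le_SucI order_refl)
  then show thesis
    using ij that[of "t (i, j)" "t (Suc i, j)"] by (simp add: row_t col_t t_less)
qed

text \<open>Since \<open>v\<close> and \<open>v \<circ> \<rho>\<close> both increase strictly down
  the columns, \<open>\<rho>\<close> preserves the order of rows inside each column. An order
  preserving permutation of a finite chain is the identity; the induction runs over the rows from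
  the top.\<close>

lemma col_strict_rigid:
  assumes v: "col_strict v" and \<rho>: "\<rho> \<in> cstab" and v\<rho>: "col_strict (v \<circ> \<rho>)"
  shows "\<rho> = id"
proof -
  have p: "\<rho> permutes {..<m}" and colp: "\<And>x. x < m \<Longrightarrow> col (\<rho> x) = col x"
    using \<rho> by (auto simp: cstab_iff)
  note pm = permutes_lessThan[OF p]
  have mono: "row (\<rho> x) < row (\<rho> y)" if "x < m" "y < m" "col x = col y" "row x < row y" for x y
  proof (rule ccontr)
    assume *: "\<not> row (\<rho> x) < row (\<rho> y)"
    have c: "col (\<rho> x) = col (\<rho> y)" using that colp by simp
    have l: "v (\<rho> x) < v (\<rho> y)" using col_strictD[OF v\<rho> that] by simp
    show False
    proof (cases "row (\<rho> x) = row (\<rho> y)")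
      case True
      then have "\<rho> x = \<rho> y" using row_col_inj c pm that by blast
      then show False using l by simp
    next
      case False
      then have "v (\<rho> y) < v (\<rho> x)"
        using * col_strictD[OF v, of "\<rho> y" "\<rho> x"] c pm that by simp
      then show False using l by simp
    qed
  qed
  have "\<rho> x = x" if "x < m" for x
    using that
  proof (induction "row x" arbitrary: x rule: less_induct)
    case less
    show ?case
    proof (rule ccontr)
      assume ne: "\<rho> x \<noteq> x"
      let ?z = "inv \<rho> x"
      have z: "\<rho> ?z = x" "?z < m"
        using permutes_inverses(1)[OF p] permutes_lessThan[OF permutes_inv[OF p]] less.prems by auto
      have zx: "?z \<noteq> x" using z ne by auto
      have cz: "col ?z = col x" using colp[OF z(2)] z(1) by simp
      have "\<not> row ?z < row x"
        using less.hyps[OF _ z(2)] z zx by auto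
      moreover have "row ?z \<noteq> row x"
        using row_col_inj[OF z(2) less.prems] cz zx by blast
      ultimately have "row (\<rho> x) < row x"
        using mono[OF less.prems z(2)] cz z(1) by simp
      then have "\<rho> (\<rho> x) = \<rho> x"
        using less.hyps[of "\<rho> x"] pm less.prems by simp
      then show False
        using ne permutes_inj[OF p] by (simp add: inj_eq)
    qed
  qed
  then show ?thesis
    using permutes_ge[OF p] by (metis eq_id_iff not_le)
qed

text \<open>If \<open>v \<circ> \<rho>\<close> were not strict in some column, a swap there would
  raise \<open>row_stat\<close>; equal entries are excluded because \<open>v\<close> is strict. So a
  maximiser is column strict, and rigidity applies.\<close>

lemma row_stat_maximal:
  assumes v: "col_strict v" and \<rho>: "\<rho> \<in> cstab"
    and max: "\<And>\<pi>. \<pi> \<in> cstab \<Longrightarrow> row_stat (v \<circ> \<pi>) \<le> row_stat (v \<circ> \<rho>)"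
  shows "\<rho> = id"
proof (rule col_strict_rigid[OF v \<rho>], rule ccontr)
  assume "\<not> col_strict (v \<circ> \<rho>)"
  then obtain x y where xy: "x < m" "y < m" "col x = col y" "row x < row y" "v (\<rho> y) \<le> v (\<rho> x)"
    using not_col_strict by (metis comp_apply)
  have p: "\<rho> permutes {..<m}" and colp: "\<And>x. x < m \<Longrightarrow> col (\<rho> x) = col x"
    using \<rho> by (auto simp: cstab_iff)
  have "\<rho> x \<noteq> \<rho> y"
    using xy(4) permutes_inj[OF p] by (auto simp: inj_eq)
  then have "row (\<rho> x) \<noteq> row (\<rho> y)"
    using row_col_inj[of "\<rho> x" "\<rho> y"] xy colp permutes_lessThan[OF p] by auto
  then have "v (\<rho> x) \<noteq> v (\<rho> y)"
    using col_strictD[OF v, of "\<rho> x" "\<rho> y"] col_strictD[OF v, of "\<rho> y" "\<rho> x"] xy colp permutes_lessThan[OF p]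
    by (cases "row (\<rho> x) < row (\<rho> y)") auto
  then have "row_stat (v \<circ> \<rho>) < row_stat (v \<circ> \<rho> \<circ> transpose x y)"
    using xy by (intro row_stat_transpose) auto
  moreover have "row_stat (v \<circ> \<rho> \<circ> transpose x y) \<le> row_stat (v \<circ> \<rho>)"
    using max[OF col_stab_comp[OF \<rho> transpose_cstab[OF xy(1-3)]]] by (simp add: comp_assoc)
  ultimately show False by simp
qed

lemma row_stat_le:
  assumes v: "col_strict v" and \<pi>: "\<pi> \<in> cstab"
  shows "row_stat (v \<circ> \<pi>) \<le> row_stat v" and "row_stat (v \<circ> \<pi>) = row_stat v \<Longrightarrow> \<pi> = id"
proof -
  have fin: "finite ((\<lambda>\<pi>. row_stat (v \<circ> \<pi>)) ` cstab)" by simp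
  have "Max ((\<lambda>\<pi>. row_stat (v \<circ> \<pi>)) ` cstab) \<in> (\<lambda>\<pi>. row_stat (v \<circ> \<pi>)) ` cstab"
    using \<pi> by (intro Max_in) auto
  then obtain \<rho> where \<rho>: "\<rho> \<in> cstab" "row_stat (v \<circ> \<rho>) = Max ((\<lambda>\<pi>. row_stat (v \<circ> \<pi>)) ` cstab)"
    by auto
  then have "row_stat (v \<circ> \<pi>) \<le> row_stat (v \<circ> \<rho>)" if "\<pi> \<in> cstab" for \<pi>
    using that by simp
  moreover from this have "\<rho> = id"
    by (rule row_stat_maximal[OF v \<rho>(1)])
  ultimately have le: "row_stat (v \<circ> \<pi>) \<le> row_stat v" if "\<pi> \<in> cstab" for \<pi>
    using that by simp
  then show "row_stat (v \<circ> \<pi>) \<le> row_stat v" using \<pi> .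
  show "\<pi> = id" if "row_stat (v \<circ> \<pi>) = row_stat v"
    by (rule row_stat_maximal[OF v \<pi>]) (simp add: that le)
qed

text \<open>By \<open>r0 \<circ> g = r0\<close> the permutation acts inside each row, so
  \<open>v\<close> and \<open>v'\<close> have the same multiset of entries there, and two weakly
  increasing lists with the same multiset coincide.\<close>

lemma row_sorted_unique:
  assumes v: "row_weak v" and v': "row_weak v'" and supp: "\<And>x. x \<ge> m \<Longrightarrow> v x = v' x"
    and g: "g permutes {..<m}" "v \<circ> g = v'" "r0 \<circ> g = r0"
  shows "v = v'"
proof
  fix x show "v x = v' x"
  proof (cases "x < m")
    case True
    define i where "i = row x"
    have i: "i < length \<mu>" using cell_row_col[OF True] by (simp add: i_def cells_def)
    let ?S = "{x. x < m \<and> row x = i}"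
    let ?L = "\<lambda>u. map (\<lambda>j. u (t (i, j))) [0..<\<mu> ! i]"
    have cell: "(i, j) \<in> cells \<mu> \<longleftrightarrow> j < \<mu> ! i" for j
      using i by (simp add: cells_def)
    have S: "?S = (\<lambda>j. t (i, j)) ` {0..<\<mu> ! i}"
    proof (intro set_eqI iffI)
      fix y assume "y \<in> ?S"
      then show "y \<in> (\<lambda>j. t (i, j)) ` {0..<\<mu> ! i}"
        using cell_row_col[of y] t_row_col[of y] cell by (intro image_eqI[of _ _ "col y"]) auto
    qed (auto simp: t_less row_t simp flip: cell)
    have inj: "inj_on (\<lambda>j. t (i, j)) {0..<\<mu> ! i}"
      by (rule inj_on_inverseI[where g = col]) (simp add: col_t flip: cell)
    have L: "mset (?L u) = image_mset u (mset_set ?S)" for u :: "nat \<Rightarrow> nat"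
    proof -
      have "mset (?L u) = image_mset (u \<circ> (\<lambda>j. t (i, j))) (mset_set {0..<\<mu> ! i})"
        by (simp add: comp_def)
      also have "\<dots> = image_mset u (image_mset (\<lambda>j. t (i, j)) (mset_set {0..<\<mu> ! i}))"
        by (rule multiset.map_comp[symmetric])
      finally show ?thesis
        by (simp only: image_mset_mset_set[OF inj] S)
    qed
    have gS: "g ` ?S = ?S"
    proof -
      have "g y \<in> ?S" if "y \<in> ?S" for y
        using that fun_cong[OF g(3), of y] permutes_lessThan[OF g(1), of y] by (auto simp: r0_eq)
      then have "g ` ?S \<subseteq> ?S" by blast
      moreover have "inj_on g ?S" using permutes_inj_on[OF g(1)] .
      ultimately show ?thesis by (intro endo_inj_surj) auto
    qed
    have "mset (?L v') = image_mset (v \<circ> g) (mset_set ?S)"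
      unfolding L g(2) ..
    also have "\<dots> = image_mset v (image_mset g (mset_set ?S))"
      by (rule multiset.map_comp[symmetric])
    also have "image_mset g (mset_set ?S) = mset_set ?S"
      using permutes_inj_on[OF g(1)] gS by (simp add: image_mset_mset_set)
    also have "image_mset v (mset_set ?S) = mset (?L v)"
      by (rule L[symmetric])
    finally have "mset (?L v') = mset (?L v)" .
    moreover have "sorted (?L u)" if "row_weak u" for u
      unfolding sorted_iff_nth_Suc
    proof (intro allI impI)
      fix j assume "Suc j < length (?L u)"
      then show "?L u ! j \<le> ?L u ! Suc j"
        using that cell[of "Suc j"] by (simp add: row_weak_def)
    qed
    ultimately have "?L v' = ?L v"
      using v v' by (metis properties_for_sort)
    moreover have "col x < \<mu> ! i" "t (i, col x) = x"
      using cell_row_col[OF True] t_row_col[OF True] cell by (simp_all add: i_def)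
    ultimately show ?thesis
      by (auto simp: list_eq_iff_nth_eq)
  qed (use supp in simp)
qed

text \<open>A nonzero value provides \<open>v \<circ> g = v' \<circ> \<pi>\<close> with
  \<open>g\<close> preserving the rows and \<open>\<pi>\<close> the columns. The first does not
  affect \<open>row_stat\<close>, and the second can only lower it below that of the column strict
  \<open>v'\<close>, with equality for the identity alone.\<close>

lemma phi_triangular:
  assumes v: "v \<in> sst" and v': "v' \<in> sst" and nz: "phi v' (v, r0) \<noteq> 0"
  shows "v = v' \<or> row_stat v < row_stat v'"
proof -
  obtain \<pi> g where \<pi>: "\<pi> \<in> cstab" and g: "g permutes {..<m}" "v \<circ> g = v' \<circ> \<pi>" "r0 \<circ> g = r0"
    using nz unfolding phi_def by (auto elim!: sum.not_neutral_contains_not_neutral split: if_splits)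
  have "row_stat v = (\<Sum>x<m. row (g x) * v (g x))"
    unfolding row_stat_def by (rule sum.permute[OF g(1), unfolded comp_def])
  also have "\<dots> = row_stat (v \<circ> g)"
    unfolding row_stat_def
  proof (rule sum.cong[OF refl])
    fix x assume "x \<in> {..<m}"
    then have "row (g x) = row x"
      using fun_cong[OF g(3), of x] permutes_lessThan[OF g(1), of x] by (simp add: r0_eq)
    then show "row (g x) * v (g x) = row x * (v \<circ> g) x" by simp
  qed
  also have "\<dots> = row_stat (v' \<circ> \<pi>)" by (simp only: g(2))
  finally have S: "row_stat v = row_stat (v' \<circ> \<pi>)" .
  have cs: "col_strict v'" using v' by (simp add: sst_def)
  show ?thesis
  proof (cases "row_stat v = row_stat v'")
    case True
    then have "\<pi> = id" using row_stat_le(2)[OF cs \<pi>] S by simp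
    then have "v = v'"
      using v v' g by (intro row_sorted_unique[of v v' g]) (auto simp: sst_def word_maps_def)
    then show ?thesis ..
  next
    case False
    then show ?thesis using row_stat_le(1)[OF cs \<pi>] S by simp
  qed
qed

text \<open>The comparison of \<open>row_stat\<close> leaves only the identity of the column
  stabilizer, so no signs remain and the value counts the row preserving permutations that fix
  \<open>v\<close>; the identity is one of them.\<close>

lemma phi_diagonal:
  assumes v: "v \<in> sst"
  shows "phi v (v, r0) \<noteq> 0"
proof -
  have cs: "col_strict v" using v by (simp add: sst_def)
  have idc: "id \<in> cstab" by (simp add: cstab_iff permutes_id)
  have "phi v (v, r0) = (\<Sum>\<pi>\<in>{id}. \<Sum>g\<in>perms. of_int (sign \<pi>) * of_bool (v \<circ> g = v \<circ> \<pi> \<and> r0 \<circ> g = r0))"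
    unfolding phi_def prod.case
  proof (rule sum.mono_neutral_right)
    show "\<forall>\<pi>\<in>cstab - {id}. (\<Sum>g\<in>perms. of_int (sign \<pi>) * of_bool (v \<circ> g = v \<circ> \<pi> \<and> r0 \<circ> g = r0)) = (0 :: complex)"
    proof
      fix \<pi> assume \<pi>: "\<pi> \<in> cstab - {id}"
      have "\<not> (v \<circ> g = v \<circ> \<pi> \<and> r0 \<circ> g = r0)" if g: "g permutes {..<m}" for g
      proof
        assume "v \<circ> g = v \<circ> \<pi> \<and> r0 \<circ> g = r0"
        then have *: "v \<circ> g = v \<circ> \<pi>" "r0 \<circ> g = r0" by auto
        have "row_stat v = (\<Sum>x<m. row (g x) * v (g x))"
          unfolding row_stat_def by (rule sum.permute[OF g(1), unfolded comp_def])
        also have "\<dots> = (\<Sum>x<m. row x * (v \<circ> \<pi>) x)"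
        proof (rule sum.cong[OF refl])
          fix x assume "x \<in> {..<m}"
          then have "row (g x) = row x"
            using fun_cong[OF *(2), of x] permutes_lessThan[OF g(1), of x] by (simp add: r0_eq)
          then show "row (g x) * v (g x) = row x * (v \<circ> \<pi>) x"
            using fun_cong[OF *(1), of x] by simp
        qed
        finally have "row_stat (v \<circ> \<pi>) = row_stat v" by (simp add: row_stat_def)
        then show False using row_stat_le(2)[OF cs] \<pi> by blast
      qed
      then show "(\<Sum>g\<in>perms. of_int (sign \<pi>) * of_bool (v \<circ> g = v \<circ> \<pi> \<and> r0 \<circ> g = r0)) = (0 :: complex)"
        by (intro sum.neutral) auto
    qed
  qed (use idc in auto)
  also have "\<dots> = of_nat (card {g \<in> perms. v \<circ> g = v \<and> r0 \<circ> g = r0})"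
    using finite_perms by (simp add: sum.inter_filter[symmetric] of_bool_def)
  finally have e: "phi v (v, r0) = of_nat (card {g \<in> perms. v \<circ> g = v \<and> r0 \<circ> g = r0})" .
  have i: "id \<in> {g \<in> perms. v \<circ> g = v \<and> r0 \<circ> g = r0}"
    by (simp add: permutes_id)
  have f: "finite {g \<in> perms. v \<circ> g = v \<and> r0 \<circ> g = r0}"
    using finite_perms by simp
  show ?thesis
    unfolding e of_nat_eq_0_iff card_0_eq[OF f] using i by (rule ex_in_conv[THEN iffD1, OF exI])
qed

lemma finite_sst: "finite sst"
  by (rule finite_subset[OF _ finite_word_maps[of m \<kappa>]]) (auto simp: sst_def)

text \<open>Evaluate a relation at \<open>(u, r0)\<close>, where \<open>u\<close> maximises
  \<open>row_stat\<close> among the indices with nonzero coefficient. By triangularity only the term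
  of \<open>u\<close> survives.\<close>

lemma phi_sst_independent:
  assumes z: "(\<Sum>v\<in>sst. c v *\<^sub>C phi v) = 0" and v: "v \<in> sst"
  shows "c v = 0"
proof (rule ccontr)
  assume "c v \<noteq> 0"
  let ?D = "{v \<in> sst. c v \<noteq> 0}"
  have fin: "finite (row_stat ` ?D)" using finite_sst by simp
  have "Max (row_stat ` ?D) \<in> row_stat ` ?D"
    using \<open>c v \<noteq> 0\<close> v by (intro Max_in fin) auto
  then obtain u where u: "u \<in> sst" "c u \<noteq> 0" "row_stat u = Max (row_stat ` ?D)" by auto
  have le: "row_stat w \<le> row_stat u" if "w \<in> sst" "c w \<noteq> 0" for w
    using Max_ge[OF fin] that u(3) by simp
  have "0 = (\<Sum>w\<in>sst. c w * phi w (u, r0))"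
    using fun_cong[OF z, of "(u, r0)"] by (simp add: sum_fun_apply)
  also have "\<dots> = (\<Sum>w\<in>{u}. c w * phi w (u, r0))"
  proof (rule sum.mono_neutral_right[OF finite_sst])
    show "\<forall>w\<in>sst - {u}. c w * phi w (u, r0) = 0"
      using phi_triangular[OF u(1)] le by force
  qed (use u in auto)
  finally show False using u phi_diagonal by simp
qed

lemma dim_span_sst: "cv.dim (cv.span (phi ` sst)) = card sst"
proof -
  have inj: "inj_on phi sst"
  proof (rule inj_onI, rule ccontr)
    fix u v assume uv: "u \<in> sst" "v \<in> sst" "phi u = phi v" "u \<noteq> v"
    have "(\<Sum>w\<in>sst. (of_bool (w = u) - of_bool (w = v)) *\<^sub>C phi w) =
        (\<Sum>w\<in>sst. (if w = u then phi w else 0)) - (\<Sum>w\<in>sst. (if w = v then phi w else 0))"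
      unfolding sum_subtractf[symmetric]
      by (intro sum.cong refl) (use uv(4) in \<open>auto simp: scaleC_one cv.scale_left_diff_distrib\<close>)
    also have "\<dots> = 0"
      using uv finite_sst by (simp add: sum.delta')
    finally have "of_bool (u = u) - of_bool (u = v) = (0 :: complex)"
      by (rule phi_sst_independent[of "\<lambda>w. of_bool (w = u) - of_bool (w = v)" u, OF _ uv(1)])
    then show False using uv(4) by simp
  qed
  have "cv.independent (phi ` sst)"
  proof (rule cv.independent_if_scalars_zero)
    fix f x assume "(\<Sum>x\<in>phi ` sst. f x *\<^sub>C x) = 0" "x \<in> phi ` sst"
    then show "f x = 0"
      using phi_sst_independent[of "f \<circ> phi"] by (auto simp: sum.reindex[OF inj])
  qed (use finite_sst in simp)
  then show ?thesis
    using cv.dim_span_eq_card_independent card_image[OF inj] by metis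
qed

end

section \<open>Straightening: the semistandard \<open>phi v\<close> span\<close>

context tableau_frame
begin

text \<open>Cells \<open>A\<close> of a column and \<open>B\<close> of the next one that violate the row condition: exchanging entries
  between them increases \<open>col_stat\<close>.\<close>

lemma phi_in_span_sst:
  assumes "v \<in> word_maps m \<kappa>"
  shows "phi v \<in> cv.span (phi ` sst)"
proof -
  \<comment> \<open>Upper bounds over the finitely many words of content \<open>\<kappa>\<close>,
    which turn an increase of the statistics into a decrease of a measure. The order is
    lexicographic: a Garnir relation raises \<open>col_stat\<close>, and sorting a column keeps it
    while raising \<open>row_stat\<close>.\<close>
  define Bc where "Bc = Max (col_stat ` word_maps m \<kappa>)"
  define Br where "Br = Max (row_stat ` word_maps m \<kappa>)"
  have Bc: "col_stat v \<le> Bc" and Br: "row_stat v \<le> Br" if "v \<in> word_maps m \<kappa>" for v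
    using that finite_word_maps by (auto simp: Bc_def Br_def)
  show ?thesis
    using assms
  proof (induction v rule: wf_induct[OF wf_measures[of "[\<lambda>v. Bc - col_stat v, \<lambda>v. Br - row_stat v]"]])
    case (1 v)
    let ?r = "measures [\<lambda>v. Bc - col_stat v, \<lambda>v. Br - row_stat v]"
    have IHc: "phi u \<in> cv.span (phi ` sst)" if "u \<in> word_maps m \<kappa>" "col_stat v < col_stat u" for u
    proof -
      have "Bc - col_stat u < Bc - col_stat v" using that Bc[OF that(1)] by linarith
      then have "(u, v) \<in> ?r" by simp
      then show ?thesis using 1(1) that(1) by blast
    qed
    have IHr: "phi u \<in> cv.span (phi ` sst)"
      if "u \<in> word_maps m \<kappa>" "col_stat v = col_stat u" "row_stat v < row_stat u" for u
    proof -
      have "Br - row_stat u < Br - row_stat v" using that Br[OF that(1)] by linarith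
      then have "(u, v) \<in> ?r" using that(2) by simp
      then show ?thesis using 1(1) that(1) by blast
    qed
    consider (col) "\<not> col_strict v" | (row) "col_strict v" "\<not> row_weak v" | (sst) "v \<in> sst"
      using 1 by (auto simp: sst_def)
    then show ?case
    proof cases
      case col
      then obtain x y where xy: "x < m" "y < m" "col x = col y" "row x < row y" "v y \<le> v x"
        by (rule not_col_strict)
      then have ne: "x \<noteq> y" by auto
      show ?thesis
      proof (cases "v x = v y")
        case True
        then show ?thesis using phi_eq_0[OF xy(1-3) ne] cv.span_zero by metis
      next
        case False
        have c: "transpose x y \<in> cstab" by (rule transpose_cstab[OF xy(1-3)])
        have "phi (v \<circ> transpose x y) \<in> cv.span (phi ` sst)"
          using word_maps_comp[OF _ cstab_perm[OF c]] 1 col_stat_cstab[OF c, of v]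
            row_stat_transpose[OF xy(1,2,4), of v] False xy(5)
          by (intro IHr) auto
        from cv.span_neg[OF this] show ?thesis
          unfolding phi_transpose[OF xy(1-3) ne, of v] minus_minus .
      qed
    next
      case row
      then obtain i j where ij: "(i, Suc j) \<in> cells \<mu>" "v (t (i, Suc j)) < v (t (i, j))"
        by (auto simp: row_weak_def not_le)
      have ij': "(i, j) \<in> cells \<mu>" using cells_down[OF ij(1)] by simp
      let ?p = "t (i, j)" and ?q = "t (i, Suc j)"
      define A where "A = {x. x < m \<and> col x = j \<and> i \<le> row x}"
      define B where "B = {x. x < m \<and> col x = Suc j \<and> row x \<le> i}"
      define Z where "Z = A \<union> B"
      have fin: "finite A" "finite B" "finite Z" and AB: "A \<inter> B = {}"
        by (auto simp: A_def B_def Z_def)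
      have vA: "v ?p \<le> v x" if "x \<in> A" for x
      proof (cases "row x = i")
        case True
        then show ?thesis using that t_row_col[of x] by (auto simp: A_def)
      next
        case False
        then show ?thesis
          using that col_strictD[OF row(1), of ?p x] ij' by (auto simp: A_def t_less row_t col_t)
      qed
      have vB: "v x \<le> v ?q" if "x \<in> B" for x
      proof (cases "row x = i")
        case True
        then show ?thesis using that t_row_col[of x] by (auto simp: B_def)
      next
        case False
        then show ?thesis
          using that col_strictD[OF row(1), of x ?q] ij(1) by (auto simp: B_def t_less row_t col_t)
      qed
      have cardA: "card A = col_len j - i"
      proof -
        have "A = (\<lambda>k. t (k, j)) ` {i..<col_len j}"
        proof (intro set_eqI iffI)
          fix x assume "x \<in> A"
          then show "x \<in> (\<lambda>k. t (k, j)) ` {i..<col_len j}"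
            using cell_row_col[of x] t_row_col[of x] by (intro image_eqI[of _ _ "row x"]) (auto simp: A_def cells_iff)
        qed (auto simp: A_def t_less row_t col_t cells_iff)
        moreover have "inj_on (\<lambda>k. t (k, j)) {i..<col_len j}"
          by (rule inj_on_inverseI[where g = row]) (simp add: row_t cells_iff)
        ultimately show ?thesis by (simp add: card_image)
      qed
      have cardB: "card B = Suc i"
      proof -
        have "B = (\<lambda>k. t (k, Suc j)) ` {..i}"
        proof (intro set_eqI iffI)
          fix x assume "x \<in> B"
          then show "x \<in> (\<lambda>k. t (k, Suc j)) ` {..i}"
            using cell_row_col[of x] t_row_col[of x] by (intro image_eqI[of _ _ "row x"]) (auto simp: B_def)
        next
          fix x assume "x \<in> (\<lambda>k. t (k, Suc j)) ` {..i}"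
          then obtain k where "x = t (k, Suc j)" "k \<le> i" by auto
          moreover have "(k, Suc j) \<in> cells \<mu>" using cells_down[OF ij(1) \<open>k \<le> i\<close>] by simp
          ultimately show "x \<in> B" by (simp add: B_def t_less row_t col_t)
        qed
        moreover have "inj_on (\<lambda>k. t (k, Suc j)) {..i}"
          by (rule inj_on_inverseI[where g = row]) (use ij(1) cells_iff in \<open>simp add: row_t\<close>)
        ultimately show ?thesis by (simp add: card_image)
      qed
      \<comment> \<open>Column \<open>j\<close> and all columns to its right have at most
        \<open>col_len j\<close> rows, and \<open>Z\<close> has one cell more. So after any column
        permutation two cells of \<open>Z\<close> share a row, which is the hypothesis of the Garnir
        relation.\<close>
      have cardZ: "card Z = Suc (col_len j)"
        using card_Un_disjoint[OF fin(1,2) AB] cardA cardB ij' by (simp add: Z_def cells_iff)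
      have Zm: "Z \<subseteq> {..<m}" by (auto simp: Z_def A_def B_def)
      have G: "(\<Sum>\<sigma> | \<sigma> permutes Z. of_int (sign \<sigma>) *\<^sub>C phi (v \<circ> \<sigma>)) = 0"
      proof (rule garnir[OF Zm])
        fix \<pi> assume \<pi>: "\<pi> \<in> cstab"
        have p: "\<pi> permutes {..<m}" using \<pi> by (rule cstab_perm)
        have i\<pi>: "inv \<pi> \<in> cstab" using \<pi> by (rule col_stab_inv)
        have "\<not> inj_on (\<lambda>x. row (inv \<pi> x)) Z"
        proof
          assume "inj_on (\<lambda>x. row (inv \<pi> x)) Z"
          moreover have "row (inv \<pi> x) < col_len j" if "x \<in> Z" for x
          proof -
            have x: "x < m" "j \<le> col x" using that by (auto simp: Z_def A_def B_def)
            then have "inv \<pi> x < m" "col (inv \<pi> x) = col x"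
              using i\<pi> permutes_lessThan[OF cstab_perm[OF i\<pi>]] by (auto simp: cstab_iff)
            then have "row (inv \<pi> x) < col_len (col x)"
              using cell_row_col[of "inv \<pi> x"] by (simp add: cells_iff)
            then show ?thesis using col_len_mono[OF x(2)] by simp
          qed
          ultimately have "card Z \<le> card {..<col_len j}"
            by (intro card_inj_on_le[of "\<lambda>x. row (inv \<pi> x)"]) auto
          then show False using cardZ by simp
        qed
        then obtain x y where xy: "x \<in> Z" "y \<in> Z" "x \<noteq> y" "row (inv \<pi> x) = row (inv \<pi> y)"
          by (auto simp: inj_on_def)
        show "\<exists>x y. x \<noteq> y \<and> x < m \<and> y < m \<and> \<pi> x \<in> Z \<and> \<pi> y \<in> Z \<and> row x = row y"
        proof (rule exI[of _ "inv \<pi> x"], rule exI[of _ "inv \<pi> y"], intro conjI)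
          show "inv \<pi> x \<noteq> inv \<pi> y"
            using xy(3) permutes_inverses(1)[OF p] by metis
        qed (use xy Zm permutes_inverses(1)[OF p] permutes_lessThan[OF cstab_perm[OF i\<pi>]] in auto)
      qed
      let ?P = "{\<sigma>. \<sigma> permutes Z}"
      \<comment> \<open>A permutation of \<open>Z\<close> that preserves \<open>B\<close> also
        preserves \<open>A\<close>, hence lies in the column stabilizer; its sign cancels the
        alternation of \<open>phi\<close>, so the term equals \<open>phi v\<close>. These terms are
        collected with the positive multiplicity \<open>card ?Y\<close>, and all other terms have
        larger \<open>col_stat\<close>.\<close>
      let ?Y = "{\<sigma>. \<sigma> permutes Z \<and> \<sigma> ` B = B}"
      have finP: "finite ?P" using fin(3) by (rule finite_permutations)
      have Y: "of_int (sign \<sigma>) *\<^sub>C phi (v \<circ> \<sigma>) = phi v" if "\<sigma> \<in> ?Y" for \<sigma>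
      proof -
        have \<sigma>: "\<sigma> permutes Z" "\<sigma> ` B = B" using that by auto
        have "\<sigma> ` A = A"
        proof -
          have AZ: "A = Z - B" using AB by (auto simp: Z_def)
          show ?thesis
            unfolding AZ image_set_diff[OF permutes_inj[OF \<sigma>(1)]] permutes_image[OF \<sigma>(1)] \<sigma>(2) ..
        qed
        then have \<sigma>A: "\<sigma> x \<in> A" if "x \<in> A" for x
          using that by blast
        have \<sigma>B: "\<sigma> x \<in> B" if "x \<in> B" for x
          using that \<sigma>(2) by blast
        have "col (\<sigma> x) = col x" for x
        proof -
          consider "x \<in> A" | "x \<in> B" | "x \<notin> Z" by (auto simp: Z_def)
          then show ?thesis
          proof cases
            case 1
            then show ?thesis using \<sigma>A[OF 1] by (simp add: A_def)
          next
            case 2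
            then show ?thesis using \<sigma>B[OF 2] by (simp add: B_def)
          next
            case 3
            then show ?thesis by (simp add: permutes_not_in[OF \<sigma>(1)])
          qed
        qed
        moreover have "\<sigma> permutes {..<m}" using permutes_subset[OF \<sigma>(1) Zm] .
        ultimately have c: "\<sigma> \<in> cstab" by (simp add: cstab_iff)
        have "of_int (sign \<sigma>) *\<^sub>C phi (v \<circ> \<sigma>) = (of_int (sign \<sigma>) * of_int (sign \<sigma>)) *\<^sub>C phi v"
          by (simp only: phi_cstab[OF c] scaleC_scaleC)
        also have "of_int (sign \<sigma>) * of_int (sign \<sigma>) = (1 :: complex)"
          by (metis of_int_1 of_int_mult sign_idempotent)
        finally show ?thesis by (simp only: scaleC_one)
      qed
      have N: "phi (v \<circ> \<sigma>) \<in> cv.span (phi ` sst)" if "\<sigma> \<in> ?P - ?Y" for \<sigma>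
      proof (rule IHc)
        have \<sigma>: "\<sigma> permutes Z" "\<sigma> ` B \<noteq> B" using that by auto
        show "v \<circ> \<sigma> \<in> word_maps m \<kappa>"
          using 1 word_maps_comp permutes_subset[OF \<sigma>(1) Zm] by blast
        \<comment> \<open>Cells of \<open>A\<close> have column index \<open>j\<close> and those of
          \<open>B\<close> have \<open>Suc j\<close>. As the total over \<open>Z\<close> does not
          change under a permutation of \<open>Z\<close>, the change of \<open>col_stat\<close> is
          the change of the sum over \<open>B\<close>.\<close>
        have split: "(\<Sum>x<m. col x * u x) = (\<Sum>x\<in>{..<m} - Z. col x * u x) + j * (\<Sum>x\<in>Z. u x) + (\<Sum>x\<in>B. u x)"
          for u :: "nat \<Rightarrow> nat"
        proof -
          have "(\<Sum>x<m. col x * u x) = (\<Sum>x\<in>{..<m} - Z. col x * u x) + (\<Sum>x\<in>Z. col x * u x)"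
            using sum.subset_diff[OF Zm] by simp
          also have "(\<Sum>x\<in>Z. col x * u x) = (\<Sum>x\<in>A. col x * u x) + (\<Sum>x\<in>B. col x * u x)"
            unfolding Z_def using fin(1,2) AB by (rule sum.union_disjoint)
          also have "(\<Sum>x\<in>A. col x * u x) = j * (\<Sum>x\<in>A. u x)"
            unfolding sum_distrib_left by (rule sum.cong) (auto simp: A_def)
          also have "(\<Sum>x\<in>B. col x * u x) = Suc j * (\<Sum>x\<in>B. u x)"
            unfolding sum_distrib_left by (rule sum.cong) (auto simp: B_def)
          also have "(\<Sum>x\<in>Z. u x) = (\<Sum>x\<in>A. u x) + (\<Sum>x\<in>B. u x)"
            unfolding Z_def using fin(1,2) AB by (rule sum.union_disjoint)
          ultimately show ?thesis by (simp add: algebra_simps)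
        qed
        have 1: "(\<Sum>x\<in>{..<m} - Z. col x * (v \<circ> \<sigma>) x) = (\<Sum>x\<in>{..<m} - Z. col x * v x)"
          by (rule sum.cong) (auto simp: permutes_not_in[OF \<sigma>(1)])
        have 2: "(\<Sum>x\<in>Z. (v \<circ> \<sigma>) x) = (\<Sum>x\<in>Z. v x)"
          using sum.permute[OF \<sigma>(1), of v] by simp
        \<comment> \<open>As many entries enter \<open>B\<close> as leave it. Those leaving are at
          most \<open>v ?q\<close>, those entering come from \<open>A\<close> and are at least
          \<open>v ?p\<close>, and \<open>v ?q < v ?p\<close> is the violated row condition. The
          choice of \<open>\<sigma>\<close> guarantees that at least one entry is exchanged.\<close>
        have "(\<Sum>x\<in>B. v x) < (\<Sum>x\<in>B. (v \<circ> \<sigma>) x)"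
        proof -
          have inj: "inj_on \<sigma> B" using permutes_inj_on[OF \<sigma>(1)] .
          define D where "D = \<sigma> ` B"
          have D: "finite D" "card D = card B" "D \<subseteq> Z"
            using fin(2) card_image[OF inj] permutes_image[OF \<sigma>(1)] by (auto simp: D_def Z_def)
          have e1: "card (D - B) = card (B - D)"
            using D(2) card_Diff_subset_Int[of D B] card_Diff_subset_Int[of B D] D(1) fin(2)
            by (simp add: Int_commute)
          have "B - D \<noteq> {}"
            using \<sigma>(2) D(2) card_subset_eq[OF D(1), of B] fin(2) by (auto simp: D_def)
          then have pos: "card (B - D) > 0" using fin(2) by (simp add: card_gt_0_iff)
          have "(\<Sum>x\<in>B - D. v x) \<le> card (B - D) * v ?q"
            using vB by (intro sum_bounded_above[of _ _ "v ?q", simplified]) auto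
          also have "\<dots> < card (D - B) * v ?p"
            using ij(2) pos by (simp add: e1)
          also have "\<dots> \<le> (\<Sum>x\<in>D - B. v x)"
            using vA D(3) by (intro sum_bounded_below[of _ "v ?p", simplified]) (auto simp: Z_def)
          finally have "(\<Sum>x\<in>B - D. v x) < (\<Sum>x\<in>D - B. v x)" .
          moreover have "(\<Sum>x\<in>B. v x) = (\<Sum>x\<in>B - D. v x) + (\<Sum>x\<in>B \<inter> D. v x)"
            using sum.Int_Diff[OF fin(2), of v D] by simp
          moreover have "(\<Sum>x\<in>D. v x) = (\<Sum>x\<in>D - B. v x) + (\<Sum>x\<in>B \<inter> D. v x)"
            using sum.Int_Diff[OF D(1), of v B] by (simp add: Int_commute)
          moreover have "(\<Sum>x\<in>D. v x) = (\<Sum>x\<in>B. (v \<circ> \<sigma>) x)"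
            unfolding D_def by (simp add: sum.reindex[OF inj])
          ultimately show ?thesis by simp
        qed
        then show "col_stat v < col_stat (v \<circ> \<sigma>)"
          unfolding col_stat_def split 1 2 by simp
      qed
      have YP: "?Y \<subseteq> ?P" by auto
      have "0 = (\<Sum>\<sigma>\<in>?P - ?Y. of_int (sign \<sigma>) *\<^sub>C phi (v \<circ> \<sigma>)) + (\<Sum>\<sigma>\<in>?Y. of_int (sign \<sigma>) *\<^sub>C phi (v \<circ> \<sigma>))"
        unfolding sum.subset_diff[OF YP finP, symmetric] G ..
      also have "(\<Sum>\<sigma>\<in>?Y. of_int (sign \<sigma>) *\<^sub>C phi (v \<circ> \<sigma>)) = (\<Sum>\<sigma>\<in>?Y. phi v)"
        by (rule sum.cong[OF refl Y])
      also have "\<dots> = of_nat (card ?Y) *\<^sub>C phi v"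
        by (rule cv.sum_constant_scale)
      finally have "0 = (\<Sum>\<sigma>\<in>?P - ?Y. of_int (sign \<sigma>) *\<^sub>C phi (v \<circ> \<sigma>)) + of_nat (card ?Y) *\<^sub>C phi v" .
      from minus_unique[OF this[symmetric], symmetric]
      have "of_nat (card ?Y) *\<^sub>C phi v = - (\<Sum>\<sigma>\<in>?P - ?Y. of_int (sign \<sigma>) *\<^sub>C phi (v \<circ> \<sigma>))" .
      moreover have "- (\<Sum>\<sigma>\<in>?P - ?Y. of_int (sign \<sigma>) *\<^sub>C phi (v \<circ> \<sigma>)) \<in> cv.span (phi ` sst)"
        by (intro cv.span_neg cv.span_sum cv.span_scale N)
      ultimately have "of_nat (card ?Y) *\<^sub>C phi v \<in> cv.span (phi ` sst)" by (simp only:)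
      then have "(1 / of_nat (card ?Y)) *\<^sub>C of_nat (card ?Y) *\<^sub>C phi v \<in> cv.span (phi ` sst)"
        by (rule cv.span_scale)
      moreover have "card ?Y \<noteq> 0"
        using finP by (auto simp: card_eq_0_iff intro!: exI[of _ id] permutes_id)
      from this have "1 / of_nat (card ?Y) * of_nat (card ?Y) = (1 :: complex)" by simp
      ultimately show ?thesis by (simp only: scaleC_scaleC scaleC_one)
    next
      case sst
      then show ?thesis by (intro cv.span_base imageI)
    qed
  qed
qed

end

section \<open>The Frobenius characteristic of the Specht module\<close>

context tableau_frame
begin

lemma card_sst_eq:
  assumes K: "proj_kernel (row_maps m) (specht \<mu>) K"
    and K_inv: "\<forall>\<pi> r s. \<pi> permutes {..<m} \<longrightarrow> K (r \<circ> \<pi>) (s \<circ> \<pi>) = K r s"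
  shows "of_nat (card sst) =
    (\<Sum>\<pi>\<in>perms. of_nat (card {w \<in> word_maps m \<kappa>. w \<circ> \<pi> = w}) * (\<Sum>r\<in>row_maps m. K r (r \<circ> \<pi>))) / fact m"
proof -
  let ?Q = "word_maps m \<kappa>" and ?X = "row_maps m"
  interpret signed_action perms "(\<circ>)" ?Q "\<lambda>\<pi> w. w \<circ> inv \<pi>" "\<lambda>_ _. 1" ?X "\<lambda>\<pi> r. r \<circ> \<pi>" "specht \<mu>" K
  proof unfold_locales
    show "finite perms" by (rule finite_perms)
    show "perms \<noteq> {}" using permutes_id by blast
    show "bij_betw (\<lambda>g. g \<circ> h) perms perms" if "h \<in> perms" for h
      using bij_betw_perms_comp_right that by blast
    show "finite ?Q" by (rule finite_word_maps)
    show "q \<circ> inv g \<in> ?Q" if "g \<in> perms" "q \<in> ?Q" for g q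
      using that by (simp add: word_maps_comp permutes_inv)
    show "q \<circ> inv (g \<circ> h) = q \<circ> inv h \<circ> inv g" if "g \<in> perms" "h \<in> perms" "q \<in> ?Q" for g h q
      using that by (simp add: o_inv_distrib permutes_bij comp_assoc)
    show "finite ?X" by (rule finite_row_maps)
    show "bij_betw (\<lambda>r. r \<circ> g) ?X ?X" if "g \<in> perms" for g
      using that bij_betw_row_maps by blast
    show "x \<circ> (g \<circ> h) = x \<circ> g \<circ> h" for x g h :: "nat \<Rightarrow> nat" by (simp only: comp_assoc)
    show "cv.subspace (specht \<mu>)" by (rule subspace_specht)
    show "u x = 0" if "u \<in> specht \<mu>" "x \<notin> ?X" for u x
      using specht_support[OF part that] .
    show "proj_kernel ?X (specht \<mu>) K" by (rule K)
    show "K (x \<circ> g) (y \<circ> g) = K x y" if "g \<in> perms" "x \<in> ?X" "y \<in> ?X" for g x y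
      using K_inv that by blast
  qed simp_all
  have "equi_maps = cv.span (phi ` ?Q)"
  proof (rule antisym)
    show "cv.span (phi ` ?Q) \<subseteq> equi_maps"
    proof (rule cv.span_minimal[OF _ subspace_equi_maps], rule image_subsetI)
      fix v assume v: "v \<in> ?Q"
      have supp: "phi v (w, r) = 0" if "(w, r) \<notin> ?Q \<times> ?X" for w r
      proof -
        have "of_bool (w \<circ> g = v) * polytabloid \<mu> t (r \<circ> g) = 0" if g: "g permutes {..<m}" for g
        proof (cases "w \<circ> g = v")
          case True
          then have "w \<in> ?Q" using v word_maps_comp_iff[OF g] by blast
          then have "r \<notin> ?X" using \<open>(w, r) \<notin> _\<close> by simp
          then have "r \<circ> g \<notin> ?X"
            using row_maps_comp[OF _ permutes_inv[OF g], of "r \<circ> g"]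
            by (auto simp: comp_assoc permutes_inv_o[OF g])
          moreover have "polytabloid \<mu> t \<in> specht \<mu>"
            unfolding specht_def using tab by (intro cv.span_base) auto
          ultimately have "polytabloid \<mu> t (r \<circ> g) = 0"
            using specht_support[OF part] by blast
          then show ?thesis by (simp only: mult_zero_right)
        qed simp
        then show ?thesis unfolding phi_eq_polytabloid by (intro sum.neutral) auto
      qed
      have inU: "(\<lambda>r. phi v (w, r)) \<in> specht \<mu>" for w
      proof -
        have "(\<Sum>g\<in>perms. of_bool (w \<circ> g = v) *\<^sub>C tabloid_act g (polytabloid \<mu> t)) \<in> specht \<mu>"
        proof (intro cv.subspace_sum cv.subspace_scale subspace_specht specht_tabloid_act)
          show "polytabloid \<mu> t \<in> specht \<mu>"
            unfolding specht_def using tab by (intro cv.span_base) auto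
        qed (auto simp: sum_m)
        also have "(\<Sum>g\<in>perms. of_bool (w \<circ> g = v) *\<^sub>C tabloid_act g (polytabloid \<mu> t)) = (\<lambda>r. phi v (w, r))"
          by (simp add: fun_eq_iff phi_eq_polytabloid sum_fun_apply tabloid_act_def)
        finally show ?thesis .
      qed
      have eq: "phi v (w \<circ> inv h, r) = phi v (w, r \<circ> h)" if h: "h permutes {..<m}" for h w r
      proof -
        have e: "w \<circ> inv h \<circ> (h \<circ> g) = w \<circ> g" for g
          using permutes_inverses(2)[OF h] by (simp add: fun_eq_iff)
        have "phi v (w \<circ> inv h, r) =
            (\<Sum>g\<in>perms. of_bool (w \<circ> inv h \<circ> (h \<circ> g) = v) * polytabloid \<mu> t (r \<circ> (h \<circ> g)))"
          unfolding phi_eq_polytabloid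
          by (rule sum.reindex_bij_betw[OF bij_betw_perms_comp_left[OF h], symmetric])
        also have "\<dots> = phi v (w, r \<circ> h)"
          unfolding phi_eq_polytabloid e by (simp only: comp_assoc)
        finally show ?thesis .
      qed
      show "phi v \<in> equi_maps"
        unfolding equi_maps_def mem_Collect_eq
      proof (intro conjI allI ballI impI)
        fix g w r assume "g \<in> perms"
        then show "phi v (w \<circ> inv g, r) = 1 * phi v (w, r \<circ> g)"
          using eq by simp
      qed (erule supp | rule inU)+
    qed
    show "equi_maps \<subseteq> cv.span (phi ` ?Q)"
    proof
      fix \<phi> assume \<phi>: "\<phi> \<in> equi_maps"
      have "\<exists>a. \<forall>r. \<phi> (w, r) = (\<Sum>g\<in>perms. a g * polytabloid \<mu> t (r \<circ> g))" if w: "w \<in> ?Q" for w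
      proof -
        have "(\<lambda>r. \<phi> (w, r)) \<in> specht \<mu>"
          using \<phi> w unfolding equi_maps_def by blast
        then have "(\<lambda>r. \<phi> (w, r)) \<in> cv.span ((\<lambda>\<pi>. tabloid_act \<pi> (polytabloid \<mu> t)) ` perms)"
          unfolding specht_eq_span[OF tab] sum_m .
        from span_image_finite[OF finite_perms this] obtain a
          where a: "(\<lambda>r. \<phi> (w, r)) = (\<Sum>g\<in>perms. a g *\<^sub>C tabloid_act g (polytabloid \<mu> t))" by blast
        have "\<phi> (w, r) = (\<Sum>g\<in>perms. a g * polytabloid \<mu> t (r \<circ> g))" for r
          using fun_cong[OF a, of r] by (simp add: sum_fun_apply tabloid_act_def)
        then show ?thesis by blast
      qed
      then have "\<forall>w\<in>?Q. \<exists>a. \<forall>r. \<phi> (w, r) = (\<Sum>g\<in>perms. a g * polytabloid \<mu> t (r \<circ> g))"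
        by (rule ballI)
      from bchoice[OF this] obtain a
        where a': "\<forall>w\<in>?Q. \<forall>r. \<phi> (w, r) = (\<Sum>g\<in>perms. a w g * polytabloid \<mu> t (r \<circ> g))" ..
      have a: "\<phi> (w, r) = (\<Sum>g\<in>perms. a w g * polytabloid \<mu> t (r \<circ> g))" if "w \<in> ?Q" for w r
        using bspec[OF a' that] by (rule spec)
      \<comment> \<open>Each \<open>\<phi> (w, _)\<close> is a combination of translates of the
        polytabloid, with coefficients \<open>a w g\<close>. Averaging the equivariance over all
        \<open>h\<close> collects these translates into the sums that define
        \<open>phi (v \<circ> g)\<close>; the average is the origin of
        \<open>fact m\<close>.\<close>
      have "\<phi> = (\<Sum>v\<in>?Q. \<Sum>g\<in>perms. (a v g / fact m) *\<^sub>C phi (v \<circ> g))"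
      proof (rule ext, clarify)
        fix w r
        have eq: "\<phi> (w, r) = \<phi> (w \<circ> h, r \<circ> h)" if h: "h permutes {..<m}" for h
        proof (cases "(w, r) \<in> ?Q \<times> ?X")
          case True
          then have "\<phi> (w \<circ> h \<circ> inv h, r) = \<phi> (w \<circ> h, r \<circ> h)"
            using \<phi> h word_maps_comp[of w m \<kappa> h] by (auto simp: equi_maps_def)
          then show ?thesis by (simp add: comp_assoc permutes_inv_o[OF h])
        next
          case False
          then have "(w \<circ> h, r \<circ> h) \<notin> ?Q \<times> ?X"
            using word_maps_comp_iff[OF h] row_maps_comp[OF _ permutes_inv[OF h], of "r \<circ> h"]
            by (auto simp: comp_assoc permutes_inv_o[OF h])
          then show ?thesis using \<phi> False by (auto simp: equi_maps_def)
        qed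
        show "\<phi> (w, r) = (\<Sum>v\<in>?Q. \<Sum>g\<in>perms. (a v g / fact m) *\<^sub>C phi (v \<circ> g)) (w, r)"
        proof (cases "w \<in> ?Q")
          case True
          have "fact m * \<phi> (w, r) = (\<Sum>h\<in>perms. \<phi> (w \<circ> h, r \<circ> h))"
          proof -
            have "(\<Sum>h\<in>perms. \<phi> (w \<circ> h, r \<circ> h)) = (\<Sum>h\<in>perms. \<phi> (w, r))"
              by (rule sum.cong[OF refl]) (use eq in auto)
            then show ?thesis by (simp add: card_permutations)
          qed
          also have "\<dots> = (\<Sum>h\<in>perms. \<Sum>v\<in>?Q. if v = w \<circ> h then (\<Sum>g\<in>perms. a v g * polytabloid \<mu> t (r \<circ> h \<circ> g)) else 0)"
            using True word_maps_comp[of w] finite_word_maps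
            by (intro sum.cong refl) (simp add: sum.delta' a)
          also have "\<dots> = (\<Sum>v\<in>?Q. \<Sum>h\<in>perms. if v = w \<circ> h then (\<Sum>g\<in>perms. a v g * polytabloid \<mu> t (r \<circ> h \<circ> g)) else 0)"
            by (rule sum.swap)
          also have "\<dots> = (\<Sum>v\<in>?Q. \<Sum>g\<in>perms. a v g * phi (v \<circ> g) (w, r))"
          proof (rule sum.cong[OF refl])
            fix v assume "v \<in> ?Q"
            have "(\<Sum>h\<in>perms. if v = w \<circ> h then (\<Sum>g\<in>perms. a v g * polytabloid \<mu> t (r \<circ> h \<circ> g)) else 0) =
                (\<Sum>h\<in>perms. \<Sum>g\<in>perms. a v g * (of_bool (w \<circ> h = v) * polytabloid \<mu> t (r \<circ> h \<circ> g)))"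
              by (intro sum.cong refl) (auto intro!: sum.neutral)
            also have "\<dots> = (\<Sum>g\<in>perms. \<Sum>h\<in>perms. a v g * (of_bool (w \<circ> h = v) * polytabloid \<mu> t (r \<circ> h \<circ> g)))"
              by (rule sum.swap)
            also have "\<dots> = (\<Sum>g\<in>perms. a v g * phi (v \<circ> g) (w, r))"
            proof (rule sum.cong[OF refl])
              fix g assume "g \<in> perms"
              then have g: "g permutes {..<m}" by simp
              have "phi (v \<circ> g) (w, r) =
                  (\<Sum>h\<in>perms. of_bool (w \<circ> (h \<circ> g) = v \<circ> g) * polytabloid \<mu> t (r \<circ> (h \<circ> g)))"
                unfolding phi_eq_polytabloid
                by (rule sum.reindex_bij_betw[OF bij_betw_perms_comp_right[OF g], symmetric])
              also have "\<dots> = (\<Sum>h\<in>perms. of_bool (w \<circ> h = v) * polytabloid \<mu> t (r \<circ> h \<circ> g))"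
                by (simp only: comp_assoc[symmetric] permutes_comp_cancel[OF g])
              finally show "(\<Sum>h\<in>perms. a v g * (of_bool (w \<circ> h = v) * polytabloid \<mu> t (r \<circ> h \<circ> g))) =
                  a v g * phi (v \<circ> g) (w, r)"
                by (simp only: sum_distrib_left)
            qed
            finally show "(\<Sum>h\<in>perms. if v = w \<circ> h then (\<Sum>g\<in>perms. a v g * polytabloid \<mu> t (r \<circ> h \<circ> g)) else 0) =
                (\<Sum>g\<in>perms. a v g * phi (v \<circ> g) (w, r))" .
          qed
          finally have "\<phi> (w, r) = (\<Sum>v\<in>?Q. \<Sum>g\<in>perms. a v g * phi (v \<circ> g) (w, r)) / fact m"
            by (simp add: field_simps)
          then show ?thesis
            by (simp add: sum_fun_apply sum_divide_distrib)
        next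
          case False
          have "phi (v \<circ> g) (w, r) = 0" if "v \<in> ?Q" "g \<in> perms" for v g
          proof -
            have "w \<circ> h \<noteq> v \<circ> g" if h: "h permutes {..<m}" for h
              using word_maps_comp_iff[OF h, of w \<kappa>] word_maps_comp[of v m \<kappa> g] \<open>v \<in> ?Q\<close> \<open>g \<in> perms\<close> False
              by auto
            then show ?thesis unfolding phi_eq_polytabloid by (intro sum.neutral) auto
          qed
          then have "(\<Sum>v\<in>?Q. \<Sum>g\<in>perms. (a v g / fact m) *\<^sub>C phi (v \<circ> g)) (w, r) = 0"
            unfolding sum_fun_apply scaleC_fun_apply scaleC_complex by (intro sum.neutral ballI) simp
          moreover have "\<phi> (w, r) = 0"
            using \<phi> False unfolding equi_maps_def by blast
          ultimately show ?thesis by simp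
        qed
      qed
      also have "\<dots> \<in> cv.span (phi ` ?Q)"
        by (intro cv.span_sum cv.span_scale cv.span_base imageI word_maps_comp) auto
      finally show "\<phi> \<in> cv.span (phi ` ?Q)" .
    qed
  qed
  also have "\<dots> = cv.span (phi ` sst)"
  proof (rule antisym)
    show "cv.span (phi ` ?Q) \<subseteq> cv.span (phi ` sst)"
      using phi_in_span_sst by (intro cv.span_minimal cv.subspace_span) auto
    show "cv.span (phi ` sst) \<subseteq> cv.span (phi ` ?Q)"
      by (intro cv.span_mono) (auto simp: sst_def)
  qed
  finally have "of_nat (card sst) = (of_nat (cv.dim equi_maps) :: complex)"
    using dim_span_sst by simp
  also have "\<dots> = (\<Sum>\<pi>\<in>perms. of_nat (card {w \<in> ?Q. w \<circ> \<pi> = w}) * (\<Sum>r\<in>?X. K r (r \<circ> \<pi>))) / fact m"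
    unfolding dim_equi_maps
  proof (intro arg_cong2[of _ _ _ _ "(/)"] sum.cong refl arg_cong2[of _ _ _ _ "(*)"])
    fix \<pi> assume "\<pi> \<in> perms"
    then have \<pi>: "\<pi> permutes {..<m}" by simp
    have "w \<circ> inv \<pi> = w \<longleftrightarrow> w \<circ> \<pi> = w" for w :: "nat \<Rightarrow> nat"
      using permutes_comp_cancel[OF \<pi>, of "w \<circ> inv \<pi>" w] permutes_inv_o[OF \<pi>]
      by (auto simp: comp_assoc)
    then show "(\<Sum>q | q \<in> ?Q \<and> q \<circ> inv \<pi> = q. 1) = of_nat (card {w \<in> ?Q. w \<circ> \<pi> = w})"
      by simp
  qed (simp add: card_permutations)
  finally show ?thesis .
qed

text \<open>The tableau \<open>t\<close> numbers the cells, so a filling of the shape and a word of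
  length \<open>m\<close> are the same data up to composition with \<open>t\<close>. The defaults 0
  off the cells and beyond \<open>m\<close> correspond to each other.\<close>

lemma mcoeff_schur: "mcoeff (schur \<mu>) \<kappa> = of_nat (card sst)"
proof -
  let ?T = "{T. is_ssyt \<mu> T \<and> image_mset T (mset_set (cells \<mu>)) = \<kappa>}"
  have tb: "image_mset t (mset_set (cells \<mu>)) = mset_set {..<m}"
    using tab sum_m by (simp add: is_tableau_def bij_betw_def image_mset_mset_set)
  have "bij_betw (\<lambda>v c. if c \<in> cells \<mu> then v (t c) else 0) sst ?T"
  proof (rule bij_betw_byWitness[where f' = "\<lambda>T x. if x < m then T (row x, col x) else 0"])
    show "\<forall>v\<in>sst. (\<lambda>x. if x < m then (\<lambda>c. if c \<in> cells \<mu> then v (t c) else 0) (row x, col x) else 0) = v"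
      by (auto simp: fun_eq_iff cell_row_col t_row_col sst_def word_maps_def)
    show "\<forall>T\<in>?T. (\<lambda>c. if c \<in> cells \<mu> then (\<lambda>x. if x < m then T (row x, col x) else 0) (t c) else 0) = T"
      by (auto simp: fun_eq_iff is_ssyt_def t_less row_t col_t)
    show "(\<lambda>v c. if c \<in> cells \<mu> then v (t c) else 0) ` sst \<subseteq> ?T"
    proof (rule image_subsetI, unfold mem_Collect_eq, rule conjI)
      fix v assume v: "v \<in> sst"
      have d: "(i, Suc j) \<in> cells \<mu> \<Longrightarrow> (i, j) \<in> cells \<mu>" "(Suc i, j) \<in> cells \<mu> \<Longrightarrow> (i, j) \<in> cells \<mu>" for i j
        using cells_down[of i "Suc j" i j] cells_down[of "Suc i" j i j] by simp_all
      show "is_ssyt \<mu> (\<lambda>c. if c \<in> cells \<mu> then v (t c) else 0)"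
        unfolding is_ssyt_def
      proof (intro conjI allI impI)
        fix i j assume c: "(i, Suc j) \<in> cells \<mu>"
        then show "(if (i, j) \<in> cells \<mu> then v (t (i, j)) else 0) \<le>
            (if (i, Suc j) \<in> cells \<mu> then v (t (i, Suc j)) else 0)"
          using v d(1)[OF c] by (simp add: sst_def row_weak_def)
      next
        fix i j assume c: "(Suc i, j) \<in> cells \<mu>"
        then show "(if (i, j) \<in> cells \<mu> then v (t (i, j)) else 0) <
            (if (Suc i, j) \<in> cells \<mu> then v (t (Suc i, j)) else 0)"
          using v d(2)[OF c] by (simp add: sst_def col_strict_def)
      qed simp
      have "image_mset (\<lambda>c. if c \<in> cells \<mu> then v (t c) else 0) (mset_set (cells \<mu>)) =
          image_mset (v \<circ> t) (mset_set (cells \<mu>))"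
        by (rule image_mset_cong) simp
      also have "\<dots> = image_mset v (image_mset t (mset_set (cells \<mu>)))"
        by (rule multiset.map_comp[symmetric])
      finally show "image_mset (\<lambda>c. if c \<in> cells \<mu> then v (t c) else 0) (mset_set (cells \<mu>)) = \<kappa>"
        using v by (simp add: tb sst_def word_maps_def)
    qed
    show "(\<lambda>T x. if x < m then T (row x, col x) else 0) ` ?T \<subseteq> sst"
    proof (rule image_subsetI)
      fix T assume "T \<in> ?T"
      then have T: "is_ssyt \<mu> T" "image_mset T (mset_set (cells \<mu>)) = \<kappa>" by auto
      let ?v = "\<lambda>x. if x < m then T (row x, col x) else 0"
      have vt: "?v (t c) = T c" if "c \<in> cells \<mu>" for c
        using that by (simp add: t_less row_t col_t)
      have d: "(i, Suc j) \<in> cells \<mu> \<Longrightarrow> (i, j) \<in> cells \<mu>" "(Suc i, j) \<in> cells \<mu> \<Longrightarrow> (i, j) \<in> cells \<mu>" for i j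
        using cells_down[of i "Suc j" i j] cells_down[of "Suc i" j i j] by simp_all
      have "image_mset ?v (mset_set {..<m}) = image_mset (?v \<circ> t) (mset_set (cells \<mu>))"
        unfolding tb[symmetric] by (rule multiset.map_comp)
      also have "\<dots> = image_mset T (mset_set (cells \<mu>))"
        by (rule image_mset_cong) (simp add: t_less row_t col_t)
      finally have "?v \<in> word_maps m \<kappa>" using T(2) by (simp add: word_maps_def)
      moreover have "col_strict ?v"
        unfolding col_strict_def
      proof (intro allI impI)
        fix i j assume c: "(Suc i, j) \<in> cells \<mu>"
        show "?v (t (i, j)) < ?v (t (Suc i, j))"
          unfolding vt[OF c] vt[OF d(2)[OF c]] using T(1) c by (simp add: is_ssyt_def)
      qed
      moreover have "row_weak ?v"
        unfolding row_weak_def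
      proof (intro allI impI)
        fix i j assume c: "(i, Suc j) \<in> cells \<mu>"
        show "?v (t (i, j)) \<le> ?v (t (i, Suc j))"
          unfolding vt[OF c] vt[OF d(1)[OF c]] using T(1) c by (simp add: is_ssyt_def)
      qed
      ultimately show "?v \<in> sst" unfolding sst_def by blast
    qed
  qed
  then show ?thesis by (simp add: schur.rep_eq bij_betw_same_card)
qed

end

text \<open>Up to replacing \<open>\<pi>\<close> by its inverse,
  \<open>\<Sum>r. K r (r \<circ> \<pi>)\<close> is the character of the Specht module, and the
  number of fixed words will be identified with a coefficient of the power sum product of the cycle
  type of \<open>\<pi>\<close>.\<close>

lemma schur_frobenius:
  assumes \<mu>: "is_partition \<mu> m"
    and K: "proj_kernel (row_maps m) (specht \<mu>) K"
    and K_inv: "\<forall>\<pi> r s. \<pi> permutes {..<m} \<longrightarrow> K (r \<circ> \<pi>) (s \<circ> \<pi>) = K r s"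
  shows "mcoeff (schur \<mu>) \<kappa> = (\<Sum>\<pi> | \<pi> permutes {..<m}.
    of_nat (card {w \<in> word_maps m \<kappa>. w \<circ> \<pi> = w}) * (\<Sum>r\<in>row_maps m. K r (r \<circ> \<pi>))) / fact m"
proof -
  obtain t where t: "is_tableau \<mu> t" using tableau_exists by blast
  interpret tableau_frame \<mu> m t \<kappa> by unfold_locales (fact \<mu> t)+
  show ?thesis unfolding mcoeff_schur by (rule card_sst_eq[OF K K_inv])
qed

section \<open>Orbits and plethysm\<close>

text \<open>Index set of the terms in a coefficient of a product over \<open>I\<close>. The empty
  multiset outside \<open>I\<close> makes a family determined by its members in
  \<open>I\<close>.\<close>

definition splits :: "'i set \<Rightarrow> nat multiset \<Rightarrow> ('i \<Rightarrow> nat multiset) set" where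
  "splits I \<kappa> = {\<beta>. (\<forall>i. i \<notin> I \<longrightarrow> \<beta> i = {#}) \<and> (\<Sum>i\<in>I. \<beta> i) = \<kappa>}"

lemma splits_subseteq:
  assumes "finite I" "\<beta> \<in> splits I \<kappa>"
  shows "\<beta> i \<subseteq># \<kappa>"
proof (cases "i \<in> I")
  case True
  then show ?thesis using assms by (auto simp: splits_def sum.remove[of I i])
qed (use assms in \<open>auto simp: splits_def\<close>)

lemma finite_splits_fun:
  assumes "finite I"
  shows "finite (splits I \<kappa>)"
proof (rule finite_subset)
  show "splits I \<kappa> \<subseteq> {f. \<forall>x. (x \<in> I \<longrightarrow> f x \<in> fst ` {(\<alpha>, \<beta>). \<alpha> + \<beta> = \<kappa>}) \<and> (x \<notin> I \<longrightarrow> f x = {#})}"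
  proof (intro subsetI CollectI allI conjI impI)
    fix \<beta> i assume \<beta>: "\<beta> \<in> splits I \<kappa>"
    show "\<beta> i \<in> fst ` {(\<alpha>, \<beta>). \<alpha> + \<beta> = \<kappa>}"
      using splits_subseteq[OF assms \<beta>, of i] by (intro image_eqI[of _ _ "(\<beta> i, \<kappa> - \<beta> i)"]) auto
    show "\<beta> i = {#}" if "i \<notin> I"
      using \<beta> that by (simp add: splits_def)
  qed
  show "finite {f. \<forall>x. (x \<in> I \<longrightarrow> f x \<in> fst ` {(\<alpha>, \<beta>). \<alpha> + \<beta> = \<kappa>}) \<and> (x \<notin> I \<longrightarrow> f x = {#})}"
    by (intro finite_set_of_finite_funs assms finite_imageI finite_splits)
qed

lemma mcoeff_prod:
  assumes "finite I"
  shows "mcoeff (\<Prod>i\<in>I. f i) \<kappa> = (\<Sum>\<beta>\<in>splits I \<kappa>. \<Prod>i\<in>I. mcoeff (f i) (\<beta> i))"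
  using assms
proof (induction I arbitrary: \<kappa> rule: finite_induct)
  case empty
  have e: "splits {} \<kappa> = (if \<kappa> = {#} then {\<lambda>_. {#}} else {})"
    by (auto simp: splits_def)
  show ?case unfolding e by (simp add: one_mps.rep_eq)
next
  case (insert i I)
  let ?j = "\<lambda>((\<alpha> :: nat multiset, \<gamma> :: nat multiset), \<beta>). \<beta>(i := \<alpha>)"
  have "mcoeff (\<Prod>j\<in>insert i I. f j) \<kappa> =
      (\<Sum>(\<alpha>, \<gamma>) | \<alpha> + \<gamma> = \<kappa>. \<Sum>\<beta>\<in>splits I \<gamma>. mcoeff (f i) \<alpha> * (\<Prod>j\<in>I. mcoeff (f j) (\<beta> j)))"
    using insert by (simp add: times_mps.rep_eq sum_distrib_left)
  also have "\<dots> = (\<Sum>(p, \<beta>)\<in>(SIGMA p:{(\<alpha>, \<gamma>). \<alpha> + \<gamma> = \<kappa>}. splits I (snd p)).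
      mcoeff (f i) (fst p) * (\<Prod>j\<in>I. mcoeff (f j) (\<beta> j)))"
    unfolding case_prod_unfold
    by (subst sum.Sigma)
       (auto simp: finite_splits[unfolded case_prod_unfold] finite_splits_fun insert.hyps case_prod_unfold)
  also have "\<dots> = (\<Sum>\<beta>\<in>splits (insert i I) \<kappa>. \<Prod>j\<in>insert i I. mcoeff (f j) (\<beta> j))"
  proof (rule sum.reindex_bij_witness[where
        i = "\<lambda>\<beta>. ((\<beta> i, \<Sum>j\<in>I. \<beta> j), \<beta>(i := {#}))" and j = ?j])
    have e: "(\<Sum>j\<in>I. if j = i then x else \<beta> j) = (\<Sum>j\<in>I. \<beta> j)" for \<beta> :: "_ \<Rightarrow> nat multiset" and x
      using insert.hyps by (intro sum.cong) auto
    fix a assume "a \<in> (SIGMA p:{(\<alpha>, \<gamma>). \<alpha> + \<gamma> = \<kappa>}. splits I (snd p))"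
    then obtain \<alpha> \<gamma> \<beta> where a: "a = ((\<alpha>, \<gamma>), \<beta>)" "\<alpha> + \<gamma> = \<kappa>" "\<beta> \<in> splits I \<gamma>" by auto
    then show "(?j a) \<in> splits (insert i I) \<kappa>"
      using insert.hyps by (auto simp: splits_def e)
    show "(\<lambda>\<beta>. ((\<beta> i, \<Sum>j\<in>I. \<beta> j), \<beta>(i := {#}))) (?j a) = a"
      using a insert.hyps by (auto simp: splits_def e fun_eq_iff)
    have "(\<Prod>j\<in>I. mcoeff (f j) ((\<beta>(i := \<alpha>)) j)) = (\<Prod>j\<in>I. mcoeff (f j) (\<beta> j))"
      using insert.hyps by (intro prod.cong) auto
    then show "(\<Prod>j\<in>insert i I. mcoeff (f j) ((?j a) j)) =
        (case a of (p, \<beta>) \<Rightarrow> mcoeff (f i) (fst p) * (\<Prod>j\<in>I. mcoeff (f j) (\<beta> j)))"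
      using a insert.hyps by simp
  next
    fix \<beta> assume \<beta>: "\<beta> \<in> splits (insert i I) \<kappa>"
    have e: "(\<Sum>j\<in>I. if j = i then x else \<beta> j) = (\<Sum>j\<in>I. \<beta> j)" for x
      using insert.hyps by (intro sum.cong) auto
    show "?j ((\<beta> i, \<Sum>j\<in>I. \<beta> j), \<beta>(i := {#})) = \<beta>"
      by simp
    show "((\<beta> i, \<Sum>j\<in>I. \<beta> j), \<beta>(i := {#})) \<in> (SIGMA p:{(\<alpha>, \<gamma>). \<alpha> + \<gamma> = \<kappa>}. splits I (snd p))"
      using \<beta> insert.hyps by (auto simp: splits_def e)
  qed
  finally show ?case .
qed

section \<open>Products over the cycles of a permutation\<close>

abbreviation orbits :: "('a \<Rightarrow> 'a) \<Rightarrow> 'a set \<Rightarrow> 'a set set" where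
  "orbits \<tau> S \<equiv> orbit \<tau> ` S"

text \<open>A base point chosen from the set alone. It serves as starting point of a cycle and as
  the place where invariant functions on the orbit are read off.\<close>

definition rep :: "'a set \<Rightarrow> 'a" where
  "rep B = (SOME x. x \<in> B)"

locale finite_perm =
  fixes \<tau> :: "'a \<Rightarrow> 'a" and S :: "'a set"
  assumes S: "finite S" and \<tau>: "\<tau> permutes S"
begin

lemma perm: "permutation \<tau>"
  using S \<tau> permutation_permutes by blast

lemma orbit_self: "x \<in> orbit \<tau> x"
  by (rule permutation_self_in_orbit[OF perm])

lemma orbit_sub: "x \<in> S \<Longrightarrow> orbit \<tau> x \<subseteq> S"
proof
  fix y assume "x \<in> S" "y \<in> orbit \<tau> x"
  from this(2,1) show "y \<in> S"
    by induct (simp_all add: permutes_in_image[OF \<tau>])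
qed

lemma orbit_eq: "y \<in> orbit \<tau> x \<Longrightarrow> orbit \<tau> y = orbit \<tau> x"
  using orbit_trans[of _ \<tau>] orbit_swap[OF orbit_self] by blast

lemma finite_orbits: "finite (orbits \<tau> S)"
  using S by simp

lemma finite_in_orbits: "B \<in> orbits \<tau> S \<Longrightarrow> finite B"
  using orbit_sub S finite_subset by blast

lemma rep_in: "B \<in> orbits \<tau> S \<Longrightarrow> rep B \<in> B"
  using orbit_self unfolding rep_def by (metis imageE someI)

lemma rep_S: "B \<in> orbits \<tau> S \<Longrightarrow> rep B \<in> S"
  using rep_in orbit_sub by blast

lemma orbit_rep: "B \<in> orbits \<tau> S \<Longrightarrow> orbit \<tau> (rep B) = B"
  using rep_in orbit_eq by (metis imageE)

lemma card_orbit_pos: "B \<in> orbits \<tau> S \<Longrightarrow> card B \<ge> 1"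
  using rep_in finite_in_orbits by (metis One_nat_def Suc_leI card_gt_0_iff empty_iff)

lemma sum_orbits: "(\<Sum>x\<in>S. f x) = (\<Sum>B\<in>orbits \<tau> S. \<Sum>x\<in>B. f x)" for f :: "'a \<Rightarrow> 'b::comm_monoid_add"
proof -
  have "\<Union> (orbits \<tau> S) = S" using orbit_sub orbit_self by blast
  moreover have "\<forall>A\<in>orbits \<tau> S. \<forall>B\<in>orbits \<tau> S. A \<noteq> B \<longrightarrow> A \<inter> B = {}"
    using orbit_eq by blast
  moreover have "\<forall>A\<in>orbits \<tau> S. finite A" using finite_in_orbits by blast
  ultimately show ?thesis using sum.Union_disjoint[of "orbits \<tau> S" f] by simp
qed

lemma invariant_orbit:
  assumes inv: "\<alpha> \<circ> \<tau> = \<alpha>" and "y \<in> orbit \<tau> x"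
  shows "\<alpha> y = \<alpha> x"
  using assms(2) by induct (use fun_cong[OF inv] in simp_all)

lemma invariant_rep:
  assumes "\<alpha> \<circ> \<tau> = \<alpha>" and "B \<in> orbits \<tau> S" "x \<in> B"
  shows "\<alpha> x = \<alpha> (rep B)"
  by (rule invariant_orbit[OF assms(1)]) (use assms(2,3) orbit_rep in blast)

end

definition invariant_splits :: "('a \<Rightarrow> 'a) \<Rightarrow> 'a set \<Rightarrow> nat multiset \<Rightarrow> ('a \<Rightarrow> nat multiset) set" where
  "invariant_splits \<tau> S \<kappa> = {\<alpha> \<in> splits S \<kappa>. \<alpha> \<circ> \<tau> = \<alpha>}"

lemma sum_const_mset: "finite B \<Longrightarrow> (\<Sum>b\<in>B. \<alpha>) = repeat_mset (card B) (\<alpha> :: 'a multiset)"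
  by (induction B rule: finite_induct) simp_all

context finite_perm
begin

text \<open>The factor of an orbit \<open>B\<close> contains only monomials
  \<open>repeat_mset (card B) \<gamma>\<close>. Giving each of the \<open>card B\<close> points of
  \<open>B\<close> its own copy of \<open>\<gamma>\<close> turns a choice of monomials into a family
  that is constant on orbits, with the same total.\<close>

lemma mcoeff_orbit_prod:
  "mcoeff (\<Prod>B\<in>orbits \<tau> S. subst_pow (c B) (card B) (h B)) \<kappa> =
    (\<Sum>\<alpha>\<in>invariant_splits \<tau> S \<kappa>. \<Prod>B\<in>orbits \<tau> S. (\<Prod>a\<in>#\<alpha> (rep B). c B a) * mcoeff (h B) (\<alpha> (rep B)))"
proof -
  let ?O = "orbits \<tau> S"
  let ?\<Phi> = "\<lambda>\<alpha> B. if B \<in> ?O then repeat_mset (card B) (\<alpha> (rep B)) else {#}"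
  have tot: "(\<Sum>B\<in>?O. ?\<Phi> \<alpha> B) = (\<Sum>b\<in>S. \<alpha> b)" if "\<alpha> \<circ> \<tau> = \<alpha>" for \<alpha> :: "'a \<Rightarrow> nat multiset"
    unfolding sum_orbits[of \<alpha>]
  proof (rule sum.cong[OF refl])
    fix B assume B: "B \<in> ?O"
    have "(\<Sum>b\<in>B. \<alpha> b) = (\<Sum>b\<in>B. \<alpha> (rep B))"
      by (rule sum.cong[OF refl]) (rule invariant_rep[OF that B])
    also have "\<dots> = repeat_mset (card B) (\<alpha> (rep B))"
      by (rule sum_const_mset[OF finite_in_orbits[OF B]])
    finally show "?\<Phi> \<alpha> B = (\<Sum>b\<in>B. \<alpha> b)"
      using B by simp
  qed
  have inj: "inj_on ?\<Phi> (invariant_splits \<tau> S \<kappa>)"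
  proof (rule inj_onI)
    fix \<alpha> \<alpha>' assume a: "\<alpha> \<in> invariant_splits \<tau> S \<kappa>" "\<alpha>' \<in> invariant_splits \<tau> S \<kappa>" and eq: "?\<Phi> \<alpha> = ?\<Phi> \<alpha>'"
    have inv: "\<alpha> \<circ> \<tau> = \<alpha>" "\<alpha>' \<circ> \<tau> = \<alpha>'"
      using a by (auto simp: invariant_splits_def)
    show "\<alpha> = \<alpha>'"
    proof
      fix b show "\<alpha> b = \<alpha>' b"
      proof (cases "b \<in> S")
        case True
        let ?B = "orbit \<tau> b"
        have B: "?B \<in> ?O" using True by simp
        have "repeat_mset (card ?B) (\<alpha> (rep ?B)) = repeat_mset (card ?B) (\<alpha>' (rep ?B))"
          using fun_cong[OF eq, of ?B] B by simp
        then have "\<alpha> (rep ?B) = \<alpha>' (rep ?B)"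
          using repeat_mset_eq_iff[OF card_orbit_pos[OF B]] by blast
        then show ?thesis
          using invariant_rep[OF inv(1) B orbit_self] invariant_rep[OF inv(2) B orbit_self] by simp
      next
        case False
        then show ?thesis using a by (auto simp: invariant_splits_def splits_def)
      qed
    qed
  qed
  have "mcoeff (\<Prod>B\<in>?O. subst_pow (c B) (card B) (h B)) \<kappa> =
      (\<Sum>\<beta>\<in>splits ?O \<kappa>. \<Prod>B\<in>?O. mcoeff (subst_pow (c B) (card B) (h B)) (\<beta> B))"
    by (rule mcoeff_prod[OF finite_orbits])
  also have "\<dots> = (\<Sum>\<beta>\<in>?\<Phi> ` invariant_splits \<tau> S \<kappa>.
      \<Prod>B\<in>?O. mcoeff (subst_pow (c B) (card B) (h B)) (\<beta> B))"
  proof (rule sum.mono_neutral_right[OF finite_splits_fun[OF finite_orbits]])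
    show "?\<Phi> ` invariant_splits \<tau> S \<kappa> \<subseteq> splits ?O \<kappa>"
    proof (rule image_subsetI)
      fix \<alpha> assume "\<alpha> \<in> invariant_splits \<tau> S \<kappa>"
      then have inv: "\<alpha> \<circ> \<tau> = \<alpha>" and "(\<Sum>b\<in>S. \<alpha> b) = \<kappa>"
        by (simp_all add: invariant_splits_def splits_def)
      then have "(\<Sum>B\<in>?O. ?\<Phi> \<alpha> B) = \<kappa>" unfolding tot[OF inv] by simp
      then show "?\<Phi> \<alpha> \<in> splits ?O \<kappa>" unfolding splits_def mem_Collect_eq by simp
    qed
    show "\<forall>\<beta>\<in>splits ?O \<kappa> - ?\<Phi> ` invariant_splits \<tau> S \<kappa>.
        (\<Prod>B\<in>?O. mcoeff (subst_pow (c B) (card B) (h B)) (\<beta> B)) = 0"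
    proof (rule ballI, rule ccontr)
      fix \<beta> assume \<beta>: "\<beta> \<in> splits ?O \<kappa> - ?\<Phi> ` invariant_splits \<tau> S \<kappa>"
        and nz: "(\<Prod>B\<in>?O. mcoeff (subst_pow (c B) (card B) (h B)) (\<beta> B)) \<noteq> 0"
      have "\<beta> B \<in> range (repeat_mset (card B))" if "B \<in> ?O" for B
      proof (rule ccontr)
        assume "\<beta> B \<notin> range (repeat_mset (card B))"
        from mcoeff_subst_pow_0[OF this]
        have "(\<Prod>B\<in>?O. mcoeff (subst_pow (c B) (card B) (h B)) (\<beta> B)) = 0"
          by (intro prod_zero[OF finite_orbits] bexI[OF _ that])
        then show False using nz by (rule notE[rotated])
      qed
      then have "\<forall>B\<in>?O. \<exists>\<gamma>. \<beta> B = repeat_mset (card B) \<gamma>" by blast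
      from bchoice[OF this] obtain \<gamma> where \<gamma>: "\<forall>B\<in>?O. \<beta> B = repeat_mset (card B) (\<gamma> B)" ..
      define \<alpha> where "\<alpha> b = (if b \<in> S then \<gamma> (orbit \<tau> b) else {#})" for b
      have inv: "\<alpha> \<circ> \<tau> = \<alpha>"
        by (simp add: fun_eq_iff \<alpha>_def permutes_in_image[OF \<tau>] permutation_orbit_step[OF perm])
      have \<Phi>: "?\<Phi> \<alpha> = \<beta>"
      proof
        fix B show "?\<Phi> \<alpha> B = \<beta> B"
        proof (cases "B \<in> ?O")
          case True
          then show ?thesis using bspec[OF \<gamma> True] by (simp add: \<alpha>_def rep_S orbit_rep)
        next
          case False
          then show ?thesis using \<beta> unfolding splits_def by auto
        qed
      qed
      have "(\<Sum>b\<in>S. \<alpha> b) = (\<Sum>B\<in>?O. \<beta> B)"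
        using tot[OF inv] unfolding \<Phi> by simp
      also have "\<dots> = \<kappa>" using \<beta> by (simp add: splits_def)
      finally have "\<alpha> \<in> invariant_splits \<tau> S \<kappa>"
        using inv by (simp add: invariant_splits_def splits_def \<alpha>_def)
      then show False using \<beta> \<Phi> by blast
    qed
  qed
  also have "\<dots> = (\<Sum>\<alpha>\<in>invariant_splits \<tau> S \<kappa>.
      \<Prod>B\<in>?O. mcoeff (subst_pow (c B) (card B) (h B)) (?\<Phi> \<alpha> B))"
    by (subst sum.reindex[OF inj]) simp
  also have "\<dots> = (\<Sum>\<alpha>\<in>invariant_splits \<tau> S \<kappa>. \<Prod>B\<in>?O. (\<Prod>a\<in>#\<alpha> (rep B). c B a) * mcoeff (h B) (\<alpha> (rep B)))"
    by (intro sum.cong prod.cong refl) (simp add: mcoeff_subst_pow_repeat[OF card_orbit_pos])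
  finally show ?thesis .
qed

end

section \<open>Power sums: fixed words, cycle types and uniqueness of expansions\<close>

lemma powsum_subst: "k \<ge> 1 \<Longrightarrow> powsum k = subst_pow (\<lambda>_. 1) k (powsum 1)"
proof (rule mps_eqI)
  fix \<kappa> assume k: "k \<ge> 1"
  show "mcoeff (powsum k) \<kappa> = mcoeff (subst_pow (\<lambda>_. 1) k (powsum 1)) \<kappa>"
  proof (cases "\<kappa> \<in> range (repeat_mset k)")
    case True
    then obtain \<alpha> where \<alpha>: "\<kappa> = repeat_mset k \<alpha>" by blast
    have "repeat_mset k \<alpha> = replicate_mset k i \<longleftrightarrow> \<alpha> = replicate_mset 1 i" for i
      using repeat_mset_eq_iff[OF k, of \<alpha> "replicate_mset 1 i"] by simp
    then show ?thesis
      by (simp add: \<alpha> mcoeff_subst_pow_repeat[OF k] powsum.rep_eq)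
  next
    case False
    then have "\<kappa> \<noteq> replicate_mset k i" for i by (metis rangeI repeat_mset_replicate_mset)
    then show ?thesis by (simp add: mcoeff_subst_pow_0[OF False] powsum.rep_eq)
  qed
qed

text \<open>A power sum is a substitution into \<open>powsum 1\<close>, whose monomials are single
  variables. So an invariant family contributes exactly if all its members are singletons, which
  makes it a word fixed by \<open>\<tau>\<close>.\<close>

lemma mcoeff_orbit_powsum:
  assumes \<tau>: "\<tau> permutes {..<m}"
  shows "mcoeff (\<Prod>B\<in>orbits \<tau> {..<m}. powsum (card B)) \<kappa> = of_nat (card {w \<in> word_maps m \<kappa>. w \<circ> \<tau> = w})"
proof -
  interpret finite_perm \<tau> "{..<m}" by unfold_locales (simp_all add: \<tau>)
  let ?O = "orbits \<tau> {..<m}" and ?I = "invariant_splits \<tau> {..<m} \<kappa>"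
  let ?W = "{w \<in> word_maps m \<kappa>. w \<circ> \<tau> = w}"
  let ?f = "\<lambda>w b. if b < m then {#w b#} else {#}"
  have finI: "finite ?I"
    using finite_splits_fun[of "{..<m}" \<kappa>] by (simp add: invariant_splits_def)
  have "mcoeff (\<Prod>B\<in>?O. powsum (card B)) \<kappa> = mcoeff (\<Prod>B\<in>?O. subst_pow (\<lambda>_. 1) (card B) (powsum 1)) \<kappa>"
    by (intro arg_cong2[of _ _ _ _ mcoeff] prod.cong refl powsum_subst card_orbit_pos)
  also have "\<dots> = (\<Sum>\<alpha>\<in>?I. \<Prod>B\<in>?O. of_bool (\<exists>i. \<alpha> (rep B) = {#i#}))"
    unfolding mcoeff_orbit_prod[of "\<lambda>_ _. 1" "\<lambda>_. powsum 1"]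
    by (intro sum.cong prod.cong refl) (simp add: powsum.rep_eq)
  also have "\<dots> = (\<Sum>\<alpha>\<in>?I. of_bool (\<forall>b<m. \<exists>i. \<alpha> b = {#i#}))"
  proof (rule sum.cong[OF refl])
    fix \<alpha> assume "\<alpha> \<in> ?I"
    then have inv: "\<alpha> \<circ> \<tau> = \<alpha>" by (simp add: invariant_splits_def)
    have iff: "(\<forall>b<m. \<exists>i. \<alpha> b = {#i#}) \<longleftrightarrow> (\<forall>B\<in>?O. \<exists>i. \<alpha> (rep B) = {#i#})"
    proof safe
      fix b assume *: "\<forall>B\<in>?O. \<exists>i. \<alpha> (rep B) = {#i#}" and b: "b < m"
      have "\<alpha> b = \<alpha> (rep (orbit \<tau> b))"
        by (rule invariant_rep[OF inv]) (use b orbit_self in auto)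
      then show "\<exists>i. \<alpha> b = {#i#}" using * b by auto
    next
      fix b assume "\<forall>b<m. \<exists>i. \<alpha> b = {#i#}" "b < m"
      then show "\<exists>i. \<alpha> (rep (orbit \<tau> b)) = {#i#}"
        using rep_S[of "orbit \<tau> b"] by simp
    qed
    show "(\<Prod>B\<in>?O. of_bool (\<exists>i. \<alpha> (rep B) = {#i#})) = (of_bool (\<forall>b<m. \<exists>i. \<alpha> b = {#i#}) :: complex)"
    proof (cases "\<forall>B\<in>?O. \<exists>i. \<alpha> (rep B) = {#i#}")
      case True
      then have "(\<Prod>B\<in>?O. of_bool (\<exists>i. \<alpha> (rep B) = {#i#})) = (1 :: complex)"
        by (intro prod.neutral) simp
      moreover have "of_bool (\<forall>b<m. \<exists>i. \<alpha> b = {#i#}) = (1 :: complex)"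
        using True unfolding iff by simp
      ultimately show ?thesis by (simp only:)
    next
      case False
      then have "(\<Prod>B\<in>?O. of_bool (\<exists>i. \<alpha> (rep B) = {#i#})) = (0 :: complex)"
        by (intro prod_zero[OF finite_orbits]) auto
      moreover have "of_bool (\<forall>b<m. \<exists>i. \<alpha> b = {#i#}) = (0 :: complex)"
        using False unfolding iff by simp
      ultimately show ?thesis by (simp only:)
    qed
  qed
  also have "\<dots> = of_nat (card {\<alpha> \<in> ?I. \<forall>b<m. \<exists>i. \<alpha> b = {#i#}})"
    by (simp only: sum_of_bool_eq finI Collect_conj_eq Collect_mem_eq)
  also have "card {\<alpha> \<in> ?I. \<forall>b<m. \<exists>i. \<alpha> b = {#i#}} = card ?W"
  proof (rule bij_betw_same_card[symmetric])
    have s: "(\<Sum>b<m. ?f w b) = image_mset w (mset_set {..<m})" for w :: "nat \<Rightarrow> nat"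
    proof -
      have "(\<Sum>b<m. ?f w b) = (\<Sum>b<m. {#w b#})" by (rule sum.cong) simp_all
      then show ?thesis unfolding sum_unfold_sum_mset sum_mset_singleton_mset .
    qed
    have bm: "b < m \<longleftrightarrow> \<tau> b < m" for b using permutes_lessThan[OF \<tau>] by simp
    show "bij_betw ?f ?W {\<alpha> \<in> ?I. \<forall>b<m. \<exists>i. \<alpha> b = {#i#}}"
    proof (rule bij_betw_byWitness[where f' = "\<lambda>\<alpha> b. if b < m then (THE i. \<alpha> b = {#i#}) else 0"])
      show "\<forall>w\<in>?W. (\<lambda>b. if b < m then (THE i. ?f w b = {#i#}) else 0) = w"
        by (auto simp: fun_eq_iff word_maps_def)
      show "\<forall>\<alpha>\<in>{\<alpha> \<in> ?I. \<forall>b<m. \<exists>i. \<alpha> b = {#i#}}. ?f (\<lambda>b. if b < m then (THE i. \<alpha> b = {#i#}) else 0) = \<alpha>"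
      proof (intro ballI ext)
        fix \<alpha> b assume \<alpha>: "\<alpha> \<in> {\<alpha> \<in> ?I. \<forall>b<m. \<exists>i. \<alpha> b = {#i#}}"
        show "?f (\<lambda>b. if b < m then (THE i. \<alpha> b = {#i#}) else 0) b = \<alpha> b"
        proof (cases "b < m")
          case True
          then obtain i where "\<alpha> b = {#i#}" using \<alpha> by blast
          then show ?thesis using True by simp
        qed (use \<alpha> in \<open>simp add: invariant_splits_def splits_def\<close>)
      qed
      show "?f ` ?W \<subseteq> {\<alpha> \<in> ?I. \<forall>b<m. \<exists>i. \<alpha> b = {#i#}}"
      proof (rule image_subsetI)
        fix w assume w: "w \<in> ?W"
        then have w\<tau>: "w \<circ> \<tau> = w" by simp
        have "?f w \<circ> \<tau> = ?f w"
        proof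
          fix b show "(?f w \<circ> \<tau>) b = ?f w b"
            using bm[of b] fun_cong[OF w\<tau>, of b] by simp
        qed
        then show "?f w \<in> {\<alpha> \<in> ?I. \<forall>b<m. \<exists>i. \<alpha> b = {#i#}}"
          using w s[of w] by (simp add: invariant_splits_def splits_def word_maps_def)
      qed
      show "(\<lambda>\<alpha> b. if b < m then (THE i. \<alpha> b = {#i#}) else 0) ` {\<alpha> \<in> ?I. \<forall>b<m. \<exists>i. \<alpha> b = {#i#}} \<subseteq> ?W"
      proof (rule image_subsetI)
        fix \<alpha> assume \<alpha>: "\<alpha> \<in> {\<alpha> \<in> ?I. \<forall>b<m. \<exists>i. \<alpha> b = {#i#}}"
        let ?w = "\<lambda>b. if b < m then (THE i. \<alpha> b = {#i#}) else 0"
        have f: "?f ?w = \<alpha>"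
        proof
          fix b
          show "?f ?w b = \<alpha> b"
          proof (cases "b < m")
            case True
            then obtain i where "\<alpha> b = {#i#}" using \<alpha> by blast
            then show ?thesis using True by simp
          qed (use \<alpha> in \<open>simp add: invariant_splits_def splits_def\<close>)
        qed
        have "image_mset ?w (mset_set {..<m}) = \<kappa>"
          unfolding s[of ?w, symmetric] f using \<alpha> by (simp add: invariant_splits_def splits_def)
        moreover have "?w \<circ> \<tau> = ?w"
        proof
          fix b
          have "\<alpha> \<circ> \<tau> = \<alpha>" using \<alpha> by (simp add: invariant_splits_def)
          from fun_cong[OF this, of b] have "\<alpha> (\<tau> b) = \<alpha> b" by simp
          then show "(?w \<circ> \<tau>) b = ?w b" using bm[of b] by simp
        qed
        ultimately show "?w \<in> ?W" by (simp add: word_maps_def)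
      qed
    qed
  qed
  finally show ?thesis .
qed

text \<open>The reversal produces the weakly decreasing order demanded by
  \<open>is_partition\<close>.\<close>

definition cycle_type :: "nat \<Rightarrow> (nat \<Rightarrow> nat) \<Rightarrow> nat list" where
  "cycle_type m \<tau> = rev (sorted_list_of_multiset (image_mset card (mset_set (orbits \<tau> {..<m}))))"

lemma mset_cycle_type: "mset (cycle_type m \<tau>) = image_mset card (mset_set (orbits \<tau> {..<m}))"
  by (simp add: cycle_type_def)

lemma is_partition_cycle_type:
  assumes \<tau>: "\<tau> permutes {..<m}"
  shows "is_partition (cycle_type m \<tau>) m"
proof -
  interpret finite_perm \<tau> "{..<m}" by unfold_locales (simp_all add: \<tau>)
  have "sorted_wrt (\<ge>) (cycle_type m \<tau>)"
    by (simp add: cycle_type_def sorted_wrt_rev)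
  moreover have "0 \<notin> set (cycle_type m \<tau>)"
    using card_orbit_pos finite_orbits by (fastforce simp: cycle_type_def)
  moreover have "sum_list (cycle_type m \<tau>) = m"
  proof -
    have "sum_list (cycle_type m \<tau>) = sum_mset (mset (cycle_type m \<tau>))"
      by (rule sum_mset_sum_list[symmetric])
    also have "\<dots> = (\<Sum>B\<in>orbits \<tau> {..<m}. card B)"
      unfolding mset_cycle_type by (simp add: sum_unfold_sum_mset)
    also have "\<dots> = (\<Sum>B\<in>orbits \<tau> {..<m}. \<Sum>x\<in>B. 1)" by simp
    also have "\<dots> = m" unfolding sum_orbits[symmetric] by simp
    finally show ?thesis .
  qed
  ultimately show ?thesis by (simp add: is_partition_def)
qed

lemma prod_list_cycle_type:
  "(\<Prod>k\<leftarrow>cycle_type m \<tau>. f k) = (\<Prod>B\<in>orbits \<tau> {..<m}. f (card B))" for f :: "nat \<Rightarrow> 'b::comm_monoid_mult"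
proof -
  have "(\<Prod>k\<leftarrow>cycle_type m \<tau>. f k) = prod_mset (image_mset f (mset (cycle_type m \<tau>)))"
    by (metis mset_map prod_mset_prod_list)
  also have "\<dots> = (\<Prod>B\<in>orbits \<tau> {..<m}. f (card B))"
    unfolding mset_cycle_type by (simp add: prod_unfold_prod_mset multiset.map_comp comp_def)
  finally show ?thesis .
qed

lemma partition_eqI:
  assumes "is_partition l a" "is_partition l' b" "mset l = mset l'"
  shows "l = l'"
proof -
  have "sorted (rev l)" "sorted (rev l')"
    using assms(1,2) by (simp_all add: is_partition_def sorted_wrt_rev)
  moreover have "mset (rev l) = mset (rev l')" using assms(3) by simp
  ultimately have "rev l = rev l'" by (metis properties_for_sort)
  then show ?thesis by simp
qed

text \<open>The ways to obtain the monomial \<open>\<kappa>\<close> by choosing one variable in each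
  factor of the product of power sums. The choice is recorded through the resulting
  monomials.\<close>

definition powsum_words :: "nat list \<Rightarrow> nat multiset \<Rightarrow> (nat \<Rightarrow> nat multiset) set" where
  "powsum_words l \<kappa> = {\<beta> \<in> splits {..<length l} \<kappa>. \<forall>i<length l. \<exists>j. \<beta> i = replicate_mset (l ! i) j}"

lemma finite_powsum_words: "finite (powsum_words l \<kappa>)"
  unfolding powsum_words_def by (rule finite_subset[OF _ finite_splits_fun[of "{..<length l}" \<kappa>]]) auto

lemma mcoeff_powsum_list: "mcoeff (\<Prod>k\<leftarrow>l. powsum k) \<kappa> = of_nat (card (powsum_words l \<kappa>))"
proof -
  let ?I = "splits {..<length l} \<kappa>" and ?P = "\<lambda>\<beta>. \<forall>i<length l. \<exists>j. \<beta> i = replicate_mset (l ! i) j"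
  have finI: "finite ?I" by (rule finite_splits_fun) simp
  have "(\<Prod>k\<leftarrow>l. powsum k) = (\<Prod>i<length l. powsum (l ! i))"
    by (simp add: prod.list_conv_set_nth atLeast0LessThan)
  then have "mcoeff (\<Prod>k\<leftarrow>l. powsum k) \<kappa> =
      (\<Sum>\<beta>\<in>?I. \<Prod>i<length l. mcoeff (powsum (l ! i)) (\<beta> i))"
    by (simp add: mcoeff_prod)
  also have "\<dots> = (\<Sum>\<beta>\<in>?I. of_bool (?P \<beta>))"
  proof (rule sum.cong[OF refl])
    fix \<beta>
    show "(\<Prod>i<length l. mcoeff (powsum (l ! i)) (\<beta> i)) = of_bool (?P \<beta>)"
    proof (cases "?P \<beta>")
      case True
      have "(\<Prod>i<length l. mcoeff (powsum (l ! i)) (\<beta> i)) = 1"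
        by (rule prod.neutral) (use True in \<open>simp add: powsum.rep_eq\<close>)
      moreover have "of_bool (?P \<beta>) = (1 :: complex)" using True by simp
      ultimately show ?thesis by (simp only:)
    next
      case False
      then obtain i where i: "i < length l" "\<not> (\<exists>j. \<beta> i = replicate_mset (l ! i) j)" by blast
      have "(\<Prod>i<length l. mcoeff (powsum (l ! i)) (\<beta> i)) = 0"
        by (rule prod_zero) (use i in \<open>auto simp: powsum.rep_eq\<close>)
      moreover have "of_bool (?P \<beta>) = (0 :: complex)" using False by simp
      ultimately show ?thesis by (simp only:)
    qed
  qed
  also have "\<dots> = of_nat (card (powsum_words l \<kappa>))"
    by (simp only: sum_of_bool_eq finI powsum_words_def Collect_conj_eq Collect_mem_eq)
  finally show ?thesis .
qed

text \<open>The monomial with exponent vector \<open>l\<close>. It detects \<open>l\<close> among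
  the power sum products of at most the same length.\<close>

definition part_mono_mset :: "nat list \<Rightarrow> nat multiset" where
  "part_mono_mset l = (\<Sum>i<length l. replicate_mset (l ! i) i)"

lemma powsum_words_self: "powsum_words l (part_mono_mset l) \<noteq> {}"
proof -
  have "(\<lambda>i. if i < length l then replicate_mset (l ! i) i else {#}) \<in> powsum_words l (part_mono_mset l)"
    by (auto simp: powsum_words_def splits_def part_mono_mset_def)
  then show ?thesis by blast
qed

text \<open>Triangularity of the power sums with respect to the monomials.\<close>

lemma powsum_words_length:
  assumes l: "is_partition l a" and l': "is_partition l' b"
    and ne: "powsum_words l' (part_mono_mset l) \<noteq> {}"
  shows "length l \<le> length l'" and "length l = length l' \<Longrightarrow> l = l'"
proof -
  obtain \<beta> where \<beta>: "\<beta> \<in> splits {..<length l'} (part_mono_mset l)"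
    "\<forall>i<length l'. \<exists>j. \<beta> i = replicate_mset (l' ! i) j"
    using ne by (auto simp: powsum_words_def)
  then have "\<forall>i\<in>{..<length l'}. \<exists>j. \<beta> i = replicate_mset (l' ! i) j" by simp
  from bchoice[OF this] obtain w where w: "\<forall>i\<in>{..<length l'}. \<beta> i = replicate_mset (l' ! i) (w i)" ..
  have sum: "(\<Sum>i<length l'. replicate_mset (l' ! i) (w i)) = part_mono_mset l"
    using \<beta>(1) w by (simp add: splits_def)
  have pos: "l ! i > 0" if "i < length l" for i
    using l that by (metis gr0I is_partition_def nth_mem)
  have pos': "l' ! i > 0" if "i < length l'" for i
    using l' that by (metis gr0I is_partition_def nth_mem)
  have set1: "set_mset (\<Sum>i<n. replicate_mset (f i) (v i)) = v ` {i. i < n \<and> f i > 0}" for n and f v :: "nat \<Rightarrow> nat"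
    by (induction n) (auto simp: less_Suc_eq)
  \<comment> \<open>All parts are positive, so the variables occurring in the monomial are exactly
    those chosen by \<open>w\<close>. Thus \<open>w\<close> merges the parts of \<open>l'\<close>
    into the parts of \<open>l\<close>; for equal lengths it is a bijection and nothing is
    merged.\<close>
  have im: "w ` {..<length l'} = {..<length l}"
  proof -
    have "w ` {..<length l'} = set_mset (part_mono_mset l)"
      unfolding sum[symmetric] set1 using pos' by auto
    also have "\<dots> = {..<length l}"
      unfolding part_mono_mset_def set1 using pos by auto
    finally show ?thesis .
  qed
  show "length l \<le> length l'"
    using card_image_le[of "{..<length l'}" w] im by simp
  show "l = l'" if len: "length l = length l'"
  proof (rule partition_eqI[OF l l'])
    have inj: "inj_on w {..<length l'}"
      using im len by (intro eq_card_imp_inj_on) auto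
    have cnt: "count (\<Sum>i<n. replicate_mset (f i) (v i)) x = (\<Sum>i<n. if v i = x then f i else 0)"
      for n x and f v :: "nat \<Rightarrow> nat"
      by (induction n) auto
    have lw: "l ! (w i) = l' ! i" if i: "i < length l'" for i
    proof -
      have wi: "w i < length l" using im i by auto
      have "l ! (w i) = (\<Sum>k<length l. if k = w i then l ! k else 0)"
        using wi by (simp add: sum.delta)
      also have "\<dots> = count (part_mono_mset l) (w i)"
        unfolding part_mono_mset_def cnt ..
      also have "\<dots> = (\<Sum>k<length l'. if w k = w i then l' ! k else 0)"
        unfolding sum[symmetric] cnt ..
      also have "\<dots> = (\<Sum>k<length l'. if k = i then l' ! k else 0)"
        using inj i by (intro sum.cong refl) (auto dest: inj_onD)
      also have "\<dots> = l' ! i"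
        using i by (simp add: sum.delta)
      finally show ?thesis .
    qed
    have "mset l' = image_mset (\<lambda>i. l' ! i) (mset_set {..<length l'})"
      by (metis atLeast0LessThan map_nth mset_map mset_upt)
    also have "\<dots> = image_mset ((\<lambda>i. l ! i) \<circ> w) (mset_set {..<length l'})"
      by (rule image_mset_cong) (simp add: lw)
    also have "\<dots> = image_mset (\<lambda>i. l ! i) (image_mset w (mset_set {..<length l'}))"
      by (rule multiset.map_comp[symmetric])
    also have "image_mset w (mset_set {..<length l'}) = mset_set {..<length l}"
      using image_mset_mset_set[OF inj] im by simp
    also have "image_mset (\<lambda>i. l ! i) (mset_set {..<length l}) = mset l"
      by (metis atLeast0LessThan map_nth mset_map mset_upt)
    finally show "mset l = mset l'" by simp
  qed
qed

lemma mcoeff_sum: "mcoeff (\<Sum>i\<in>I. f i) \<kappa> = (\<Sum>i\<in>I. mcoeff (f i) \<kappa>)"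
  by (induction I rule: infinite_finite_induct) (simp_all add: zero_mps.rep_eq plus_mps.rep_eq)

text \<open>Let \<open>l\<close> be of maximal length among the indices where the two expansions
  differ. No other index of difference reaches the monomial of \<open>l\<close>: shorter ones
  cannot, and those of the same length would equal \<open>l\<close>.\<close>

lemma powsum_expansion_unique:
  assumes c: "powsum_expansion f c" and c': "powsum_expansion f c'"
  shows "c = c'"
proof (rule ccontr)
  assume "c \<noteq> c'"
  define D where "D = {l. c l \<noteq> c' l}"
  define F where "F = {l. c l \<noteq> 0} \<union> {l. c' l \<noteq> 0}"
  have finF: "finite F" and part: "\<And>l. l \<in> F \<Longrightarrow> is_partition l (sum_list l)"
    using c c' by (auto simp: powsum_expansion_def F_def)
  have DF: "D \<subseteq> F" by (auto simp: D_def F_def)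
  then have finD: "finite D" using finF finite_subset by blast
  have "D \<noteq> {}" using \<open>c \<noteq> c'\<close> by (auto simp: D_def)
  then have "Max (length ` D) \<in> length ` D" using finD by (intro Max_in) auto
  then obtain l where l: "l \<in> D" "length l = Max (length ` D)" by auto
  have ex: "mcoeff f \<kappa> = (\<Sum>l\<in>F. e l * of_nat (card (powsum_words l \<kappa>)))"
    if e: "powsum_expansion f e" "{l. e l \<noteq> 0} \<subseteq> F" for e \<kappa>
  proof -
    have "f = (\<Sum>l | e l \<noteq> 0. e l *\<^sub>C (\<Prod>k\<leftarrow>l. powsum k))"
      using e(1) by (simp add: powsum_expansion_def)
    then have "mcoeff f \<kappa> = (\<Sum>l | e l \<noteq> 0. e l * of_nat (card (powsum_words l \<kappa>)))"
      by (simp only: mcoeff_sum scaleC_mps.rep_eq mcoeff_powsum_list)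
    also have "\<dots> = (\<Sum>l\<in>F. e l * of_nat (card (powsum_words l \<kappa>)))"
      using finF e(2) by (intro sum.mono_neutral_left) auto
    finally show ?thesis .
  qed
  let ?k = "part_mono_mset l"
  have "0 = (\<Sum>l'\<in>F. (c l' - c' l') * of_nat (card (powsum_words l' ?k)))"
    using ex[OF c, of ?k] ex[OF c', of ?k] by (simp add: F_def left_diff_distrib sum_subtractf)
  also have "\<dots> = (\<Sum>l'\<in>{l}. (c l' - c' l') * of_nat (card (powsum_words l' ?k)))"
  proof (rule sum.mono_neutral_right[OF finF])
    show "{l} \<subseteq> F" using l DF by auto
    show "\<forall>l'\<in>F - {l}. (c l' - c' l') * of_nat (card (powsum_words l' ?k)) = 0"
    proof
      fix l' assume l': "l' \<in> F - {l}"
      show "(c l' - c' l') * of_nat (card (powsum_words l' ?k)) = 0"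
      proof (cases "l' \<in> D")
        case True
        then have "length l' \<le> length l" using l(2) finD by simp
        then have "powsum_words l' ?k = {}"
          using powsum_words_length[OF part part, of l l'] l l' DF by fastforce
        then show ?thesis by simp
      qed (simp add: D_def)
    qed
  qed
  finally have "(c l - c' l) * of_nat (card (powsum_words l ?k)) = 0" by simp
  then show False
    using l(1) powsum_words_self[of l] finite_powsum_words[of l ?k] by (simp add: D_def)
qed

text \<open>Sorting the Frobenius formula by cycle type gives a power sum expansion of
  \<open>schur \<mu>\<close>. By uniqueness it is the one selected in \<open>plethysm\<close>, so
  each power sum of degree \<open>k\<close> may be replaced by \<open>\<theta> k g\<close>, one
  factor for every cycle.\<close>

lemma plethysm_schur:
  assumes \<mu>: "is_partition \<mu> m"
    and K: "proj_kernel (row_maps m) (specht \<mu>) K"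
    and K_inv: "\<forall>\<pi> r s. \<pi> permutes {..<m} \<longrightarrow> K (r \<circ> \<pi>) (s \<circ> \<pi>) = K r s"
  shows "plethysm \<theta> (schur \<mu>) g = (\<Sum>\<pi> | \<pi> permutes {..<m}.
    ((\<Sum>r\<in>row_maps m. K r (r \<circ> \<pi>)) / fact m) *\<^sub>C (\<Prod>B\<in>orbits \<pi> {..<m}. \<theta> (card B) g))"
proof -
  let ?P = "{\<pi>. \<pi> permutes {..<m}}"
  have finP: "finite ?P" by (simp add: finite_permutations)
  define \<chi> where "\<chi> \<pi> = (\<Sum>r\<in>row_maps m. K r (r \<circ> \<pi>)) / fact m" for \<pi>
  define c where "c l = (\<Sum>\<pi> | \<pi> \<in> ?P \<and> cycle_type m \<pi> = l. \<chi> \<pi>)" for l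
  let ?T = "cycle_type m ` ?P"
  have c0: "c l = 0" if "l \<notin> ?T" for l
  proof -
    have "{\<pi>. \<pi> \<in> ?P \<and> cycle_type m \<pi> = l} = {}" using that by blast
    then show ?thesis unfolding c_def by (simp only: sum.empty)
  qed
  have finc: "finite {l. c l \<noteq> 0}"
    by (rule finite_subset[of _ ?T]) (use c0 finP in auto)
  have sumc: "(\<Sum>l | c l \<noteq> 0. c l *\<^sub>C G l) = (\<Sum>\<pi>\<in>?P. \<chi> \<pi> *\<^sub>C G (cycle_type m \<pi>))" for G :: "nat list \<Rightarrow> mps"
  proof -
    have "(\<Sum>l | c l \<noteq> 0. c l *\<^sub>C G l) = (\<Sum>l\<in>?T. c l *\<^sub>C G l)"
      using finP c0 by (intro sum.mono_neutral_left) auto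
    also have "\<dots> = (\<Sum>l\<in>?T. \<Sum>\<pi> | \<pi> \<in> ?P \<and> cycle_type m \<pi> = l. \<chi> \<pi> *\<^sub>C G (cycle_type m \<pi>))"
      unfolding c_def cv.scale_sum_left by (intro sum.cong) auto
    also have "\<dots> = (\<Sum>\<pi>\<in>?P. \<chi> \<pi> *\<^sub>C G (cycle_type m \<pi>))"
      by (rule sum.image_gen[OF finP, symmetric])
    finally show ?thesis .
  qed
  have "schur \<mu> = (\<Sum>l | c l \<noteq> 0. c l *\<^sub>C (\<Prod>k\<leftarrow>l. powsum k))"
  proof (rule mps_eqI)
    fix \<kappa>
    have "mcoeff (schur \<mu>) \<kappa> =
        (\<Sum>\<pi>\<in>?P. \<chi> \<pi> * of_nat (card {w \<in> word_maps m \<kappa>. w \<circ> \<pi> = w}))"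
      unfolding schur_frobenius[OF \<mu> K K_inv] sum_divide_distrib[of _ ?P]
      by (rule sum.cong[OF refl]) (simp add: \<chi>_def mult.commute)
    also have "\<dots> = (\<Sum>\<pi>\<in>?P. \<chi> \<pi> * mcoeff (\<Prod>B\<in>orbits \<pi> {..<m}. powsum (card B)) \<kappa>)"
      by (rule sum.cong[OF refl]) (simp add: mcoeff_orbit_powsum)
    also have "\<dots> = mcoeff (\<Sum>l | c l \<noteq> 0. c l *\<^sub>C (\<Prod>k\<leftarrow>l. powsum k)) \<kappa>"
      unfolding sumc[of "\<lambda>l. \<Prod>k\<leftarrow>l. powsum k"] mcoeff_sum scaleC_mps.rep_eq prod_list_cycle_type ..
    finally show "mcoeff (schur \<mu>) \<kappa> = mcoeff (\<Sum>l | c l \<noteq> 0. c l *\<^sub>C (\<Prod>k\<leftarrow>l. powsum k)) \<kappa>" .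
  qed
  moreover have "is_partition l (sum_list l)" if "c l \<noteq> 0" for l
  proof -
    have "l \<in> ?T" using that by (rule contrapos_np) (rule c0)
    then obtain \<pi> where "\<pi> permutes {..<m}" "l = cycle_type m \<pi>" by auto
    then show ?thesis using is_partition_cycle_type[of \<pi> m] by (simp add: is_partition_def)
  qed
  ultimately have ce: "powsum_expansion (schur \<mu>) c"
    using finc unfolding powsum_expansion_def by blast
  have "(THE c. powsum_expansion (schur \<mu>) c) = c"
    by (rule the_equality[of "powsum_expansion (schur \<mu>)", OF ce]) (rule powsum_expansion_unique[OF _ ce])
  then have "plethysm \<theta> (schur \<mu>) g = (\<Sum>l | c l \<noteq> 0. c l *\<^sub>C (\<Prod>k\<leftarrow>l. \<theta> k g))"
    unfolding plethysm_def Let_def by (simp only:)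
  also have "\<dots> = (\<Sum>\<pi>\<in>?P. \<chi> \<pi> *\<^sub>C (\<Prod>B\<in>orbits \<pi> {..<m}. \<theta> (card B) g))"
    unfolding sumc[of "\<lambda>l. \<Prod>k\<leftarrow>l. \<theta> k g"] prod_list_cycle_type ..
  finally show ?thesis unfolding \<chi>_def .
qed

section \<open>Coefficients of the series H and E\<close>

lift_definition univ_series :: "(nat \<Rightarrow> complex) \<Rightarrow> nat \<Rightarrow> mps" is
  "\<lambda>f j \<kappa>. if set_mset \<kappa> \<subseteq> {j} then f (count \<kappa> j) else 0" .

text \<open>Distinct variables leave only one way to split a monomial among the factors. The factors
  \<open>1 + mvar j\<close>, the inverse of \<open>1 - mvar j\<close> and the powers of
  \<open>mvar j\<close> all have the form \<open>univ_series f j\<close>, so this covers H, E and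
  the monomials of a character.\<close>

lemma mcoeff_prod_univ:
  assumes J: "finite J"
  shows "mcoeff (\<Prod>j\<in>J. univ_series (f j) j) \<kappa> = (if set_mset \<kappa> \<subseteq> J then \<Prod>j\<in>J. f j (count \<kappa> j) else 0)"
proof -
  define \<beta>0 where "\<beta>0 j = (if j \<in> J then replicate_mset (count \<kappa> j) j else {#})" for j
  have tot: "count (\<Sum>j\<in>J. \<beta> j) x = (if x \<in> J then count (\<beta> x) x else 0)"
    if "\<And>j. j \<in> J \<Longrightarrow> set_mset (\<beta> j) \<subseteq> {j}" for \<beta> :: "nat \<Rightarrow> nat multiset" and x
  proof -
    have "count (\<Sum>j\<in>J. \<beta> j) x = (\<Sum>j\<in>J. count (\<beta> j) x)"
      by (rule count_sum)
    also have "\<dots> = (\<Sum>j\<in>J. if j = x then count (\<beta> x) x else 0)"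
    proof (rule sum.cong[OF refl])
      fix j assume "j \<in> J"
      then show "count (\<beta> j) x = (if j = x then count (\<beta> x) x else 0)"
        using that[of j] by (auto simp: count_eq_zero_iff)
    qed
    also have "\<dots> = (if x \<in> J then count (\<beta> x) x else 0)"
      using J by (simp add: sum.delta)
    finally show ?thesis .
  qed
  have only: "\<beta> = \<beta>0 \<and> set_mset \<kappa> \<subseteq> J"
    if \<beta>: "\<beta> \<in> splits J \<kappa>" and s: "\<And>j. j \<in> J \<Longrightarrow> set_mset (\<beta> j) \<subseteq> {j}" for \<beta>
  proof -
    have k: "count \<kappa> x = (if x \<in> J then count (\<beta> x) x else 0)" for x
      using tot[OF s, of x] \<beta> by (simp add: splits_def)
    have "\<beta> j = \<beta>0 j" for j
    proof (cases "j \<in> J")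
      case True
      then show ?thesis using s[OF True] k[of j]
        by (auto simp: \<beta>0_def multiset_eq_iff count_eq_zero_iff)
    next
      case False
      then show ?thesis using \<beta> by (simp add: splits_def \<beta>0_def)
    qed
    moreover have "set_mset \<kappa> \<subseteq> J"
      using k by (metis count_eq_zero_iff subsetI)
    ultimately show ?thesis by blast
  qed
  have "mcoeff (\<Prod>j\<in>J. univ_series (f j) j) \<kappa> = (\<Sum>\<beta>\<in>splits J \<kappa>. \<Prod>j\<in>J. mcoeff (univ_series (f j) j) (\<beta> j))"
    by (rule mcoeff_prod[OF J])
  also have "\<dots> = (\<Sum>\<beta>\<in>(if set_mset \<kappa> \<subseteq> J then {\<beta>0} else {}). \<Prod>j\<in>J. mcoeff (univ_series (f j) j) (\<beta> j))"
  proof (rule sum.mono_neutral_right[OF finite_splits_fun[OF J]])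
    have "\<beta>0 \<in> splits J \<kappa>" if "set_mset \<kappa> \<subseteq> J"
    proof -
      have "(\<Sum>j\<in>J. \<beta>0 j) = \<kappa>"
      proof (rule multiset_eqI)
        fix x
        have "count (\<Sum>j\<in>J. \<beta>0 j) x = (if x \<in> J then count (\<beta>0 x) x else 0)"
          by (rule tot) (auto simp: \<beta>0_def)
        also have "\<dots> = count \<kappa> x"
          using that by (auto simp: \<beta>0_def count_eq_zero_iff)
        finally show "count (\<Sum>j\<in>J. \<beta>0 j) x = count \<kappa> x" .
      qed
      then show ?thesis unfolding splits_def by (simp add: \<beta>0_def)
    qed
    then show "(if set_mset \<kappa> \<subseteq> J then {\<beta>0} else {}) \<subseteq> splits J \<kappa>" by simp
    show "\<forall>\<beta>\<in>splits J \<kappa> - (if set_mset \<kappa> \<subseteq> J then {\<beta>0} else {}).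
        (\<Prod>j\<in>J. mcoeff (univ_series (f j) j) (\<beta> j)) = 0"
    proof
      fix \<beta> assume \<beta>: "\<beta> \<in> splits J \<kappa> - (if set_mset \<kappa> \<subseteq> J then {\<beta>0} else {})"
      then obtain j where j: "j \<in> J" "\<not> set_mset (\<beta> j) \<subseteq> {j}"
        using only[of \<beta>] by (metis Diff_iff insertI1)
      show "(\<Prod>j\<in>J. mcoeff (univ_series (f j) j) (\<beta> j)) = 0"
        by (rule prod_zero[OF J]) (use j in \<open>auto simp: univ_series.rep_eq\<close>)
    qed
  qed
  also have "\<dots> = (if set_mset \<kappa> \<subseteq> J then \<Prod>j\<in>J. f j (count \<kappa> j) else 0)"
    by (auto simp: univ_series.rep_eq \<beta>0_def intro!: prod.cong)
  finally show ?thesis .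
qed

lemma one_plus_mvar: "1 + mvar j = univ_series (\<lambda>k. of_bool (k \<le> 1)) j"
proof (rule mps_eqI)
  fix \<kappa>
  show "mcoeff (1 + mvar j) \<kappa> = mcoeff (univ_series (\<lambda>k. of_bool (k \<le> 1)) j) \<kappa>"
  proof (cases "set_mset \<kappa> \<subseteq> {j}")
    case True
    then have "\<kappa> = replicate_mset (count \<kappa> j) j"
      by (auto simp: multiset_eq_iff count_eq_zero_iff)
    then obtain k where "\<kappa> = replicate_mset k j" by blast
    then show ?thesis
      by (cases k; cases "k - 1") (auto simp: plus_mps.rep_eq one_mps.rep_eq mvar.rep_eq univ_series.rep_eq)
  qed (auto simp: plus_mps.rep_eq one_mps.rep_eq mvar.rep_eq univ_series.rep_eq)
qed

lemma one_minus_mvar_inverse: "(1 - mvar j) * univ_series (\<lambda>_. 1) j = 1"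
proof -
  have "univ_series (\<lambda>_. 1) j = Abs_mps (\<lambda>\<kappa>. if \<exists>k. \<kappa> = replicate_mset k j then 1 else 0)"
  proof (rule mps_eqI)
    fix \<kappa> :: "nat multiset"
    have "set_mset \<kappa> \<subseteq> {j} \<longleftrightarrow> (\<exists>k. \<kappa> = replicate_mset k j)"
      by (metis set_mset_subset_singletonD set_mset_replicate_mset_subset empty_subsetI subset_refl)
    then show "mcoeff (univ_series (\<lambda>_. 1) j) \<kappa> =
        mcoeff (Abs_mps (\<lambda>\<kappa>. if \<exists>k. \<kappa> = replicate_mset k j then 1 else 0)) \<kappa>"
      by (simp add: univ_series.rep_eq Abs_mps_inverse)
  qed
  then show ?thesis using mps_one_minus_var_unit by simp
qed

lemma divide_prod_one_minus: "f / (\<Prod>j\<in>J. 1 - mvar (g j)) = f * (\<Prod>j\<in>J. univ_series (\<lambda>_. 1) (g j))"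
proof -
  have "(\<Prod>j\<in>J. 1 - mvar (g j)) * (\<Prod>j\<in>J. univ_series (\<lambda>_. 1) (g j)) = 1"
    unfolding prod.distrib[symmetric] one_minus_mvar_inverse by simp
  then show ?thesis by (simp add: divide_mps_def mps_inverse_eqI)
qed

lemma prod_split_add: "(\<Prod>j<m. f j) * (\<Prod>j<n. f (m + j)) = (\<Prod>j<m + n. f j)" for f :: "nat \<Rightarrow> 'b::comm_monoid_mult"
proof -
  have "(\<Prod>j<m + n. f j) = (\<Prod>j<m. f j) * (\<Prod>j\<in>{m..<m + n}. f j)"
    by (simp add: ivl_disj_un_one(2)[symmetric] prod.union_disjoint ivl_disj_int_one(2) flip: atLeast0LessThan)
       (metis add_leE le_add1 prod.atLeastLessThan_concat zero_le)
  also have "(\<Prod>j\<in>{m..<m + n}. f j) = (\<Prod>j<n. f (m + j))"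
    by (rule prod.reindex_bij_witness[where i = "\<lambda>j. m + j" and j = "\<lambda>j. j - m"]) auto
  finally show ?thesis by simp
qed

text \<open>\<open>P\<close> marks the variables allowed at most once: the odd ones for H, the even
  ones for E. With H belonging to even rows and E to odd rows, these are in both cases the columns
  whose parity differs from that of the row, hence the odd matrix units.\<close>

definition admissible :: "nat \<Rightarrow> nat \<Rightarrow> (nat \<Rightarrow> bool) \<Rightarrow> nat multiset \<Rightarrow> bool" where
  "admissible m n P \<kappa> \<longleftrightarrow> set_mset \<kappa> \<subseteq> {..<m + n} \<and> (\<forall>j. P j \<longrightarrow> count \<kappa> j \<le> 1)"

lemma mcoeff_admissible:
  assumes "F = (\<Prod>j<m + n. univ_series (\<lambda>k. if P j then of_bool (k \<le> 1) else 1) j)"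
  shows "mcoeff F \<kappa> = of_bool (admissible m n P \<kappa>)"
proof (cases "set_mset \<kappa> \<subseteq> {..<m + n}")
  case True
  have out: "count \<kappa> j = 0" if "\<not> j < m + n" for j
    using True that by (auto simp: count_eq_zero_iff)
  show ?thesis
  proof (cases "\<forall>j. P j \<longrightarrow> count \<kappa> j \<le> 1")
    case T: True
    then have "(\<Prod>j<m + n. if P j then of_bool (count \<kappa> j \<le> 1) else 1) = (1 :: complex)"
      by (intro prod.neutral) auto
    then have "mcoeff F \<kappa> = 1"
      unfolding assms mcoeff_prod_univ[OF finite_lessThan] using True by (simp only: if_True)
    moreover have "admissible m n P \<kappa>" using True T by (simp add: admissible_def)
    ultimately show ?thesis by simp
  next
    case F: False
    then obtain j where j: "P j" "\<not> count \<kappa> j \<le> 1" by blast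
    then have "j < m + n" using out[of j] by (cases "j < m + n") auto
    then have "(\<Prod>j<m + n. if P j then of_bool (count \<kappa> j \<le> 1) else 1) = (0 :: complex)"
      using j by (intro prod_zero) auto
    then have "mcoeff F \<kappa> = 0"
      unfolding assms mcoeff_prod_univ[OF finite_lessThan] using True by (simp only: if_True)
    moreover have "\<not> admissible m n P \<kappa>" using F by (simp add: admissible_def)
    ultimately show ?thesis by simp
  qed
next
  case False
  then show ?thesis by (simp add: assms mcoeff_prod_univ admissible_def)
qed

lemma mcoeff_H_series: "mcoeff (H_series m n) \<kappa> = of_bool (admissible m n (\<lambda>j. m \<le> j) \<kappa>)"
proof (rule mcoeff_admissible)
  let ?f = "\<lambda>j. univ_series (\<lambda>k. if m \<le> j then of_bool (k \<le> 1) else 1) j"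
  have "H_series m n = (\<Prod>j<m. ?f j) * (\<Prod>j<n. ?f (m + j))"
    unfolding H_series_def divide_prod_one_minus one_plus_mvar by (simp add: mult.commute)
  also have "\<dots> = (\<Prod>j<m + n. ?f j)" by (rule prod_split_add[of ?f])
  finally show "H_series m n = (\<Prod>j<m + n. ?f j)" .
qed

lemma mcoeff_E_series: "mcoeff (E_series m n) \<kappa> = of_bool (admissible m n (\<lambda>j. j < m) \<kappa>)"
proof (rule mcoeff_admissible)
  let ?f = "\<lambda>j. univ_series (\<lambda>k. if j < m then of_bool (k \<le> 1) else 1) j"
  have "E_series m n = (\<Prod>j<m. ?f j) * (\<Prod>j<n. ?f (m + j))"
    unfolding E_series_def divide_prod_one_minus one_plus_mvar by simp
  also have "\<dots> = (\<Prod>j<m + n. ?f j)" by (rule prod_split_add[of ?f])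
  finally show "E_series m n = (\<Prod>j<m + n. ?f j)" .
qed

section \<open>Supersymmetric functions on words\<close>

text \<open>Such an \<open>f\<close> factors through the supersymmetric algebra on the letters: even
  letters commute and letters with \<open>od\<close> anticommute.\<close>

definition supersym :: "('a \<Rightarrow> bool) \<Rightarrow> ('a list \<Rightarrow> complex) \<Rightarrow> bool" where
  "supersym od f \<longleftrightarrow> (\<forall>xs x y zs. f (xs @ x # y # zs) = (if od x \<and> od y then -1 else 1) * f (xs @ y # x # zs))"

lemma supersymD:
  "supersym od f \<Longrightarrow> f (xs @ x # y # zs) = (if od x \<and> od y then -1 else 1) * f (xs @ y # x # zs)"
  unfolding supersym_def by blast

text \<open>The sign of the permutation that sorts the odd letters, and \<open>0\<close> if an odd letter is repeated.\<close>

fun osgn :: "('a::linorder \<Rightarrow> bool) \<Rightarrow> 'a list \<Rightarrow> complex" where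
  "osgn od [] = 1"
| "osgn od (x # xs) =
    (if od x then (if x \<in> set xs then 0 else (-1) ^ length (filter (\<lambda>y. od y \<and> y < x) xs)) else 1) * osgn od xs"

lemma osgn_swap_head: "osgn od (x # y # zs) = (if od x \<and> od y then -1 else 1) * osgn od (y # x # zs)"
  by (cases x y rule: linorder_cases) auto

lemma supersym_osgn: "supersym od (osgn od)"
  unfolding supersym_def
proof (intro allI)
  fix xs x y zs
  show "osgn od (xs @ x # y # zs) = (if od x \<and> od y then -1 else 1) * osgn od (xs @ y # x # zs)"
  proof (induction xs)
    case Nil
    then show ?case using osgn_swap_head[of od x y zs] by (simp only: append_Nil)
  next
    case (Cons w xs)
    have 1: "w \<in> set (xs @ x # y # zs) \<longleftrightarrow> w \<in> set (xs @ y # x # zs)" by auto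
    have 2: "length (filter P (xs @ x # y # zs)) = length (filter P (xs @ y # x # zs))" for P by simp
    show ?case
      unfolding append_Cons osgn.simps 1 2 Cons.IH by (simp only: mult.left_commute)
  qed
qed

lemma osgn_sq: "osgn od u * osgn od u = of_bool (\<forall>x. od x \<longrightarrow> count (mset u) x \<le> 1)"
proof (induction u)
  case (Cons x u)
  have sq: "((-1) ^ k * (-1) ^ k :: complex) = 1" for k
    by (simp flip: power_add mult_2)
  show ?case
  proof (cases "od x \<and> x \<in> set u")
    case True
    then have "\<not> count (mset (x # u)) x \<le> 1" by (simp add: count_mset_0_iff)
    then have "\<not> (\<forall>z. od z \<longrightarrow> count (mset (x # u)) z \<le> 1)" using True by blast
    then have "of_bool (\<forall>z. od z \<longrightarrow> count (mset (x # u)) z \<le> 1) = (0 :: complex)" by simp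
    moreover have "osgn od (x # u) = 0" using True by simp
    ultimately show ?thesis by (simp only: mult_zero_left)
  next
    case False
    have "od z \<longrightarrow> (count (mset (x # u)) z \<le> 1 \<longleftrightarrow> count (mset u) z \<le> 1)" for z
      using False by (cases "z = x") (simp_all add: count_mset_0_iff[THEN iffD2])
    then have e: "(\<forall>z. od z \<longrightarrow> count (mset (x # u)) z \<le> 1) \<longleftrightarrow> (\<forall>z. od z \<longrightarrow> count (mset u) z \<le> 1)"
      by blast
    define s :: complex
      where "s = (if od x then (-1) ^ length (filter (\<lambda>y. od y \<and> y < x) u) else 1)"
    have "osgn od (x # u) = s * osgn od u" "s * s = 1"
      using False sq by (simp_all add: s_def)
    then have "osgn od (x # u) * osgn od (x # u) = osgn od u * osgn od u"
      by (metis mult.assoc mult.left_commute mult_1)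
    then show ?thesis unfolding e Cons.IH .
  qed
qed simp

lemma swap_invariant_move:
  assumes g: "\<And>xs x y zs. g (xs @ x # y # zs) = g (xs @ y # x # zs)"
  shows "g (pre @ x # ys @ zs) = g (pre @ ys @ x # zs)"
proof (induction ys arbitrary: pre)
  case (Cons y ys)
  have "g (pre @ x # (y # ys) @ zs) = g ((pre @ [y]) @ x # ys @ zs)"
    using g[of pre x y "ys @ zs"] by simp
  also have "\<dots> = g ((pre @ [y]) @ ys @ x # zs)" by (rule Cons.IH)
  finally show ?case by simp
qed simp

lemma swap_invariant_mset:
  assumes g: "\<And>xs x y zs. g (xs @ x # y # zs) = g (xs @ y # x # zs)" and "mset u = mset u'"
  shows "g u = g u'"
proof -
  have "g (pre @ u) = g (pre @ u')" for pre
    using assms(2)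
  proof (induction u arbitrary: pre u')
    case (Cons x u)
    then have "x \<in> set u'" by (metis list.set_intros(1) mset_eq_setD)
    then obtain ys zs where u': "u' = ys @ x # zs" by (meson split_list)
    then have "mset u = mset (ys @ zs)" using Cons.prems by simp
    then have "g ((pre @ [x]) @ u) = g ((pre @ [x]) @ ys @ zs)" by (rule Cons.IH)
    then show ?case
      using swap_invariant_move[of g, OF g, of pre x ys zs] by (simp add: u')
  qed simp
  from this[of "[]"] show ?thesis by simp
qed

text \<open>An adjacent exchange gives the same sign in both factors, so the product is invariant
  under exchanges and depends only on the content of the word.\<close>

lemma supersym_mset:
  assumes f: "supersym od f" and h: "supersym od h" and e: "mset u = mset u'"
  shows "h u * f u = h u' * f u'"
proof (rule swap_invariant_mset[of "\<lambda>u. h u * f u", OF _ e])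
  fix xs x y zs
  have 1: "f (xs @ x # y # zs) = (if od x \<and> od y then -1 else 1) * f (xs @ y # x # zs)"
    by (rule supersymD, rule f)
  have 2: "h (xs @ x # y # zs) = (if od x \<and> od y then -1 else 1) * h (xs @ y # x # zs)"
    by (rule supersymD, rule h)
  show "h (xs @ x # y # zs) * f (xs @ x # y # zs) = h (xs @ y # x # zs) * f (xs @ y # x # zs)"
    unfolding 1 2 by simp
qed

text \<open>Without repeated odd letters \<open>osgn\<close> squares to 1, so \<open>f\<close> can
  be recovered from the order-independent product with \<open>osgn\<close>. On words of one content,
  \<open>f\<close> is therefore determined by a single value.\<close>

lemma supersym_osgn_mset:
  assumes f: "supersym od f" and e: "mset u = mset u'" and adm: "\<forall>x. od x \<longrightarrow> count (mset u) x \<le> 1"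
  shows "f u = osgn od u * (osgn od u' * f u')"
proof -
  have "osgn od u * osgn od u = 1" unfolding osgn_sq using adm by simp
  then have "f u = osgn od u * (osgn od u * f u)" by (simp flip: mult.assoc)
  also have "osgn od u * f u = osgn od u' * f u'"
    by (rule supersym_mset[OF f supersym_osgn e])
  finally show ?thesis .
qed

text \<open>With the two copies of \<open>x\<close> moved to the front, \<open>f\<close> equals its
  own negative. The square \<open>f u * f u\<close> does not depend on the order of the letters and
  carries the vanishing back to \<open>u\<close>.\<close>

lemma supersym_repeated:
  assumes f: "supersym od f" and "od x" "count (mset u) x > 1"
  shows "f u = 0"
proof -
  have "{#x, x#} \<subseteq># mset u"
    using assms(3) by (auto simp: subseteq_mset_def)
  then obtain M where M: "mset u = {#x, x#} + M" by (metis subset_mset.le_iff_add)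
  obtain r where r: "mset r = M" using ex_mset by blast
  have e: "mset u = mset (x # x # r)" using M r by simp
  have "f (x # x # r) = - f (x # x # r)"
    using supersymD[OF f, of "[]" x x r] \<open>od x\<close> by simp
  then have "f (x # x # r) = 0" by (simp add: eq_neg_iff_add_eq_0 flip: mult_2)
  then have "f u * f u = 0"
    using supersym_mset[OF f f e] by simp
  then show ?thesis by simp
qed

lemma supersym_map:
  assumes f: "supersym od f" and g: "\<And>x. od (g x) = od x"
  shows "supersym od (\<lambda>u. f (map g u))"
  unfolding supersym_def
proof (intro allI)
  fix xs x y zs
  show "f (map g (xs @ x # y # zs)) = (if od x \<and> od y then -1 else 1) * f (map g (xs @ y # x # zs))"
    using supersymD[OF f, of "map g xs" "g x" "g y" "map g zs"] by (simp only: list.map map_append g)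
qed

lemma supersym_move:
  assumes f: "supersym od f"
  shows "f (pre @ ys @ x # post) = (if od x then (-1) ^ length (filter od ys) else 1) * f (pre @ x # ys @ post)"
proof (induction ys arbitrary: pre)
  case (Cons y ys)
  have "f (pre @ (y # ys) @ x # post) = f ((pre @ [y]) @ ys @ x # post)" by simp
  also have "\<dots> = (if od x then (-1) ^ length (filter od ys) else 1) * f ((pre @ [y]) @ x # ys @ post)"
    by (rule Cons.IH)
  also have "f ((pre @ [y]) @ x # ys @ post) = (if od y \<and> od x then -1 else 1) * f (pre @ x # y # ys @ post)"
    using supersymD[OF f, of pre y x "ys @ post"] by simp
  finally show ?case by auto
qed simp

text \<open>The first letter of the block passes \<open>length B - 1\<close> letters of its own
  parity.\<close>

lemma supersym_rotate1:
  assumes f: "supersym od f" and B: "B \<noteq> []" "\<And>x. x \<in> set B \<Longrightarrow> od x = o'"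
  shows "f (pre @ rotate1 B @ post) = (if o' then (-1) ^ (length B - 1) else 1) * f (pre @ B @ post)"
proof -
  obtain x ys where xy: "B = x # ys" using B(1) by (cases B) auto
  have "filter od ys = (if o' then ys else [])"
    using B(2) xy by (auto simp: filter_id_conv filter_empty_conv)
  then show ?thesis
    using supersym_move[OF f, of pre ys x post] B(2)[of x] by (simp add: xy)
qed

lemma supersym_rotate_blocks:
  assumes f: "supersym od f"
    and B: "\<And>B. B \<in> set bs \<Longrightarrow> B \<noteq> [] \<and> (\<forall>x\<in>set B. od x = od (hd B))"
  shows "f (pre @ concat (map rotate1 bs)) =
    (\<Prod>B\<leftarrow>bs. if od (hd B) then (-1) ^ (length B - 1) else 1) * f (pre @ concat bs)"
  using B
proof (induction bs arbitrary: pre)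
  case (Cons B bs)
  have "f (pre @ concat (map rotate1 (B # bs))) = f ((pre @ rotate1 B) @ concat (map rotate1 bs))"
    by simp
  also have "\<dots> = (\<Prod>B\<leftarrow>bs. if od (hd B) then (-1) ^ (length B - 1) else 1) * f ((pre @ rotate1 B) @ concat bs)"
    by (rule Cons.IH) (use Cons.prems in simp)
  also have "f ((pre @ rotate1 B) @ concat bs) =
      (if od (hd B) then (-1) ^ (length B - 1) else 1) * f (pre @ B @ concat bs)"
    using supersym_rotate1[OF f, of B "od (hd B)" pre "concat bs"] Cons.prems by simp
  finally show ?case by (simp add: mult.assoc mult.left_commute)
qed simp

section \<open>Words of matrix units\<close>

text \<open>Words in the letters \<open>(b, a)\<close>, which stand for the matrix units of the superspace of endomorphisms. The factor
  \<open>gam\<close> is the sign of the isomorphism between tensor powers of matrix units and matrix units of tensor powers.\<close>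

type_synonym biword = "(nat \<times> nat) list"

fun gam :: "nat \<Rightarrow> biword \<Rightarrow> complex" where
  "gam m [] = 1"
| "gam m (x # u) = (-1) ^ (idx_parity m (snd x) * (\<Sum>y\<leftarrow>u. idx_parity m (fst y))) * gam m u"

definition opair :: "nat \<Rightarrow> nat \<times> nat \<Rightarrow> bool" where
  "opair m x \<longleftrightarrow> idx_parity m (fst x) \<noteq> idx_parity m (snd x)"

text \<open>For \<open>x\<close> before \<open>y\<close> the exponent of \<open>gam\<close> contains
  the column parity of \<open>x\<close> times the row parity of \<open>y\<close>. The exchange
  replaces this crossing by the opposite one and affects no other.\<close>

lemma gam_swap: "gam m (xs @ x # y # zs) =
    (-1) ^ (idx_parity m (snd x) * idx_parity m (fst y) + idx_parity m (snd y) * idx_parity m (fst x)) *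
    gam m (xs @ y # x # zs)"
proof (induction xs)
  case Nil
  have "(-1) ^ (a * (b + s) + c * s) = ((-1) ^ (a * b + c * d) * (-1) ^ (c * (d + s) + a * s) :: complex)"
    for a b c d s :: nat
  proof -
    have "(-1) ^ (a * b + c * d) * (-1) ^ (c * (d + s) + a * s) =
        ((-1) ^ (a * (b + s) + c * s) * (-1) ^ (2 * (c * d)) :: complex)"
      unfolding power_add[symmetric] by (rule arg_cong[of _ _ "\<lambda>k. (-1) ^ k"]) (simp add: algebra_simps)
    then show ?thesis by (simp add: power_mult)
  qed
  from this[of "idx_parity m (snd x)" "idx_parity m (fst y)" "\<Sum>y\<leftarrow>zs. idx_parity m (fst y)"
      "idx_parity m (snd y)" "idx_parity m (fst x)"]
  show ?case by (simp add: power_add mult.assoc)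
next
  case (Cons w xs)
  have "(\<Sum>y\<leftarrow>xs @ x # y # zs. idx_parity m (fst y)) = (\<Sum>y\<leftarrow>xs @ y # x # zs. idx_parity m (fst y))" by simp
  then show ?case
    unfolding append_Cons gam.simps Cons.IH by (simp only: mult.left_commute)
qed

lemma gam_sq: "gam m u * gam m u = 1"
proof (induction u)
  case (Cons x u)
  have sq: "((-1) ^ k * (-1) ^ k :: complex) = 1" for k
    by (simp flip: power_add mult_2)
  have "gam m (x # u) * gam m (x # u) = ((-1) ^ (idx_parity m (snd x) * (\<Sum>y\<leftarrow>u. idx_parity m (fst y))) *
      (-1) ^ (idx_parity m (snd x) * (\<Sum>y\<leftarrow>u. idx_parity m (fst y)))) * (gam m u * gam m u)"
    by (simp only: gam.simps ac_simps)
  then show ?case by (simp only: sq Cons.IH mult_1)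
qed simp

lemma gam_map:
  assumes "\<And>x. idx_parity m (fst (g x)) = idx_parity m (fst x)" "\<And>x. snd (g x) = snd x"
  shows "gam m (map g u) = gam m u"
proof (induction u)
  case (Cons x u)
  have "map (idx_parity m \<circ> (fst \<circ> g)) u = map (idx_parity m \<circ> fst) u" by (simp add: assms(1))
  then show ?case by (simp add: Cons.IH assms comp_def)
qed simp

text \<open>The sign of a transposition of two letters, compared with the signs of the two projections.\<close>

lemma opair_sign:
  "(-1) ^ (idx_parity m (fst x) * idx_parity m (fst y) + idx_parity m (snd x) * idx_parity m (snd y)) *
   (-1) ^ (idx_parity m (snd x) * idx_parity m (fst y) + idx_parity m (snd y) * idx_parity m (fst x)) =
   (if opair m x \<and> opair m y then -1 else 1 :: complex)"
  by (simp add: opair_def idx_parity_def)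

text \<open>A biword up to the order of its letters is a matrix of nonnegative integers. Its row
  \<open>b\<close> is stored as the multiset of column indices, that is, as a monomial.\<close>

definition rows :: "biword \<Rightarrow> nat \<Rightarrow> nat multiset" where
  "rows u b = image_mset snd (filter_mset (\<lambda>x. fst x = b) (mset u))"

lemma count_rows: "count (rows u b) a = count (mset u) (b, a)"
  by (induction u) (auto simp: rows_def)

lemma rows_eq_iff: "rows u = rows u' \<longleftrightarrow> mset u = mset u'"
proof
  assume "rows u = rows u'"
  then show "mset u = mset u'"
    by (intro multiset_eqI) (metis count_rows surj_pair)
qed (simp add: rows_def fun_eq_iff)

lemma rows_map:
  assumes g: "bij g"
  shows "rows (map (\<lambda>x. (g (fst x), snd x)) u) = rows u \<circ> inv g"
proof
  fix b
  have "g c = b \<longleftrightarrow> c = inv g b" for c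
    using g by (metis bij_inv_eq_iff)
  then show "rows (map (\<lambda>x. (g (fst x), snd x)) u) b = (rows u \<circ> inv g) b"
    by (induction u) (simp_all add: rows_def)
qed

lemma sum_rows:
  assumes "set (map fst u) \<subseteq> {..<N}"
  shows "(\<Sum>b<N. rows u b) = mset (map snd u)"
  using assms
proof (induction u)
  case (Cons x u)
  have "(\<Sum>b<N. rows (x # u) b) = (\<Sum>b<N. (if b = fst x then {#snd x#} else {#}) + rows u b)"
    by (intro sum.cong) (auto simp: rows_def)
  also have "\<dots> = (\<Sum>b<N. if b = fst x then {#snd x#} else {#}) + (\<Sum>b<N. rows u b)"
    by (rule sum.distrib)
  finally show ?case using Cons by (simp add: sum.delta)
qed (simp add: rows_def)

lemma rows_surj:
  assumes "\<And>b. N \<le> b \<Longrightarrow> \<beta> b = {#}"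
  shows "\<exists>u. rows u = \<beta>"
proof -
  obtain u where u: "mset u = (\<Sum>b<N. image_mset (Pair b) (\<beta> b))" using ex_mset by blast
  have "count (mset u) (b, a) = count (\<beta> b) a" for a b
  proof -
    have p: "count (image_mset (Pair c) M) (b, a) = (if c = b then count M a else 0)" for c and M :: "nat multiset"
      by (induction M) auto
    have "count (mset u) (b, a) = (\<Sum>c<N. if c = b then count (\<beta> c) a else 0)"
      unfolding u count_sum p ..
    also have "\<dots> = count (\<beta> b) a"
      using assms[of b] by (cases "b < N") (simp_all add: sum.delta)
    finally show ?thesis .
  qed
  then have "rows u = \<beta>" by (intro ext multiset_eqI) (simp add: count_rows)
  then show ?thesis by blast
qed

section \<open>The Schur superalgebra in coordinates\<close>

lemma lin_mapsD:
  assumes "F \<in> lin_maps V W"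
  shows "u \<in> V \<Longrightarrow> v \<in> V \<Longrightarrow> F (u + v) = F u + F v" and "v \<in> V \<Longrightarrow> F (c *\<^sub>C v) = c *\<^sub>C F v"
    and "v \<in> V \<Longrightarrow> F v \<in> W" and "v \<notin> V \<Longrightarrow> F v = 0"
  using assms unfolding lin_maps_def by blast+

lemma lin_maps_sum:
  assumes F: "F \<in> lin_maps V W" and V: "cv.subspace V" and v: "\<And>i. i \<in> I \<Longrightarrow> v i \<in> V"
  shows "F (\<Sum>i\<in>I. c i *\<^sub>C v i) = (\<Sum>i\<in>I. c i *\<^sub>C F (v i))"
  using v
proof (induction I rule: infinite_finite_induct)
  case (insert i I)
  have "(\<Sum>i\<in>I. c i *\<^sub>C v i) \<in> V"
    by (intro cv.subspace_sum[OF V] cv.subspace_scale[OF V] insert.prems) simp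
  moreover have "c i *\<^sub>C v i \<in> V" by (intro cv.subspace_scale[OF V] insert.prems) simp
  ultimately have "F (c i *\<^sub>C v i + (\<Sum>i\<in>I. c i *\<^sub>C v i)) = c i *\<^sub>C F (v i) + (\<Sum>i\<in>I. c i *\<^sub>C F (v i))"
    using lin_mapsD(1)[OF F] lin_mapsD(2)[OF F] insert by simp
  then show ?case by (simp only: sum.insert[OF insert.hyps])
qed (simp_all add: lin_maps_zero[OF F])

lemma lin_mapsI:
  assumes "\<And>u v. u \<in> V \<Longrightarrow> v \<in> V \<Longrightarrow> F (u + v) = F u + F v" "\<And>c v. v \<in> V \<Longrightarrow> F (c *\<^sub>C v) = c *\<^sub>C F v"
    "\<And>v. v \<in> V \<Longrightarrow> F v \<in> W" "\<And>v. v \<notin> V \<Longrightarrow> F v = 0"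
  shows "F \<in> lin_maps V W"
  unfolding lin_maps_def using assms by blast

lemma subspace_lin_maps:
  assumes W: "cv.subspace W"
  shows "cv.subspace (lin_maps V W)"
proof (rule cv.subspaceI)
  show "0 \<in> lin_maps V W"
    by (rule lin_mapsI) (simp_all add: cv.subspace_0[OF W])
  fix F G assume F: "F \<in> lin_maps V W" and G: "G \<in> lin_maps V W"
  show "F + G \<in> lin_maps V W"
  proof (rule lin_mapsI)
    show "(F + G) v \<in> W" if "v \<in> V" for v
      using cv.subspace_add[OF W lin_mapsD(3)[OF F that] lin_mapsD(3)[OF G that]] by simp
  qed (simp_all add: lin_mapsD[OF F] lin_mapsD[OF G] scaleC_add_right)
next
  fix a F assume F: "F \<in> lin_maps V W"
  show "a *\<^sub>C F \<in> lin_maps V W"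
  proof (rule lin_mapsI)
    show "(a *\<^sub>C F) v \<in> W" if "v \<in> V" for v
      using cv.subspace_scale[OF W lin_mapsD(3)[OF F that]] by simp
  qed (simp_all add: lin_mapsD[OF F] scaleC_add_right scaleC_scaleC mult.commute)
qed

locale super_words =
  fixes m n d :: nat
begin

abbreviation "Wd \<equiv> words m n d"
abbreviation "T \<equiv> tpow m n d"
abbreviation "S \<equiv> schur_alg m n d"
abbreviation "par \<equiv> idx_parity m"

lemma finite_words: "finite Wd"
  unfolding words_def by (rule finite_subset[OF _ finite_lists_length_eq[of "{..<m + n}" d]]) auto

lemma subspace_T: "cv.subspace T"
  by (rule cv.subspaceI) (simp_all add: tpow_def)

lemma delta_T: "w \<in> Wd \<Longrightarrow> delta w \<in> T"
  by (auto simp: tpow_def delta_def)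

lemma T_zero: "x \<in> T \<Longrightarrow> v \<notin> Wd \<Longrightarrow> x v = 0"
  by (simp add: tpow_def)

lemma lin_expand:
  assumes F: "F \<in> lin_maps T W" and x: "x \<in> T"
  shows "F x = (\<Sum>w\<in>Wd. x w *\<^sub>C F (delta w))"
proof -
  have "x = (\<Sum>w\<in>Wd. x w *\<^sub>C delta w)"
    by (rule fun_eq_sum_delta[OF finite_words]) (rule T_zero[OF x])
  then have "F x = F (\<Sum>w\<in>Wd. x w *\<^sub>C delta w)" by (rule arg_cong)
  also have "\<dots> = (\<Sum>w\<in>Wd. x w *\<^sub>C F (delta w))"
    by (rule lin_maps_sum[OF F subspace_T]) (rule delta_T)
  finally show ?thesis .
qed

lemma lin_ext:
  assumes F: "F \<in> lin_maps T W" and G: "G \<in> lin_maps T W" and e: "\<And>w. w \<in> Wd \<Longrightarrow> F (delta w) = G (delta w)"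
  shows "F = G"
proof
  fix x show "F x = G x"
  proof (cases "x \<in> T")
    case True
    show ?thesis unfolding lin_expand[OF F True] lin_expand[OF G True] by (rule sum.cong[OF refl]) (simp only: e)
  next
    case False
    then show ?thesis using lin_mapsD(4)[OF F False] lin_mapsD(4)[OF G False] by simp
  qed
qed

lemma on_basis_delta:
  assumes "w \<in> Wd"
  shows "on_basis m n d \<phi> (delta w) = \<phi> w"
proof
  fix v
  have "on_basis m n d \<phi> (delta w) v = (\<Sum>w'\<in>Wd. if w' = w then \<phi> w v else 0)"
    using delta_T[OF assms] unfolding on_basis_def
    by (auto simp: sum_fun_apply delta_def intro!: sum.cong)
  then show "on_basis m n d \<phi> (delta w) v = \<phi> w v"
    using assms finite_words by (simp add: sum.delta)
qed

lemma on_basis_apply: "x \<in> T \<Longrightarrow> on_basis m n d \<phi> x v = (\<Sum>w\<in>Wd. x w * \<phi> w v)"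
  by (simp add: on_basis_def sum_fun_apply)

lemma on_basis_lin:
  assumes "\<And>w. w \<in> Wd \<Longrightarrow> \<phi> w \<in> T"
  shows "on_basis m n d \<phi> \<in> lin_maps T T"
proof (rule lin_mapsI)
  fix u v assume uv: "u \<in> T" "v \<in> T"
  then have "u + v \<in> T" by (rule cv.subspace_add[OF subspace_T])
  then show "on_basis m n d \<phi> (u + v) = on_basis m n d \<phi> u + on_basis m n d \<phi> v"
    using uv by (intro ext) (simp add: on_basis_apply distrib_right sum.distrib)
next
  fix c v assume v: "v \<in> T"
  then have "c *\<^sub>C v \<in> T" by (rule cv.subspace_scale[OF subspace_T])
  then show "on_basis m n d \<phi> (c *\<^sub>C v) = c *\<^sub>C on_basis m n d \<phi> v"
    using v by (intro ext) (simp add: on_basis_apply sum_distrib_left mult.assoc)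
next
  fix v assume v: "v \<in> T"
  have "on_basis m n d \<phi> v = (\<Sum>w\<in>Wd. v w *\<^sub>C \<phi> w)" using v unfolding on_basis_def by (simp only: if_True)
  also have "\<dots> \<in> T" by (intro cv.subspace_sum[OF subspace_T] cv.subspace_scale[OF subspace_T] assms)
  finally show "on_basis m n d \<phi> v \<in> T" .
next
  fix v assume "v \<notin> T"
  then show "on_basis m n d \<phi> v = 0" unfolding on_basis_def by (simp only: if_False)
qed

definition swapw :: "nat \<Rightarrow> nat list \<Rightarrow> nat list" where
  "swapw k w = w[k := w ! Suc k, Suc k := w ! k]"

definition sgk :: "nat \<Rightarrow> nat list \<Rightarrow> complex" where
  "sgk k w = (-1) ^ (par (w ! k) * par (w ! Suc k))"

lemma swapw_append: "length xs = k \<Longrightarrow> swapw k (xs @ x # y # zs) = xs @ y # x # zs"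
  by (simp add: swapw_def nth_append list_update_append)

lemma split_at:
  assumes "Suc k < length w"
  obtains xs x y zs where "w = xs @ x # y # zs" "length xs = k"
proof
  show "w = take k w @ w ! k # w ! Suc k # drop (Suc (Suc k)) w"
    using assms by (metis Cons_nth_drop_Suc Suc_lessD append_take_drop_id)
  show "length (take k w) = k" using assms by simp
qed

lemma swapw_facts:
  assumes k: "Suc k < d" and w: "w \<in> Wd"
  shows "swapw k w \<in> Wd" "swapw k (swapw k w) = w" "sgk k (swapw k w) = sgk k w" "mset (swapw k w) = mset w"
proof -
  have "Suc k < length w" using k w by (simp add: words_def)
  then obtain xs x y zs where e: "w = xs @ x # y # zs" "length xs = k" by (rule split_at)
  show "swapw k w \<in> Wd" using w by (auto simp: e(1) swapw_append[OF e(2)] words_def)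
  show "swapw k (swapw k w) = w" by (simp add: e(1) swapw_append[OF e(2)])
  show "sgk k (swapw k w) = sgk k w"
    using e(2) by (simp add: e(1) swapw_append[OF e(2)] sgk_def nth_append mult.commute)
  show "mset (swapw k w) = mset w" by (simp add: e(1) swapw_append[OF e(2)])
qed

lemma sgk_sq: "sgk k w * sgk k w = 1"
  by (simp add: sgk_def flip: power_add mult_2)

lemma swapw_inj: "Suc k < d \<Longrightarrow> v \<in> Wd \<Longrightarrow> w \<in> Wd \<Longrightarrow> swapw k v = swapw k w \<longleftrightarrow> v = w"
  using swapw_facts(2) by metis

lemma adj_swap_lin: "Suc k < d \<Longrightarrow> adj_swap m n d k \<in> lin_maps T T"
  unfolding adj_swap_def
  by (intro on_basis_lin cv.subspace_scale[OF subspace_T] delta_T) (rule swapw_facts(1)[unfolded swapw_def])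

lemma adj_swap_delta: "w \<in> Wd \<Longrightarrow> adj_swap m n d k (delta w) = sgk k w *\<^sub>C delta (swapw k w)"
  unfolding adj_swap_def sgk_def swapw_def by (rule on_basis_delta)

lemma adj_swap_apply:
  assumes x: "x \<in> T" and k: "Suc k < d" and v: "v \<in> Wd"
  shows "adj_swap m n d k x v = sgk k v * x (swapw k v)"
proof -
  have "adj_swap m n d k x v = (\<Sum>w\<in>Wd. x w * (sgk k w * delta (swapw k w) v))"
    unfolding adj_swap_def on_basis_apply[OF x] by (simp add: sgk_def swapw_def)
  also have "\<dots> = (\<Sum>w\<in>Wd. if w = swapw k v then sgk k v * x (swapw k v) else 0)"
  proof (rule sum.cong[OF refl])
    fix w assume w: "w \<in> Wd"
    have "v = swapw k w \<longleftrightarrow> w = swapw k v" using swapw_facts(2)[OF k] v w by metis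
    then show "x w * (sgk k w * delta (swapw k w) v) = (if w = swapw k v then sgk k v * x (swapw k v) else 0)"
      using swapw_facts(3)[OF k v] by (auto simp: delta_def)
  qed
  also have "\<dots> = sgk k v * x (swapw k v)"
    using finite_words swapw_facts(1)[OF k v] by (simp add: sum.delta)
  finally show ?thesis .
qed

lemma schur_lin: "\<eta> \<in> S \<Longrightarrow> \<eta> \<in> lin_maps T T"
  by (simp add: schur_alg_def)

lemma schur_adj_swap:
  assumes \<eta>: "\<eta> \<in> S" and k: "Suc k < d"
  shows "\<eta> \<circ> adj_swap m n d k = adj_swap m n d k \<circ> \<eta>"
proof -
  have i: "on_basis m n d delta \<in> lin_maps T T" by (rule on_basis_lin[OF delta_T])
  \<comment> \<open>The neutral element of \<open>sym_ops\<close> is the identity of the tensor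
    power extended by 0, not \<open>id\<close>, so \<open>adj_swap\<close> occurs there only as this
    composition.\<close>
  have "adj_swap m n d k \<circ> on_basis m n d delta = adj_swap m n d k"
  proof (rule lin_ext)
    show "adj_swap m n d k \<circ> on_basis m n d delta \<in> lin_maps T T"
      by (rule lin_maps_comp[OF i adj_swap_lin[OF k]])
    show "adj_swap m n d k \<in> lin_maps T T" by (rule adj_swap_lin[OF k])
    show "(adj_swap m n d k \<circ> on_basis m n d delta) (delta w) = adj_swap m n d k (delta w)" if "w \<in> Wd" for w
      by (simp only: comp_apply on_basis_delta[OF that])
  qed
  then have "adj_swap m n d k \<in> sym_ops m n d"
    using sym_ops.step[OF sym_ops.one k, of m n] by simp
  then show ?thesis using \<eta> by (simp add: schur_alg_def)
qed

text \<open>This is commutation with an adjacent transposition, read off in matrix entries: both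
  words are permuted at once, and each contributes its own Koszul sign.\<close>

lemma schur_matrix:
  assumes \<eta>: "\<eta> \<in> S" and k: "Suc k < d" and v: "v \<in> Wd" and w: "w \<in> Wd"
  shows "\<eta> (delta (swapw k w)) (swapw k v) = sgk k v * sgk k w * \<eta> (delta w) v"
proof -
  note lin = schur_lin[OF \<eta>]
  have "\<eta> (adj_swap m n d k (delta w)) = adj_swap m n d k (\<eta> (delta w))"
    using fun_cong[OF schur_adj_swap[OF \<eta> k], of "delta w"] by (simp only: comp_apply)
  moreover have "\<eta> (adj_swap m n d k (delta w)) = sgk k w *\<^sub>C \<eta> (delta (swapw k w))"
    unfolding adj_swap_delta[OF w] by (rule lin_mapsD(2)[OF lin delta_T[OF swapw_facts(1)[OF k w]]])
  ultimately have "sgk k w * \<eta> (delta (swapw k w)) (swapw k v) = adj_swap m n d k (\<eta> (delta w)) (swapw k v)"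
    by (metis scaleC_fun_apply scaleC_complex)
  also have "\<dots> = sgk k v * \<eta> (delta w) v"
    using adj_swap_apply[OF lin_mapsD(3)[OF lin delta_T[OF w]] k swapw_facts(1)[OF k v]]
    by (simp only: swapw_facts(2,3)[OF k v])
  finally have "sgk k w * (sgk k w * \<eta> (delta (swapw k w)) (swapw k v)) = sgk k w * (sgk k v * \<eta> (delta w) v)"
    by (rule arg_cong)
  then show ?thesis
    by (simp only: mult.assoc[symmetric] sgk_sq mult_1 mult.commute[of "sgk k w" "sgk k v"])
qed

text \<open>Converse of the exchange rule for matrix entries. It yields commutation with the
  adjacent transpositions, and this passes to all of \<open>sym_ops\<close> by induction.\<close>

lemma schur_algI:
  assumes F: "F \<in> lin_maps T T"
    and M: "\<And>k v w. Suc k < d \<Longrightarrow> v \<in> Wd \<Longrightarrow> w \<in> Wd \<Longrightarrow>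
      F (delta (swapw k w)) (swapw k v) = sgk k v * sgk k w * F (delta w) v"
  shows "F \<in> S"
proof -
  have c: "F \<circ> adj_swap m n d k = adj_swap m n d k \<circ> F" if k: "Suc k < d" for k
  proof (rule lin_ext)
    show "F \<circ> adj_swap m n d k \<in> lin_maps T T" by (rule lin_maps_comp[OF adj_swap_lin[OF k] F])
    show "adj_swap m n d k \<circ> F \<in> lin_maps T T" by (rule lin_maps_comp[OF F adj_swap_lin[OF k]])
    fix w assume w: "w \<in> Wd"
    have Fw: "F (delta w) \<in> T" "F (delta (swapw k w)) \<in> T"
      using lin_mapsD(3)[OF F] delta_T w swapw_facts(1)[OF k w] by auto
    have 1: "(F \<circ> adj_swap m n d k) (delta w) = sgk k w *\<^sub>C F (delta (swapw k w))"
      unfolding comp_apply adj_swap_delta[OF w] by (rule lin_mapsD(2)[OF F delta_T[OF swapw_facts(1)[OF k w]]])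
    show "(F \<circ> adj_swap m n d k) (delta w) = (adj_swap m n d k \<circ> F) (delta w)"
    proof
      fix v show "(F \<circ> adj_swap m n d k) (delta w) v = (adj_swap m n d k \<circ> F) (delta w) v"
      proof (cases "v \<in> Wd")
        case True
        note sv = swapw_facts[OF k True]
        have "F (delta (swapw k w)) v = sgk k v * sgk k w * F (delta w) (swapw k v)"
          using M[OF k sv(1) w] by (simp only: sv(2,3))
        then have "sgk k w * F (delta (swapw k w)) v = sgk k w * sgk k w * (sgk k v * F (delta w) (swapw k v))"
          by (simp only: ac_simps)
        then show ?thesis
          unfolding 1 by (simp add: adj_swap_apply[OF Fw(1) k True] sgk_sq)
      next
        case False
        have A: "adj_swap m n d k (F (delta w)) \<in> T" by (rule lin_mapsD(3)[OF adj_swap_lin[OF k] Fw(1)])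
        show ?thesis
          unfolding 1 using T_zero[OF A False] T_zero[OF Fw(2) False]
          by (simp only: comp_apply scaleC_fun_apply scaleC_complex mult_zero_right)
      qed
    qed
  qed
  have "F \<circ> s = s \<circ> F" if "s \<in> sym_ops m n d" for s
    using that
  proof induction
    case one
    show ?case
    proof (rule lin_ext)
      have i: "on_basis m n d delta \<in> lin_maps T T" by (rule on_basis_lin[OF delta_T])
      show "F \<circ> on_basis m n d delta \<in> lin_maps T T" by (rule lin_maps_comp[OF i F])
      show "on_basis m n d delta \<circ> F \<in> lin_maps T T" by (rule lin_maps_comp[OF F i])
      fix w assume w: "w \<in> Wd"
      have Fw: "F (delta w) \<in> T" by (rule lin_mapsD(3)[OF F delta_T[OF w]])
      have "on_basis m n d delta (F (delta w)) = (\<Sum>w'\<in>Wd. F (delta w) w' *\<^sub>C delta w')"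
        using Fw unfolding on_basis_def by (simp only: if_True)
      also have "\<dots> = F (delta w)"
        by (rule fun_eq_sum_delta[OF finite_words, symmetric]) (rule T_zero[OF Fw])
      finally show "(F \<circ> on_basis m n d delta) (delta w) = (on_basis m n d delta \<circ> F) (delta w)"
        by (simp only: comp_apply on_basis_delta[OF w])
    qed
  next
    case (step s k)
    have "F \<circ> (adj_swap m n d k \<circ> s) = adj_swap m n d k \<circ> (F \<circ> s)"
      using c[OF step.hyps(2)] by (metis comp_assoc)
    then show ?case unfolding step.IH by (simp only: comp_assoc)
  qed
  then show ?thesis using F by (simp add: schur_alg_def)
qed

definition proper :: "biword \<Rightarrow> bool" where
  "proper u \<longleftrightarrow> length u = d \<and> set u \<subseteq> {..<m + n} \<times> {..<m + n}"

lemma proper_words: "proper u \<Longrightarrow> map fst u \<in> Wd" "proper u \<Longrightarrow> map snd u \<in> Wd"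
  by (auto simp: proper_def words_def)

lemma proper_zip: "v \<in> Wd \<Longrightarrow> w \<in> Wd \<Longrightarrow> proper (zip v w)"
  by (auto simp: proper_def words_def dest: set_zip_leftD set_zip_rightD)

text \<open>Matrix coefficients with the rows and columns zipped into one biword. The factor
  \<open>gam\<close> converts invariance under the symmetric group into supersymmetry, and the value
  0 off proper words extends the exchange law to all words.\<close>

definition Nf :: "(tens \<Rightarrow> tens) \<Rightarrow> biword \<Rightarrow> complex" where
  "Nf \<eta> u = (if proper u then gam m u * \<eta> (delta (map snd u)) (map fst u) else 0)"

lemma sgk_map: "length xs = k \<Longrightarrow> sgk k (xs @ x # y # zs) = (-1) ^ (par x * par y)"
  by (simp add: sgk_def nth_append)

text \<open>The signs of the row word and of the column word combine with the change of
  \<open>gam\<close> to the sign for exchanging two matrix units, by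
  \<open>opair_sign\<close>.\<close>

lemma supersym_Nf:
  assumes \<eta>: "\<eta> \<in> S"
  shows "supersym (opair m) (Nf \<eta>)"
  unfolding supersym_def
proof (intro allI)
  fix xs zs :: biword and x y
  let ?u = "xs @ x # y # zs" and ?u' = "xs @ y # x # zs"
  let ?k = "length xs"
  have p: "proper ?u \<longleftrightarrow> proper ?u'" by (auto simp: proper_def)
  show "Nf \<eta> ?u = (if opair m x \<and> opair m y then -1 else 1) * Nf \<eta> ?u'"
  proof (cases "proper ?u'")
    case True
    then have k: "Suc ?k < d" by (auto simp: proper_def)
    have f: "map fst ?u = swapw ?k (map fst ?u')" "map snd ?u = swapw ?k (map snd ?u')"
      by (simp_all add: swapw_append)
    have s: "sgk ?k (map fst ?u') = (-1) ^ (par (fst y) * par (fst x))"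
      "sgk ?k (map snd ?u') = (-1) ^ (par (snd y) * par (snd x))"
      by (simp_all add: sgk_map)
    let ?E = "\<eta> (delta (map snd ?u')) (map fst ?u')"
    have E: "\<eta> (delta (map snd ?u)) (map fst ?u) =
        sgk ?k (map fst ?u') * sgk ?k (map snd ?u') * ?E"
      unfolding f by (rule schur_matrix[OF \<eta> k proper_words[OF True]])
    have "Nf \<eta> ?u = gam m ?u * \<eta> (delta (map snd ?u)) (map fst ?u)"
      using True p by (simp only: Nf_def if_True)
    also have "\<dots> = ((-1) ^ (par (fst y) * par (fst x) + par (snd y) * par (snd x)) *
        (-1) ^ (par (snd x) * par (fst y) + par (snd y) * par (fst x))) * (gam m ?u' * ?E)"
      unfolding E s gam_swap[of m xs x y zs] power_add by (simp only: mult.assoc mult.left_commute)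
    also have "gam m ?u' * ?E = Nf \<eta> ?u'"
      using True by (simp only: Nf_def if_True)
    finally have "Nf \<eta> ?u = ((-1) ^ (par (fst x) * par (fst y) + par (snd x) * par (snd y)) *
        (-1) ^ (par (snd x) * par (fst y) + par (snd y) * par (fst x))) * Nf \<eta> ?u'"
      by (simp only: mult.commute[of "par (fst x)" "par (fst y)"] mult.commute[of "par (snd x)" "par (snd y)"])
    then show ?thesis unfolding opair_sign .
  next
    case False
    then show ?thesis using p by (simp add: Nf_def)
  qed
qed

lemma schur_eqI:
  assumes "\<eta> \<in> S" "\<eta>' \<in> S" and N: "\<And>u. proper u \<Longrightarrow> Nf \<eta> u = Nf \<eta>' u"
  shows "\<eta> = \<eta>'"
proof (rule lin_ext[OF schur_lin[OF assms(1)] schur_lin[OF assms(2)]])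
  fix w assume w: "w \<in> Wd"
  show "\<eta> (delta w) = \<eta>' (delta w)"
  proof
    fix v show "\<eta> (delta w) v = \<eta>' (delta w) v"
    proof (cases "v \<in> Wd")
      case True
      let ?u = "zip v w"
      have u: "proper ?u" by (rule proper_zip[OF True w])
      have l: "length v = length w" using True w by (simp add: words_def)
      have "gam m ?u * \<eta> (delta w) v = gam m ?u * \<eta>' (delta w) v"
        using N[OF u] u l by (simp add: Nf_def)
      then have "gam m ?u * gam m ?u * \<eta> (delta w) v = gam m ?u * gam m ?u * \<eta>' (delta w) v"
        by (simp only: mult.assoc)
      then show ?thesis by (simp add: gam_sq)
    next
      case False
      then show ?thesis
        using T_zero[OF lin_mapsD(3)[OF schur_lin[OF assms(1)] delta_T[OF w]] False]
          T_zero[OF lin_mapsD(3)[OF schur_lin[OF assms(2)] delta_T[OF w]] False] by simp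
    qed
  qed
qed

text \<open>Inverse of \<open>Nf\<close>. The same factor appears again because \<open>gam\<close>
  squares to 1.\<close>

definition Op :: "(biword \<Rightarrow> complex) \<Rightarrow> tens \<Rightarrow> tens" where
  "Op f = on_basis m n d (\<lambda>w v. if v \<in> Wd then gam m (zip v w) * f (zip v w) else 0)"

lemma Op_delta: "w \<in> Wd \<Longrightarrow> v \<in> Wd \<Longrightarrow> Op f (delta w) v = gam m (zip v w) * f (zip v w)"
  unfolding Op_def by (simp add: on_basis_delta)

lemma Op_lin: "Op f \<in> lin_maps T T"
  unfolding Op_def by (rule on_basis_lin) (simp add: tpow_def)

lemma Nf_Op: "proper u \<Longrightarrow> Nf (Op f) u = f u"
  using proper_words[of u] gam_sq[of m u] by (simp add: Nf_def Op_delta zip_map_fst_snd flip: mult.assoc)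

lemma Op_schur:
  assumes f: "supersym (opair m) f"
  shows "Op f \<in> S"
proof (rule schur_algI[OF Op_lin])
  fix k v w assume k: "Suc k < d" and v: "v \<in> Wd" and w: "w \<in> Wd"
  let ?u = "zip v w"
  have len: "length v = d" "length w = d" using v w by (simp_all add: words_def)
  then have "Suc k < length ?u" using k by simp
  then obtain xs x y zs where e: "?u = xs @ x # y # zs" "length xs = k" by (rule split_at)
  have vw: "v = map fst xs @ fst x # fst y # map fst zs" "w = map snd xs @ snd x # snd y # map snd zs"
    using map_fst_zip[of v w] map_snd_zip[of v w] len unfolding e(1) by simp_all
  have sv: "swapw k v = map fst xs @ fst y # fst x # map fst zs" "swapw k w = map snd xs @ snd y # snd x # map snd zs"
    unfolding vw by (rule swapw_append, simp add: e(2))+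
  have z: "zip (swapw k v) (swapw k w) = xs @ y # x # zs"
    unfolding sv by (simp add: zip_map_fst_snd zip_append)
  have s: "sgk k v = (-1) ^ (par (fst x) * par (fst y))" "sgk k w = (-1) ^ (par (snd x) * par (snd y))"
    unfolding vw by (rule sgk_map, simp add: e(2))+
  have "Op f (delta (swapw k w)) (swapw k v) = gam m (xs @ y # x # zs) * f (xs @ y # x # zs)"
    using Op_delta[OF swapw_facts(1)[OF k w] swapw_facts(1)[OF k v], of f] unfolding z .
  also have "\<dots> = (-1) ^ (par (snd y) * par (fst x) + par (snd x) * par (fst y)) *
      (if opair m y \<and> opair m x then -1 else 1) * (gam m ?u * f ?u)"
    unfolding gam_swap[of m xs y x zs] supersymD[OF f, of xs y x zs] e(1) by (simp only: ac_simps)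
  also have "(-1) ^ (par (snd y) * par (fst x) + par (snd x) * par (fst y)) *
      (if opair m y \<and> opair m x then -1 else 1) = sgk k v * sgk k w"
    unfolding s opair_sign[of m y x, symmetric] by (simp add: idx_parity_def)
  finally show "Op f (delta (swapw k w)) (swapw k v) = sgk k v * sgk k w * Op f (delta w) v"
    unfolding Op_delta[OF w v] .
qed

lemma subspace_S: "cv.subspace S"
proof (rule cv.subspaceI)
  show "0 \<in> S" by (rule schur_algI) (simp_all add: cv.subspace_0[OF subspace_lin_maps[OF subspace_T]])
  show "F + G \<in> S" if "F \<in> S" "G \<in> S" for F G
    by (rule schur_algI)
       (simp_all add: cv.subspace_add[OF subspace_lin_maps[OF subspace_T]] schur_lin that
         schur_matrix[OF that(1)] schur_matrix[OF that(2)] distrib_left)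
  show "a *\<^sub>C F \<in> S" if "F \<in> S" for a F
    by (rule schur_algI)
       (simp_all add: cv.subspace_scale[OF subspace_lin_maps[OF subspace_T]] schur_lin that
         schur_matrix[OF that] mult.left_commute)
qed

lemma Nf_sum: "Nf (\<Sum>i\<in>I. c i *\<^sub>C F i) u = (\<Sum>i\<in>I. c i * Nf (F i) u)"
  by (simp add: Nf_def sum_fun_apply sum_distrib_left mult.left_commute)

end

section \<open>Parity components and parity preserving permutations\<close>

lemma vec_part_add: "vec_part m b (u + v) = vec_part m b u + vec_part m b v"
  by (auto simp: vec_part_def fun_eq_iff)

lemma vec_part_scale: "vec_part m b (c *\<^sub>C v) = c *\<^sub>C vec_part m b v"
  by (auto simp: vec_part_def fun_eq_iff)

lemma vec_part_zero: "vec_part m b 0 = 0"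
  by (auto simp: vec_part_def fun_eq_iff)

lemma permutes_idx_perm:
  assumes \<tau>: "\<tau> permutes {..<m}" and \<sigma>: "\<sigma> permutes {..<n}"
  shows "idx_perm m \<tau> \<sigma> permutes {..<m + n}"
proof (rule bij_imp_permutes)
  show "idx_perm m \<tau> \<sigma> x = x" if "x \<notin> {..<m + n}" for x
    using that permutes_ge[OF \<sigma>, of "x - m"] by (simp add: idx_perm_def)
  have lt: "\<tau> i < m \<longleftrightarrow> i < m" "\<sigma> j < n \<longleftrightarrow> j < n" for i j
    by (rule permutes_lessThan[OF \<tau>], rule permutes_lessThan[OF \<sigma>])
  show "bij_betw (idx_perm m \<tau> \<sigma>) {..<m + n} {..<m + n}"
  proof (rule bij_betw_byWitness[where f' = "idx_perm m (inv \<tau>) (inv \<sigma>)"])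
    have lt': "inv \<tau> i < m \<longleftrightarrow> i < m" "inv \<sigma> j < n \<longleftrightarrow> j < n" for i j
      by (rule permutes_lessThan[OF permutes_inv[OF \<tau>]], rule permutes_lessThan[OF permutes_inv[OF \<sigma>]])
    show "\<forall>a\<in>{..<m + n}. idx_perm m (inv \<tau>) (inv \<sigma>) (idx_perm m \<tau> \<sigma> a) = a"
      by (auto simp: idx_perm_def lt permutes_inverses[OF \<tau>] permutes_inverses[OF \<sigma>])
    show "\<forall>a\<in>{..<m + n}. idx_perm m \<tau> \<sigma> (idx_perm m (inv \<tau>) (inv \<sigma>) a) = a"
      by (auto simp: idx_perm_def lt' permutes_inverses[OF \<tau>] permutes_inverses[OF \<sigma>])
    show "idx_perm m \<tau> \<sigma> ` {..<m + n} \<subseteq> {..<m + n}"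
    proof (rule image_subsetI)
      fix i assume "i \<in> {..<m + n}"
      then show "idx_perm m \<tau> \<sigma> i \<in> {..<m + n}"
        using lt(1)[of i] lt(2)[of "i - m"] by (cases "i < m") (simp_all add: idx_perm_def)
    qed
    show "idx_perm m (inv \<tau>) (inv \<sigma>) ` {..<m + n} \<subseteq> {..<m + n}"
    proof (rule image_subsetI)
      fix i assume "i \<in> {..<m + n}"
      then show "idx_perm m (inv \<tau>) (inv \<sigma>) i \<in> {..<m + n}"
        using lt'(1)[of i] lt'(2)[of "i - m"] by (cases "i < m") (simp_all add: idx_perm_def)
    qed
  qed
qed

lemma idx_perm_less: "\<tau> permutes {..<m} \<Longrightarrow> idx_perm m \<tau> \<sigma> i < m \<longleftrightarrow> i < m"
  by (simp add: idx_perm_def permutes_lessThan)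

lemma idx_perm_comp:
  assumes "\<tau>' permutes {..<m}"
  shows "idx_perm m (\<tau> \<circ> \<tau>') (\<sigma> \<circ> \<sigma>') = idx_perm m \<tau> \<sigma> \<circ> idx_perm m \<tau>' \<sigma>'"
  using permutes_lessThan[OF assms] by (auto simp: fun_eq_iff idx_perm_def)

context super_words
begin

abbreviation "od \<equiv> opair m"

abbreviation "wpar w \<equiv> (\<Sum>i\<leftarrow>w. par i) mod 2"

lemma end_part_T:
  "v \<in> T \<Longrightarrow> end_part m n d a \<eta> v = vec_part m (a mod 2) (\<eta> (vec_part m 0 v)) + vec_part m ((a + 1) mod 2) (\<eta> (vec_part m 1 v))"
  unfolding end_part_def by simp

lemma end_part_lin:
  assumes \<eta>: "\<eta> \<in> lin_maps T T"
  shows "end_part m n d a \<eta> \<in> lin_maps T T"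
proof (rule lin_mapsI)
  fix u v assume u: "u \<in> T" and v: "v \<in> T"
  have "u + v \<in> T" by (rule cv.subspace_add[OF subspace_T u v])
  then show "end_part m n d a \<eta> (u + v) = end_part m n d a \<eta> u + end_part m n d a \<eta> v"
    unfolding end_part_T[OF u] end_part_T[OF v] end_part_T[OF \<open>u + v \<in> T\<close>] vec_part_add
      lin_mapsD(1)[OF \<eta> vec_part_in[OF u] vec_part_in[OF v]] by (simp only: add_ac)
next
  fix c v assume v: "v \<in> T"
  have cv: "c *\<^sub>C v \<in> T" by (rule cv.subspace_scale[OF subspace_T v])
  show "end_part m n d a \<eta> (c *\<^sub>C v) = c *\<^sub>C end_part m n d a \<eta> v"
    unfolding end_part_T[OF v] end_part_T[OF cv] vec_part_scale lin_mapsD(2)[OF \<eta> vec_part_in[OF v]]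
    by (simp only: scaleC_add_right)
next
  fix v assume v: "v \<in> T"
  show "end_part m n d a \<eta> v \<in> T"
    unfolding end_part_T[OF v]
    by (intro cv.subspace_add[OF subspace_T] vec_part_in lin_mapsD(3)[OF \<eta>] v)
next
  fix v assume "v \<notin> T"
  then show "end_part m n d a \<eta> v = 0" by (simp only: end_part_def if_False)
qed

lemma end_part_delta:
  assumes \<eta>: "\<eta> \<in> lin_maps T T" and w: "w \<in> Wd"
  shows "end_part m n d a \<eta> (delta w) v = (if wpar v = (a + wpar w) mod 2 then \<eta> (delta w) v else 0)"
proof -
  have vd: "vec_part m b (delta w) = (if wpar w = b then delta w else 0)" for b
    by (auto simp: vec_part_def delta_def fun_eq_iff)
  have "wpar w = 0 \<or> wpar w = 1" by auto
  then show ?thesis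
  proof
    assume p: "wpar w = 0"
    have "end_part m n d a \<eta> (delta w) = vec_part m (a mod 2) (\<eta> (delta w))"
      unfolding end_part_T[OF delta_T[OF w]] vd p using vec_part_zero lin_maps_zero[OF \<eta>] by simp
    then show ?thesis unfolding p by (simp add: vec_part_def)
  next
    assume p: "wpar w = 1"
    have "end_part m n d a \<eta> (delta w) = vec_part m ((a + 1) mod 2) (\<eta> (delta w))"
      unfolding end_part_T[OF delta_T[OF w]] vd p using vec_part_zero lin_maps_zero[OF \<eta>] by simp
    then show ?thesis unfolding p by (simp add: vec_part_def)
  qed
qed

lemma wpar_swapw:
  assumes "Suc k < d" "w \<in> Wd"
  shows "wpar (swapw k w) = wpar w"
proof -
  have "sum_mset (mset (map par (swapw k w))) = sum_mset (mset (map par w))"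
    unfolding mset_map swapw_facts(4)[OF assms] ..
  then show ?thesis by (simp only: sum_mset_sum_list)
qed

lemma end_part_schur:
  assumes \<eta>: "\<eta> \<in> S"
  shows "end_part m n d a \<eta> \<in> S"
proof (rule schur_algI[OF end_part_lin[OF schur_lin[OF \<eta>]]])
  fix k v w assume k: "Suc k < d" and v: "v \<in> Wd" and w: "w \<in> Wd"
  show "end_part m n d a \<eta> (delta (swapw k w)) (swapw k v) = sgk k v * sgk k w * end_part m n d a \<eta> (delta w) v"
    unfolding end_part_delta[OF schur_lin[OF \<eta>] w] end_part_delta[OF schur_lin[OF \<eta>] swapw_facts(1)[OF k w]]
      wpar_swapw[OF k v] wpar_swapw[OF k w] schur_matrix[OF \<eta> k v w] by simp
qed

lemma end_part_sum:
  assumes \<eta>: "\<eta> \<in> lin_maps T T"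
  shows "end_part m n d 0 \<eta> + end_part m n d 1 \<eta> = \<eta>"
proof (rule lin_ext[OF _ \<eta>])
  show "end_part m n d 0 \<eta> + end_part m n d 1 \<eta> \<in> lin_maps T T"
    by (intro cv.subspace_add[OF subspace_lin_maps[OF subspace_T]] end_part_lin \<eta>)
  fix w assume w: "w \<in> Wd"
  show "(end_part m n d 0 \<eta> + end_part m n d 1 \<eta>) (delta w) = \<eta> (delta w)"
  proof
    fix v
    have "wpar v = (1 + wpar w) mod 2 \<longleftrightarrow> \<not> wpar v = (0 + wpar w) mod 2"
      by presburger
    then show "(end_part m n d 0 \<eta> + end_part m n d 1 \<eta>) (delta w) v = \<eta> (delta w) v"
      unfolding plus_fun_apply end_part_delta[OF \<eta> w] by simp
  qed
qed

end

section \<open>Elements of the Schur superalgebra composed with a weight projection\<close>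

locale super_weight = super_words +
  fixes \<kappa> :: "nat multiset"
  assumes size: "size \<kappa> = d"
begin

definition "W = weight_proj m n d \<kappa>"

lemma W_delta: "w \<in> Wd \<Longrightarrow> W (delta w) = (if mset w = \<kappa> then delta w else 0)"
  unfolding W_def weight_proj_def by (rule on_basis_delta)

lemma W_schur: "W \<in> S"
proof (rule schur_algI)
  show "W \<in> lin_maps T T"
    unfolding W_def weight_proj_def
    by (rule on_basis_lin) (use delta_T cv.subspace_0[OF subspace_T] in auto)
  fix k v w assume k: "Suc k < d" and v: "v \<in> Wd" and w: "w \<in> Wd"
  have "delta (swapw k w) (swapw k v) = sgk k v * sgk k w * delta w v"
    using swapw_inj[OF k v w] sgk_sq[of k v] by (auto simp: delta_def)
  then show "W (delta (swapw k w)) (swapw k v) = sgk k v * sgk k w * W (delta w) v"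
    unfolding W_delta[OF w] W_delta[OF swapw_facts(1)[OF k w]] swapw_facts(4)[OF k w] by simp
qed

lemma W_even: "end_homogeneous m n d 0 W"
  unfolding end_homogeneous_def
proof (intro ballI impI)
  fix b v assume b: "b \<in> {0, 1 :: nat}" and v: "v \<in> T" "vec_part m b v = v"
  have Wv: "W v w = (if mset w = \<kappa> \<and> w \<in> Wd then v w else 0)" for w
  proof -
    have "W v w = (\<Sum>w'\<in>Wd. v w' * (if mset w' = \<kappa> then delta w' else 0) w)"
      unfolding W_def weight_proj_def by (rule on_basis_apply[OF v(1)])
    also have "\<dots> = (\<Sum>w'\<in>Wd. if w' = w then (if mset w = \<kappa> then v w else 0) else 0)"
      by (rule sum.cong[OF refl]) (auto simp: delta_def)
    also have "\<dots> = (if mset w = \<kappa> \<and> w \<in> Wd then v w else 0)"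
      using finite_words by (simp add: sum.delta)
    finally show ?thesis .
  qed
  have b0: "(0 + b) mod 2 = b" using b by auto
  show "vec_part m ((0 + b) mod 2) (W v) = W v"
    unfolding b0
  proof
    fix w
    have "vec_part m b v w = v w" by (rule fun_cong[OF v(2)])
    then have "v w = 0" if "wpar w \<noteq> b" using that by (simp add: vec_part_def)
    then show "vec_part m b (W v) w = W v w"
      unfolding vec_part_def by (simp add: Wv)
  qed
qed

text \<open>As \<open>W\<close> is even, only the terms with trivial sign survive, and the sums over
  the parity components of \<open>f\<close> and of \<open>\<eta>\<close> reassemble these
  maps.\<close>

lemma sInd_act_W:
  fixes f :: "(tens \<Rightarrow> tens) \<Rightarrow> 'u::cvec"
  assumes f: "f \<in> lin_maps S U" and \<eta>: "\<eta> \<in> S"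
  shows "sInd_act m n d W f \<eta> = f (\<eta> \<circ> W)"
proof -
  have W0: "end_part m n d 0 W = W" and W1: "end_part m n d 1 W = 0"
    using end_part_homogeneous[OF schur_lin[OF W_schur] W_even] by simp_all
  have lin\<eta>: "\<eta> \<in> lin_maps T T" by (rule schur_lin[OF \<eta>])
  note e\<eta> = end_part_schur[OF \<eta>]
  have comp: "\<zeta> \<circ> W \<in> S" if "\<zeta> \<in> S" for \<zeta> by (rule schur_alg_comp[OF that W_schur])
  have hp: "hom_part m n d 0 f \<zeta> + hom_part m n d 1 f \<zeta> = f \<zeta>" if \<zeta>: "\<zeta> \<in> S" for \<zeta>
  proof -
    have "f (end_part m n d 0 \<zeta> + end_part m n d 1 \<zeta>) = f (end_part m n d 0 \<zeta>) + f (end_part m n d 1 \<zeta>)"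
      by (rule lin_mapsD(1)[OF f end_part_schur[OF \<zeta>] end_part_schur[OF \<zeta>]])
    then show ?thesis
      unfolding end_part_sum[OF schur_lin[OF \<zeta>]] hom_part_def using \<zeta> by simp
  qed
  have z: "hom_part m n d b f (end_part m n d c \<eta> \<circ> 0) = 0" for b c
  proof -
    have "end_part m n d c \<eta> \<circ> 0 = (0 :: tens \<Rightarrow> tens)"
      using lin_maps_zero[OF schur_lin[OF e\<eta>[of c]]] by (intro ext) (simp only: comp_apply zero_fun_apply)
    moreover have "end_part m n d b (0 :: tens \<Rightarrow> tens) = 0"
      by (auto simp: end_part_def vec_part_def fun_eq_iff)
    ultimately show ?thesis using lin_maps_zero[OF f] by (simp add: hom_part_def)
  qed
  have "sInd_act m n d W f \<eta> = (\<Sum>b\<in>{0, 1}. \<Sum>c\<in>{0, 1}. hom_part m n d b f (end_part m n d c \<eta> \<circ> W))"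
    unfolding sInd_act_def using \<eta> W0 W1 z by (simp add: scaleC_one)
  also have "\<dots> = f (end_part m n d 0 \<eta> \<circ> W) + f (end_part m n d 1 \<eta> \<circ> W)"
    using hp[OF comp[OF e\<eta>[of 0]]] hp[OF comp[OF e\<eta>[of 1]]] by (simp add: add_ac)
  also have "\<dots> = f ((end_part m n d 0 \<eta> \<circ> W) + (end_part m n d 1 \<eta> \<circ> W))"
    by (rule lin_mapsD(1)[OF f comp[OF e\<eta>[of 0]] comp[OF e\<eta>[of 1]], symmetric])
  also have "(end_part m n d 0 \<eta> \<circ> W) + (end_part m n d 1 \<eta> \<circ> W) = (end_part m n d 0 \<eta> + end_part m n d 1 \<eta>) \<circ> W"
    by (simp add: fun_eq_iff)
  finally show ?thesis unfolding end_part_sum[OF lin\<eta>] .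
qed

text \<open>Rows are indexed by basis vectors, and the total of the rows prescribes the column sums.
  The row condition is phrased by \<open>admissible\<close> so that it is literally the support of
  the coefficients of H for even rows and of E for odd rows.\<close>

definition Qk :: "(nat \<Rightarrow> nat multiset) set" where
  "Qk = {\<beta> \<in> splits {..<m + n} \<kappa>. \<forall>b<m + n. admissible m n (if b < m then (\<lambda>j. m \<le> j) else (\<lambda>j. j < m)) (\<beta> b)}"

lemma finite_Qk: "finite Qk"
  unfolding Qk_def by (rule finite_subset[OF _ finite_splits_fun[of "{..<m + n}" \<kappa>]]) auto

lemma opair_iff: "od (b, a) \<longleftrightarrow> (if b < m then m \<le> a else a < m)"
  by (auto simp: opair_def idx_parity_def)

lemma rows_Qk:
  assumes u: "proper u"
  shows "rows u \<in> Qk \<longleftrightarrow> mset (map snd u) = \<kappa> \<and> (\<forall>x. od x \<longrightarrow> count (mset u) x \<le> 1)"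
proof -
  have fst: "set (map fst u) \<subseteq> {..<m + n}" using u by (auto simp: proper_def)
  have out: "rows u b = {#}" if "b \<notin> {..<m + n}" for b
    using fst that by (auto simp: rows_def filter_mset_eq_conv simp flip: set_mset_eq_empty_iff)
  have "rows u \<in> splits {..<m + n} \<kappa> \<longleftrightarrow> mset (map snd u) = \<kappa>"
    unfolding splits_def using out sum_rows[OF fst] by simp
  moreover have "(\<forall>b<m + n. admissible m n (if b < m then (\<lambda>j. m \<le> j) else (\<lambda>j. j < m)) (rows u b)) \<longleftrightarrow>
      (\<forall>x. od x \<longrightarrow> count (mset u) x \<le> 1)"
  proof
    assume L: "\<forall>b<m + n. admissible m n (if b < m then (\<lambda>j. m \<le> j) else (\<lambda>j. j < m)) (rows u b)"
    show "\<forall>x. od x \<longrightarrow> count (mset u) x \<le> 1"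
    proof (intro allI impI)
      fix x assume x: "od x"
      obtain b a where ba: "x = (b, a)" by (cases x)
      show "count (mset u) x \<le> 1"
      proof (cases "b < m + n")
        case True
        then show ?thesis using L x unfolding ba count_rows[symmetric] opair_iff admissible_def
          by (auto split: if_splits)
      next
        case False
        then show ?thesis using out[of b] unfolding ba count_rows[symmetric] by simp
      qed
    qed
  next
    assume R: "\<forall>x. od x \<longrightarrow> count (mset u) x \<le> 1"
    show "\<forall>b<m + n. admissible m n (if b < m then (\<lambda>j. m \<le> j) else (\<lambda>j. j < m)) (rows u b)"
    proof (intro allI impI)
      fix b assume "b < m + n"
      have "set_mset (rows u b) \<subseteq> {..<m + n}" using u by (auto simp: rows_def proper_def)
      moreover have "count (rows u b) j \<le> 1" if "od (b, j)" for j
        using R that unfolding count_rows by blast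
      ultimately show "admissible m n (if b < m then (\<lambda>j. m \<le> j) else (\<lambda>j. j < m)) (rows u b)"
        unfolding admissible_def using opair_iff[of b] by auto
    qed
  qed
  ultimately show ?thesis by (simp add: Qk_def)
qed

text \<open>The row conditions bound the letters, and the column sums force the length to be
  \<open>size \<kappa>\<close>, which is \<open>d\<close>.\<close>

lemma rows_proper:
  assumes "rows u \<in> Qk"
  shows "proper u"
proof -
  have lt: "b < m + n \<and> a < m + n" if "(b, a) \<in> set u" for a b
  proof -
    have a: "a \<in># rows u b" using that by (force simp: rows_def)
    then have "b < m + n" using assms by (cases "b < m + n") (auto simp: Qk_def splits_def)
    moreover from this have "set_mset (rows u b) \<subseteq> {..<m + n}" using assms by (auto simp: Qk_def admissible_def)
    ultimately show ?thesis using a by auto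
  qed
  then have "set (map fst u) \<subseteq> {..<m + n}" by auto
  then have "mset (map snd u) = \<kappa>"
    using sum_rows[of u "m + n"] assms by (simp add: Qk_def splits_def)
  then have "length u = d" using size by (metis length_map size_mset)
  then show ?thesis using lt by (auto simp: proper_def)
qed

text \<open>A reference word for each matrix. Coordinates and signs are normalised against its
  \<open>osgn\<close>.\<close>

definition cw :: "(nat \<Rightarrow> nat multiset) \<Rightarrow> biword" where
  "cw \<beta> = (SOME u. rows u = \<beta>)"

lemma rows_cw: "\<beta> \<in> Qk \<Longrightarrow> rows (cw \<beta>) = \<beta>"
  unfolding cw_def by (rule someI_ex[OF rows_surj[of "m + n"]]) (simp add: Qk_def splits_def)

lemma adm_rows:
  assumes "rows u \<in> Qk"
  shows "\<forall>x. od x \<longrightarrow> count (mset u) x \<le> 1"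
  using assms rows_Qk[OF rows_proper[OF assms]] by simp

lemma osgn_sq_Qk: "rows u \<in> Qk \<Longrightarrow> osgn od u * osgn od u = 1"
  unfolding osgn_sq using adm_rows by simp

text \<open>The signed sum of the matrix units whose biword has matrix \<open>\<beta>\<close>: a
  standard basis element of the Schur superalgebra.\<close>

definition Nop :: "(nat \<Rightarrow> nat multiset) \<Rightarrow> tens \<Rightarrow> tens" where
  "Nop \<beta> = Op (\<lambda>u. osgn od u * of_bool (rows u = \<beta>))"

lemma Nop_schur: "Nop \<beta> \<in> S"
  unfolding Nop_def
proof (rule Op_schur, unfold supersym_def, intro allI)
  fix xs zs :: biword and x y
  have "rows (xs @ x # y # zs) = rows (xs @ y # x # zs)" by (simp add: rows_eq_iff)
  then show "osgn od (xs @ x # y # zs) * of_bool (rows (xs @ x # y # zs) = \<beta>) =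
      (if od x \<and> od y then -1 else 1) * (osgn od (xs @ y # x # zs) * of_bool (rows (xs @ y # x # zs) = \<beta>))"
    unfolding supersymD[OF supersym_osgn, of od xs x y zs] by (simp only: mult.assoc)
qed

lemma Nf_Nop: "proper u \<Longrightarrow> Nf (Nop \<beta>) u = osgn od u * of_bool (rows u = \<beta>)"
  unfolding Nop_def by (rule Nf_Op)

definition coef :: "(tens \<Rightarrow> tens) \<Rightarrow> (nat \<Rightarrow> nat multiset) \<Rightarrow> complex" where
  "coef \<eta> \<beta> = osgn od (cw \<beta>) * Nf \<eta> (cw \<beta>)"

lemma Nf_coef:
  assumes \<eta>: "\<eta> \<in> S" and u: "rows u \<in> Qk"
  shows "Nf \<eta> u = osgn od u * coef \<eta> (rows u)"
  unfolding coef_def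
  by (rule supersym_osgn_mset[OF supersym_Nf[OF \<eta>] _ adm_rows[OF u]])
     (simp add: rows_cw[OF u] flip: rows_eq_iff)

lemma coef_add: "coef (\<eta> + \<eta>') \<beta> = coef \<eta> \<beta> + coef \<eta>' \<beta>"
  by (simp add: coef_def Nf_def distrib_left)

lemma coef_scale: "coef (c *\<^sub>C \<eta>) \<beta> = c * coef \<eta> \<beta>"
  by (simp add: coef_def Nf_def mult.left_commute)

lemma coef_Nop:
  assumes "\<beta> \<in> Qk"
  shows "coef (Nop \<beta>') \<beta> = of_bool (\<beta> = \<beta>')"
proof -
  have r: "rows (cw \<beta>) = \<beta>" by (rule rows_cw[OF assms])
  have p: "proper (cw \<beta>)" by (rule rows_proper) (simp only: r assms)
  have "osgn od (cw \<beta>) * osgn od (cw \<beta>) = 1" by (rule osgn_sq_Qk) (simp only: r assms)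
  then show ?thesis unfolding coef_def Nf_Nop[OF p] r by (simp flip: mult.assoc)
qed

lemma Nf_comp_W:
  assumes \<eta>: "\<eta> \<in> S" and u: "proper u"
  shows "Nf (\<eta> \<circ> W) u = (if mset (map snd u) = \<kappa> then Nf \<eta> u else 0)"
  using lin_maps_zero[OF schur_lin[OF \<eta>]] u
  by (simp add: Nf_def W_delta[OF proper_words(2)[OF u]])

lemma coef_comp_W:
  assumes \<eta>: "\<eta> \<in> S" and \<beta>: "\<beta> \<in> Qk"
  shows "coef (\<eta> \<circ> W) \<beta> = coef \<eta> \<beta>"
proof -
  have r: "rows (cw \<beta>) \<in> Qk" using rows_cw[OF \<beta>] \<beta> by simp
  have p: "proper (cw \<beta>)" by (rule rows_proper[OF r])
  show ?thesis unfolding coef_def Nf_comp_W[OF \<eta> p] using r rows_Qk[OF p] by simp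
qed

text \<open>It suffices to compare normalised coefficients on proper words. If the column word has
  another weight, \<open>W\<close> kills it; if an odd letter is repeated, supersymmetry does;
  otherwise the coefficient is \<open>osgn\<close> times the coordinate.\<close>

lemma comp_W_expand:
  assumes \<eta>: "\<eta> \<in> S"
  shows "\<eta> \<circ> W = (\<Sum>\<beta>\<in>Qk. coef \<eta> \<beta> *\<^sub>C Nop \<beta>)"
proof (rule schur_eqI)
  show "\<eta> \<circ> W \<in> S" by (rule schur_alg_comp[OF \<eta> W_schur])
  show "(\<Sum>\<beta>\<in>Qk. coef \<eta> \<beta> *\<^sub>C Nop \<beta>) \<in> S"
    by (intro cv.subspace_sum[OF subspace_S] cv.subspace_scale[OF subspace_S] Nop_schur)
  fix u assume u: "proper u"
  have "Nf (\<Sum>\<beta>\<in>Qk. coef \<eta> \<beta> *\<^sub>C Nop \<beta>) u = (\<Sum>\<beta>\<in>Qk. if \<beta> = rows u then osgn od u * coef \<eta> (rows u) else 0)"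
    unfolding Nf_sum Nf_Nop[OF u] by (rule sum.cong[OF refl]) auto
  also have "\<dots> = (if rows u \<in> Qk then osgn od u * coef \<eta> (rows u) else 0)"
    using finite_Qk by (simp add: sum.delta)
  also have "\<dots> = Nf (\<eta> \<circ> W) u"
  proof (cases "rows u \<in> Qk")
    case True
    then show ?thesis unfolding Nf_comp_W[OF \<eta> u] using rows_Qk[OF u] Nf_coef[OF \<eta> True] by simp
  next
    case False
    show ?thesis
    proof (cases "mset (map snd u) = \<kappa>")
      case True
      then obtain x where "od x" "count (mset u) x > 1"
        using False rows_Qk[OF u] by (auto simp: not_le)
      then have "Nf \<eta> u = 0" by (rule supersym_repeated[OF supersym_Nf[OF \<eta>]])
      then show ?thesis unfolding Nf_comp_W[OF \<eta> u] using False by simp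
    next
      case False': False
      then show ?thesis unfolding Nf_comp_W[OF \<eta> u] using False by simp
    qed
  qed
  finally show "Nf (\<eta> \<circ> W) u = Nf (\<Sum>\<beta>\<in>Qk. coef \<eta> \<beta> *\<^sub>C Nop \<beta>) u" by simp
qed

definition pm :: "(nat \<Rightarrow> nat) \<Rightarrow> nat \<times> nat \<Rightarrow> nat \<times> nat" where
  "pm g = (\<lambda>x. (g (fst x), snd x))"

text \<open>The permutations of basis indices that preserve parity; those of the form
  \<open>idx_perm m \<tau> \<sigma>\<close> are the ones to which this is applied.\<close>

definition gperm :: "(nat \<Rightarrow> nat) \<Rightarrow> bool" where
  "gperm g \<longleftrightarrow> g permutes {..<m + n} \<and> (\<forall>b. g b < m \<longleftrightarrow> b < m)"

text \<open>The sign with which \<open>g\<close> sends the basis element of \<open>\<beta>\<close>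
  to that of \<open>\<beta> \<circ> inv g\<close>: it compares the sorting signs of a word before
  and after relabelling its rows.\<close>

definition eps :: "(nat \<Rightarrow> nat) \<Rightarrow> (nat \<Rightarrow> nat multiset) \<Rightarrow> complex" where
  "eps g \<beta> = osgn od (cw \<beta>) * osgn od (map (pm g) (cw \<beta>))"

lemma gperm_inv:
  assumes "gperm g"
  shows "gperm (inv g)"
proof -
  have g: "g permutes {..<m + n}" and l: "\<And>b. g b < m \<longleftrightarrow> b < m"
    using assms by (simp_all add: gperm_def)
  have "inv g b < m \<longleftrightarrow> b < m" for b
    using l[of "inv g b"] permutes_inverses(1)[OF g, of b] by simp
  then show ?thesis using permutes_inv[OF g] by (simp add: gperm_def)
qed

lemma gperm_bij: "gperm g \<Longrightarrow> bij g"
  unfolding gperm_def by (blast intro: permutes_bij)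

lemma opair_pm: "gperm g \<Longrightarrow> od (pm g x) = od x"
  by (simp add: opair_def pm_def idx_parity_def gperm_def)

lemma gam_pm: "gperm g \<Longrightarrow> gam m (map (pm g) u) = gam m u"
  by (rule gam_map) (simp_all add: pm_def idx_parity_def gperm_def)

lemma rows_pm: "gperm g \<Longrightarrow> rows (map (pm g) u) = rows u \<circ> inv g"
  unfolding pm_def by (rule rows_map[OF gperm_bij])

lemma pm_comp: "map (pm g) (map (pm h) u) = map (pm (g \<circ> h)) u"
  by (simp add: pm_def)

lemma pm_inv: "gperm g \<Longrightarrow> map (pm g) (map (pm (inv g)) u) = u"
  unfolding pm_comp using permutes_inverses(1)[of g "{..<m + n}"] by (simp add: gperm_def pm_def)

lemma proper_pm:
  assumes g: "gperm g"
  shows "proper (map (pm g) u) \<longleftrightarrow> proper u"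
proof -
  have "g b < m + n \<longleftrightarrow> b < m + n" for b
    using g permutes_lessThan[of g "m + n" b] by (simp add: gperm_def)
  then show ?thesis by (auto simp: proper_def pm_def)
qed

lemma Qk_act:
  assumes g: "gperm g" and \<beta>: "\<beta> \<in> Qk"
  shows "\<beta> \<circ> inv g \<in> Qk"
proof -
  have gi: "inv g permutes {..<m + n}" "\<And>b. inv g b < m \<longleftrightarrow> b < m"
    using gperm_inv[OF g] by (simp_all add: gperm_def)
  have "(\<Sum>b<m + n. (\<beta> \<circ> inv g) b) = (\<Sum>b<m + n. \<beta> b)"
    by (rule sum.permute[OF gi(1), symmetric])
  moreover have "(\<beta> \<circ> inv g) b = {#}" if "b \<notin> {..<m + n}" for b
    using \<beta> that permutes_not_in[OF gi(1) that] by (simp add: Qk_def splits_def)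
  ultimately have "\<beta> \<circ> inv g \<in> splits {..<m + n} \<kappa>" using \<beta> by (simp add: Qk_def splits_def)
  moreover have "admissible m n (if b < m then (\<lambda>j. m \<le> j) else (\<lambda>j. j < m)) ((\<beta> \<circ> inv g) b)" if "b < m + n" for b
  proof -
    have "inv g b < m + n" using that permutes_lessThan[OF gi(1)] by simp
    then have "admissible m n (if inv g b < m then (\<lambda>j. m \<le> j) else (\<lambda>j. j < m)) (\<beta> (inv g b))"
      using \<beta> by (simp add: Qk_def)
    then show ?thesis unfolding gi(2) comp_apply .
  qed
  ultimately show ?thesis by (simp add: Qk_def)
qed

text \<open>A product of two supersymmetric functions depends only on the content, so any word of
  the matrix may replace the reference word. The computation for fixed matrices relies on this
  freedom.\<close>

lemma eps_eq:
  assumes g: "gperm g" and u: "rows u \<in> Qk"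
  shows "eps g (rows u) = osgn od u * osgn od (map (pm g) u)"
proof -
  have s: "supersym od (\<lambda>u. osgn od (map (pm g) u))"
    by (rule supersym_map[of od "osgn od" "pm g", OF supersym_osgn]) (rule opair_pm[OF g])
  have "mset (cw (rows u)) = mset u" using rows_cw[OF u] by (simp add: rows_eq_iff)
  from supersym_mset[OF s supersym_osgn this] show ?thesis unfolding eps_def .
qed

lemma eps_sq:
  assumes g: "gperm g" and \<beta>: "\<beta> \<in> Qk"
  shows "eps g \<beta> * eps g \<beta> = 1"
proof -
  have 1: "osgn od (cw \<beta>) * osgn od (cw \<beta>) = 1"
    by (rule osgn_sq_Qk) (simp only: rows_cw[OF \<beta>] \<beta>)
  have 2: "osgn od (map (pm g) (cw \<beta>)) * osgn od (map (pm g) (cw \<beta>)) = 1"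
    by (rule osgn_sq_Qk) (simp only: rows_pm[OF g] rows_cw[OF \<beta>] Qk_act[OF g \<beta>])
  have "eps g \<beta> * eps g \<beta> = (osgn od (cw \<beta>) * osgn od (cw \<beta>)) *
      (osgn od (map (pm g) (cw \<beta>)) * osgn od (map (pm g) (cw \<beta>)))"
    unfolding eps_def by (simp only: ac_simps)
  then show ?thesis unfolding 1 2 by simp
qed

text \<open>The sorting sign of the intermediate word occurs twice and cancels.\<close>

lemma eps_mul:
  assumes g: "gperm g" and h: "gperm h" and \<beta>: "\<beta> \<in> Qk"
  shows "eps (g \<circ> h) \<beta> = eps g (\<beta> \<circ> inv h) * eps h \<beta>"
proof -
  let ?u = "cw \<beta>" and ?v = "map (pm h) (cw \<beta>)"
  have rv: "rows ?v = \<beta> \<circ> inv h" unfolding rows_pm[OF h] rows_cw[OF \<beta>] ..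
  have vQ: "rows ?v \<in> Qk" unfolding rv by (rule Qk_act[OF h \<beta>])
  have "eps g (\<beta> \<circ> inv h) = osgn od ?v * osgn od (map (pm g) ?v)"
    using eps_eq[OF g vQ] unfolding rv .
  then have "eps g (\<beta> \<circ> inv h) * eps h \<beta> =
      (osgn od ?v * osgn od ?v) * (osgn od ?u * osgn od (map (pm g) ?v))"
    unfolding eps_def[of h] by (simp only: ac_simps)
  also have "\<dots> = osgn od ?u * osgn od (map (pm (g \<circ> h)) ?u)"
    unfolding osgn_sq_Qk[OF vQ] pm_comp by simp
  finally show ?thesis unfolding eps_def[of "g \<circ> h"] by simp
qed

definition ge :: "(nat \<Rightarrow> nat) \<Rightarrow> tens \<Rightarrow> tens" where
  "ge g = on_basis m n d (\<lambda>w. delta (map g w))"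

lemma map_words:
  assumes g: "gperm g" and w: "w \<in> Wd"
  shows "map g w \<in> Wd"
proof -
  have "g b < m + n" if "b < m + n" for b
    using g permutes_lessThan[of g "m + n" b] that by (simp add: gperm_def)
  then show ?thesis using w by (auto simp: words_def)
qed

lemma map_inv_words: "gperm g \<Longrightarrow> v = map g w \<longleftrightarrow> w = map (inv g) v"
  using bij_is_inj[OF gperm_bij] bij_is_surj[OF gperm_bij] surj_f_inv_f[of g] inv_f_f[of g]
  by (auto simp: comp_def)

lemma ge_schur:
  assumes g: "gperm g"
  shows "ge g \<in> S"
proof (rule schur_algI)
  show "ge g \<in> lin_maps T T"
    unfolding ge_def by (rule on_basis_lin) (rule delta_T[OF map_words[OF g]])
  fix k v w assume k: "Suc k < d" and v: "v \<in> Wd" and w: "w \<in> Wd"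
  have l: "Suc k < length w" using w k by (simp add: words_def)
  have s: "map g (swapw k w) = swapw k (map g w)"
    using l by (simp add: swapw_def map_update)
  have "par (g b) = par b" for b using g by (simp add: gperm_def idx_parity_def)
  then have e: "sgk k (map g w) = sgk k w" using l by (simp add: sgk_def)
  have "delta (swapw k (map g w)) (swapw k v) = sgk k v * sgk k w * delta (map g w) v"
    using swapw_inj[OF k v map_words[OF g w]] sgk_sq[of k v] e by (auto simp: delta_def)
  then show "ge g (delta (swapw k w)) (swapw k v) = sgk k v * sgk k w * ge g (delta w) v"
    unfolding ge_def on_basis_delta[OF w] on_basis_delta[OF swapw_facts(1)[OF k w]] s .
qed

lemma ge_apply:
  assumes g: "gperm g" and x: "x \<in> T" and v: "v \<in> Wd"
  shows "ge g x v = x (map (inv g) v)"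
proof -
  have "ge g x v = (\<Sum>w\<in>Wd. x w * delta (map g w) v)"
    unfolding ge_def by (rule on_basis_apply[OF x])
  also have "\<dots> = (\<Sum>w\<in>Wd. if w = map (inv g) v then x (map (inv g) v) else 0)"
    by (rule sum.cong[OF refl]) (simp add: delta_def map_inv_words[OF g])
  also have "\<dots> = x (map (inv g) v)"
    using finite_words map_words[OF gperm_inv[OF g] v] by (simp add: sum.delta)
  finally show ?thesis .
qed

lemma Nf_ge:
  assumes g: "gperm g" and \<eta>: "\<eta> \<in> S" and u: "proper u"
  shows "Nf (ge g \<circ> \<eta>) u = Nf \<eta> (map (pm (inv g)) u)"
proof -
  have "ge g (\<eta> (delta (map snd u))) (map fst u) = \<eta> (delta (map snd u)) (map (inv g) (map fst u))"
    by (rule ge_apply[OF g lin_mapsD(3)[OF schur_lin[OF \<eta>] delta_T[OF proper_words(2)[OF u]]] proper_words(1)[OF u]])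
  then show ?thesis
    using u proper_pm[OF gperm_inv[OF g]] gam_pm[OF gperm_inv[OF g]]
    by (simp add: Nf_def pm_def comp_def)
qed

text \<open>Left multiplication by \<open>g\<close> relabels the rows of a biword and leaves its
  columns and \<open>gam\<close> unchanged. The sign comes from sorting the relabelled word.\<close>

lemma coef_ge:
  assumes g: "gperm g" and \<eta>: "\<eta> \<in> S" and \<beta>: "\<beta> \<in> Qk"
  shows "coef (ge g \<circ> \<eta>) (\<beta> \<circ> inv g) = eps g \<beta> * coef \<eta> \<beta>"
proof -
  let ?u = "cw (\<beta> \<circ> inv g)"
  let ?u' = "map (pm (inv g)) ?u"
  have Q: "\<beta> \<circ> inv g \<in> Qk" by (rule Qk_act[OF g \<beta>])
  have r: "rows ?u = \<beta> \<circ> inv g" by (rule rows_cw[OF Q])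
  have p: "proper ?u" by (rule rows_proper) (simp only: r Q)
  have "rows ?u' = \<beta> \<circ> inv g \<circ> inv (inv g)" unfolding rows_pm[OF gperm_inv[OF g]] r ..
  also have "\<dots> = \<beta>"
    using gperm_bij[OF g] by (simp add: inv_inv_eq comp_assoc bij_is_inj)
  finally have r': "rows ?u' = \<beta>" .
  have Q': "rows ?u' \<in> Qk" unfolding r' by (rule \<beta>)
  have "coef (ge g \<circ> \<eta>) (\<beta> \<circ> inv g) = osgn od ?u * Nf \<eta> ?u'"
    unfolding coef_def Nf_ge[OF g \<eta> p] ..
  also have "Nf \<eta> ?u' = osgn od ?u' * coef \<eta> \<beta>"
    using Nf_coef[OF \<eta> Q'] unfolding r' .
  also have "osgn od ?u * (osgn od ?u' * coef \<eta> \<beta>) = (osgn od ?u' * osgn od (map (pm g) ?u')) * coef \<eta> \<beta>"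
    unfolding pm_inv[OF g] by (simp only: ac_simps)
  also have "osgn od ?u' * osgn od (map (pm g) ?u') = eps g \<beta>"
    using eps_eq[OF g Q'] unfolding r' by simp
  finally show ?thesis .
qed

end

section \<open>Signs of matrices fixed by a permutation of the rows\<close>

lemma count_concat: "count (mset (concat xss)) x = (\<Sum>xs\<leftarrow>xss. count (mset xs) x)"
  by (induction xss) simp_all

lemma concat_concat_map: "concat (concat (map F xs)) = concat (map (\<lambda>x. concat (F x)) xs)"
  by (induction xs) simp_all

context finite_perm
begin

text \<open>The points of the orbit in the order in which \<open>\<tau>\<close> visits them, so that
  applying \<open>\<tau>\<close> is a rotation of the list.\<close>

definition cyc :: "'a set \<Rightarrow> 'a list" where
  "cyc B = map (\<lambda>i. (\<tau> ^^ i) (rep B)) [0..<card B]"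

lemma cyc_facts:
  assumes B: "B \<in> orbits \<tau> S"
  shows "set (cyc B) = B" "distinct (cyc B)" "map \<tau> (cyc B) = rotate1 (cyc B)"
proof -
  let ?x = "rep B" and ?k = "funpow_dist1 \<tau> (rep B) (rep B)"
  have o: "orbit \<tau> ?x = B" by (rule orbit_rep[OF B])
  have x: "?x \<in> orbit \<tau> ?x" by (rule orbit_self)
  have im: "(\<lambda>i. (\<tau> ^^ i) ?x) ` {0..<?k} = B"
    using orbit_conv_funpow_dist1[OF x] o by simp
  have inj: "inj_on (\<lambda>i. (\<tau> ^^ i) ?x) {0..<?k}"
    by (rule inj_on_funpow_dist1[OF x])
  have k: "card B = ?k" using card_image[OF inj] im by simp
  show "set (cyc B) = B" unfolding cyc_def k set_map set_upt by (rule im)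
  show "distinct (cyc B)" unfolding cyc_def k distinct_map set_upt using inj by (simp only: distinct_upt simp_thms)
  have per: "(\<tau> ^^ card B) ?x = ?x" unfolding k by (rule funpow_dist1_prop[OF x])
  show "map \<tau> (cyc B) = rotate1 (cyc B)"
  proof (rule nth_equalityI)
    fix i assume "i < length (map \<tau> (cyc B))"
    then have i: "i < card B" by (simp add: cyc_def)
    have "map \<tau> (cyc B) ! i = (\<tau> ^^ Suc i) ?x" using i by (simp add: cyc_def)
    also have "\<dots> = (\<tau> ^^ (Suc i mod card B)) ?x"
    proof (cases "Suc i = card B")
      case True
      then show ?thesis using per by simp
    qed (use i in simp)
    also have "\<dots> = rotate1 (cyc B) ! i" using i by (simp add: nth_rotate1 cyc_def)
    finally show "map \<tau> (cyc B) ! i = rotate1 (cyc B) ! i" .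
  qed simp
qed

lemma hd_cyc: "B \<in> orbits \<tau> S \<Longrightarrow> cyc B \<noteq> [] \<and> hd (cyc B) = rep B"
  using card_orbit_pos[of B] by (cases "card B") (auto simp: cyc_def hd_map upt_conv_Cons simp del: upt_Suc)

lemma length_cyc [simp]: "length (cyc B) = card B"
  by (simp add: cyc_def)

end

context super_weight
begin

abbreviation osign :: "nat set \<Rightarrow> nat \<Rightarrow> complex" where
  "osign B a \<equiv> if od (rep B, a) then (-1) ^ (card B - 1) else 1"

text \<open>Ordering the letters so that the orbit of each letter is contiguous, \<open>g\<close> rotates every block.\<close>

lemma eps_fixed:
  assumes g: "gperm g" and \<beta>: "\<beta> \<in> Qk" and fixed: "\<beta> \<circ> g = \<beta>"
  shows "eps g \<beta> = (\<Prod>B\<in>orbits g {..<m + n}. \<Prod>a\<in>#\<beta> (rep B). osign B a)"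
proof -
  interpret finite_perm g "{..<m + n}" using g by unfold_locales (simp_all add: gperm_def)
  let ?O = "orbits g {..<m + n}"
  obtain Bs where Bs: "set Bs = ?O" "distinct Bs" using finite_distinct_list[OF finite_orbits] by blast
  define la where "la B = (SOME l. mset l = \<beta> (rep B))" for B
  have la: "mset (la B) = \<beta> (rep B)" for B unfolding la_def by (rule someI_ex[OF ex_mset])
  \<comment> \<open>For each orbit of rows and each entry \<open>a\<close> of the multiset shared by
    its rows there is one block, running through the orbit with fixed column \<open>a\<close>. All
    letters of a block have the same parity, and the concatenation of the blocks is a word of the
    matrix \<open>\<beta>\<close>.\<close>
  define blk where "blk B a = map (\<lambda>b. (b, a)) (cyc B)" for B and a :: nat
  define bl where "bl = concat (map (\<lambda>B. map (blk B) (la B)) Bs)"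
  let ?u = "concat bl"
  have bl: "\<exists>B a. B \<in> ?O \<and> X = blk B a" if "X \<in> set bl" for X
    using that Bs(1) by (auto simp: bl_def)
  have inv: "(\<lambda>b. b < m) \<circ> g = (\<lambda>b. b < m)" using g by (simp add: gperm_def fun_eq_iff)
  have same: "(b < m) = (rep B < m)" if "B \<in> ?O" "b \<in> B" for b B
    by (rule invariant_rep[OF inv that])
  have hdb: "blk B a \<noteq> [] \<and> hd (blk B a) = (rep B, a) \<and> length (blk B a) = card B" if "B \<in> ?O" for B a
    using hd_cyc[OF that] by (simp add: blk_def hd_map)
  have odb: "od x = od (hd (blk B a))" if "B \<in> ?O" "x \<in> set (blk B a)" for x B a
    using that hdb[OF that(1), of a] same[OF that(1)] cyc_facts(1)[OF that(1)]
    by (auto simp: blk_def opair_iff)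
  have rot: "map (pm g) (blk B a) = rotate1 (blk B a)" if "B \<in> ?O" for B a
  proof -
    have "map (pm g) (blk B a) = map (\<lambda>b. (b, a)) (map g (cyc B))"
      by (simp add: blk_def pm_def)
    then show ?thesis unfolding cyc_facts(3)[OF that] blk_def rotate1_map .
  qed
  have ru: "rows ?u = \<beta>"
  proof (intro ext multiset_eqI)
    fix b a
    have c1: "count (mset (blk B a')) (b, a) = (if a' = a \<and> b \<in> B then 1 else 0)" if "B \<in> ?O" for B a'
    proof -
      have "distinct (blk B a')"
        using cyc_facts(2)[OF that] by (simp add: blk_def distinct_map inj_on_def)
      then have "count (mset (blk B a')) (b, a) = (if (b, a) \<in> set (blk B a') then 1 else 0)"
        unfolding distinct_count_atmost_1 by blast
      moreover have "(b, a) \<in> set (blk B a') \<longleftrightarrow> a' = a \<and> b \<in> B"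
        using cyc_facts(1)[OF that] by (auto simp: blk_def)
      ultimately show ?thesis by simp
    qed
    have c2: "count (mset (concat (map (blk B) l))) (b, a) = (if b \<in> B then count (mset l) a else 0)"
      if "B \<in> ?O" for B l
      by (induction l) (simp_all add: c1[OF that])
    have "?u = concat (map (\<lambda>B. concat (map (blk B) (la B))) Bs)"
      unfolding bl_def by (rule concat_concat_map)
    then have "count (rows ?u b) a = (\<Sum>B\<leftarrow>Bs. count (mset (concat (map (blk B) (la B)))) (b, a))"
      unfolding count_rows by (simp only: count_concat[of "map (\<lambda>B. concat (map (blk B) (la B))) Bs"] map_map comp_def)
    also have "\<dots> = (\<Sum>B\<in>?O. count (mset (concat (map (blk B) (la B)))) (b, a))"
      unfolding Bs(1)[symmetric] by (rule sum.distinct_set_conv_list[OF Bs(2), symmetric])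
    also have "\<dots> = (\<Sum>B\<in>?O. if b \<in> B then count (\<beta> (rep B)) a else 0)"
      by (rule sum.cong[OF refl]) (simp only: c2 la)
    also have "\<dots> = count (\<beta> b) a"
    proof (cases "b < m + n")
      case True
      have "(\<Sum>B\<in>?O. if b \<in> B then count (\<beta> (rep B)) a else 0) =
          (\<Sum>B\<in>?O. if B = orbit g b then count (\<beta> b) a else 0)"
      proof (rule sum.cong[OF refl])
        fix B assume B: "B \<in> ?O"
        have "b \<in> B \<longleftrightarrow> B = orbit g b"
        proof
          assume b: "b \<in> B"
          obtain x where x: "B = orbit g x" using B by blast
          have "orbit g b = orbit g x" by (rule orbit_eq) (use b x in simp)
          then show "B = orbit g b" using x by simp
        next
          assume "B = orbit g b"
          then show "b \<in> B" using orbit_self[of b] by simp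
        qed
        then show "(if b \<in> B then count (\<beta> (rep B)) a else 0) = (if B = orbit g b then count (\<beta> b) a else 0)"
          using invariant_rep[OF fixed B, of b] by auto
      qed
      then show ?thesis using True finite_orbits by (simp add: sum.delta)
    next
      case False
      have "b \<notin> B" if B: "B \<in> ?O" for B
      proof -
        obtain x where "x \<in> {..<m + n}" "B = orbit g x" using B by blast
        then show ?thesis using orbit_sub[of x] False by auto
      qed
      moreover have "\<beta> b = {#}" using \<beta> False by (simp add: Qk_def splits_def)
      ultimately show ?thesis by simp
    qed
    finally show "count (rows ?u b) a = count (\<beta> b) a" .
  qed
  have uQ: "rows ?u \<in> Qk" unfolding ru by (rule \<beta>)
  have "map (pm g) ?u = concat (map (map (pm g)) bl)" by (rule map_concat)
  also have "map (map (pm g)) bl = map rotate1 bl"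
  proof (rule map_cong[OF refl])
    fix X assume "X \<in> set bl"
    then obtain B a where "B \<in> ?O" "X = blk B a" using bl by blast
    then show "map (pm g) X = rotate1 X" using rot by simp
  qed
  finally have "osgn od (map (pm g) ?u) = osgn od ([] @ concat (map rotate1 bl))" by simp
  also have "\<dots> = (\<Prod>X\<leftarrow>bl. if od (hd X) then (-1) ^ (length X - 1) else 1) * osgn od ([] @ ?u)"
  proof (rule supersym_rotate_blocks[OF supersym_osgn])
    fix X assume "X \<in> set bl"
    then obtain B a where Ba: "B \<in> ?O" "X = blk B a" using bl by blast
    show "X \<noteq> [] \<and> (\<forall>x\<in>set X. od x = od (hd X))"
      unfolding Ba(2) by (intro conjI ballI, rule conjunct1[OF hdb[OF Ba(1)]], rule odb[OF Ba(1)])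
  qed
  finally have F: "osgn od (map (pm g) ?u) =
      (\<Prod>X\<leftarrow>bl. if od (hd X) then (-1) ^ (length X - 1) else 1) * osgn od ?u"
    unfolding append_Nil .
  have E: "eps g \<beta> = osgn od ?u * osgn od (map (pm g) ?u)"
    using eps_eq[OF g uQ] unfolding ru .
  \<comment> \<open>The odd letters of a word of this matrix are distinct, so its sorting sign
    squares to 1 and only the rotation signs of the blocks remain.\<close>
  have "eps g \<beta> = (osgn od ?u * osgn od ?u) * (\<Prod>X\<leftarrow>bl. if od (hd X) then (-1) ^ (length X - 1) else 1)"
    unfolding E F by (rule mult.left_commute[THEN trans]) (rule mult.commute)
  also have "\<dots> = (\<Prod>X\<leftarrow>bl. if od (hd X) then (-1) ^ (length X - 1) else 1)"
    unfolding osgn_sq_Qk[OF uQ] by simp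
  also have "\<dots> = (\<Prod>B\<leftarrow>Bs. \<Prod>a\<leftarrow>la B. osign B a)"
  proof -
    let ?s = "\<lambda>X. if od (hd X) then (-1) ^ (length X - 1) else (1 :: complex)"
    have sb: "?s (blk B a) = osign B a" if "B \<in> ?O" for B a
      using hdb[OF that, of a] by simp
    have pl: "(\<Prod>X\<leftarrow>map (blk B) l. ?s X) = (\<Prod>a\<leftarrow>l. osign B a)" if "B \<in> ?O" for B l
      by (induction l) (simp_all only: list.map prod_list.Nil prod_list.Cons sb[OF that])
    have "(\<Prod>X\<leftarrow>concat (map (\<lambda>B. map (blk B) (la B)) Cs). ?s X) = (\<Prod>B\<leftarrow>Cs. \<Prod>a\<leftarrow>la B. osign B a)"
      if "set Cs \<subseteq> ?O" for Cs
      using that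
    proof (induction Cs)
      case (Cons B Cs)
      then show ?case
        using pl[of B "la B"] by (simp only: list.map concat.simps map_append prod_list.append prod_list.Cons list.set) simp
    qed simp
    then show ?thesis using Bs(1) unfolding bl_def by blast
  qed
  also have "\<dots> = (\<Prod>B\<leftarrow>Bs. \<Prod>a\<in>#\<beta> (rep B). osign B a)"
    unfolding la[symmetric] by (simp add: prod_mset_prod_list flip: mset_map)
  also have "\<dots> = (\<Prod>B\<in>?O. \<Prod>a\<in>#\<beta> (rep B). osign B a)"
    unfolding Bs(1)[symmetric] by (rule prod.distinct_set_conv_list[OF Bs(2), symmetric])
  finally show ?thesis .
qed

end

text \<open>The reproducing identity is linear in \<open>u\<close>, so it need only be checked on
  pure tensors, where it factors.\<close>

lemma proj_kernel_outer:
  fixes K1 :: "'r \<Rightarrow> 'r \<Rightarrow> complex" and K2 :: "'s \<Rightarrow> 's \<Rightarrow> complex"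
  assumes X: "finite X1" "finite X2" and K1: "proj_kernel X1 U1 K1" and K2: "proj_kernel X2 U2 K2"
  shows "proj_kernel (X1 \<times> X2) (outer_tensor U1 U2) (\<lambda>(r, s) (r', s'). K1 r r' * K2 s s')"
  unfolding proj_kernel_def
proof (intro conjI ballI allI)
  let ?K = "\<lambda>(r, s) (r', s'). K1 r r' * K2 s s'"
  fix y assume "y \<in> X1 \<times> X2"
  then obtain r' s' where y: "y = (r', s')" "r' \<in> X1" "s' \<in> X2" by auto
  have "(\<lambda>(r, s). K1 r r' * K2 s s') \<in> outer_tensor U1 U2"
    unfolding outer_tensor_def
  proof (rule cv.span_base, rule CollectI, intro exI conjI)
    show "(\<lambda>r. K1 r r') \<in> U1" using K1 y(2) unfolding proj_kernel_def by blast
    show "(\<lambda>s. K2 s s') \<in> U2" using K2 y(3) unfolding proj_kernel_def by blast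
  qed (rule refl)
  also have "(\<lambda>(r, s). K1 r r' * K2 s s') = (\<lambda>x. ?K x y)" by (auto simp: fun_eq_iff y)
  finally show "(\<lambda>x. ?K x y) \<in> outer_tensor U1 U2" .
next
  let ?K = "\<lambda>(r, s) (r', s'). K1 r r' * K2 s s'"
  fix u x assume u: "u \<in> outer_tensor U1 U2"
  let ?R = "{u. \<forall>x. u x = (\<Sum>y\<in>X1 \<times> X2. ?K x y * u y)}"
  have "outer_tensor U1 U2 \<subseteq> ?R"
    unfolding outer_tensor_def
  proof (rule cv.span_minimal)
    show "cv.subspace ?R"
    proof (rule cv.subspaceI)
      show "0 \<in> ?R" by simp
      show "u + v \<in> ?R" if u: "u \<in> ?R" and v: "v \<in> ?R" for u v
      proof (rule CollectI, rule allI)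
        fix x
        have "(u + v) x = (\<Sum>y\<in>X1 \<times> X2. ?K x y * u y) + (\<Sum>y\<in>X1 \<times> X2. ?K x y * v y)"
          unfolding plus_fun_apply
          by (rule arg_cong2[where f = "(+)", OF spec[OF CollectD[OF u]] spec[OF CollectD[OF v]]])
        then show "(u + v) x = (\<Sum>y\<in>X1 \<times> X2. ?K x y * (u + v) y)"
          unfolding plus_fun_apply distrib_left sum.distrib .
      qed
      show "c *\<^sub>C u \<in> ?R" if u: "u \<in> ?R" for c u
      proof (rule CollectI, rule allI)
        fix x
        have "(c *\<^sub>C u) x = c * (\<Sum>y\<in>X1 \<times> X2. ?K x y * u y)"
          unfolding scaleC_fun_apply scaleC_complex
          by (rule arg_cong[where f = "(*) c", OF spec[OF CollectD[OF u]]])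
        then show "(c *\<^sub>C u) x = (\<Sum>y\<in>X1 \<times> X2. ?K x y * (c *\<^sub>C u) y)"
          unfolding scaleC_fun_apply scaleC_complex sum_distrib_left by (simp only: mult.left_commute)
      qed
    qed
    show "{\<lambda>(r, s). v r * w s |v w. v \<in> U1 \<and> w \<in> U2} \<subseteq> ?R"
    proof (rule subsetI, rule CollectI, rule allI)
      fix u :: "'r \<times> 's \<Rightarrow> complex" and x :: "'r \<times> 's" assume "u \<in> {\<lambda>(r, s). v r * w s |v w. v \<in> U1 \<and> w \<in> U2}"
      then obtain v w where vw: "u = (\<lambda>(r, s). v r * w s)" "v \<in> U1" "w \<in> U2" by blast
      obtain r s where x: "x = (r, s)" by (cases x)
      have v: "v r = (\<Sum>y\<in>X1. K1 r y * v y)" by (rule spec[OF bspec[OF conjunct2[OF K1[unfolded proj_kernel_def]] vw(2)]])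
      have w: "w s = (\<Sum>y\<in>X2. K2 s y * w y)" by (rule spec[OF bspec[OF conjunct2[OF K2[unfolded proj_kernel_def]] vw(3)]])
      have "u x = (\<Sum>y\<in>X1. K1 r y * v y) * (\<Sum>y\<in>X2. K2 s y * w y)"
        unfolding v[symmetric] w[symmetric] by (simp add: vw(1) x)
      also have "\<dots> = (\<Sum>y\<in>X1 \<times> X2. ?K x y * u y)"
        unfolding sum_product sum.cartesian_product x vw(1)
        by (rule sum.cong[OF refl]) (auto simp: ac_simps)
      finally show "u x = (\<Sum>y\<in>X1 \<times> X2. ?K x y * u y)" .
    qed
  qed
  then show "u x = (\<Sum>y\<in>X1 \<times> X2. ?K x y * u y)" using u by blast
qed

lemma outer_tensor_support:
  assumes u: "u \<in> outer_tensor U1 U2" and s1: "\<And>v r. v \<in> U1 \<Longrightarrow> r \<notin> X1 \<Longrightarrow> v r = 0"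
    and s2: "\<And>w s. w \<in> U2 \<Longrightarrow> s \<notin> X2 \<Longrightarrow> w s = 0" and x: "x \<notin> X1 \<times> X2"
  shows "u x = 0"
proof -
  have "outer_tensor U1 U2 \<subseteq> {u. u x = 0}"
    unfolding outer_tensor_def
  proof (rule cv.span_minimal)
    show "cv.subspace {u :: _ \<Rightarrow> complex. u x = 0}" by (rule cv.subspaceI) simp_all
    show "{\<lambda>(r, s). v r * w s |v w. v \<in> U1 \<and> w \<in> U2} \<subseteq> {u. u x = 0}"
    proof (rule subsetI, rule CollectI)
      fix u assume "u \<in> {\<lambda>(r, s). v r * w s |v w. v \<in> U1 \<and> w \<in> U2}"
      then obtain v w where vw: "u = (\<lambda>(r, s). v r * w s)" "v \<in> U1" "w \<in> U2" by blast
      obtain r s where rs: "x = (r, s)" by (cases x)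
      then have "r \<notin> X1 \<or> s \<notin> X2" using x by blast
      then have "v r = 0 \<or> w s = 0" using s1[OF vw(2)] s2[OF vw(3)] by blast
      then show "u x = 0" by (auto simp: vw(1) rs)
    qed
  qed
  then show ?thesis using u by blast
qed

section \<open>The weight spaces of the superinduced module\<close>

lemma (in super_weight) grp_emb_ge: "grp_emb m n d \<tau> \<sigma> = ge (idx_perm m \<tau> \<sigma>)"
  by (simp only: grp_emb_def ge_def)

locale super_induced = super_weight +
  fixes \<mu> \<nu> :: "nat list" and K1 K2 :: "(nat \<Rightarrow> nat) \<Rightarrow> (nat \<Rightarrow> nat) \<Rightarrow> complex"
  assumes \<mu>: "is_partition \<mu> m" and \<nu>: "is_partition \<nu> n"
    and K1: "proj_kernel (row_maps m) (specht \<mu>) K1"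
    and K1_inv: "\<forall>\<pi> r s. \<pi> permutes {..<m} \<longrightarrow> K1 (r \<circ> \<pi>) (s \<circ> \<pi>) = K1 r s"
    and K2: "proj_kernel (row_maps n) (specht \<nu>) K2"
    and K2_inv: "\<forall>\<pi> r s. \<pi> permutes {..<n} \<longrightarrow> K2 (r \<circ> \<pi>) (s \<circ> \<pi>) = K2 r s"
begin

definition "G = {\<tau>. \<tau> permutes {..<m}} \<times> {\<sigma>. \<sigma> permutes {..<n}}"
definition "U = outer_tensor (specht \<mu>) (specht \<nu>)"
definition "X = row_maps m \<times> row_maps n"

abbreviation gmul :: "(nat \<Rightarrow> nat) \<times> (nat \<Rightarrow> nat) \<Rightarrow> (nat \<Rightarrow> nat) \<times> (nat \<Rightarrow> nat) \<Rightarrow> (nat \<Rightarrow> nat) \<times> (nat \<Rightarrow> nat)" where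
  "gmul p q \<equiv> (fst p \<circ> fst q, snd p \<circ> snd q)"

abbreviation gi :: "(nat \<Rightarrow> nat) \<times> (nat \<Rightarrow> nat) \<Rightarrow> nat \<Rightarrow> nat" where
  "gi p \<equiv> idx_perm m (fst p) (snd p)"

lemma gperm_gi: "p \<in> G \<Longrightarrow> gperm (gi p)"
  unfolding gperm_def G_def by (auto simp: idx_perm_less intro: permutes_idx_perm)

lemma gi_mul: "q \<in> G \<Longrightarrow> gi (gmul p q) = gi p \<circ> gi q"
  unfolding G_def by (auto simp: idx_perm_comp)

lemma bij_row_maps_iff: "\<pi> permutes {..<k} \<Longrightarrow> r \<circ> \<pi> \<in> row_maps k \<longleftrightarrow> r \<in> row_maps k"
  using row_maps_comp[of r k \<pi>] row_maps_comp[OF _ permutes_inv, of "r \<circ> \<pi>" k \<pi>]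
  by (auto simp: comp_assoc permutes_inv_o)

text \<open>The inverse makes relabelling of rows a left action, while precomposition on tabloids
  reverses the order of products, as \<open>xa_mul\<close> prescribes.\<close>

sublocale A: signed_action G gmul Qk "\<lambda>p \<beta>. \<beta> \<circ> inv (gi p)" "\<lambda>p. eps (gi p)"
  X "\<lambda>p x. (fst x \<circ> fst p, snd x \<circ> snd p)" U "\<lambda>(r, s) (r', s'). K1 r r' * K2 s s'"
proof unfold_locales
  show "finite G" unfolding G_def by (simp add: finite_permutations)
  show "G \<noteq> {}" unfolding G_def using permutes_id by blast
  show "bij_betw (\<lambda>g. gmul g h) G G" if "h \<in> G" for h
  proof (rule bij_betw_byWitness[where f' = "\<lambda>g. gmul g (inv (fst h), inv (snd h))"])
    have h: "fst h permutes {..<m}" "snd h permutes {..<n}" using that by (auto simp: G_def)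
    show "\<forall>g\<in>G. gmul (gmul g h) (inv (fst h), inv (snd h)) = g"
      "\<forall>g\<in>G. gmul (gmul g (inv (fst h), inv (snd h))) h = g"
      by (auto simp: comp_assoc permutes_inv_o[OF h(1)] permutes_inv_o[OF h(2)])
    show "(\<lambda>g. gmul g h) ` G \<subseteq> G" "(\<lambda>g. gmul g (inv (fst h), inv (snd h))) ` G \<subseteq> G"
      using h permutes_inv[OF h(1)] permutes_inv[OF h(2)] by (auto simp: G_def intro: permutes_compose)
  qed
  show "finite Qk" by (rule finite_Qk)
  show "q \<circ> inv (gi g) \<in> Qk" if "g \<in> G" "q \<in> Qk" for g q
    by (rule Qk_act[OF gperm_gi[OF that(1)] that(2)])
  show "q \<circ> inv (gi (gmul g h)) = q \<circ> inv (gi h) \<circ> inv (gi g)" if "g \<in> G" "h \<in> G" "q \<in> Qk" for g h q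
    unfolding gi_mul[OF that(2)] o_inv_distrib[OF gperm_bij[OF gperm_gi[OF that(1)]] gperm_bij[OF gperm_gi[OF that(2)]]]
    by (simp only: comp_assoc)
  show "eps (gi (gmul g h)) q = eps (gi g) (q \<circ> inv (gi h)) * eps (gi h) q" if "g \<in> G" "h \<in> G" "q \<in> Qk" for g h q
    unfolding gi_mul[OF that(2)] by (rule eps_mul[OF gperm_gi[OF that(1)] gperm_gi[OF that(2)] that(3)])
  show "eps (gi g) q * eps (gi g) q = 1" if "g \<in> G" "q \<in> Qk" for g q
    by (rule eps_sq[OF gperm_gi[OF that(1)] that(2)])
  show "finite X" unfolding X_def by (simp add: finite_row_maps)
  show "bij_betw (\<lambda>x. (fst x \<circ> fst g, snd x \<circ> snd g)) X X" if "g \<in> G" for g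
  proof (rule bij_betw_byWitness[where f' = "\<lambda>x. (fst x \<circ> inv (fst g), snd x \<circ> inv (snd g))"])
    have g: "fst g permutes {..<m}" "snd g permutes {..<n}" using that by (auto simp: G_def)
    show "\<forall>a\<in>X. (fst (fst a \<circ> fst g, snd a \<circ> snd g) \<circ> inv (fst g), snd (fst a \<circ> fst g, snd a \<circ> snd g) \<circ> inv (snd g)) = a"
      "\<forall>a\<in>X. (fst (fst a \<circ> inv (fst g), snd a \<circ> inv (snd g)) \<circ> fst g, snd (fst a \<circ> inv (fst g), snd a \<circ> inv (snd g)) \<circ> snd g) = a"
      by (auto simp: comp_assoc permutes_inv_o[OF g(1)] permutes_inv_o[OF g(2)])
    show "(\<lambda>x. (fst x \<circ> fst g, snd x \<circ> snd g)) ` X \<subseteq> X"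
      "(\<lambda>x. (fst x \<circ> inv (fst g), snd x \<circ> inv (snd g))) ` X \<subseteq> X"
      using g permutes_inv[OF g(1)] permutes_inv[OF g(2)] by (auto simp: X_def row_maps_comp)
  qed
  show "(fst x \<circ> fst (gmul g h), snd x \<circ> snd (gmul g h)) =
      (fst (fst x \<circ> fst g, snd x \<circ> snd g) \<circ> fst h, snd (fst x \<circ> fst g, snd x \<circ> snd g) \<circ> snd h)"
    if "g \<in> G" "h \<in> G" "x \<in> X" for g h x
    by (simp only: fst_conv snd_conv comp_assoc)
  show "cv.subspace U" unfolding U_def outer_tensor_def by (rule cv.subspace_span)
  show "u x = 0" if u: "u \<in> U" and x: "x \<notin> X" for u x
  proof (rule outer_tensor_support[of u "specht \<mu>" "specht \<nu>" "row_maps m" "row_maps n" x])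
    show "u \<in> outer_tensor (specht \<mu>) (specht \<nu>)" using u by (simp only: U_def)
    show "v r = 0" if "v \<in> specht \<mu>" "r \<notin> row_maps m" for v r
      by (rule specht_support[OF \<mu> that])
    show "v r = 0" if "v \<in> specht \<nu>" "r \<notin> row_maps n" for v r
      by (rule specht_support[OF \<nu> that])
    show "x \<notin> row_maps m \<times> row_maps n" using x by (simp only: X_def not_False_eq_True)
  qed
  show "proj_kernel X U (\<lambda>(r, s) (r', s'). K1 r r' * K2 s s')"
    unfolding X_def U_def by (rule proj_kernel_outer[OF finite_row_maps finite_row_maps K1 K2])
  show "(case (fst x \<circ> fst g, snd x \<circ> snd g) of (r, s) \<Rightarrow> \<lambda>(r', s'). K1 r r' * K2 s s') (fst y \<circ> fst g, snd y \<circ> snd g) =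
      (case x of (r, s) \<Rightarrow> \<lambda>(r', s'). K1 r r' * K2 s s') y" if "g \<in> G" "x \<in> X" "y \<in> X" for g x y
  proof -
    have g: "fst g permutes {..<m}" "snd g permutes {..<n}" using that by (auto simp: G_def)
    have "K1 (fst x \<circ> fst g) (fst y \<circ> fst g) = K1 (fst x) (fst y)"
      by (rule K1_inv[rule_format, OF g(1)])
    moreover have "K2 (snd x \<circ> snd g) (snd y \<circ> snd g) = K2 (snd x) (snd y)"
      by (rule K2_inv[rule_format, OF g(2)])
    ultimately show ?thesis by (simp add: case_prod_unfold)
  qed
qed

text \<open>Rebuilds a map on the algebra from its values on the basis elements:
  \<open>\<phi> (\<beta>, _)\<close> is the intended value at \<open>Nop \<beta>\<close>.\<close>

definition Psi :: "((nat \<Rightarrow> nat multiset) \<times> ((nat \<Rightarrow> nat) \<times> (nat \<Rightarrow> nat)) \<Rightarrow> complex) \<Rightarrow> (tens \<Rightarrow> tens) \<Rightarrow>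
    (nat \<Rightarrow> nat) \<times> (nat \<Rightarrow> nat) \<Rightarrow> complex" where
  "Psi \<phi> = (\<lambda>\<eta>. if \<eta> \<in> S then (\<lambda>x. \<Sum>\<beta>\<in>Qk. coef \<eta> \<beta> * \<phi> (\<beta>, x)) else 0)"

lemma Psi_apply: "\<eta> \<in> S \<Longrightarrow> Psi \<phi> \<eta> x = (\<Sum>\<beta>\<in>Qk. coef \<eta> \<beta> * \<phi> (\<beta>, x))"
  by (simp add: Psi_def)

lemma Psi_out: "\<eta> \<notin> S \<Longrightarrow> Psi \<phi> \<eta> = 0"
  by (simp only: Psi_def if_False)

lemma linear_Psi: "Vector_Spaces.linear scaleC scaleC Psi"
proof (rule Vector_Spaces.linear_iff[THEN iffD2], intro conjI allI)
  fix f g :: "(nat \<Rightarrow> nat multiset) \<times> ((nat \<Rightarrow> nat) \<times> (nat \<Rightarrow> nat)) \<Rightarrow> complex" and c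
  show "Psi (f + g) = Psi f + Psi g"
  proof (intro ext)
    fix \<eta> x show "Psi (f + g) \<eta> x = (Psi f + Psi g) \<eta> x"
      by (cases "\<eta> \<in> S") (simp_all add: Psi_apply Psi_out distrib_left sum.distrib)
  qed
  show "Psi (c *\<^sub>C f) = c *\<^sub>C Psi f"
  proof (intro ext)
    fix \<eta> x show "Psi (c *\<^sub>C f) \<eta> x = (c *\<^sub>C Psi f) \<eta> x"
      by (cases "\<eta> \<in> S") (simp_all add: Psi_apply Psi_out sum_distrib_left mult.left_commute)
  qed
qed (rule cv.vector_space_axioms)+

lemma Psi_lin:
  assumes \<phi>: "\<phi> \<in> A.equi_maps"
  shows "Psi \<phi> \<in> lin_maps S U"
proof (rule lin_mapsI)
  fix \<eta> \<eta>' assume \<eta>: "\<eta> \<in> S" "\<eta>' \<in> S"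
  have "\<eta> + \<eta>' \<in> S" by (rule cv.subspace_add[OF subspace_S \<eta>])
  then show "Psi \<phi> (\<eta> + \<eta>') = Psi \<phi> \<eta> + Psi \<phi> \<eta>'"
    using \<eta> by (intro ext) (simp add: Psi_apply coef_add distrib_right sum.distrib)
next
  fix c \<eta> assume \<eta>: "\<eta> \<in> S"
  have "c *\<^sub>C \<eta> \<in> S" by (rule cv.subspace_scale[OF subspace_S \<eta>])
  then show "Psi \<phi> (c *\<^sub>C \<eta>) = c *\<^sub>C Psi \<phi> \<eta>"
    using \<eta> by (intro ext) (simp add: Psi_apply coef_scale sum_distrib_left mult.assoc)
next
  fix \<eta> assume \<eta>: "\<eta> \<in> S"
  have U: "(\<lambda>x. \<phi> (\<beta>, x)) \<in> U" if "\<beta> \<in> Qk" for \<beta>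
    using \<phi> that unfolding A.equi_maps_def by blast
  have "(\<Sum>\<beta>\<in>Qk. coef \<eta> \<beta> *\<^sub>C (\<lambda>x. \<phi> (\<beta>, x))) \<in> U"
    by (intro cv.subspace_sum[OF A.U] cv.subspace_scale[OF A.U] U)
  also have "(\<Sum>\<beta>\<in>Qk. coef \<eta> \<beta> *\<^sub>C (\<lambda>x. \<phi> (\<beta>, x))) = Psi \<phi> \<eta>"
    by (intro ext) (simp add: Psi_apply[OF \<eta>] sum_fun_apply)
  finally show "Psi \<phi> \<eta> \<in> U" .
next
  fix \<eta> assume "\<eta> \<notin> S"
  then show "Psi \<phi> \<eta> = 0" by (rule Psi_out)
qed

lemma bij_Qk: "gperm g \<Longrightarrow> bij_betw (\<lambda>\<beta>. \<beta> \<circ> inv g) Qk Qk"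
proof (rule bij_betw_byWitness[where f' = "\<lambda>\<beta>. \<beta> \<circ> g"])
  assume g: "gperm g"
  then have p: "g permutes {..<m + n}" by (simp add: gperm_def)
  show "\<forall>\<beta>\<in>Qk. \<beta> \<circ> inv g \<circ> g = \<beta>" "\<forall>\<beta>\<in>Qk. \<beta> \<circ> g \<circ> inv g = \<beta>"
    by (simp_all add: comp_assoc permutes_inv_o[OF p])
  show "(\<lambda>\<beta>. \<beta> \<circ> inv g) ` Qk \<subseteq> Qk" using Qk_act[OF g] by blast
  have "\<beta> \<circ> g \<in> Qk" if "\<beta> \<in> Qk" for \<beta>
    using Qk_act[OF gperm_inv[OF g] that] by (simp add: inv_inv_eq[OF gperm_bij[OF g]])
  then show "(\<lambda>\<beta>. \<beta> \<circ> g) ` Qk \<subseteq> Qk" by blast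
qed

lemma equi_maps_act:
  assumes \<phi>: "\<phi> \<in> A.equi_maps" and \<tau>: "\<tau> permutes {..<m}" and \<sigma>: "\<sigma> permutes {..<n}" and \<beta>: "\<beta> \<in> Qk"
  shows "\<phi> (\<beta> \<circ> inv (idx_perm m \<tau> \<sigma>), (r, s)) = eps (idx_perm m \<tau> \<sigma>) \<beta> * \<phi> (\<beta>, (r \<circ> \<tau>, s \<circ> \<sigma>))"
proof (cases "(r, s) \<in> X")
  case True
  have G: "(\<tau>, \<sigma>) \<in> G" using \<tau> \<sigma> by (simp add: G_def)
  have "\<forall>g\<in>G. \<forall>q\<in>Qk. \<forall>x\<in>X. \<phi> (q \<circ> inv (gi g), x) = eps (gi g) q * \<phi> (q, (fst x \<circ> fst g, snd x \<circ> snd g))"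
    using \<phi> unfolding A.equi_maps_def by blast
  from this[THEN bspec, OF G, THEN bspec, OF \<beta>, THEN bspec, OF True]
  show ?thesis by (simp only: fst_conv snd_conv)
next
  case False
  then have "(r \<circ> \<tau>, s \<circ> \<sigma>) \<notin> X"
    unfolding X_def by (simp add: bij_row_maps_iff[OF \<tau>] bij_row_maps_iff[OF \<sigma>])
  moreover have "\<phi> (q, x) = 0" if "x \<notin> X" for q x
    using \<phi> that unfolding A.equi_maps_def by blast
  ultimately show ?thesis using False by simp
qed

text \<open>After reindexing the matrices by \<open>\<beta> \<circ> inv g\<close>, the coordinate
  and the value of \<open>\<phi>\<close> each produce \<open>eps g \<beta>\<close>, and the square
  of this sign is 1.\<close>

lemma Psi_sInd:
  assumes \<phi>: "\<phi> \<in> A.equi_maps"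
  shows "Psi \<phi> \<in> sInd m n d U outer_act"
  unfolding sInd_def
proof (rule CollectI, intro conjI allI impI)
  show "Psi \<phi> \<in> lin_maps S U" by (rule Psi_lin[OF \<phi>])
  fix \<tau> \<sigma> \<eta> assume \<tau>: "\<tau> permutes {..<m}" and \<sigma>: "\<sigma> permutes {..<n}" and \<eta>: "\<eta> \<in> S"
  let ?g = "idx_perm m \<tau> \<sigma>"
  have g: "gperm ?g" using gperm_gi[of "(\<tau>, \<sigma>)"] \<tau> \<sigma> by (simp add: G_def)
  have ge: "ge ?g \<circ> \<eta> \<in> S" by (rule schur_alg_comp[OF ge_schur[OF g] \<eta>])
  show "Psi \<phi> (grp_emb m n d \<tau> \<sigma> \<circ> \<eta>) = outer_act \<tau> \<sigma> (Psi \<phi> \<eta>)"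
  proof (rule ext, clarify)
    fix r s
    have "Psi \<phi> (grp_emb m n d \<tau> \<sigma> \<circ> \<eta>) (r, s) = (\<Sum>\<beta>\<in>Qk. coef (ge ?g \<circ> \<eta>) \<beta> * \<phi> (\<beta>, (r, s)))"
      unfolding grp_emb_ge by (rule Psi_apply[OF ge])
    also have "\<dots> = (\<Sum>\<beta>\<in>Qk. coef (ge ?g \<circ> \<eta>) (\<beta> \<circ> inv ?g) * \<phi> (\<beta> \<circ> inv ?g, (r, s)))"
      by (rule sum.reindex_bij_betw[OF bij_Qk[OF g], symmetric])
    also have "\<dots> = (\<Sum>\<beta>\<in>Qk. coef \<eta> \<beta> * \<phi> (\<beta>, (r \<circ> \<tau>, s \<circ> \<sigma>)))"
    proof (rule sum.cong[OF refl])
      fix \<beta> assume \<beta>: "\<beta> \<in> Qk"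
      have "eps ?g \<beta> * coef \<eta> \<beta> * (eps ?g \<beta> * \<phi> (\<beta>, (r \<circ> \<tau>, s \<circ> \<sigma>))) =
          (eps ?g \<beta> * eps ?g \<beta>) * (coef \<eta> \<beta> * \<phi> (\<beta>, (r \<circ> \<tau>, s \<circ> \<sigma>)))"
        by (simp only: ac_simps)
      then show "coef (ge ?g \<circ> \<eta>) (\<beta> \<circ> inv ?g) * \<phi> (\<beta> \<circ> inv ?g, (r, s)) = coef \<eta> \<beta> * \<phi> (\<beta>, (r \<circ> \<tau>, s \<circ> \<sigma>))"
        unfolding coef_ge[OF g \<eta> \<beta>] equi_maps_act[OF \<phi> \<tau> \<sigma> \<beta>] eps_sq[OF g \<beta>] mult_1 .
    qed
    also have "\<dots> = outer_act \<tau> \<sigma> (Psi \<phi> \<eta>) (r, s)"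
      unfolding outer_act_def by (simp add: Psi_apply[OF \<eta>])
    finally show "Psi \<phi> (grp_emb m n d \<tau> \<sigma> \<circ> \<eta>) (r, s) = outer_act \<tau> \<sigma> (Psi \<phi> \<eta>) (r, s)" .
  qed
qed

lemma Psi_W:
  assumes \<phi>: "\<phi> \<in> A.equi_maps"
  shows "sInd_act m n d W (Psi \<phi>) = Psi \<phi>"
proof
  fix \<eta> show "sInd_act m n d W (Psi \<phi>) \<eta> = Psi \<phi> \<eta>"
  proof (cases "\<eta> \<in> S")
    case True
    have W: "\<eta> \<circ> W \<in> S" by (rule schur_alg_comp[OF True W_schur])
    show ?thesis
      unfolding sInd_act_W[OF Psi_lin[OF \<phi>] True]
    proof
      fix x
      show "Psi \<phi> (\<eta> \<circ> W) x = Psi \<phi> \<eta> x"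
        unfolding Psi_apply[OF True] Psi_apply[OF W]
        by (rule sum.cong[OF refl]) (simp only: coef_comp_W[OF True])
    qed
  next
    case False
    then show ?thesis unfolding Psi_out[OF False] sInd_act_def by (simp only: if_False)
  qed
qed

lemma Nop_W: "\<beta> \<in> Qk \<Longrightarrow> Nop \<beta> \<circ> W = Nop \<beta>"
proof -
  assume \<beta>: "\<beta> \<in> Qk"
  have "Nop \<beta> \<circ> W = (\<Sum>\<beta>'\<in>Qk. coef (Nop \<beta>) \<beta>' *\<^sub>C Nop \<beta>')"
    by (rule comp_W_expand[OF Nop_schur])
  also have "\<dots> = (\<Sum>\<beta>'\<in>Qk. if \<beta>' = \<beta> then Nop \<beta> else 0)"
  proof (rule sum.cong[OF refl])
    fix \<beta>' assume "\<beta>' \<in> Qk"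
    then have "coef (Nop \<beta>) \<beta>' = of_bool (\<beta>' = \<beta>)" by (rule coef_Nop)
    then show "coef (Nop \<beta>) \<beta>' *\<^sub>C Nop \<beta>' = (if \<beta>' = \<beta> then Nop \<beta> else 0)"
      by (cases "\<beta>' = \<beta>") (simp_all only: simp_thms of_bool_eq if_True if_False scaleC_one cv.scale_zero_left)
  qed
  also have "\<dots> = Nop \<beta>" using finite_Qk \<beta> by (simp only: sum.delta if_True)
  finally show ?thesis .
qed

lemma ge_Nop:
  assumes g: "gperm g" and \<beta>: "\<beta> \<in> Qk"
  shows "ge g \<circ> Nop \<beta> = eps g \<beta> *\<^sub>C Nop (\<beta> \<circ> inv g)"
proof -
  have S: "ge g \<circ> Nop \<beta> \<in> S" by (rule schur_alg_comp[OF ge_schur[OF g] Nop_schur])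
  have "ge g \<circ> Nop \<beta> = ge g \<circ> Nop \<beta> \<circ> W"
    using Nop_W[OF \<beta>] by (simp only: comp_assoc)
  also have "\<dots> = (\<Sum>\<beta>'\<in>Qk. coef (ge g \<circ> Nop \<beta>) \<beta>' *\<^sub>C Nop \<beta>')"
    by (rule comp_W_expand[OF S])
  also have "\<dots> = (\<Sum>\<beta>'\<in>Qk. coef (ge g \<circ> Nop \<beta>) (\<beta>' \<circ> inv g) *\<^sub>C Nop (\<beta>' \<circ> inv g))"
    by (rule sum.reindex_bij_betw[OF bij_Qk[OF g], symmetric])
  also have "\<dots> = (\<Sum>\<beta>'\<in>Qk. if \<beta>' = \<beta> then eps g \<beta> *\<^sub>C Nop (\<beta> \<circ> inv g) else 0)"
  proof (rule sum.cong[OF refl])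
    fix \<beta>' assume \<beta>': "\<beta>' \<in> Qk"
    have c: "coef (ge g \<circ> Nop \<beta>) (\<beta>' \<circ> inv g) = eps g \<beta>' * of_bool (\<beta>' = \<beta>)"
      unfolding coef_ge[OF g Nop_schur \<beta>'] coef_Nop[OF \<beta>'] ..
    show "coef (ge g \<circ> Nop \<beta>) (\<beta>' \<circ> inv g) *\<^sub>C Nop (\<beta>' \<circ> inv g) =
        (if \<beta>' = \<beta> then eps g \<beta> *\<^sub>C Nop (\<beta> \<circ> inv g) else 0)"
      unfolding c by (cases "\<beta>' = \<beta>") (simp_all only: simp_thms of_bool_eq if_True if_False mult_1_right mult_zero_right cv.scale_zero_left)
  qed
  also have "\<dots> = eps g \<beta> *\<^sub>C Nop (\<beta> \<circ> inv g)"
    using finite_Qk \<beta> by (simp only: sum.delta if_True)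
  finally show ?thesis .
qed

text \<open>Since \<open>\<eta> \<circ> W\<close> is a combination of the
  \<open>Nop \<beta>\<close>, the function acted on by \<open>W\<close> is determined by its values
  there. Applying \<open>f\<close> to the relation \<open>ge_Nop\<close> gives the equivariance of
  these values.\<close>

lemma sInd_W_Psi:
  assumes f: "f \<in> sInd m n d U outer_act"
  shows "\<exists>\<phi>\<in>A.equi_maps. sInd_act m n d W f = Psi \<phi>"
proof -
  have lin: "f \<in> lin_maps S U" using f unfolding sInd_def by blast
  have equi: "f (grp_emb m n d \<tau> \<sigma> \<circ> \<eta>) = outer_act \<tau> \<sigma> (f \<eta>)"
    if "\<tau> permutes {..<m}" "\<sigma> permutes {..<n}" "\<eta> \<in> S" for \<tau> \<sigma> \<eta>
    using f that unfolding sInd_def by blast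
  define \<phi> where "\<phi> = (\<lambda>(\<beta>, x). if \<beta> \<in> Qk then f (Nop \<beta>) x else 0)"
  have fU: "f (Nop \<beta>) \<in> U" for \<beta> by (rule lin_mapsD(3)[OF lin Nop_schur])
  have "\<phi> \<in> A.equi_maps"
    unfolding A.equi_maps_def
  proof (rule CollectI, intro conjI allI ballI impI)
    fix q x assume "(q, x) \<notin> Qk \<times> X"
    then have "q \<notin> Qk \<or> x \<notin> X" by simp
    then show "\<phi> (q, x) = 0" using A.suppU[OF fU[of q], of x] by (auto simp: \<phi>_def)
  next
    fix q assume q: "q \<in> Qk"
    have "(\<lambda>x. \<phi> (q, x)) = f (Nop q)" using q by (simp add: \<phi>_def)
    then show "(\<lambda>x. \<phi> (q, x)) \<in> U" using fU by (simp only:)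
  next
    fix p q x assume p: "p \<in> G" and q: "q \<in> Qk" and "x \<in> X"
    have g: "gperm (gi p)" by (rule gperm_gi[OF p])
    have pp: "fst p permutes {..<m}" "snd p permutes {..<n}" using p by (auto simp: G_def)
    have "eps (gi p) q *\<^sub>C f (Nop (q \<circ> inv (gi p))) = f (eps (gi p) q *\<^sub>C Nop (q \<circ> inv (gi p)))"
      by (rule lin_mapsD(2)[OF lin Nop_schur, symmetric])
    also have "\<dots> = outer_act (fst p) (snd p) (f (Nop q))"
      unfolding ge_Nop[OF g q, symmetric] grp_emb_ge[symmetric] by (rule equi[OF pp Nop_schur])
    finally have "eps (gi p) q * f (Nop (q \<circ> inv (gi p))) x = outer_act (fst p) (snd p) (f (Nop q)) x"
      by (metis scaleC_fun_apply scaleC_complex)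
    then have "eps (gi p) q * f (Nop (q \<circ> inv (gi p))) x = f (Nop q) (fst x \<circ> fst p, snd x \<circ> snd p)"
      by (simp add: outer_act_def case_prod_unfold)
    then have "eps (gi p) q * (eps (gi p) q * f (Nop (q \<circ> inv (gi p))) x) =
        eps (gi p) q * f (Nop q) (fst x \<circ> fst p, snd x \<circ> snd p)" by (rule arg_cong)
    then have "f (Nop (q \<circ> inv (gi p))) x = eps (gi p) q * f (Nop q) (fst x \<circ> fst p, snd x \<circ> snd p)"
      by (simp only: mult.assoc[symmetric] eps_sq[OF g q] mult_1)
    then show "\<phi> (q \<circ> inv (gi p), x) = eps (gi p) q * \<phi> (q, (fst x \<circ> fst p, snd x \<circ> snd p))"
      using q Qk_act[OF g q] by (simp add: \<phi>_def)
  qed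
  moreover have "sInd_act m n d W f = Psi \<phi>"
  proof
    fix \<eta> show "sInd_act m n d W f \<eta> = Psi \<phi> \<eta>"
    proof (cases "\<eta> \<in> S")
      case True
      have "f (\<eta> \<circ> W) = (\<Sum>\<beta>\<in>Qk. coef \<eta> \<beta> *\<^sub>C f (Nop \<beta>))"
        unfolding comp_W_expand[OF True] by (rule lin_maps_sum[OF lin subspace_S]) (rule Nop_schur)
      also have "\<dots> = Psi \<phi> \<eta>"
        by (intro ext) (simp add: Psi_apply[OF True] sum_fun_apply \<phi>_def)
      finally show ?thesis unfolding sInd_act_W[OF lin True] .
    next
      case False
      then show ?thesis unfolding Psi_out[OF False] sInd_act_def by (simp only: if_False)
    qed
  qed
  ultimately show ?thesis by blast
qed

lemma inj_Psi: "inj_on Psi A.equi_maps"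
proof (rule inj_onI)
  fix \<phi> \<psi> assume \<phi>: "\<phi> \<in> A.equi_maps" and \<psi>: "\<psi> \<in> A.equi_maps" and e: "Psi \<phi> = Psi \<psi>"
  \<comment> \<open>The coordinates of \<open>Nop \<beta>\<close> are those of a unit vector, so
    evaluation there recovers the values of the equivariant map.\<close>
  have v: "Psi \<chi> (Nop \<beta>) x = \<chi> (\<beta>, x)" if "\<beta> \<in> Qk" for \<chi> \<beta> x
  proof -
    have "Psi \<chi> (Nop \<beta>) x = (\<Sum>\<beta>'\<in>Qk. if \<beta>' = \<beta> then \<chi> (\<beta>, x) else 0)"
      unfolding Psi_apply[OF Nop_schur] by (rule sum.cong[OF refl]) (simp add: coef_Nop)
    then show ?thesis using finite_Qk that by (simp add: sum.delta)
  qed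
  show "\<phi> = \<psi>"
  proof (rule ext, clarify)
    fix \<beta> r s
    show "\<phi> (\<beta>, r, s) = \<psi> (\<beta>, r, s)"
    proof (cases "\<beta> \<in> Qk")
      case True
      then show ?thesis using v[OF True, of \<phi> "(r, s)"] v[OF True, of \<psi> "(r, s)"] unfolding e by simp
    next
      case False
      then have "\<phi> (\<beta>, r, s) = 0" "\<psi> (\<beta>, r, s) = 0"
        using \<phi> \<psi> unfolding A.equi_maps_def by blast+
      then show ?thesis by simp
    qed
  qed
qed

text \<open>\<open>Psi\<close> identifies the weight space with the equivariant maps. In the trace
  formula the kernel is a product, so the trace splits into the two Specht characters, and
  \<open>card G\<close> supplies the two factorials.\<close>

lemma dim_weight_space:
  "of_nat (cv.dim (sInd_act m n d (weight_proj m n d \<kappa>) ` sInd m n d U outer_act)) =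
    (\<Sum>\<tau> | \<tau> permutes {..<m}. \<Sum>\<sigma> | \<sigma> permutes {..<n}.
      (\<Sum>r\<in>row_maps m. K1 r (r \<circ> \<tau>)) / fact m * ((\<Sum>s\<in>row_maps n. K2 s (s \<circ> \<sigma>)) / fact n) *
      (\<Sum>\<beta> | \<beta> \<in> Qk \<and> \<beta> \<circ> idx_perm m \<tau> \<sigma> = \<beta>. eps (idx_perm m \<tau> \<sigma>) \<beta>))"
proof -
  have "sInd_act m n d W ` sInd m n d U outer_act = Psi ` A.equi_maps"
  proof (intro equalityI image_subsetI)
    fix f assume "f \<in> sInd m n d U outer_act"
    then show "sInd_act m n d W f \<in> Psi ` A.equi_maps" using sInd_W_Psi by blast
  next
    fix \<phi> assume \<phi>: "\<phi> \<in> A.equi_maps"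
    show "Psi \<phi> \<in> sInd_act m n d W ` sInd m n d U outer_act"
      by (rule image_eqI[of "Psi \<phi>" "sInd_act m n d W" "Psi \<phi>", OF Psi_W[OF \<phi>, symmetric] Psi_sInd[OF \<phi>]])
  qed
  then have "cv.dim (sInd_act m n d W ` sInd m n d U outer_act) = cv.dim A.equi_maps"
    using dim_image_inj_on[OF linear_Psi A.subspace_equi_maps inj_Psi] by simp
  then have "of_nat (cv.dim (sInd_act m n d W ` sInd m n d U outer_act)) = (\<Sum>g\<in>G.
      (\<Sum>q | q \<in> Qk \<and> q \<circ> inv (gi g) = q. eps (gi g) q) *
      (\<Sum>x\<in>X. (\<lambda>(r, s) (r', s'). K1 r r' * K2 s s') x (fst x \<circ> fst g, snd x \<circ> snd g))) / of_nat (card G)"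
    using A.dim_equi_maps by simp
  also have "\<dots> = (\<Sum>g\<in>G. (\<Sum>r\<in>row_maps m. K1 r (r \<circ> fst g)) / fact m *
      ((\<Sum>s\<in>row_maps n. K2 s (s \<circ> snd g)) / fact n) *
      (\<Sum>\<beta> | \<beta> \<in> Qk \<and> \<beta> \<circ> gi g = \<beta>. eps (gi g) \<beta>))"
    unfolding sum_divide_distrib[of _ G]
  proof (rule sum.cong[OF refl])
    fix g assume g: "g \<in> G"
    have p: "gi g permutes {..<m + n}" using gperm_gi[OF g] by (simp add: gperm_def)
    have iff: "q \<circ> inv (gi g) = q \<longleftrightarrow> q \<circ> gi g = q" for q :: "nat \<Rightarrow> nat multiset"
    proof -
      have "q \<circ> inv (gi g) = q \<longleftrightarrow> q \<circ> inv (gi g) \<circ> gi g = q \<circ> gi g"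
        by (rule permutes_comp_cancel[OF p, symmetric])
      moreover have "q \<circ> inv (gi g) \<circ> gi g = q" by (simp add: comp_assoc permutes_inv_o[OF p])
      ultimately show ?thesis by (simp only: eq_commute[of q "q \<circ> gi g"])
    qed
    have c: "(\<Sum>x\<in>X. (\<lambda>(r, s) (r', s'). K1 r r' * K2 s s') x (fst x \<circ> fst g, snd x \<circ> snd g)) =
        (\<Sum>r\<in>row_maps m. K1 r (r \<circ> fst g)) * (\<Sum>s\<in>row_maps n. K2 s (s \<circ> snd g))"
      unfolding X_def sum_product sum.cartesian_product by (rule sum.cong[OF refl]) auto
    have card: "of_nat (card G) = (fact m * fact n :: complex)"
      unfolding G_def card_cartesian_product by (simp add: card_permutations)
    show "(\<Sum>q | q \<in> Qk \<and> q \<circ> inv (gi g) = q. eps (gi g) q) *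
        (\<Sum>x\<in>X. (\<lambda>(r, s) (r', s'). K1 r r' * K2 s s') x (fst x \<circ> fst g, snd x \<circ> snd g)) / of_nat (card G) =
      (\<Sum>r\<in>row_maps m. K1 r (r \<circ> fst g)) / fact m * ((\<Sum>s\<in>row_maps n. K2 s (s \<circ> snd g)) / fact n) *
      (\<Sum>\<beta> | \<beta> \<in> Qk \<and> \<beta> \<circ> gi g = \<beta>. eps (gi g) \<beta>)"
      unfolding c card iff
      by (simp only: times_divide_eq_left times_divide_eq_right divide_divide_eq_left mult.commute[of "fact n"] ac_simps)
  qed
  also have "\<dots> = (\<Sum>\<tau> | \<tau> permutes {..<m}. \<Sum>\<sigma> | \<sigma> permutes {..<n}.
      (\<Sum>r\<in>row_maps m. K1 r (r \<circ> \<tau>)) / fact m * ((\<Sum>s\<in>row_maps n. K2 s (s \<circ> \<sigma>)) / fact n) *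
      (\<Sum>\<beta> | \<beta> \<in> Qk \<and> \<beta> \<circ> idx_perm m \<tau> \<sigma> = \<beta>. eps (idx_perm m \<tau> \<sigma>) \<beta>))"
    unfolding G_def sum.cartesian_product by (rule sum.cong[OF refl]) (simp only: case_prod_unfold)
  finally show ?thesis unfolding W_def .
qed

end

section \<open>The character formula\<close>

lemma scaleC_mult_mps: "(a *\<^sub>C f) * (b *\<^sub>C g) = (a * b) *\<^sub>C (f * g)" for f g :: mps
  by (rule mps_eqI)
     (simp add: times_mps.rep_eq scaleC_mps.rep_eq sum_distrib_left case_prod_unfold ac_simps)

lemma orbit_idx_left:
  assumes \<tau>: "\<tau> permutes {..<m}" and i: "i < m"
  shows "orbit (idx_perm m \<tau> \<sigma>) i = orbit \<tau> i"
proof -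
  have "(idx_perm m \<tau> \<sigma> ^^ k) i = (\<tau> ^^ k) i \<and> (\<tau> ^^ k) i < m" for k
    by (induction k) (simp_all add: i idx_perm_def permutes_lessThan[OF \<tau>])
  then show ?thesis unfolding orbit_altdef by simp
qed

lemma orbit_idx_right: "orbit (idx_perm m \<tau> \<sigma>) (m + j) = (+) m ` orbit \<sigma> j"
proof -
  have "(idx_perm m \<tau> \<sigma> ^^ k) (m + j) = m + (\<sigma> ^^ k) j" for k
    by (induction k) (simp_all add: idx_perm_def)
  then show ?thesis unfolding orbit_altdef by auto
qed

lemma orbits_idx:
  assumes \<tau>: "\<tau> permutes {..<m}"
  shows "orbits (idx_perm m \<tau> \<sigma>) {..<m + n} = orbits \<tau> {..<m} \<union> image ((+) m) ` orbits \<sigma> {..<n}"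
proof -
  have e: "{..<m + n} = {..<m} \<union> (+) m ` {..<n}"
  proof (intro equalityI subsetI)
    fix i assume i: "i \<in> {..<m + n}"
    show "i \<in> {..<m} \<union> (+) m ` {..<n}"
    proof (cases "i < m")
      case False
      then have "i = m + (i - m)" "i - m < n" using i by auto
      then show ?thesis by blast
    qed simp
  qed auto
  have "orbits (idx_perm m \<tau> \<sigma>) {..<m} = orbits \<tau> {..<m}"
    by (rule image_cong[OF refl]) (simp add: orbit_idx_left[OF \<tau>])
  moreover have "orbits (idx_perm m \<tau> \<sigma>) ((+) m ` {..<n}) = image ((+) m) ` orbits \<sigma> {..<n}"
    unfolding image_image orbit_idx_right ..
  ultimately show ?thesis unfolding e image_Un by simp
qed

context super_weight
begin

text \<open>All rows in the orbit \<open>B\<close> have the same parity, and \<open>rep B\<close>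
  decides it.\<close>

definition hrow :: "nat set \<Rightarrow> mps" where
  "hrow B = (if rep B < m then H_series m n else E_series m n)"

text \<open>Both p_k[.] and p_k{.} put the sign (-1)^(k-1) on exactly the variables whose parity
  differs from that of the row type, which is \<open>osign\<close>. The two products therefore merge
  into one over the orbits of the combined permutation.\<close>

lemma prod_orbits_split:
  assumes \<tau>: "\<tau> permutes {..<m}" and \<sigma>: "\<sigma> permutes {..<n}"
  shows "(\<Prod>B\<in>orbits \<tau> {..<m}. pow_bracket m (card B) (H_series m n)) *
      (\<Prod>B\<in>orbits \<sigma> {..<n}. pow_brace m (card B) (E_series m n)) =
    (\<Prod>B\<in>orbits (idx_perm m \<tau> \<sigma>) {..<m + n}. subst_pow (osign B) (card B) (hrow B))"
proof -
  interpret a: finite_perm \<tau> "{..<m}" by unfold_locales (simp_all add: \<tau>)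
  interpret b: finite_perm \<sigma> "{..<n}" by unfold_locales (simp_all add: \<sigma>)
  let ?F = "\<lambda>B. subst_pow (osign B) (card B) (hrow B)"
  let ?I = "image ((+) m) :: nat set \<Rightarrow> nat set"
  have 1: "pow_bracket m (card B) (H_series m n) = ?F B" if B: "B \<in> orbits \<tau> {..<m}" for B
  proof -
    have r: "rep B < m" using a.rep_S[OF B] by simp
    then have "osign B = (\<lambda>j. if j < m then 1 else (-1) ^ (card B - 1))"
      by (auto simp: fun_eq_iff opair_iff)
    then show ?thesis using r by (simp add: pow_bracket_def hrow_def)
  qed
  have 2: "pow_brace m (card B) (E_series m n) = ?F (?I B)" if B: "B \<in> orbits \<sigma> {..<n}" for B
  proof -
    have "B \<noteq> {}" using b.rep_in[OF B] by blast
    then have "?I B \<noteq> {}" by simp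
    then have "rep (?I B) \<in> ?I B" unfolding rep_def by (rule some_in_eq[THEN iffD2])
    then have r: "\<not> rep (?I B) < m" by auto
    have c: "card (?I B) = card B" by (rule card_image) simp
    have "osign (?I B) = (\<lambda>j. if j < m then (-1) ^ (card B - 1) else 1)"
      using r by (auto simp: fun_eq_iff opair_iff c)
    then show ?thesis using r by (simp add: pow_brace_def hrow_def c)
  qed
  have disj: "orbits \<tau> {..<m} \<inter> ?I ` orbits \<sigma> {..<n} = {}"
  proof (rule ccontr)
    assume "orbits \<tau> {..<m} \<inter> ?I ` orbits \<sigma> {..<n} \<noteq> {}"
    then obtain B B' where B: "B \<in> orbits \<tau> {..<m}" "B = ?I B'" by blast
    have "rep B < m" "rep B \<in> ?I B'" using a.rep_S[OF B(1)] a.rep_in[OF B(1)] B(2) by auto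
    then show False by auto
  qed
  have inj: "inj_on ?I (orbits \<sigma> {..<n})"
    by (rule inj_onI) (simp add: inj_image_eq_iff)
  have "(\<Prod>B\<in>orbits (idx_perm m \<tau> \<sigma>) {..<m + n}. ?F B) =
      (\<Prod>B\<in>orbits \<tau> {..<m}. ?F B) * (\<Prod>B\<in>?I ` orbits \<sigma> {..<n}. ?F B)"
    unfolding orbits_idx[OF \<tau>] by (rule prod.union_disjoint[OF a.finite_orbits _ disj]) (simp add: b.finite_orbits)
  also have "(\<Prod>B\<in>?I ` orbits \<sigma> {..<n}. ?F B) = (\<Prod>B\<in>orbits \<sigma> {..<n}. ?F (?I B))"
    by (rule prod.reindex[OF inj, unfolded comp_def])
  also have "\<dots> = (\<Prod>B\<in>orbits \<sigma> {..<n}. pow_brace m (card B) (E_series m n))"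
    by (rule prod.cong[OF refl 2[symmetric]])
  also have "(\<Prod>B\<in>orbits \<tau> {..<m}. ?F B) = (\<Prod>B\<in>orbits \<tau> {..<m}. pow_bracket m (card B) (H_series m n))"
    by (rule prod.cong[OF refl 1[symmetric]])
  finally show ?thesis by simp
qed

text \<open>The coefficient is a sum over families of monomials constant on the orbits. The
  coefficients of H and E are the indicator of the row condition, tested once per orbit, so fixed
  elements of \<open>Qk\<close> remain, and the product of the signs is \<open>eps\<close> by the
  rotation of blocks.\<close>

lemma mcoeff_prod_hrow:
  assumes g: "gperm g"
  shows "mcoeff (\<Prod>B\<in>orbits g {..<m + n}. subst_pow (osign B) (card B) (hrow B)) \<kappa> =
    (\<Sum>\<beta> | \<beta> \<in> Qk \<and> \<beta> \<circ> g = \<beta>. eps g \<beta>)"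
proof -
  interpret finite_perm g "{..<m + n}" using g by unfold_locales (simp_all add: gperm_def)
  let ?O = "orbits g {..<m + n}" and ?I = "invariant_splits g {..<m + n} \<kappa>"
  let ?A = "\<lambda>b. admissible m n (if b < m then (\<lambda>j. m \<le> j) else (\<lambda>j. j < m))"
  have finI: "finite ?I"
    unfolding invariant_splits_def by (rule finite_subset[OF _ finite_splits_fun[of "{..<m + n}" \<kappa>]]) auto
  have h: "mcoeff (hrow B) \<gamma> = of_bool (?A (rep B) \<gamma>)" for B \<gamma>
    by (simp add: hrow_def mcoeff_H_series mcoeff_E_series)
  have inv: "(\<lambda>b. b < m) \<circ> g = (\<lambda>b. b < m)" using g by (simp add: gperm_def fun_eq_iff)
  have Q: "\<alpha> \<in> Qk \<longleftrightarrow> (\<forall>B\<in>?O. ?A (rep B) (\<alpha> (rep B)))" if \<alpha>: "\<alpha> \<in> ?I" for \<alpha>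
  proof -
    have fixed: "\<alpha> \<circ> g = \<alpha>" and sp: "\<alpha> \<in> splits {..<m + n} \<kappa>" using \<alpha> by (simp_all add: invariant_splits_def)
    have "(\<forall>b<m + n. ?A b (\<alpha> b)) \<longleftrightarrow> (\<forall>B\<in>?O. ?A (rep B) (\<alpha> (rep B)))"
    proof
      assume L: "\<forall>b<m + n. ?A b (\<alpha> b)"
      show "\<forall>B\<in>?O. ?A (rep B) (\<alpha> (rep B))"
      proof
        fix B assume "B \<in> ?O"
        then have "rep B < m + n" using rep_S by simp
        then show "?A (rep B) (\<alpha> (rep B))" using L by blast
      qed
    next
      assume R: "\<forall>B\<in>?O. ?A (rep B) (\<alpha> (rep B))"
      show "\<forall>b<m + n. ?A b (\<alpha> b)"
      proof (intro allI impI)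
        fix b assume b: "b < m + n"
        then have B: "orbit g b \<in> ?O" by simp
        have "\<alpha> b = \<alpha> (rep (orbit g b))" by (rule invariant_rep[OF fixed B orbit_self])
        moreover have "(b < m) = (rep (orbit g b) < m)" by (rule invariant_rep[OF inv B orbit_self])
        ultimately show "?A b (\<alpha> b)" using bspec[OF R B] by simp
      qed
    qed
    then show ?thesis using sp unfolding Qk_def by blast
  qed
  have "mcoeff (\<Prod>B\<in>?O. subst_pow (osign B) (card B) (hrow B)) \<kappa> =
      (\<Sum>\<alpha>\<in>?I. \<Prod>B\<in>?O. (\<Prod>a\<in>#\<alpha> (rep B). osign B a) * mcoeff (hrow B) (\<alpha> (rep B)))"
    by (rule mcoeff_orbit_prod)
  also have "\<dots> = (\<Sum>\<alpha>\<in>{\<beta>. \<beta> \<in> Qk \<and> \<beta> \<circ> g = \<beta>}. eps g \<alpha>)"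
  proof (rule sum.mono_neutral_cong_right[OF finI])
    show "{\<beta>. \<beta> \<in> Qk \<and> \<beta> \<circ> g = \<beta>} \<subseteq> ?I" by (auto simp: invariant_splits_def Qk_def)
    show "\<forall>\<alpha>\<in>?I - {\<beta>. \<beta> \<in> Qk \<and> \<beta> \<circ> g = \<beta>}.
        (\<Prod>B\<in>?O. (\<Prod>a\<in>#\<alpha> (rep B). osign B a) * mcoeff (hrow B) (\<alpha> (rep B))) = 0"
    proof
      fix \<alpha> assume \<alpha>: "\<alpha> \<in> ?I - {\<beta>. \<beta> \<in> Qk \<and> \<beta> \<circ> g = \<beta>}"
      then have "\<alpha> \<notin> Qk" unfolding invariant_splits_def by blast
      then obtain B where B: "B \<in> ?O" "\<not> ?A (rep B) (\<alpha> (rep B))" using Q \<alpha> by blast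
      then have "(\<Prod>a\<in>#\<alpha> (rep B). osign B a) * mcoeff (hrow B) (\<alpha> (rep B)) = 0" unfolding h by simp
      then show "(\<Prod>B\<in>?O. (\<Prod>a\<in>#\<alpha> (rep B). osign B a) * mcoeff (hrow B) (\<alpha> (rep B))) = 0"
        by (intro prod_zero[OF finite_orbits] bexI[OF _ B(1)])
    qed
    fix \<alpha> assume "\<alpha> \<in> {\<beta>. \<beta> \<in> Qk \<and> \<beta> \<circ> g = \<beta>}"
    then have \<alpha>: "\<alpha> \<in> Qk" "\<alpha> \<circ> g = \<alpha>" by auto
    then have I: "\<alpha> \<in> ?I" by (simp add: invariant_splits_def Qk_def)
    show "(\<Prod>B\<in>?O. (\<Prod>a\<in>#\<alpha> (rep B). osign B a) * mcoeff (hrow B) (\<alpha> (rep B))) = eps g \<alpha>"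
      unfolding eps_fixed[OF g \<alpha>]
    proof (rule prod.cong[OF refl])
      fix B assume "B \<in> ?O"
      then have "?A (rep B) (\<alpha> (rep B))" using Q[OF I] \<alpha>(1) by blast
      then show "(\<Prod>a\<in>#\<alpha> (rep B). osign B a) * mcoeff (hrow B) (\<alpha> (rep B)) = (\<Prod>a\<in>#\<alpha> (rep B). osign B a)"
        unfolding h by simp
    qed
  qed
  finally show ?thesis .
qed

text \<open>The series live in infinitely many variables, so monomials with a variable outside the
  first \<open>m + n\<close> must be shown to have coefficient 0 on the plethysm side as
  well.\<close>

lemma Qk_empty:
  assumes "\<kappa> \<notin> weights m n d"
  shows "Qk = {}"
proof (rule ccontr)
  assume "Qk \<noteq> {}"
  then obtain \<beta> where \<beta>: "\<beta> \<in> Qk" by blast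
  then have sum: "(\<Sum>b<m + n. \<beta> b) = \<kappa>" and adm: "\<And>b. b < m + n \<Longrightarrow> set_mset (\<beta> b) \<subseteq> {..<m + n}"
    by (auto simp: Qk_def splits_def admissible_def)
  have "set_mset \<kappa> \<subseteq> {..<m + n}"
    unfolding sum[symmetric] using adm by (auto simp: set_mset_sum)
  then show False using assms size by (simp add: weights_def)
qed

end

lemma finite_weights: "finite (weights m n d)"
proof (rule finite_subset)
  show "weights m n d \<subseteq> mset ` words m n d"
  proof
    fix \<kappa> assume \<kappa>: "\<kappa> \<in> weights m n d"
    obtain w where "mset w = \<kappa>" using ex_mset by blast
    then show "\<kappa> \<in> mset ` words m n d"
      using \<kappa> by (intro image_eqI[of _ _ w]) (auto simp: weights_def words_def simp flip: size_mset)
  qed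
  show "finite (mset ` words m n d)" by (intro finite_imageI super_words.finite_words)
qed

lemma mcoeff_weight_monomial:
  assumes \<kappa>: "set_mset \<kappa> \<subseteq> {..<m + n}"
  shows "mcoeff ((\<Prod>i<m. mvar i ^ count \<kappa> i) * (\<Prod>j<n. mvar (m + j) ^ count \<kappa> (m + j))) \<kappa>' = of_bool (\<kappa>' = \<kappa>)"
proof -
  have p: "mvar i ^ k = univ_series (\<lambda>l. of_bool (l = k)) i" for i k
  proof (rule mps_eqI)
    fix \<gamma> :: "nat multiset"
    have "\<gamma> = replicate_mset k i \<longleftrightarrow> set_mset \<gamma> \<subseteq> {i} \<and> count \<gamma> i = k"
    proof
      assume "set_mset \<gamma> \<subseteq> {i} \<and> count \<gamma> i = k"
      then show "\<gamma> = replicate_mset k i" by (auto simp: multiset_eq_iff count_eq_zero_iff)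
    qed auto
    then show "mcoeff (mvar i ^ k) \<gamma> = mcoeff (univ_series (\<lambda>l. of_bool (l = k)) i) \<gamma>"
      by (simp add: mcoeff_mvar_power univ_series.rep_eq)
  qed
  have "(\<Prod>i<m. mvar i ^ count \<kappa> i) * (\<Prod>j<n. mvar (m + j) ^ count \<kappa> (m + j)) = (\<Prod>i<m + n. mvar i ^ count \<kappa> i)"
    by (rule prod_split_add[of "\<lambda>i. mvar i ^ count \<kappa> i"])
  then have e: "mcoeff ((\<Prod>i<m. mvar i ^ count \<kappa> i) * (\<Prod>j<n. mvar (m + j) ^ count \<kappa> (m + j))) \<kappa>' =
      (if set_mset \<kappa>' \<subseteq> {..<m + n} then \<Prod>i<m + n. of_bool (count \<kappa>' i = count \<kappa> i) else 0)"
    unfolding p by (simp only: mcoeff_prod_univ[OF finite_lessThan])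
  show ?thesis
  proof (cases "\<kappa>' = \<kappa>")
    case True
    then show ?thesis unfolding e using \<kappa> by simp
  next
    case False
    have "(\<Prod>i<m + n. of_bool (count \<kappa>' i = count \<kappa> i)) = (0 :: complex)" if s: "set_mset \<kappa>' \<subseteq> {..<m + n}"
    proof -
      obtain x where x: "count \<kappa>' x \<noteq> count \<kappa> x" using False by (auto simp: multiset_eq_iff)
      then have "x \<in># \<kappa>' \<or> x \<in># \<kappa>" by (metis count_eq_zero_iff)
      then have "x \<in> {..<m + n}" using s \<kappa> by blast
      then show ?thesis by (intro prod_zero bexI[of _ x]) (use x in auto)
    qed
    then show ?thesis unfolding e using False by simp
  qed
qed

lemma mcoeff_fchar:
  "mcoeff (fchar m n d act V) \<kappa> =
    (if \<kappa> \<in> weights m n d then of_nat (cv.dim (act (weight_proj m n d \<kappa>) ` V)) else 0)"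
proof -
  have "mcoeff (fchar m n d act V) \<kappa> =
      (\<Sum>\<kappa>'\<in>weights m n d. if \<kappa>' = \<kappa> then of_nat (cv.dim (act (weight_proj m n d \<kappa>) ` V)) else 0)"
    unfolding fchar_def mcoeff_sum scaleC_mps.rep_eq
  proof (rule sum.cong[OF refl])
    fix \<kappa>' assume "\<kappa>' \<in> weights m n d"
    then have "set_mset \<kappa>' \<subseteq> {..<m + n}" by (simp add: weights_def)
    from mcoeff_weight_monomial[OF this, of \<kappa>]
    show "of_nat (cv.dim (act (weight_proj m n d \<kappa>') ` V)) *
        mcoeff ((\<Prod>i<m. mvar i ^ count \<kappa>' i) * (\<Prod>j<n. mvar (m + j) ^ count \<kappa>' (m + j))) \<kappa> =
      (if \<kappa>' = \<kappa> then of_nat (cv.dim (act (weight_proj m n d \<kappa>) ` V)) else 0)"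
      by auto
  qed
  then show ?thesis using finite_weights by (simp add: sum.delta)
qed

theorem corollary3p12:
  fixes m n d :: nat and \<mu> \<nu> :: "nat list"
  assumes "d \<ge> 1" and "is_partition \<mu> m" and "is_partition \<nu> n"
  shows "fchar m n d (sInd_act m n d) (sInd m n d (outer_tensor (specht \<mu>) (specht \<nu>)) outer_act) =
    homog_part d (plethysm (pow_bracket m) (schur \<mu>) (H_series m n) *
                  plethysm (pow_brace m) (schur \<nu>) (E_series m n))"
proof -
  obtain K1 where kern1: "proj_kernel (row_maps m) (specht \<mu>) K1"
    "\<forall>\<pi> r s. \<pi> permutes {..<m} \<longrightarrow> K1 (r \<circ> \<pi>) (s \<circ> \<pi>) = K1 r s"
    using specht_kernel_exists[OF assms(2)] by (elim exE conjE)
  obtain K2 where kern2: "proj_kernel (row_maps n) (specht \<nu>) K2"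
    "\<forall>\<pi> r s. \<pi> permutes {..<n} \<longrightarrow> K2 (r \<circ> \<pi>) (s \<circ> \<pi>) = K2 r s"
    using specht_kernel_exists[OF assms(3)] by (elim exE conjE)
  let ?V = "sInd m n d (outer_tensor (specht \<mu>) (specht \<nu>)) outer_act"
  let ?R = "plethysm (pow_bracket m) (schur \<mu>) (H_series m n) * plethysm (pow_brace m) (schur \<nu>) (E_series m n)"
  let ?a = "\<lambda>\<tau>. (\<Sum>r\<in>row_maps m. K1 r (r \<circ> \<tau>)) / fact m" and ?b = "\<lambda>\<sigma>. (\<Sum>s\<in>row_maps n. K2 s (s \<circ> \<sigma>)) / fact n"
  show ?thesis
  proof (rule mps_eqI)
    fix \<kappa>
    show "mcoeff (fchar m n d (sInd_act m n d) ?V) \<kappa> = mcoeff (homog_part d ?R) \<kappa>"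
    proof (cases "size \<kappa> = d")
      case False
      then show ?thesis by (simp add: mcoeff_fchar weights_def homog_part.rep_eq)
    next
      case True
      \<comment> \<open>Only the degree of \<open>\<kappa>\<close> is fixed by the locale. This
        permits one expansion of the right-hand side for all monomials of degree \<open>d\<close>;
        whether \<open>\<kappa>\<close> is a weight is decided afterwards.\<close>
      interpret super_induced m n d \<kappa> \<mu> \<nu> K1 K2
        by unfold_locales (fact True assms(2,3) kern1 kern2)+
      have "mcoeff ?R \<kappa> = (\<Sum>\<tau> | \<tau> permutes {..<m}. \<Sum>\<sigma> | \<sigma> permutes {..<n}. ?a \<tau> * ?b \<sigma> *
          mcoeff ((\<Prod>B\<in>orbits \<tau> {..<m}. pow_bracket m (card B) (H_series m n)) *
            (\<Prod>B\<in>orbits \<sigma> {..<n}. pow_brace m (card B) (E_series m n))) \<kappa>)"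
        unfolding plethysm_schur[OF assms(2) kern1] plethysm_schur[OF assms(3) kern2] sum_product scaleC_mult_mps
          mcoeff_sum scaleC_mps.rep_eq ..
      also have "\<dots> = (\<Sum>\<tau> | \<tau> permutes {..<m}. \<Sum>\<sigma> | \<sigma> permutes {..<n}. ?a \<tau> * ?b \<sigma> *
          (\<Sum>\<beta> | \<beta> \<in> Qk \<and> \<beta> \<circ> idx_perm m \<tau> \<sigma> = \<beta>. eps (idx_perm m \<tau> \<sigma>) \<beta>))"
      proof (rule sum.cong[OF refl], rule sum.cong[OF refl])
        fix \<tau> \<sigma> assume "\<tau> \<in> {\<tau>. \<tau> permutes {..<m}}" "\<sigma> \<in> {\<sigma>. \<sigma> permutes {..<n}}"
        then have p: "\<tau> permutes {..<m}" "\<sigma> permutes {..<n}" by auto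
        have g: "gperm (idx_perm m \<tau> \<sigma>)" using gperm_gi[of "(\<tau>, \<sigma>)"] p by (simp add: G_def)
        show "?a \<tau> * ?b \<sigma> * mcoeff ((\<Prod>B\<in>orbits \<tau> {..<m}. pow_bracket m (card B) (H_series m n)) *
            (\<Prod>B\<in>orbits \<sigma> {..<n}. pow_brace m (card B) (E_series m n))) \<kappa> =
          ?a \<tau> * ?b \<sigma> * (\<Sum>\<beta> | \<beta> \<in> Qk \<and> \<beta> \<circ> idx_perm m \<tau> \<sigma> = \<beta>. eps (idx_perm m \<tau> \<sigma>) \<beta>)"
          unfolding prod_orbits_split[OF p] mcoeff_prod_hrow[OF g] ..
      qed
      also have "\<dots> = mcoeff (fchar m n d (sInd_act m n d) ?V) \<kappa>"
      proof (cases "\<kappa> \<in> weights m n d")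
        case True
        then show ?thesis
          unfolding mcoeff_fchar dim_weight_space[symmetric] by (simp only: U_def if_True)
      next
        case False
        then show ?thesis by (simp add: mcoeff_fchar Qk_empty[OF False])
      qed
      finally show ?thesis using True by (simp add: homog_part.rep_eq)
    qed
  qed
qed

end
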